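(* Fix $k\in\{2,3,5,11,17,41\}$ and let $f:\mathbb{N}_0\to\mathbb{Q}$ be defined for all positive integers $n$ by one of the following four expressions: \[ \tfrac14\#\{(x,y)\in\mathbb{Z}^2 : x^2+y^2=n\},\quad \tfrac12\#\{(x,y)\in\mathbb{Z}^2 : x^2+2y^2=n\}, \] \[ \tfrac16\#\{(x,y)\in\mathbb{Z}^2 : x^2+xy+y^2=n\},\quad \tfrac12\#\{(x,y)\in\mathbb{Z}^2 : x^2+xy+ky^2=n\}, \] and put $f(0)=1$. Then, as $x\to\infty$, \[ \max_{n\le x}\log f(f(n)) = \frac{\sqrt{\log x}}{\log_2 x}\left(\frac{c}{\sqrt 2}+\mathcal{O}\!\left(\frac{\log_3 x}{\log_2 x}\right)\right), \qquad c=\left(8\sum_{l=1}^{\infty}\left(\log\left(1+\frac1l\right)\right)^2\right)^{1/2}. \]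
   Context: $\log$ is the natural logarithm, $\log_k$ denotes the $k$-fold iterated natural logarithm, and $\log 0=-\infty$ by convention. The maximum is over positive integers $n\le x$. *)

theory Defs
  imports "HOL-Analysis.Analysis" "HOL-Library.Landau_Symbols"
begin

text \<open>The natural logarithm on the nonnegative reals with \<open>log 0 = -\<infinity>\<close> (in HOL, \<open>ln 0 = 0\<close>).\<close>

definition elog :: "real \<Rightarrow> ereal" where
  "elog t = (if t = 0 then -\<infinity> else ereal (ln t))"

text \<open>
  For \<open>f\<close> with values in \<open>\<rat>\<close>, the composition \<open>f(f(n))\<close> identifies \<open>\<nat>\<close> with its image in \<open>\<rat>\<close>.
  The lemma \<open>normalised_count_in_Nats\<close> below shows that every value \<open>f(n)\<close> considered here
  lies in that image, so that the inverse used here is always applied inside its domain.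
\<close>

definition nat_of_rat :: "rat \<Rightarrow> nat" where
  "nat_of_rat = the_inv of_nat"

lemma nat_of_rat_of_nat [simp]: "nat_of_rat (of_nat m) = m"
  unfolding nat_of_rat_def by (rule the_inv_f_f) (simp add: inj_def)

lemma finite_form_reps:
  fixes b c m :: int
  assumes "b\<^sup>2 < 4 * c"
  shows "finite {(x, y). x\<^sup>2 + b * x * y + c * y\<^sup>2 = m}"
proof -
  define B where "B = {- (4 * \<bar>m\<bar>) .. 4 * \<bar>m\<bar>}"
  define h where "h = (\<lambda>(x::int, y::int). (2 * x + b * y, y))"
  have le_sq: "\<bar>t\<bar> \<le> t\<^sup>2" for t :: int
  proof (cases "t = 0")
    case False
    then have "\<bar>t\<bar> * 1 \<le> \<bar>t\<bar> * \<bar>t\<bar>" by (intro mult_left_mono) auto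
    then show ?thesis by (simp add: power2_eq_square)
  qed auto
  have "h ` {(x, y). x\<^sup>2 + b * x * y + c * y\<^sup>2 = m} \<subseteq> B \<times> B"
  proof (clarsimp simp: h_def)
    fix x y :: int
    assume m: "m = x\<^sup>2 + b * x * y + c * y\<^sup>2"
    have eq: "4 * m = (2 * x + b * y)\<^sup>2 + (4 * c - b\<^sup>2) * y\<^sup>2"
      by (simp add: m power2_eq_square algebra_simps)
    have "1 * y\<^sup>2 \<le> (4 * c - b\<^sup>2) * y\<^sup>2"
      using assms by (intro mult_right_mono) auto
    then have "(2 * x + b * y)\<^sup>2 \<le> 4 * m" "y\<^sup>2 \<le> 4 * m"
      using eq zero_le_power2[of "2 * x + b * y"] zero_le_power2[of y] by linarith+
    then have "\<bar>2 * x + b * y\<bar> \<le> 4 * \<bar>m\<bar>" "\<bar>y\<bar> \<le> 4 * \<bar>m\<bar>"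
      using le_sq[of "2 * x + b * y"] le_sq[of y] by linarith+
    then show "2 * x + b * y \<in> B \<and> y \<in> B"
      unfolding B_def m by auto
  qed
  then have "finite (h ` {(x, y). x\<^sup>2 + b * x * y + c * y\<^sup>2 = m})"
    by (rule finite_subset) (simp add: B_def)
  moreover have "inj_on h A" for A
    by (auto simp: h_def inj_on_def)
  ultimately show ?thesis
    by (rule finite_imageD)
qed

text \<open>
  The maps \<open>h i\<close> below are the multiplications by the units of the quadratic order, and \<open>Q\<close> is a
  fundamental sector for them.
\<close>

lemma sector_dvd_card:
  fixes S :: "'a set" and h :: "nat \<Rightarrow> 'a \<Rightarrow> 'a" and idx :: "'a \<Rightarrow> nat"
  assumes fin: "finite S"
    and maps: "\<And>i p. i < m \<Longrightarrow> p \<in> S \<Longrightarrow> h i p \<in> S"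
    and inj: "\<And>i. i < m \<Longrightarrow> inj (h i)"
    and idx: "\<And>p. p \<in> S \<Longrightarrow> idx p < m"
    and sector: "\<And>i p. i < m \<Longrightarrow> p \<in> S \<Longrightarrow> h i p \<in> Q \<longleftrightarrow> i = idx p"
  shows "m dvd card S"
proof -
  define T where "T = (\<lambda>i. {p \<in> S. idx p = i})"
  have "card (T i) = card (S \<inter> Q)" if i: "i < m" for i
  proof -
    have injS: "inj_on (h i) S" using inj[OF i] by (auto simp: inj_on_def inj_def)
    have surj: "h i ` S = S" using fin injS maps[OF i] by (intro endo_inj_surj) auto
    have "h i ` T i = S \<inter> Q"
    proof (intro equalityI subsetI)
      fix q assume "q \<in> h i ` T i"
      then obtain p where "p \<in> S" "idx p = i" "q = h i p" by (auto simp: T_def)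
      then show "q \<in> S \<inter> Q" using maps[OF i] sector[OF i, of p] by simp
    next
      fix q assume q: "q \<in> S \<inter> Q"
      then have "q \<in> h i ` S" by (simp only: surj Int_iff)
      then obtain p where p: "p \<in> S" "q = h i p" by (rule imageE)
      then have "p \<in> T i" using q sector[OF i, of p] by (simp add: T_def)
      then show "q \<in> h i ` T i" using p(2) by (rule_tac image_eqI)
    qed
    moreover have "inj_on (h i) (T i)" using injS by (auto simp: T_def inj_on_def)
    ultimately show ?thesis using card_image[of "h i" "T i"] by simp
  qed
  then have "(\<Sum>i<m. card (T i)) = m * card (S \<inter> Q)" by simp
  moreover have "card (\<Union>i<m. T i) = (\<Sum>i<m. card (T i))"
    using fin by (intro card_UN_disjoint) (auto simp: T_def)
  moreover have "(\<Union>i<m. T i) = S" using idx by (auto simp: T_def)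
  ultimately show ?thesis by simp
qed

lemma two_dvd_card_form:
  fixes b c m :: int
  assumes "b\<^sup>2 < 4 * c" "m > 0"
  shows "2 dvd card {(x, y). x\<^sup>2 + b * x * y + c * y\<^sup>2 = m}"
proof -
  let ?S = "{(x, y). x\<^sup>2 + b * x * y + c * y\<^sup>2 = m}"
  define h where "h = (\<lambda>i (x::int, y::int). if i = (0::nat) then (x, y) else (-x, -y))"
  define Q where "Q = {(x::int, y::int). x > 0 \<or> x = 0 \<and> y > 0}"
  define idx where "idx = (\<lambda>p. if p \<in> Q then 0 else 1::nat)"
  show ?thesis
  proof (rule sector_dvd_card[where h = h and Q = Q and idx = idx])
    show "finite ?S" using assms by (intro finite_form_reps)
    fix i :: nat and p assume i: "i < 2" and p: "p \<in> ?S"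
    obtain x y where xy: "p = (x, y)" by force
    have nz: "\<not> (x = 0 \<and> y = 0)" using p assms(2) by (auto simp: xy)
    have i': "i = 0 \<or> i = 1" using i by auto
    show "h i p \<in> ?S" using p i' by (auto simp: xy h_def)
    show "h i p \<in> Q \<longleftrightarrow> i = idx p"
      using nz i' unfolding xy h_def idx_def Q_def by auto
  qed (auto simp: h_def inj_def idx_def)
qed

lemma four_dvd_card_sum_squares:
  assumes "(m::int) > 0"
  shows "4 dvd card {(x, y). x\<^sup>2 + y\<^sup>2 = m}"
proof -
  let ?S = "{(x, y). x\<^sup>2 + y\<^sup>2 = m}"
  define h where "h = (\<lambda>i (x::int, y::int). if i = (0::nat) then (x, y) else if i = 1 then (y, -x)
     else if i = 2 then (-x, -y) else (-y, x))"
  define Q where "Q = {(x::int, y::int). x > 0 \<and> y \<ge> 0}"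
  define idx where "idx = (\<lambda>(x::int, y::int). if x > 0 \<and> y \<ge> 0 then 0 else if x \<le> 0 \<and> y > 0 then 1
     else if x < 0 \<and> y \<le> 0 then 2 else 3::nat)"
  show ?thesis
  proof (rule sector_dvd_card[where h = h and Q = Q and idx = idx])
    show "finite ?S" using finite_form_reps[of 0 1 m] by simp
    fix i :: nat and p assume i: "i < 4" and p: "p \<in> ?S"
    obtain x y where xy: "p = (x, y)" by force
    have nz: "\<not> (x = 0 \<and> y = 0)" using p assms by (auto simp: xy)
    have i': "i = 0 \<or> i = 1 \<or> i = 2 \<or> i = 3" using i by auto
    show "h i p \<in> ?S" using p i' by (elim disjE) (auto simp: xy h_def)
    show "h i p \<in> Q \<longleftrightarrow> i = idx p"
      using i' nz by (elim disjE) (auto simp: xy h_def idx_def Q_def)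
  qed (auto simp: h_def inj_def idx_def)
qed

lemma six_dvd_card_eisenstein:
  assumes "(m::int) > 0"
  shows "6 dvd card {(x, y). x\<^sup>2 + x * y + y\<^sup>2 = m}"
proof -
  let ?S = "{(x, y). x\<^sup>2 + x * y + y\<^sup>2 = m}"
  define h where "h = (\<lambda>i (x::int, y::int). if i = (0::nat) then (x, y) else if i = 1 then (x + y, -x)
     else if i = 2 then (y, -x - y) else if i = 3 then (-x, -y)
     else if i = 4 then (-x - y, x) else (-y, x + y))"
  define Q where "Q = {(x::int, y::int). x > 0 \<and> y \<ge> 0}"
  define idx where "idx = (\<lambda>(x::int, y::int). if x > 0 \<and> y \<ge> 0 then 0
     else if x + y > 0 \<and> x \<le> 0 then 1 else if y > 0 \<and> x + y \<le> 0 then 2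
     else if x < 0 \<and> y \<le> 0 then 3 else if x + y < 0 \<and> x \<ge> 0 then 4 else 5::nat)"
  show ?thesis
  proof (rule sector_dvd_card[where h = h and Q = Q and idx = idx])
    show "finite ?S" using finite_form_reps[of 1 1 m] by simp
    fix i :: nat and p assume i: "i < 6" and p: "p \<in> ?S"
    obtain x y where xy: "p = (x, y)" by force
    have nz: "\<not> (x = 0 \<and> y = 0)" using p assms by (auto simp: xy)
    have i': "i = 0 \<or> i = 1 \<or> i = 2 \<or> i = 3 \<or> i = 4 \<or> i = 5" using i by auto
    show "h i p \<in> ?S" using p i'
      by (elim disjE) (auto simp: xy h_def power2_eq_square algebra_simps)
    show "h i p \<in> Q \<longleftrightarrow> i = idx p"
      using i' nz by (elim disjE) (auto simp: xy h_def idx_def Q_def)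
  qed (auto simp: h_def inj_def idx_def)
qed

lemma normalised_count_in_Nats:
  fixes f :: "nat \<Rightarrow> rat" and k :: int
  assumes "k \<in> {2, 3, 5, 11, 17, 41}"
    and "f 0 = 1"
    and "(\<forall>n>0. f n = 1/4 * of_nat (card {(x::int, y::int). x\<^sup>2 + y\<^sup>2 = int n})) \<or>
         (\<forall>n>0. f n = 1/2 * of_nat (card {(x::int, y::int). x\<^sup>2 + 2 * y\<^sup>2 = int n})) \<or>
         (\<forall>n>0. f n = 1/6 * of_nat (card {(x::int, y::int). x\<^sup>2 + x * y + y\<^sup>2 = int n})) \<or>
         (\<forall>n>0. f n = 1/2 * of_nat (card {(x::int, y::int). x\<^sup>2 + x * y + k * y\<^sup>2 = int n}))"
  shows "f n \<in> \<nat>"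
proof (cases "n = 0")
  case False
  then have n: "int n > 0" by simp
  have dvds: "4 dvd card {(x::int, y::int). x\<^sup>2 + y\<^sup>2 = int n}"
    "2 dvd card {(x::int, y::int). x\<^sup>2 + 2 * y\<^sup>2 = int n}"
    "6 dvd card {(x::int, y::int). x\<^sup>2 + x * y + y\<^sup>2 = int n}"
    "2 dvd card {(x::int, y::int). x\<^sup>2 + x * y + k * y\<^sup>2 = int n}"
    using four_dvd_card_sum_squares[OF n] two_dvd_card_form[of 0 2, OF _ n]
      six_dvd_card_eisenstein[OF n] two_dvd_card_form[of 1 k, OF _ n] assms(1) by auto
  have quot: "q \<in> \<nat>" if "d dvd N" "d \<noteq> 0" "q = 1 / of_nat d * of_nat N" for d N :: nat and q :: rat
    using that by (auto elim!: dvdE)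
  from assms(3) show ?thesis
  proof (elim disjE)
    assume "\<forall>n>0. f n = 1/4 * of_nat (card {(x::int, y::int). x\<^sup>2 + y\<^sup>2 = int n})"
    then show ?thesis using False by (intro quot[OF dvds(1)]) simp_all
  next
    assume "\<forall>n>0. f n = 1/2 * of_nat (card {(x::int, y::int). x\<^sup>2 + 2 * y\<^sup>2 = int n})"
    then show ?thesis using False by (intro quot[OF dvds(2)]) simp_all
  next
    assume "\<forall>n>0. f n = 1/6 * of_nat (card {(x::int, y::int). x\<^sup>2 + x * y + y\<^sup>2 = int n})"
    then show ?thesis using False by (intro quot[OF dvds(3)]) simp_all
  next
    assume "\<forall>n>0. f n = 1/2 * of_nat (card {(x::int, y::int). x\<^sup>2 + x * y + k * y\<^sup>2 = int n})"
    then show ?thesis using False by (intro quot[OF dvds(4)]) simp_all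
  qed
qed (use assms in simp)

lemma summable_ln_sq: "summable (\<lambda>l. (ln (1 + 1 / real (Suc l)))\<^sup>2)"
proof (rule summable_comparison_test')
  show "summable (\<lambda>l. inverse ((real (Suc l))\<^sup>2))"
    using inverse_power_summable[of 2, where 'a = real] by (subst summable_Suc_iff) auto
  show "norm ((ln (1 + 1 / real (Suc l)))\<^sup>2) \<le> inverse ((real (Suc l))\<^sup>2)" for l
  proof -
    have "(ln (1 + 1 / real (Suc l)))\<^sup>2 \<le> (1 / real (Suc l))\<^sup>2"
      by (intro power_mono ln_add_one_self_le_self ln_ge_zero) auto
    then show ?thesis by (simp add: power_divide inverse_eq_divide)
  qed
qed

end

theory Submission
  imports Defs "HOL-Complex_Analysis.Complex_Analysis" "HOL-Number_Theory.Number_Theory"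
    "HOL-Real_Asymp.Real_Asymp"
begin

text \<open>
  Each \<open>f n\<close> is the number of ideals of norm \<open>n\<close> in an imaginary quadratic field of class number one:
  it is multiplicative and equals \<open>e + 1\<close> at the \<open>e\<close>-th power of a split prime. Counting lattice
  points gives \<open>f\<close> the mean value \<open>\<rho> > 0\<close> with error \<open>O(N\<^sup>1\<^sup>/\<^sup>2)\<close>, which continues its Dirichlet series
  beyond the line \<open>Re s = 1\<close>; the inequality \<open>3 + 4 cos t + cos 2t \<ge> 0\<close> and Perron's formula on
  \<open>Re s = 1\<close> yield that \<open>u / (2 ln u) (1 + O(1 / ln u))\<close> split primes are at most \<open>u\<close>.

  For \<open>f (f n)\<close> to be large, \<open>f n = \<Prod> q\<^bsup>b\<^esup>\<close> should have many divisors; it is cheapest to create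
  every prime factor \<open>q\<close> of \<open>f n\<close> by an exponent \<open>q - 1\<close> in \<open>n\<close>, at a cost of about
  \<open>(q - 1) (ln ln n) / 2\<close> in \<open>ln n\<close>. Maximising \<open>\<Sum> ln (b + 1) = \<Sum> \<Sum> ln (1 + 1 / l)\<close> under this
  linear budget is a concave problem. With multiplier \<open>1 / Y\<close> the \<open>l\<close>-th factor \<open>q\<close> is used
  when \<open>q \<le> Y ln (1 + 1 / l)\<close>, and the prime ideal theorem evaluates both the value and the cost
  in terms of \<open>\<Sum> (ln (1 + 1 / l))\<^sup>2\<close>.
\<close>

section \<open>Quadratic forms of class number one\<close>

text \<open>Put \<open>w = sqrt (ln x)\<close>, so that the budget is \<open>w^2\<close>, and let
  \<open>S\<close> be the sum of the squares of \<open>ln (1 + 1 / l)\<close>. The dual bound with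
  parameter \<open>Y\<close> is about \<open>w^2 / (Y ln w) + S Y / (4 ln Y)\<close>. It is smallest
  near \<open>Y = 2 w / sqrt S\<close>, where both terms agree and add up to
  \<open>2 sqrt S * w / (2 ln w)\<close>. As \<open>2 ln w = ln ln x\<close> and
  \<open>c / sqrt 2 = 2 sqrt S\<close>, this is the main term. The error \<open>ln_3 / ln_2\<close>
  is the price of treating different logarithms as equal: those of the relevant primes differ from
  \<open>ln w\<close> by \<open>O(ln ln w)\<close>. Counting primes loses only a factor
  \<open>1 + O(1 / ln u)\<close>, so it suffices to save one logarithm there; bounds that are
  uniform to the right of \<open>Re s = 1\<close> give this. The obstacle in the upper bound is that
  small primes in \<open>n\<close> are cheap. They are cut off at \<open>w / (2 ln w)^3\<close> and
  estimated crudely, being too few to matter. In the lower bound the primes of \<open>n\<close> are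
  taken up to \<open>Y (ln Y)^3\<close>, a range with enough split primes whose logarithms are still
  at most about \<open>ln Y\<close>. Class number one allows ideals to be replaced by elements
  throughout.\<close>

text \<open>
  The hypothesis on small primes is the Minkowski-type criterion for class number one: the primes
  up to \<open>sqrt (D / 3)\<close>, with \<open>D = 4 c - b\<^sup>2\<close>, are inert. A reduction argument then shows that every
  prime is either inert or represented by the form.
\<close>

locale quadratic_form =
  fixes b c :: int
  assumes definite: "b\<^sup>2 < 4 * c"
    and small_primes: "\<And>p x. prime p \<Longrightarrow> 3 * p\<^sup>2 \<le> 4 * c - b\<^sup>2 \<Longrightarrow> \<not> p dvd x\<^sup>2 + b * x + c"
begin

text \<open>The pair \<open>(x, y)\<close> stands for \<open>x + y w\<close> in the quadratic order
  with \<open>w^2 = b w - c\<close>; \<open>nrm\<close>, \<open>mul\<close>, \<open>cnj2\<close> and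
  \<open>tr\<close> are norm, product, conjugate and trace of that order.\<close>

definition nrm :: "int \<times> int \<Rightarrow> int" where
  "nrm z = (fst z)\<^sup>2 + b * fst z * snd z + c * (snd z)\<^sup>2"

definition mul :: "int \<times> int \<Rightarrow> int \<times> int \<Rightarrow> int \<times> int" where
  "mul z w = (fst z * fst w - c * snd z * snd w, fst z * snd w + snd z * fst w + b * snd z * snd w)"

definition cnj2 :: "int \<times> int \<Rightarrow> int \<times> int" where
  "cnj2 z = (fst z + b * snd z, - snd z)"

definition tr :: "int \<times> int \<Rightarrow> int" where
  "tr z = 2 * fst z + b * snd z"

definition scale :: "int \<Rightarrow> int \<times> int \<Rightarrow> int \<times> int" where
  "scale k z = (k * fst z, k * snd z)"

definition reps :: "int \<Rightarrow> (int \<times> int) set" where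
  "reps n = {z. nrm z = n}"

lemma nrm_mul: "nrm (mul z w) = nrm z * nrm w"
  by (simp add: nrm_def mul_def power2_eq_square algebra_simps)

lemma nrm_cnj2 [simp]: "nrm (cnj2 z) = nrm z"
  by (simp add: nrm_def cnj2_def power2_eq_square algebra_simps)

lemma cnj2_cnj2 [simp]: "cnj2 (cnj2 z) = z"
  by (simp add: cnj2_def)

lemma mul_cnj2: "mul z (mul (cnj2 z) u) = scale (nrm z) u"
  by (simp add: mul_def nrm_def cnj2_def scale_def power2_eq_square algebra_simps)

lemma mul_cnj2': "mul (cnj2 z) (mul z u) = scale (nrm z) u"
  by (simp add: mul_def nrm_def cnj2_def scale_def power2_eq_square algebra_simps)

lemma mul_scale: "mul z (scale k w) = scale k (mul z w)"
  by (simp add: mul_def scale_def algebra_simps)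

lemma nrm_scale: "nrm (scale k z) = k\<^sup>2 * nrm z"
  by (simp add: nrm_def scale_def power2_eq_square algebra_simps)

lemma scale_inj: "k \<noteq> 0 \<Longrightarrow> scale k z = scale k w \<longleftrightarrow> z = w"
  by (auto simp: scale_def prod_eq_iff)

lemma mul_tr: "mul w z = scale (tr w) z - mul (cnj2 w) z"
  by (simp add: scale_def mul_def cnj2_def tr_def algebra_simps)

lemma four_nrm: "4 * nrm z = (2 * fst z + b * snd z)\<^sup>2 + (4 * c - b\<^sup>2) * (snd z)\<^sup>2"
  by (simp add: nrm_def power2_eq_square algebra_simps)

lemma nrm_nonneg: "nrm z \<ge> 0"
proof -
  have "4 * nrm z \<ge> 0" unfolding four_nrm using definite by auto
  then show ?thesis by simp
qed

lemma reps_eq: "reps m = {(x, y). x\<^sup>2 + b * x * y + c * y\<^sup>2 = m}"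
  by (auto simp: reps_def nrm_def)

lemma finite_reps: "finite (reps n)"
  unfolding reps_eq by (rule finite_form_reps[OF definite])

lemma mul_inj:
  assumes "nrm w \<noteq> 0" "mul w z = mul w z'" shows "z = z'"
  using mul_cnj2'[of w z] mul_cnj2'[of w z'] assms scale_inj by metis

lemma dvd_nrm_prime_snd:
  assumes "prime p" "p dvd nrm z" "p dvd snd z"
  obtains u where "z = scale p u"
proof -
  have "p dvd nrm z - snd z * (b * fst z + c * snd z)" using assms by (intro dvd_diff dvd_mult2)
  also have "nrm z - snd z * (b * fst z + c * snd z) = fst z ^ 2"
    by (simp add: nrm_def power2_eq_square algebra_simps)
  finally have "p dvd fst z" using assms(1) prime_dvd_power by blast
  then obtain x where x: "fst z = p * x" by auto
  from assms(3) obtain y where "snd z = p * y" by auto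
  with x have "z = scale p (x, y)" by (simp add: scale_def prod_eq_iff)
  then show thesis by (rule that)
qed

text \<open>An element of prime norm acts as a prime. The product of the second coordinates of
  \<open>mul w z\<close> and \<open>mul (cnj2 w) z\<close> is an integer combination of
  \<open>nrm w\<close> and \<open>nrm z\<close>, so \<open>p\<close> divides one of them. As
  \<open>p\<close> also divides the norm of that product, it divides the whole pair, and multiplying
  by the conjugate element cancels \<open>p\<close>.\<close>

lemma prime_divides:
  assumes "prime p" "nrm w = p" "p dvd nrm z"
  shows "(\<exists>u. z = mul w u) \<or> (\<exists>u. z = mul (cnj2 w) u)"
proof -
  have p0: "p \<noteq> 0" using assms by auto
  have main: "\<exists>u. z = mul v u" if v: "nrm v = p" "p dvd snd (mul (cnj2 v) z)" for v
  proof -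
    have "p dvd nrm (mul (cnj2 v) z)" using v by (simp add: nrm_mul)
    from dvd_nrm_prime_snd[OF assms(1) this v(2)] obtain u where u: "mul (cnj2 v) z = scale p u" .
    have "scale p z = mul v (scale p u)" using mul_cnj2[of v z] u v by simp
    also have "\<dots> = scale p (mul v u)" by (rule mul_scale)
    finally have "z = mul v u" using scale_inj[OF p0] by simp
    then show ?thesis ..
  qed
  have "snd (mul w z) * snd (mul (cnj2 w) z) = (snd z)\<^sup>2 * nrm w - (snd w)\<^sup>2 * nrm z"
    by (simp add: mul_def nrm_def cnj2_def power2_eq_square algebra_simps)
  then have "p dvd snd (mul w z) * snd (mul (cnj2 w) z)" using assms by simp
  then have "p dvd snd (mul w z) \<or> p dvd snd (mul (cnj2 w) z)"
    using assms(1) prime_dvd_multD by blast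
  then show ?thesis using main[of w] main[of "cnj2 w"] assms(2) by auto
qed

text \<open>Descent on the cofactor: a prime \<open>q\<close> dividing \<open>m\<close> has an
  element of norm \<open>q\<close>, and this element or its conjugate divides \<open>z\<close>; the
  quotient has norm \<open>p * m / q\<close>.\<close>

lemma represented_of_multiple:
  assumes "p * m = nrm z" "m > 0" "\<And>q. prime q \<Longrightarrow> q dvd m \<Longrightarrow> \<exists>w. nrm w = q"
  shows "\<exists>w. nrm w = p"
  using assms
proof (induction "nat m" arbitrary: m z rule: less_induct)
  case less
  show ?case
  proof (cases "m = 1")
    case True
    then show ?thesis using less.prems(1) by (intro exI[of _ z]) simp
  next
    case False
    then obtain q where q: "prime q" "q dvd m" using less.prems(2) prime_factor_int[of m] by auto
    then obtain w where w: "nrm w = q" using less.prems(3) by blast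
    from q obtain m' where m': "m = q * m'" by auto
    have qpos: "q > 1" using q by (simp add: prime_gt_1_int)
    have "q dvd nrm z" using less.prems(1) m' by (metis dvd_triv_left mult.left_commute)
    from prime_divides[OF q(1) w this] obtain v u where "z = mul v u" "nrm v = q"
      using w nrm_cnj2 by metis
    then have "q * nrm u = p * m" using less.prems(1) by (simp add: nrm_mul)
    then have "q * nrm u = q * (p * m')" using m' by (simp only: mult_ac)
    then have u: "p * m' = nrm u" using qpos by simp
    have m'pos: "m' > 0" using less.prems(2) m' qpos by (simp add: zero_less_mult_iff)
    have "m' < m" using m' qpos m'pos by simp
    then have "nat m' < nat m" using m'pos by simp
    from less.hyps[OF this u m'pos] show ?thesis using less.prems(3) m' by auto
  qed
qed

text \<open>Strong induction on \<open>p\<close>. Once \<open>2 x + b\<close> is at most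
  \<open>p\<close> in absolute value, \<open>x^2 + b x + c = p m\<close> with
  \<open>4 p m <= p^2 + D < 4 p^2\<close>, where \<open>D = 4 c - b^2 < 3 p^2\<close> by
  \<open>small_primes\<close>; hence \<open>m < p\<close>. Every prime factor of \<open>m\<close>
  has the same root and is smaller than \<open>p\<close>, so it is represented and the descent
  applies.\<close>

lemma represented_of_root:
  assumes "prime p" "p dvd x\<^sup>2 + b * x + c"
  shows "\<exists>w. nrm w = p"
  using assms
proof (induction "nat p" arbitrary: p x rule: less_induct)
  case less
  have ppos: "p > 1" using less.prems by (simp add: prime_gt_1_int)
  have big: "4 * c - b\<^sup>2 < 3 * p\<^sup>2" using small_primes[OF less.prems(1)] less.prems(2) by force
  \<comment> \<open>The shift by \<open>(p + b) div 2\<close> centres the residue at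
    \<open>- b / 2\<close> up to rounding, which gives \<open>- p <= 2 x' + b < p\<close>.\<close>
  define x' where "x' = (x + (p + b) div 2) mod p - (p + b) div 2"
  have cong: "p dvd x' - x"
  proof -
    have "x' - x = - (p * ((x + (p + b) div 2) div p))"
      unfolding x'_def by (simp add: minus_mult_div_eq_mod [symmetric])
    then show ?thesis by simp
  qed
  have "0 \<le> (x + (p + b) div 2) mod p" "(x + (p + b) div 2) mod p < p" using ppos by auto
  moreover have "2 * ((p + b) div 2) \<le> p + b" "2 * ((p + b) div 2) \<ge> p + b - 1" by presburger+
  ultimately have "\<bar>2 * (r - e) + b\<bar> \<le> p" if "r = (x + (p + b) div 2) mod p" "e = (p + b) div 2" for r e
    using that by auto
  then have "\<bar>2 * x' + b\<bar> \<le> p" unfolding x'_def by blast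
  then have sq: "(2 * x' + b)\<^sup>2 \<le> p\<^sup>2" using ppos by (simp add: abs_le_square_iff [symmetric])
  have "x'\<^sup>2 + b * x' + c = (x\<^sup>2 + b * x + c) + (x' - x) * (x' + x + b)"
    by (simp add: power2_eq_square algebra_simps)
  then have "p dvd x'\<^sup>2 + b * x' + c" using cong less.prems(2) by (metis dvd_add dvd_mult2)
  then obtain m where m: "x'\<^sup>2 + b * x' + c = p * m" by auto
  have four: "4 * (p * m) = (2 * x' + b)\<^sup>2 + (4 * c - b\<^sup>2)"
    unfolding m [symmetric] by (simp add: power2_eq_square algebra_simps)
  have mpos: "m > 0"
  proof -
    have "4 * (p * m) > 0" unfolding four using definite zero_le_power2[of "2*x'+b"] by linarith
    then show ?thesis using ppos by (simp add: zero_less_mult_iff)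
  qed
  have "4 * (p * m) < 4 * (p * p)" using four sq big by (simp add: power2_eq_square)
  then have mp: "m < p" using ppos by simp
  have "p * m = nrm (x', 1)" using m by (simp add: nrm_def)
  then show ?case
  proof (rule represented_of_multiple[OF _ mpos])
    fix q assume q: "prime q" "q dvd m"
    have "q \<le> m" using q(2) mpos zdvd_imp_le by blast
    then have "nat q < nat p" using mp ppos by simp
    then show "\<exists>w. nrm w = q" using less.hyps[OF _ q(1), of x'] q(2) m by simp
  qed
qed

text \<open>If \<open>p\<close> did not divide the second coordinate, dividing by it modulo
  \<open>p\<close> would turn \<open>z\<close> into a root of \<open>x^2 + b x + c\<close>, and then
  \<open>p\<close> would be represented.\<close>

lemma inert_divides:
  assumes p: "prime p" and nr: "\<nexists>w. nrm w = p" and z: "p dvd nrm z"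
  obtains u where "z = scale p u"
proof (cases "p dvd snd z")
  case True
  then show thesis using dvd_nrm_prime_snd[OF p z] that by blast
next
  case False
  then have "coprime p (snd z)" using p prime_imp_coprime by blast
  then obtain i j where ij: "i * p + j * snd z = 1" using bezout_int[of p "snd z"] by auto
  then have j: "j * snd z = 1 - i * p" by simp
  define x where "x = j * fst z"
  have e: "x\<^sup>2 + b * x + c = j\<^sup>2 * nrm z + i * p * (b * x + c * (2 - i * p))"
  proof -
    have "j\<^sup>2 * nrm z = x\<^sup>2 + b * x * (j * snd z) + c * (j * snd z)\<^sup>2"
      by (simp add: nrm_def x_def power2_eq_square algebra_simps)
    then show ?thesis unfolding j by (simp add: power2_eq_square algebra_simps)
  qed
  have "p dvd x\<^sup>2 + b * x + c" unfolding e using z by simp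
  then show thesis using represented_of_root[OF p] nr by blast
qed

section \<open>Representations of a prime multiple\<close>

lemma card_mul_reps:
  assumes "nrm w \<noteq> 0" shows "card (mul w ` reps n) = card (reps n)"
  by (rule card_image) (use mul_inj[OF assms] in \<open>auto simp: inj_on_def\<close>)

lemma reps_prime_mult:
  assumes "prime p" "nrm w = p"
  shows "reps (p * n) = mul w ` reps n \<union> mul (cnj2 w) ` reps n"
proof (intro equalityI subsetI)
  fix z assume z: "z \<in> reps (p * n)"
  then have "p dvd nrm z" by (simp add: reps_def)
  then obtain v u where vu: "z = mul v u" "v = w \<or> v = cnj2 w"
    using prime_divides[OF assms] by blast
  have "p \<noteq> 0" using assms(1) by auto
  then have "nrm u = n" using z vu assms(2) by (auto simp: reps_def nrm_mul)
  then show "z \<in> mul w ` reps n \<union> mul (cnj2 w) ` reps n" using vu by (auto simp: reps_def)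
qed (use assms in \<open>auto simp: reps_def nrm_mul\<close>)

text \<open>The conjugate equals \<open>tr w - w\<close>, and \<open>p\<close>, the product of
  \<open>w\<close> and its conjugate, divides the trace. Hence \<open>w\<close> divides its
  conjugate, and the two images in \<open>reps_prime_mult\<close> coincide.\<close>

lemma card_reps_ramified:
  assumes "prime p" "nrm w = p" "p dvd tr w"
  shows "card (reps (p * n)) = card (reps n)"
proof -
  have p0: "p \<noteq> 0" using assms(1) by auto
  from assms(3) obtain t where t: "tr w = p * t" by auto
  have "mul (cnj2 w) ` reps n \<subseteq> mul w ` reps n"
  proof
    fix y assume "y \<in> mul (cnj2 w) ` reps n"
    then obtain u where u: "u \<in> reps n" and y: "y = mul (cnj2 w) u" by blast
    define v where "v = mul (cnj2 w) (scale t u) - u"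
    have e: "mul (cnj2 w) u = mul w v"
    proof -
      have "mul w v = mul w (mul (cnj2 w) (scale t u)) - mul w u"
        unfolding v_def by (simp add: mul_def algebra_simps)
      also have "mul w (mul (cnj2 w) (scale t u)) = scale (tr w) u"
        unfolding mul_cnj2 using t assms(2) by (simp add: scale_def)
      finally show ?thesis using mul_tr[of w u] by (simp add: algebra_simps)
    qed
    have "nrm w * nrm v = p * n" using u assms(2) unfolding nrm_mul [symmetric] e [symmetric]
      by (simp add: nrm_mul reps_def)
    then have "v \<in> reps n" using p0 assms(2) by (simp add: reps_def)
    then show "y \<in> mul w ` reps n" using e y by auto
  qed
  then have "reps (p * n) = mul w ` reps n" using reps_prime_mult[OF assms(1,2)] by auto
  then show ?thesis using card_mul_reps p0 assms(2) by simp
qed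

text \<open>A pair divisible by \<open>w\<close> and by its conjugate becomes a multiple of
  \<open>p\<close> when multiplied by either of them, hence also when multiplied by their sum
  \<open>tr w\<close>. Since the trace is prime to \<open>p\<close>, Bezout makes the pair itself a
  multiple of \<open>p\<close>.\<close>

lemma scale_reps_inter:
  assumes "prime p" "nrm w = p" "\<not> p dvd tr w" "n \<noteq> 0"
  shows "mul w ` reps n \<inter> mul (cnj2 w) ` reps n = (if p dvd n then scale p ` reps (n div p) else {})"
proof -
  have p0: "p \<noteq> 0" using assms(1) by auto
  have "coprime p (tr w)" using assms(1,3) prime_imp_coprime by blast
  then obtain i j where ij: "i * p + j * tr w = 1" using bezout_int[of p "tr w"] by auto
  have sub: "\<exists>x. z = scale p x \<and> n = p * nrm x" if z: "z \<in> mul w ` reps n" "z \<in> mul (cnj2 w) ` reps n" for z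
  proof -
    obtain u where u: "z = mul w u" "nrm u = n" using z(1) by (auto simp: reps_def)
    obtain v where v: "z = mul (cnj2 w) v" using z(2) by auto
    note uv = u(1) v u(2)
    have "mul w z = scale p v" using uv(2) mul_cnj2[of w v] assms(2) by simp
    moreover have "mul (cnj2 w) z = scale p u" using uv(1) mul_cnj2'[of w u] assms(2) by simp
    ultimately have "scale (tr w) z = scale p (u + v)"
      using mul_tr[of w z] by (simp add: scale_def algebra_simps prod_eq_iff)
    then have s: "tr w * fst z = p * (fst u + fst v)" "tr w * snd z = p * (snd u + snd v)"
      by (simp_all add: scale_def prod_eq_iff)
    define x where "x = (i * fst z + j * (fst u + fst v), i * snd z + j * (snd u + snd v))"
    have "fst z = (i * p + j * tr w) * fst z" "snd z = (i * p + j * tr w) * snd z" using ij by simp_all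
    then have "fst z = p * fst x" "snd z = p * snd x"
      using s by (simp_all add: x_def algebra_simps)
    then have zx: "z = scale p x" by (simp add: scale_def prod_eq_iff)
    have "nrm z = p * n" using uv(1,3) assms(2) by (simp add: nrm_mul)
    then have "p * n = p\<^sup>2 * nrm x" using zx by (simp add: nrm_scale)
    then have "n = p * nrm x" using p0 by (simp add: power2_eq_square)
    then show ?thesis using zx by blast
  qed
  show ?thesis
  proof (cases "p dvd n")
    case False
    then show ?thesis using sub by fastforce
  next
    case True
    then obtain m where m: "n = p * m" by auto
    have "scale p x \<in> mul w ` reps n \<inter> mul (cnj2 w) ` reps n" if "nrm x = m" for x
    proof
      have "scale p x = mul w (mul (cnj2 w) x)" using mul_cnj2 assms(2) by simp
      then show "scale p x \<in> mul w ` reps n" using that assms(2) m by (auto simp: reps_def nrm_mul)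
      have "scale p x = mul (cnj2 w) (mul w x)" using mul_cnj2' assms(2) by simp
      then show "scale p x \<in> mul (cnj2 w) ` reps n" using that assms(2) m by (auto simp: reps_def nrm_mul)
    qed
    moreover have "z \<in> scale p ` reps m" if "z \<in> mul w ` reps n" "z \<in> mul (cnj2 w) ` reps n" for z
      using sub[OF that] m p0 by (auto simp: reps_def)
    ultimately have "mul w ` reps n \<inter> mul (cnj2 w) ` reps n = scale p ` reps m"
      unfolding reps_def by blast
    then show ?thesis using m p0 by simp
  qed
qed

lemma card_scale_reps: "p \<noteq> 0 \<Longrightarrow> card (scale p ` reps n) = card (reps n)"
  by (rule card_image) (auto simp: inj_on_def scale_inj)

text \<open>Inclusion-exclusion for the two images. The resulting recursion
  \<open>r (p n) = 2 r n - r (n / p)\<close> is the one solved by \<open>e + 1\<close> along the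
  powers of \<open>p\<close>.\<close>

lemma card_reps_split:
  assumes "prime p" "nrm w = p" "\<not> p dvd tr w" "n \<noteq> 0"
  shows "card (reps (p * n)) + (if p dvd n then card (reps (n div p)) else 0) = 2 * card (reps n)"
proof -
  have p0: "p \<noteq> 0" using assms(1) by auto
  have "card (mul w ` reps n) + card (mul (cnj2 w) ` reps n) =
      card (mul w ` reps n \<union> mul (cnj2 w) ` reps n) + card (mul w ` reps n \<inter> mul (cnj2 w) ` reps n)"
    by (intro card_Un_Int finite_imageI finite_reps)
  then show ?thesis
    unfolding reps_prime_mult[OF assms(1,2)] scale_reps_inter[OF assms]
    using card_mul_reps[of w] card_mul_reps[of "cnj2 w"] assms(2) p0 card_scale_reps by auto
qed

lemma card_reps_inert:
  assumes "prime p" "\<nexists>w. nrm w = p" "n \<noteq> 0"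
  shows "card (reps (p * n)) = (if p dvd n then card (reps (n div p)) else 0)"
proof -
  have p0: "p \<noteq> 0" using assms(1) by auto
  have "reps (p * n) = (if p dvd n then scale p ` reps (n div p) else {})"
  proof -
    have "\<exists>u. z = scale p u \<and> n = p * nrm u" if "nrm z = p * n" for z
    proof -
      have "p dvd nrm z" using that by simp
      from inert_divides[OF assms(1,2) this] obtain u where "z = scale p u" .
      then show ?thesis using that p0 by (intro exI[of _ u]) (simp add: nrm_scale power2_eq_square)
    qed
    then have iff: "z \<in> reps (p * n) \<longleftrightarrow> (\<exists>u. z = scale p u \<and> n = p * nrm u)" for z
      unfolding reps_def mem_Collect_eq using p0 nrm_scale[of p] by (metis mult.assoc power2_eq_square)
    show ?thesis
    proof (cases "p dvd n")
      case True
      then obtain m where "n = p * m" by auto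
      then have "z \<in> reps (p * n) \<longleftrightarrow> z \<in> scale p ` reps m" for z
        unfolding iff using p0 by (auto simp: reps_def)
      then show ?thesis using \<open>n = p * m\<close> p0 by auto
    qed (use iff in fastforce)
  qed
  then show ?thesis using card_scale_reps[OF p0] by simp
qed

text \<open>The trace condition says that \<open>w\<close> and its conjugate are not associates; a
  prime whose elements of norm \<open>p\<close> have trace divisible by \<open>p\<close> is
  ramified.\<close>

definition split_primes :: "nat set" where
  "split_primes = {p. prime p \<and> (\<exists>w. nrm w = int p \<and> \<not> int p dvd tr w)}"

definition inert_primes :: "nat set" where
  "inert_primes = {p. prime p \<and> (\<nexists>w. nrm w = int p)}"

text \<open>\<open>card (reps 1)\<close> is the number of units of the order, so the quotient counts
  elements of norm \<open>n\<close> up to units, that is, ideals.\<close>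

definition rep_density :: "nat \<Rightarrow> real" where
  "rep_density n = real (card (reps (int n))) / real (card (reps 1))"

lemma card_reps_1_pos: "card (reps 1) > 0"
proof -
  have "(1, 0) \<in> reps 1" by (simp add: reps_def nrm_def)
  then show ?thesis using finite_reps card_gt_0_iff by blast
qed

lemma rep_density_1: "rep_density 1 = 1"
  using card_reps_1_pos by (simp add: rep_density_def)

lemma rep_density_nonneg: "rep_density n \<ge> 0"
  by (simp add: rep_density_def)

lemma rep_density_split:
  assumes "p \<in> split_primes" "n > 0"
  shows "rep_density (p * n) = 2 * rep_density n - (if p dvd n then rep_density (n div p) else 0)"
proof -
  obtain w where w: "prime (int p)" "nrm w = int p" "\<not> int p dvd tr w"
    using assms by (auto simp: split_primes_def)
  have "card (reps (int (p * n))) + (if p dvd n then card (reps (int (n div p))) else 0) = 2 * card (reps (int n))"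
    using card_reps_split[OF w, of "int n"] assms(2) by (simp only: zdiv_int of_nat_mult int_dvd_int_iff)
  then have "real (card (reps (int (p * n)))) + (if p dvd n then real (card (reps (int (n div p)))) else 0)
      = 2 * real (card (reps (int n)))"
    unfolding of_nat_eq_iff[where 'a = real, symmetric] by (simp split: if_splits)
  then have "real (card (reps (int (p * n)))) = 2 * real (card (reps (int n))) -
      (if p dvd n then real (card (reps (int (n div p)))) else 0)"
    by simp
  then show ?thesis unfolding rep_density_def by (auto simp: diff_divide_distrib)
qed

lemma rep_density_inert:
  assumes "p \<in> inert_primes" "n > 0"
  shows "rep_density (p * n) = (if p dvd n then rep_density (n div p) else 0)"
proof -
  have w: "prime (int p)" "\<nexists>w. nrm w = int p"
    using assms by (auto simp: inert_primes_def)
  show ?thesis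
    using card_reps_inert[OF w, of "int n"] assms(2) by (simp add: rep_density_def zdiv_int)
qed

lemma rep_density_ramified:
  assumes "prime p" "p \<notin> split_primes" "p \<notin> inert_primes"
  shows "rep_density (p * n) = rep_density n"
proof -
  obtain w where w: "prime (int p)" "nrm w = int p" "int p dvd tr w"
    using assms by (auto simp: split_primes_def inert_primes_def)
  show ?thesis
    using card_reps_ramified[OF w, of "int n"] by (simp add: rep_density_def)
qed

end

section \<open>Lattice points in an ellipse\<close>

text \<open>Cut off at 0, so that the function decreases on the whole positive half line and rows
  beyond the top of the ellipse count as empty.\<close>

definition semicircle :: "real \<Rightarrow> real" where
  "semicircle u = sqrt (max 0 (1 - u\<^sup>2))"

definition semicircle_area :: "real \<Rightarrow> real" where
  "semicircle_area v = integral {0..v} semicircle"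

lemma semicircle_le_1: "semicircle u \<le> 1"
  by (simp add: semicircle_def)

lemma semicircle_antimono:
  assumes "0 \<le> u" "u \<le> v" shows "semicircle v \<le> semicircle u"
proof -
  have "u\<^sup>2 \<le> v\<^sup>2" using assms by (intro power_mono) auto
  then show ?thesis by (auto simp: semicircle_def max_def)
qed

lemma semicircle_eq_0: "1 \<le> u \<Longrightarrow> semicircle u = 0"
  using one_le_power[of u 2] by (simp add: semicircle_def)

lemma continuous_on_semicircle: "continuous_on A semicircle"
  unfolding semicircle_def by (intro continuous_intros)

lemma semicircle_area_bounds:
  assumes "0 \<le> u" "u \<le> v"
  shows "(v - u) * semicircle v \<le> semicircle_area v - semicircle_area u"
    and "semicircle_area v - semicircle_area u \<le> (v - u) * semicircle u"
proof -
  have int: "semicircle integrable_on {x..y}" for x y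
    by (intro integrable_continuous_real continuous_on_semicircle)
  have e: "semicircle_area v - semicircle_area u = integral {u..v} semicircle"
    unfolding semicircle_area_def
    using Henstock_Kurzweil_Integration.integral_combine[of 0 u v semicircle] assms int by simp
  have "integral {u..v} (\<lambda>_. semicircle v) \<le> integral {u..v} semicircle"
    using assms int by (intro integral_le) (auto intro: semicircle_antimono)
  then show "(v - u) * semicircle v \<le> semicircle_area v - semicircle_area u"
    using e assms by (simp add: mult.commute)
  have "integral {u..v} semicircle \<le> integral {u..v} (\<lambda>_. semicircle u)"
    using assms int by (intro integral_le) (auto intro: semicircle_antimono)
  then show "semicircle_area v - semicircle_area u \<le> (v - u) * semicircle u"
    using e assms by (simp add: mult.commute)
qed

lemma semicircle_area_1_pos: "semicircle_area 1 > 0"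
proof -
  have "semicircle (1/2) > 0" by (simp add: semicircle_def power2_eq_square)
  then have "0 < semicircle_area (1/2) - semicircle_area 0"
    using semicircle_area_bounds(1)[of 0 "1/2"] by simp
  moreover have "semicircle_area 0 = 0" by (simp add: semicircle_area_def)
  ultimately show ?thesis using semicircle_area_bounds(1)[of "1/2" 1] semicircle_eq_0[of 1] by simp
qed

lemma semicircle_area_eq: "1 \<le> v \<Longrightarrow> semicircle_area v = semicircle_area 1"
  using semicircle_area_bounds[of 1 v] semicircle_eq_0[of 1] semicircle_eq_0[of v] by simp

text \<open>The function decreases, so each unit step of the antiderivative \<open>F\<close> lies
  between two neighbouring terms. Sum and integral therefore differ by at most the first value,
  which is 1 whatever \<open>Y\<close> is.\<close>

lemma sum_semicircle:
  assumes Y: "Y > 0" and n: "real n \<ge> Y"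
  shows "\<bar>(\<Sum>y=1..n. semicircle (real y / Y)) - Y * semicircle_area 1\<bar> \<le> 1"
proof -
  define F where "F y = Y * semicircle_area (real y / Y)" for y
  have step: "semicircle (real (Suc y) / Y) \<le> F (Suc y) - F y" "F (Suc y) - F y \<le> semicircle (real y / Y)" for y
  proof -
    have d: "real (Suc y) / Y - real y / Y = 1 / Y" by (simp add: diff_divide_distrib [symmetric])
    have "semicircle (real (Suc y) / Y) = Y * ((real (Suc y) / Y - real y / Y) * semicircle (real (Suc y) / Y))"
      unfolding d using Y by simp
    also have "\<dots> \<le> Y * (semicircle_area (real (Suc y) / Y) - semicircle_area (real y / Y))"
      using Y by (intro mult_left_mono semicircle_area_bounds(1)) (auto simp: divide_right_mono)
    finally show "semicircle (real (Suc y) / Y) \<le> F (Suc y) - F y"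
      by (simp add: F_def right_diff_distrib)
    have "Y * (semicircle_area (real (Suc y) / Y) - semicircle_area (real y / Y)) \<le>
        Y * ((real (Suc y) / Y - real y / Y) * semicircle (real y / Y))"
      using Y by (intro mult_left_mono semicircle_area_bounds(2)) (auto simp: divide_right_mono)
    also have "\<dots> = semicircle (real y / Y)" unfolding d using Y by simp
    finally show "F (Suc y) - F y \<le> semicircle (real y / Y)"
      by (simp add: F_def right_diff_distrib)
  qed
  have F0: "F 0 = 0" by (simp add: F_def semicircle_area_def)
  have "(\<Sum>y=1..m. semicircle (real y / Y)) \<le> F m" for m
  proof (induction m)
    case (Suc m)
    then show ?case using step(1)[of m] by simp
  qed (simp add: F0)
  then have 1: "(\<Sum>y=1..n. semicircle (real y / Y)) \<le> F n" .
  have 2: "F (Suc m) - 1 \<le> (\<Sum>y=1..m. semicircle (real y / Y))" for m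
  proof (induction m)
    case 0
    then show ?case using step(2)[of 0] semicircle_le_1[of "real 0 / Y"] F0 by simp
  next
    case (Suc m)
    then show ?case using step(2)[of "Suc m"] by simp
  qed
  have 3: "F m = Y * semicircle_area 1" if "real m \<ge> Y" for m
    unfolding F_def using that Y by (subst semicircle_area_eq) auto
  show ?thesis using 1 2[of n] 3[of n] 3[of "Suc n"] n by simp
qed

lemma card_int_interval:
  fixes \<alpha> \<beta> :: real assumes "\<alpha> \<le> \<beta>"
  shows "\<bar>real (card {x::int. \<alpha> \<le> of_int x \<and> of_int x \<le> \<beta>}) - (\<beta> - \<alpha>)\<bar> \<le> 1"
proof -
  have "{x::int. \<alpha> \<le> of_int x \<and> of_int x \<le> \<beta>} = {\<lceil>\<alpha>\<rceil>..\<lfloor>\<beta>\<rfloor>}"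
    by (auto simp: ceiling_le_iff le_floor_iff)
  then have "real (card {x::int. \<alpha> \<le> of_int x \<and> of_int x \<le> \<beta>}) = real (nat (\<lfloor>\<beta>\<rfloor> - \<lceil>\<alpha>\<rceil> + 1))"
    by simp
  moreover have "\<lfloor>\<beta>\<rfloor> - \<lceil>\<alpha>\<rceil> + 1 \<ge> 0"
  proof (rule ccontr)
    assume "\<not> ?thesis"
    then have "real_of_int \<lfloor>\<beta>\<rfloor> + 1 \<le> real_of_int \<lceil>\<alpha>\<rceil> - 1" by linarith
    then show False using assms by linarith
  qed
  ultimately have "real (card {x::int. \<alpha> \<le> of_int x \<and> of_int x \<le> \<beta>}) = real_of_int \<lfloor>\<beta>\<rfloor> - real_of_int \<lceil>\<alpha>\<rceil> + 1"
    by simp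
  then show ?thesis by linarith
qed

context quadratic_form
begin

definition lattice_count :: "nat \<Rightarrow> nat" where
  "lattice_count N = card {z. nrm z \<le> int N}"

lemma lattice_set_Union: "{z. nrm z \<le> int N} = (\<Union>m\<in>{0..N}. reps (int m))"
proof (intro equalityI subsetI)
  fix z assume "z \<in> {z. nrm z \<le> int N}"
  then have "nat (nrm z) \<in> {0..N}" "z \<in> reps (int (nat (nrm z)))"
    using nrm_nonneg[of z] by (auto simp: reps_def)
  then show "z \<in> (\<Union>m\<in>{0..N}. reps (int m))" by blast
qed (auto simp: reps_def)

lemma lattice_count_eq_sum: "lattice_count N = (\<Sum>m=0..N. card (reps (int m)))"
  unfolding lattice_count_def lattice_set_Union
  by (intro card_UN_disjoint ballI finite_reps) (auto simp: reps_def)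

text \<open>After multiplication by 4 and completion of the square, row \<open>y\<close> consists of
  the integers in an interval of length \<open>sqrt W\<close>.\<close>

lemma lattice_row:
  "\<bar>real (card {x. nrm (x, y) \<le> int N}) - sqrt (max 0 (4 * real N - (4 * c - b\<^sup>2) * (real_of_int y)\<^sup>2))\<bar> \<le> 1"
proof -
  define W where "W = 4 * real N - (4 * c - b\<^sup>2) * (real_of_int y)\<^sup>2"
  have iff: "nrm (x, y) \<le> int N \<longleftrightarrow> (2 * real_of_int x + b * y)\<^sup>2 \<le> W" for x
  proof -
    have "nrm (x, y) \<le> int N \<longleftrightarrow> 4 * nrm (x, y) \<le> 4 * int N" by simp
    also have "\<dots> \<longleftrightarrow> (2 * x + b * y)\<^sup>2 \<le> 4 * int N - (4 * c - b\<^sup>2) * y\<^sup>2"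
      unfolding four_nrm by auto
    also have "\<dots> \<longleftrightarrow> real_of_int ((2 * x + b * y)\<^sup>2) \<le> real_of_int (4 * int N - (4 * c - b\<^sup>2) * y\<^sup>2)"
      by (simp only: of_int_le_iff)
    finally show ?thesis by (simp add: W_def)
  qed
  show ?thesis
  proof (cases "W \<ge> 0")
    case False
    then have "\<not> (2 * real_of_int x + b * y)\<^sup>2 \<le> W" for x
      using zero_le_power2[of "2 * real_of_int x + b * y"] by linarith
    then show ?thesis unfolding iff W_def [symmetric] using False by simp
  next
    case True
    have "(2 * real_of_int x + b * y)\<^sup>2 \<le> W \<longleftrightarrow>
        (- sqrt W - b * y) / 2 \<le> of_int x \<and> of_int x \<le> (sqrt W - b * y) / 2" for x
    proof -
      have "(2 * real_of_int x + b * y)\<^sup>2 \<le> W \<longleftrightarrow> (2 * real_of_int x + b * y)\<^sup>2 \<le> (sqrt W)\<^sup>2" using True by simp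
      also have "\<dots> \<longleftrightarrow> \<bar>2 * real_of_int x + b * y\<bar> \<le> \<bar>sqrt W\<bar>"
        by (rule abs_le_square_iff [symmetric])
      finally show ?thesis using True by (auto simp: abs_le_iff)
    qed
    then have "{x. nrm (x, y) \<le> int N} =
        {x::int. (- sqrt W - b * y) / 2 \<le> of_int x \<and> of_int x \<le> (sqrt W - b * y) / 2}"
      unfolding iff by simp
    moreover have "(sqrt W - b * y) / 2 - (- sqrt W - b * y) / 2 = sqrt W" by (simp add: field_simps)
    ultimately show ?thesis
      using card_int_interval[of "(- sqrt W - b * y) / 2" "(sqrt W - b * y) / 2"] True
      unfolding W_def [symmetric] by simp
  qed
qed

text \<open>The hypothesis on \<open>n\<close> empties every row with \<open>|y| > n\<close>; what
  remains is an error of at most 1 for each of the \<open>2 n + 3\<close> rows that are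
  summed.\<close>

lemma lattice_count_rows:
  assumes "4 * real N \<le> (4 * c - b\<^sup>2) * (real n)\<^sup>2"
  shows "\<bar>real (lattice_count N) - (\<Sum>y\<in>{-int (Suc n)..int (Suc n)}. sqrt (max 0 (4 * real N - (4 * c - b\<^sup>2) * (real_of_int y)\<^sup>2)))\<bar> \<le> 2 * real n + 3"
proof -
  let ?A = "\<lambda>y. {x. nrm (x, y) \<le> int N}"
  let ?I = "{-int (Suc n)..int (Suc n)}"
  let ?s = "\<lambda>y::int. sqrt (max 0 (4 * real N - (4 * c - b\<^sup>2) * (real_of_int y)\<^sup>2))"
  have D: "real_of_int (4 * c - b\<^sup>2) > 0" using definite by linarith
  have yb: "y \<in> ?I" if "nrm (x, y) \<le> int N" for x y
  proof (rule ccontr)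
    assume "y \<notin> ?I"
    then have "\<bar>real_of_int y\<bar> > real n" by auto
    then have "(real n)\<^sup>2 < \<bar>real_of_int y\<bar>\<^sup>2" by (intro power_strict_mono) auto
    then have "(4 * c - b\<^sup>2) * (real n)\<^sup>2 < (4 * c - b\<^sup>2) * (real_of_int y)\<^sup>2"
      using D by (intro mult_strict_left_mono) auto
    then have "4 * real N < real_of_int ((4 * c - b\<^sup>2) * y\<^sup>2)" using assms by simp
    also have "(4 * c - b\<^sup>2) * y\<^sup>2 \<le> 4 * nrm (x, y)" unfolding four_nrm by simp
    finally have "real_of_int (4 * int N) < real_of_int (4 * nrm (x, y))" by simp
    then have "4 * int N < 4 * nrm (x, y)" by (simp only: of_int_less_iff)
    then show False using that by simp
  qed
  have fin: "finite (?A y)" for y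
  proof (rule finite_subset)
    show "?A y \<subseteq> fst ` (\<Union>m\<in>{0..N}. reps (int m))"
      unfolding lattice_set_Union [symmetric] by force
  qed (simp add: finite_reps)
  have "{z. nrm z \<le> int N} = prod.swap ` (SIGMA y:?I. ?A y)"
  proof (intro equalityI subsetI)
    fix z assume z: "z \<in> {z. nrm z \<le> int N}"
    then have "(snd z, fst z) \<in> (SIGMA y:?I. ?A y)" using yb[of "fst z" "snd z"] by simp
    then show "z \<in> prod.swap ` (SIGMA y:?I. ?A y)" by (rule rev_image_eqI) simp
  next
    fix z assume "z \<in> prod.swap ` (SIGMA y:?I. ?A y)"
    then obtain w where "w \<in> (SIGMA y:?I. ?A y)" "z = prod.swap w" by blast
    then show "z \<in> {z. nrm z \<le> int N}" by (cases w) simp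
  qed
  then have "lattice_count N = card (SIGMA y:?I. ?A y)"
    unfolding lattice_count_def by (simp add: card_image)
  also have "\<dots> = (\<Sum>y\<in>?I. card (?A y))" using fin by (intro card_SigmaI) auto
  finally have "real (lattice_count N) - (\<Sum>y\<in>?I. ?s y) = (\<Sum>y\<in>?I. real (card (?A y)) - ?s y)"
    by (simp add: sum_subtractf)
  also have "\<bar>\<dots>\<bar> \<le> (\<Sum>y\<in>?I. \<bar>real (card (?A y)) - ?s y\<bar>)" by (rule sum_abs)
  also have "\<dots> \<le> (\<Sum>y\<in>?I. 1)" by (intro sum_mono lattice_row)
  also have "\<dots> = 2 * real n + 3" by simp
  finally show ?thesis .
qed

lemma sum_symmetric_int:
  fixes h :: "int \<Rightarrow> real"
  assumes "\<And>y. h (- y) = h y"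
  shows "(\<Sum>y\<in>{-int n..int n}. h y) = h 0 + 2 * (\<Sum>y=1..n. h (int y))"
proof (induction n)
  case (Suc n)
  have "{-int (Suc n)..int (Suc n)} = insert (int (Suc n)) (insert (- int (Suc n)) {-int n..int n})" by auto
  then have "(\<Sum>y\<in>{-int (Suc n)..int (Suc n)}. h y) = h (int (Suc n)) + (h (- int (Suc n)) + (\<Sum>y\<in>{-int n..int n}. h y))"
    by simp
  then show ?case using Suc assms[of "int (Suc n)"] by simp
qed simp

text \<open>\<open>Y\<close> is the half-height of the ellipse \<open>nrm <= N\<close>, and row
  \<open>y\<close> has length \<open>2 sqrt N\<close> times \<open>semicircle (y / Y)\<close>; so
  the area is \<open>8 N / sqrt D\<close> times \<open>semicircle_area 1\<close>. Rounding the rows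
  costs \<open>2 n + 3 <= 9 sqrt N\<close>, and replacing the sum over rows by the integral costs at
  most \<open>6 sqrt N\<close>.\<close>

lemma lattice_count_asymp:
  fixes \<kappa> defines "\<kappa> \<equiv> 8 * semicircle_area 1 / sqrt (real_of_int (4 * c - b\<^sup>2))"
  assumes N: "N \<ge> 1"
  shows "\<bar>real (lattice_count N) - \<kappa> * real N\<bar> \<le> 15 * sqrt (real N)"
proof -
  define D where "D = real_of_int (4 * c - b\<^sup>2)"
  have D: "D \<ge> 1" using definite unfolding D_def by linarith
  define Y where "Y = sqrt (4 * real N / D)"
  define n where "n = nat \<lceil>Y\<rceil>"
  have Y0: "Y > 0" using N D by (simp add: Y_def)
  have Y2: "D * Y\<^sup>2 = 4 * real N" using N D by (simp add: Y_def)
  have nY: "real n \<ge> Y" "real n \<le> Y + 1" unfolding n_def using Y0 by linarith+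
  have "4 * real N / D \<le> 4 * real N" using D N by (simp add: field_simps)
  then have "Y \<le> sqrt (4 * real N)" unfolding Y_def by (rule real_sqrt_le_mono)
  then have YN: "Y \<le> 2 * sqrt (real N)" by (simp add: real_sqrt_mult)
  have le: "4 * real N \<le> (4 * c - b\<^sup>2) * (real n)\<^sup>2"
  proof -
    have "D * Y\<^sup>2 \<le> D * (real n)\<^sup>2" using D nY Y0 by (intro mult_left_mono power_mono) auto
    then show ?thesis using Y2 by (simp add: D_def)
  qed
  let ?s = "\<lambda>y::int. sqrt (max 0 (4 * real N - (4 * c - b\<^sup>2) * (real_of_int y)\<^sup>2))"
  have s: "?s y = 2 * sqrt (real N) * semicircle (real_of_int y / Y)" for y
  proof -
    have "4 * real N / Y\<^sup>2 = D" using Y2 Y0 by (simp add: field_simps)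
    then have "4 * real N - D * (real_of_int y)\<^sup>2 = 4 * real N * (1 - (real_of_int y / Y)\<^sup>2)"
      by (auto simp: power_divide right_diff_distrib)
    then have "4 * real N - (4 * c - b\<^sup>2) * (real_of_int y)\<^sup>2 = 4 * real N * (1 - (real_of_int y / Y)\<^sup>2)"
      by (simp only: D_def)
    also have "max 0 \<dots> = 4 * real N * max 0 (1 - (real_of_int y / Y)\<^sup>2)"
      by (simp add: max_mult_distrib_left)
    finally show ?thesis by (simp add: semicircle_def real_sqrt_mult)
  qed
  have "(\<Sum>y\<in>{-int (Suc n)..int (Suc n)}. ?s y) = ?s 0 + 2 * (\<Sum>y=1..Suc n. ?s (int y))"
    by (rule sum_symmetric_int) simp
  also have "\<dots> = 2 * sqrt (real N) * (1 + 2 * (\<Sum>y=1..Suc n. semicircle (real y / Y)))"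
    unfolding s by (simp add: sum_distrib_left semicircle_def algebra_simps)
  finally have sum: "(\<Sum>y\<in>{-int (Suc n)..int (Suc n)}. ?s y) =
      2 * sqrt (real N) * (1 + 2 * (\<Sum>y=1..Suc n. semicircle (real y / Y)))" .
  define \<sigma> where "\<sigma> = (\<Sum>y=1..Suc n. semicircle (real y / Y)) - Y * semicircle_area 1"
  have \<sigma>: "\<bar>\<sigma>\<bar> \<le> 1" unfolding \<sigma>_def using nY by (intro sum_semicircle Y0) auto
  have \<kappa>: "4 * sqrt (real N) * (Y * semicircle_area 1) = \<kappa> * real N"
    unfolding \<kappa>_def Y_def D_def [symmetric] using D
    by (simp add: real_sqrt_mult real_sqrt_divide)
  have q: "sqrt (real N) \<ge> 1" using N by simp
  have "\<bar>real (lattice_count N) - 2 * sqrt (real N) * (1 + 2 * (\<sigma> + Y * semicircle_area 1))\<bar> \<le> 2 * real n + 3"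
    using lattice_count_rows[OF le] unfolding sum by (simp add: \<sigma>_def)
  also have "2 * sqrt (real N) * (1 + 2 * (\<sigma> + Y * semicircle_area 1)) = \<kappa> * real N + sqrt (real N) * (2 + 4 * \<sigma>)"
    using \<kappa> by (simp add: algebra_simps)
  finally have "\<bar>real (lattice_count N) - \<kappa> * real N\<bar> \<le> 2 * real n + 3 + \<bar>sqrt (real N) * (2 + 4 * \<sigma>)\<bar>"
    by linarith
  also have "\<bar>sqrt (real N) * (2 + 4 * \<sigma>)\<bar> \<le> sqrt (real N) * 6"
    unfolding abs_mult using \<sigma> q by (intro mult_mono) auto
  finally show ?thesis using nY YN q by linarith
qed

text \<open>Only the origin has norm 0, and division by the number of units turns lattice points
  into values of \<open>rep_density\<close>. The constant 16 is the previous 15 plus 1 for the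
  removed origin.\<close>

lemma sum_rep_density_asymp:
  "\<exists>\<rho>>0. \<exists>C. \<forall>N\<ge>1. \<bar>(\<Sum>n=1..N. rep_density n) - \<rho> * real N\<bar> \<le> C * sqrt (real N)"
proof -
  define \<kappa> where "\<kappa> = 8 * semicircle_area 1 / sqrt (real_of_int (4 * c - b\<^sup>2))"
  define w where "w = real (card (reps 1))"
  have w: "w \<ge> 1" using card_reps_1_pos by (simp add: w_def)
  have D: "real_of_int (4 * c - b\<^sup>2) > 0" using definite by linarith
  then have \<kappa>: "\<kappa> > 0" unfolding \<kappa>_def using semicircle_area_1_pos by (auto intro: divide_pos_pos)
  have "reps 0 = {(0, 0)}"
  proof -
    have zero: "x = 0 \<and> y = 0" if "nrm (x, y) = 0" for x y
    proof -
      have "(2 * x + b * y)\<^sup>2 + (4 * c - b\<^sup>2) * y\<^sup>2 = 0" using four_nrm[of "(x, y)"] that by simp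
      moreover have "(4 * c - b\<^sup>2) * y\<^sup>2 \<ge> 0" using definite by simp
      ultimately have "(4 * c - b\<^sup>2) * y\<^sup>2 = 0" "(2 * x + b * y)\<^sup>2 = 0"
        using zero_le_power2[of "2 * x + b * y"] by linarith+
      moreover have "4 * c - b\<^sup>2 \<noteq> 0" using definite by simp
      ultimately have "y = 0" "2 * x + b * y = 0" by simp_all
      then show ?thesis by simp
    qed
    have "reps 0 \<subseteq> {(0, 0)}"
    proof
      fix z assume "z \<in> reps 0"
      then have "nrm (fst z, snd z) = 0" by (simp add: reps_def)
      from zero[OF this] show "z \<in> {(0, 0)}" by (cases z) simp
    qed
    moreover have "(0, 0) \<in> reps 0" by (simp add: reps_def nrm_def)
    ultimately show ?thesis by blast
  qed
  then have r0: "card (reps 0) = 1" by simp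
  have "\<bar>(\<Sum>n=1..N. rep_density n) - \<kappa> / w * real N\<bar> \<le> 16 * sqrt (real N)" if N: "N \<ge> 1" for N
  proof -
    have "real (lattice_count N) = 1 + w * (\<Sum>n=1..N. rep_density n)"
      unfolding lattice_count_eq_sum using r0 w
      by (simp add: sum.atLeast_Suc_atMost rep_density_def w_def sum_distrib_left)
    then have e: "w * ((\<Sum>n=1..N. rep_density n) - \<kappa> / w * real N) = (real (lattice_count N) - \<kappa> * real N) - 1"
      using w by (simp add: algebra_simps)
    have "1 * \<bar>(\<Sum>n=1..N. rep_density n) - \<kappa> / w * real N\<bar> \<le> w * \<bar>(\<Sum>n=1..N. rep_density n) - \<kappa> / w * real N\<bar>"
      using w by (intro mult_right_mono) auto
    also have "\<dots> = \<bar>(real (lattice_count N) - \<kappa> * real N) - 1\<bar>"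
      using w unfolding e [symmetric] by (simp add: abs_mult)
    also have "\<dots> \<le> 15 * sqrt (real N) + 1"
      using lattice_count_asymp[OF N] unfolding \<kappa>_def by linarith
    also have "\<dots> \<le> 16 * sqrt (real N)" using N by simp
    finally show ?thesis by simp
  qed
  then show ?thesis using \<kappa> w by (intro exI[of _ "\<kappa> / w"]) (auto intro!: divide_pos_pos)
qed

end

section \<open>The von Mangoldt weights of a quadratic field\<close>

text \<open>
  The recursions characterise the number of ideals of norm \<open>n\<close>, with \<open>P\<close> and \<open>I\<close> the split and
  the inert primes.
\<close>

locale split_multiplicative =
  fixes g :: "nat \<Rightarrow> real" and P I :: "nat set"
  assumes P_prime: "\<And>p. p \<in> P \<Longrightarrow> prime p"
    and PI_disjoint: "P \<inter> I = {}"
    and g_1: "g 1 = 1"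
    and g_split: "\<And>p n. p \<in> P \<Longrightarrow> n > 0 \<Longrightarrow>
          g (p * n) = 2 * g n - (if p dvd n then g (n div p) else 0)"
    and g_inert: "\<And>p n. p \<in> I \<Longrightarrow> n > 0 \<Longrightarrow> g (p * n) = (if p dvd n then g (n div p) else 0)"
    and g_ramified: "\<And>p n. prime p \<Longrightarrow> p \<notin> P \<Longrightarrow> p \<notin> I \<Longrightarrow> g (p * n) = g n"
begin

definition loc :: "nat \<Rightarrow> nat \<Rightarrow> real" where
  "loc p a = (if p \<in> P then real a + 1 else if p \<in> I then (if even a then 1 else 0) else 1)"

text \<open>The induction takes two steps at once, because the recursions look back to
  \<open>n div p\<close>.\<close>

lemma g_prime_power_mult:
  assumes p: "prime p" "\<not> p dvd m" "m > 0"
  shows "g (p ^ a * m) = loc p a * g m"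
proof (induction a rule: induct_nat_012)
  case 0
  then show ?case by (simp add: loc_def)
next
  case 1
  then show ?case
    using g_split[of p m] g_inert[of p m] g_ramified[of p m] p by (auto simp: loc_def)
next
  case (ge2 a)
  let ?n = "p ^ Suc a * m"
  have pos: "?n > 0" using p by (simp add: prime_gt_0_nat)
  have d: "p dvd ?n" "?n div p = p ^ a * m" using p by (auto simp: prime_gt_0_nat)
  have e: "p ^ Suc (Suc a) * m = p * ?n" by simp
  show ?case
  proof (cases "p \<in> P")
    case True
    then show ?thesis unfolding e using g_split[OF True pos] d ge2 by (simp add: loc_def algebra_simps)
  next
    case notP: False
    show ?thesis
    proof (cases "p \<in> I")
      case True
      then show ?thesis unfolding e using g_inert[OF True pos] d ge2 notP by (simp add: loc_def)
    next
      case False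
      then show ?thesis unfolding e using g_ramified[OF p(1) notP False, of ?n] ge2 notP by (simp add: loc_def)
    qed
  qed
qed

lemma g_prod:
  assumes "n > 0"
  shows "g n = (\<Prod>p\<in>prime_factors n. loc p (multiplicity p n))"
  using assms
proof (induction n rule: less_induct)
  case (less n)
  show ?case
  proof (cases "n = 1")
    case True
    then show ?thesis using g_1 by simp
  next
    case False
    then obtain p where p: "prime p" "p dvd n" using prime_factor_nat by blast
    define a where "a = multiplicity p n"
    obtain m where m: "n = p ^ a * m" "\<not> p dvd m"
      using multiplicity_decompose'[of n p] less.prems p unfolding a_def by (metis not_prime_unit not_gr0)
    have a0: "a > 0" unfolding a_def using p less.prems by (simp add: prime_multiplicity_gt_zero_iff)
    have m0: "m > 0" using m less.prems by (auto intro: Nat.gr0I)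
    have "p ^ a > 1" using a0 p(1) by (metis one_less_power prime_gt_1_nat)
    then have "m < n" using m(1) m0 by simp
    from less.IH[OF this m0] have IH: "g m = (\<Prod>q\<in>prime_factors m. loc q (multiplicity q m))" .
    have pf: "prime_factors n = insert p (prime_factors m)"
      using m(1) m0 a0 p(1) prime_factors_product[of "p ^ a" m]
      by (auto simp: prime_factors_power prime_prime_factors prime_gt_0_nat)
    have pn: "p \<notin> prime_factors m" using m(2) by auto
    have mq: "multiplicity q n = multiplicity q m" if "q \<in> prime_factors m" for q
    proof -
      have q: "prime q" "q \<noteq> p" using that pn by auto
      have "multiplicity q n = multiplicity q (p ^ a) + multiplicity q m"
        unfolding m(1) using q p m0 by (intro prime_elem_multiplicity_mult_distrib) auto
      also have "multiplicity q (p ^ a) = 0"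
        using q p(1) by (intro multiplicity_distinct_prime_power)
      finally show ?thesis by simp
    qed
    have "(\<Prod>q\<in>prime_factors n. loc q (multiplicity q n)) =
        loc p a * (\<Prod>q\<in>prime_factors m. loc q (multiplicity q n))"
      unfolding pf using pn by (simp add: a_def)
    also have "(\<Prod>q\<in>prime_factors m. loc q (multiplicity q n)) = g m"
      unfolding IH using mq by (intro prod.cong) auto
    finally show ?thesis using g_prime_power_mult[OF p(1) m(2) m0, of a] m(1) by simp
  qed
qed

text \<open>A nonzero value forces even exponents at all inert primes; these and the ramified primes
  then contribute the factor 1.\<close>

lemma g_eq_prod:
  assumes "n > 0" "g n \<noteq> 0"
  shows "g n = (\<Prod>p\<in>prime_factors n \<inter> P. real (multiplicity p n) + 1)"
proof -
  have nz: "loc p (multiplicity p n) \<noteq> 0" if "p \<in> prime_factors n" for p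
    using assms(2) that unfolding g_prod[OF assms(1)] by simp
  have "g n = (\<Prod>p\<in>prime_factors n. if p \<in> P then real (multiplicity p n) + 1 else 1)"
    unfolding g_prod[OF assms(1)]
  proof (intro prod.cong refl)
    fix p assume "p \<in> prime_factors n"
    with nz have "loc p (multiplicity p n) \<noteq> 0" by blast
    then show "loc p (multiplicity p n) = (if p \<in> P then real (multiplicity p n) + 1 else 1)"
      by (auto simp: loc_def split: if_splits)
  qed
  also have "\<dots> = (\<Prod>p\<in>prime_factors n \<inter> P. real (multiplicity p n) + 1)"
    by (simp add: prod.inter_restrict)
  finally show ?thesis .
qed

lemma g_eq_prod_split:
  assumes "n > 0" "prime_factors n \<subseteq> P"
  shows "g n = (\<Prod>p\<in>prime_factors n. real (multiplicity p n) + 1)"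
  unfolding g_prod[OF assms(1)] using assms(2) by (intro prod.cong) (auto simp: loc_def)

text \<open>The coefficients of the negative logarithmic derivative of the Dirichlet series of \<open>g\<close>.\<close>

definition lam_coeff :: "nat \<Rightarrow> nat \<Rightarrow> real" where
  "lam_coeff p j = (if p \<in> P then 2 else if p \<in> I then (if even j then 2 else 0) else 1)"

definition lam :: "nat \<Rightarrow> real" where
  "lam n = lam_coeff (aprimedivisor n) (multiplicity (aprimedivisor n) n) * mangoldt n"

lemma lam_nonneg: "lam n \<ge> 0"
  unfolding lam_def lam_coeff_def by (simp add: mangoldt_nonneg)

lemma lam_le: "n > 0 \<Longrightarrow> lam n \<le> 2 * ln (real n)"
  using mangoldt_le[of n] mangoldt_nonneg[of n] by (auto simp: lam_def lam_coeff_def)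

lemma lam_prime_power:
  assumes "prime p" "k > 0" shows "lam (p ^ k) = lam_coeff p k * ln (real p)"
  using assms by (simp add: lam_def aprimedivisor_prime_power)

lemma lam_eq_0: "\<not> primepow n \<Longrightarrow> lam n = 0"
  by (simp add: lam_def mangoldt_def)

text \<open>This is \<open>lam_convolution\<close> on the powers of one prime, divided by
  \<open>ln p\<close>: a local Euler factor times its logarithmic derivative is its
  derivative.\<close>

lemma sum_lam_coeff: "(\<Sum>j\<in>{0<..a}. lam_coeff p j * loc p (a - j)) = real a * loc p a"
proof (cases "p \<in> P")
  case True
  have "(\<Sum>j\<in>{0<..a}. lam_coeff p j * loc p (a - j)) = (\<Sum>j\<in>{0<..a}. 2 * (real (a - j) + 1))"
    using True by (simp add: lam_coeff_def loc_def)
  also have "\<dots> = real a * (real a + 1)"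
  proof (induction a)
    case (Suc a)
    have "(\<Sum>j\<in>{0<..Suc a}. 2 * (real (Suc a - j) + 1)) = (\<Sum>j\<in>{0<..a}. 2 * (real (a - j) + 1) + 2) + 2"
    proof -
      have "{0<..Suc a} = insert (Suc a) {0<..a}" by auto
      moreover have "(\<Sum>j\<in>{0<..a}. 2 * (real (Suc a - j) + 1)) = (\<Sum>j\<in>{0<..a}. 2 * (real (a - j) + 1) + 2)"
        by (intro sum.cong) (auto simp: Suc_diff_le)
      ultimately show ?thesis by simp
    qed
    also have "\<dots> = real a * (real a + 1) + 2 * real a + 2"
      by (subst sum.distrib, subst Suc) simp
    finally show ?case by (simp add: algebra_simps)
  qed simp
  finally show ?thesis using True by (simp add: loc_def)
next
  case notP: False
  show ?thesis
  proof (cases "p \<in> I")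
    case True
    have "(\<Sum>j\<in>{0<..a}. lam_coeff p j * loc p (a - j)) =
        (\<Sum>j\<in>{0<..a}. if even j \<and> even a then 2 else (0::real))"
      using True notP by (intro sum.cong) (auto simp: lam_coeff_def loc_def)
    also have "\<dots> = (if even a then real a else 0)"
    proof (cases "even a")
      case ev: True
      have "(\<Sum>j\<in>{0<..2*m}. if even j then 2 else (0::real)) = real (2 * m)" for m
      proof (induction m)
        case (Suc m)
        have "{0<..2 * Suc m} = insert (2*m+2) (insert (2*m+1) {0<..2*m})" by auto
        then show ?case using Suc by simp
      qed simp
      from this[of "a div 2"] show ?thesis using ev by simp
    qed simp
    finally show ?thesis using True notP by (simp add: loc_def)
  next
    case False
    then show ?thesis using notP by (simp add: lam_coeff_def loc_def)
  qed
qed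

text \<open>Only prime powers dividing \<open>n\<close> contribute. With \<open>n = p^a m\<close>,
  the powers of one prime \<open>p\<close> give \<open>g n\<close> times \<open>a ln p\<close> by
  \<open>sum_lam_coeff\<close>, and these amounts add up to \<open>g n ln n\<close>.\<close>

lemma lam_convolution:
  assumes n: "n > 0"
  shows "(\<Sum>d | d dvd n. lam d * g (n div d)) = g n * ln (real n)"
proof -
  let ?S = "SIGMA p:prime_factors n. {0<..multiplicity p n}"
  have inj: "inj_on (\<lambda>(p, k). p ^ k) ?S"
  proof (rule inj_onI, clarify)
    fix p k q j assume a: "p \<in> prime_factors n" "k \<in> {0<..multiplicity p n}"
      "q \<in> prime_factors n" "j \<in> {0<..multiplicity q n}" "p ^ k = q ^ j"
    have pq: "prime p" "prime q" using a by auto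
    have "aprimedivisor (p ^ k) = p" "aprimedivisor (q ^ j) = q"
      using a(2,4) pq by (simp_all add: aprimedivisor_prime_power)
    then have "p = q" using a(5) by simp
    then show "p = q \<and> k = j" using a(5) pq by (metis power_inject_exp prime_gt_1_nat)
  qed
  have im: "(\<lambda>(p, k). p ^ k) ` ?S = primepow_factors n"
    unfolding primepow_factors_altdef[OF gr_implies_not0[OF n]] by (force simp: image_iff)
  have "(\<Sum>d | d dvd n. lam d * g (n div d)) = (\<Sum>d\<in>primepow_factors n. lam d * g (n div d))"
    using n lam_eq_0 by (intro sum.mono_neutral_right) (force simp: primepow_factors_def)+
  also have "\<dots> = (\<Sum>(p, k)\<in>?S. lam (p ^ k) * g (n div p ^ k))"
    unfolding im [symmetric] by (subst sum.reindex[OF inj]) (simp add: case_prod_unfold o_def)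
  also have "\<dots> = (\<Sum>p\<in>prime_factors n. \<Sum>k\<in>{0<..multiplicity p n}. lam (p ^ k) * g (n div p ^ k))"
    by (rule sum.Sigma [symmetric]) auto
  also have "\<dots> = (\<Sum>p\<in>prime_factors n. g n * (real (multiplicity p n) * ln (real p)))"
  proof (rule sum.cong)
    fix p assume "p \<in> prime_factors n"
    then have p: "prime p" "p dvd n" by auto
    define a where "a = multiplicity p n"
    obtain m where m: "n = p ^ a * m" "\<not> p dvd m"
      using multiplicity_decompose'[of n p] n p unfolding a_def by (metis not_prime_unit not_gr0)
    have m0: "m > 0" using m n by (auto intro: Nat.gr0I)
    have "(\<Sum>k\<in>{0<..a}. lam (p ^ k) * g (n div p ^ k)) =
        (\<Sum>k\<in>{0<..a}. (lam_coeff p k * loc p (a - k)) * (ln (real p) * g m))"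
    proof (rule sum.cong)
      fix k assume k: "k \<in> {0<..a}"
      have "p ^ a = p ^ k * p ^ (a - k)" using k by (simp flip: power_add)
      then have "n div p ^ k = p ^ (a - k) * m" using m(1) p(1) by (simp add: prime_gt_0_nat mult.assoc)
      then show "lam (p ^ k) * g (n div p ^ k) = (lam_coeff p k * loc p (a - k)) * (ln (real p) * g m)"
        using k p(1) g_prime_power_mult[OF p(1) m(2) m0] by (simp add: lam_prime_power)
    qed simp
    also have "\<dots> = (real a * loc p a) * (ln (real p) * g m)"
      unfolding sum_lam_coeff [symmetric] by (simp add: sum_distrib_right)
    also have "\<dots> = g n * (real a * ln (real p))"
      using g_prime_power_mult[OF p(1) m(2) m0, of a] m(1) by simp
    finally show "(\<Sum>k\<in>{0<..multiplicity p n}. lam (p ^ k) * g (n div p ^ k)) =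
        g n * (real (multiplicity p n) * ln (real p))"
      unfolding a_def .
  qed simp
  also have "\<dots> = g n * (\<Sum>p\<in>prime_factors n. real (multiplicity p n) * ln (real p))"
    by (simp add: sum_distrib_left)
  also have "(\<Sum>p\<in>prime_factors n. real (multiplicity p n) * ln (real p)) = ln (real n)"
  proof -
    have "real n = (\<Prod>p\<in>prime_factors n. real p ^ multiplicity p n)"
      using n prime_factorization_nat[of n] by (metis (mono_tags, lifting) of_nat_prod of_nat_power prod.cong)
    then have "ln (real n) = ln (\<Prod>p\<in>prime_factors n. real p ^ multiplicity p n)" by simp
    also have "\<dots> = (\<Sum>p\<in>prime_factors n. ln (real p ^ multiplicity p n))"
      by (intro ln_prod) (auto simp: in_prime_factors_iff prime_gt_0_nat)
    finally show ?thesis by (auto simp: ln_realpow prime_gt_0_nat in_prime_factors_iff intro!: sum.cong)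
  qed
  finally show ?thesis .
qed

lemma lam_split_prime: "q \<in> P \<Longrightarrow> lam q = 2 * ln (real q)"
  using lam_prime_power[of q 1] P_prime[of q] by (simp add: lam_coeff_def)

definition ramified :: "nat set" where
  "ramified = {p. prime p \<and> p \<notin> P \<and> p \<notin> I}"

text \<open>Besides the split primes, \<open>lam\<close> lives on ramified primes and on powers
  \<open>p^k\<close> with \<open>k >= 2\<close>, because an inert prime has coefficient 0 at odd
  exponents. For \<open>k >= 2\<close> both \<open>p <= sqrt N\<close> and
  \<open>k <= log 2 N\<close>, so there are few such \<open>n\<close>.\<close>

lemma lam_nonzero_cases:
  assumes n: "lam n \<noteq> 0" "n \<notin> P" "n \<le> N"
  shows "n \<in> ramified \<or> n \<in> (\<lambda>(p, k). p ^ k) ` ({1..nat \<lfloor>sqrt (real N)\<rfloor>} \<times> {1..nat \<lfloor>log 2 (real N)\<rfloor>})"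
proof -
  have "primepow n" using n(1) lam_eq_0 by blast
  then obtain p k where pk: "prime p" "k > 0" "n = p ^ k" by (auto simp: primepow_def)
  have p2: "p \<ge> 2" using prime_ge_2_nat[OF pk(1)] .
  show ?thesis
  proof (cases "k = 1")
    case True
    then have "lam p \<noteq> 0" using n pk by simp
    then have "p \<notin> I" using lam_prime_power[OF pk(1), of 1] n(2) pk True by (auto simp: lam_coeff_def)
    then show ?thesis using pk n(2) True by (simp add: ramified_def)
  next
    case False
    then have "p ^ 2 \<le> p ^ k" using pk p2 by (intro power_increasing) auto
    then have "p ^ 2 \<le> N" using pk n by simp
    then have "real (p ^ 2) \<le> real N" by (simp only: of_nat_le_iff)
    then have "real p \<le> sqrt (real N)" by (intro real_le_rsqrt) simp
    then have 1: "p \<in> {1..nat \<lfloor>sqrt (real N)\<rfloor>}" using p2 by (simp add: le_nat_iff le_floor_iff)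
    have "(2::nat) ^ k \<le> p ^ k" using p2 by (intro power_mono) auto
    then have "2 ^ k \<le> N" using pk(3) n(3) by linarith
    then have "real (2 ^ k) \<le> real N" by (simp only: of_nat_le_iff)
    then have "2 powr real k \<le> real N" by (simp add: powr_realpow)
    moreover have "real N > 0" using \<open>2 ^ k \<le> N\<close> by (cases N) auto
    ultimately have "real k \<le> log 2 (real N)" by (simp add: le_log_iff)
    then have 2: "k \<in> {1..nat \<lfloor>log 2 (real N)\<rfloor>}" using pk(2) by (simp add: le_nat_iff le_floor_iff)
    show ?thesis using 1 2 pk(3) by (intro disjI2 image_eqI[of _ _ "(p, k)"]) auto
  qed
qed

lemma theta_of_psi:
  assumes fin: "finite ramified"
    and psi: "\<And>N. N \<ge> 3 \<Longrightarrow> \<bar>(\<Sum>n=1..N. lam n * (ln (real n))\<^sup>2) - real N * (ln (real N))\<^sup>2\<bar> \<le> K * real N * ln (real N)"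
  shows "\<exists>K0\<ge>0. \<forall>N\<ge>3. \<bar>(\<Sum>q\<in>{q\<in>P. q \<le> N}. 2 * ln (real q) ^ 3) - real N * ln (real N) ^ 2\<bar> \<le> K0 * real N * ln (real N)"
proof -
  define r where "r = real (card ramified)"
  define K0 where "K0 = \<bar>K\<bar> + 864 + 72 * r"
  have "\<bar>(\<Sum>q\<in>{q\<in>P. q \<le> N}. 2 * ln (real q) ^ 3) - real N * ln (real N) ^ 2\<bar> \<le> K0 * real N * ln (real N)" if N: "N \<ge> 3" for N
  proof -
    define x where "x = real N"
    define l where "l = ln x"
    have x: "x \<ge> 3" using N by (simp add: x_def)
    have l0: "l \<ge> 0" using x by (simp add: l_def)
    define Bd where "Bd = {n \<in> {1..N}. n \<notin> P \<and> lam n \<noteq> 0}"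
    let ?f = "\<lambda>n. lam n * (ln (real n))\<^sup>2"
    have Psub: "{q\<in>P. q \<le> N} \<subseteq> {1..N}" using P_prime prime_ge_1_nat by auto
    have "(\<Sum>n=1..N. ?f n) = (\<Sum>n\<in>{q\<in>P. q \<le> N} \<union> Bd. ?f n)"
      using Psub by (intro sum.mono_neutral_right) (auto simp: Bd_def)
    also have "\<dots> = (\<Sum>q\<in>{q\<in>P. q \<le> N}. ?f q) + (\<Sum>n\<in>Bd. ?f n)"
      using finite_subset[OF Psub] by (intro sum.union_disjoint) (auto simp: Bd_def)
    also have "(\<Sum>q\<in>{q\<in>P. q \<le> N}. ?f q) = (\<Sum>q\<in>{q\<in>P. q \<le> N}. 2 * ln (real q) ^ 3)"
      by (intro sum.cong) (auto simp: lam_split_prime power2_eq_square power3_eq_cube)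
    finally have split: "(\<Sum>n=1..N. ?f n) = (\<Sum>q\<in>{q\<in>P. q \<le> N}. 2 * ln (real q) ^ 3) + (\<Sum>n\<in>Bd. ?f n)" .
    have Bd0: "(\<Sum>n\<in>Bd. ?f n) \<ge> 0" using lam_nonneg by (intro sum_nonneg) auto
    have "(\<Sum>n\<in>Bd. ?f n) \<le> (\<Sum>n\<in>Bd. 2 * l ^ 3)"
    proof (rule sum_mono)
      fix n assume n: "n \<in> Bd"
      then have n1: "n \<ge> 1" "n \<le> N" by (auto simp: Bd_def)
      then have nl: "0 \<le> ln (real n)" "ln (real n) \<le> l" by (auto simp: l_def x_def)
      have "?f n \<le> (2 * ln (real n)) * (ln (real n))\<^sup>2" using lam_le[of n] n1 by (intro mult_right_mono) auto
      also have "\<dots> = 2 * ln (real n) ^ 3" by (simp add: power2_eq_square power3_eq_cube)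
      also have "\<dots> \<le> 2 * l ^ 3" using nl by (intro mult_left_mono power_mono) auto
      finally show "?f n \<le> 2 * l ^ 3" .
    qed
    also have "\<dots> = real (card Bd) * (2 * l ^ 3)" by simp
    also have "\<dots> \<le> (r + sqrt x * (2 * l)) * (2 * l ^ 3)"
    proof (intro mult_right_mono)
      let ?G = "{1..nat \<lfloor>sqrt (real N)\<rfloor>} \<times> {1..nat \<lfloor>log 2 (real N)\<rfloor>}"
      have "Bd \<subseteq> ramified \<union> (\<lambda>(p, k). p ^ k) ` ?G"
      proof
        fix n assume "n \<in> Bd"
        then show "n \<in> ramified \<union> (\<lambda>(p, k). p ^ k) ` ?G" using lam_nonzero_cases[of n N] by (auto simp: Bd_def)
      qed
      then have "card Bd \<le> card (ramified \<union> (\<lambda>(p, k). p ^ k) ` ?G)" using fin by (intro card_mono) auto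
      also have "\<dots> \<le> card ramified + card ((\<lambda>(p, k). p ^ k) ` ?G)" by (rule card_Un_le)
      also have "card ((\<lambda>(p, k). p ^ k) ` ?G) \<le> card ?G" by (rule card_image_le) simp
      also have "card ?G = nat \<lfloor>sqrt x\<rfloor> * nat \<lfloor>log 2 x\<rfloor>" by (simp add: x_def)
      finally have "card Bd \<le> card ramified + nat \<lfloor>sqrt x\<rfloor> * nat \<lfloor>log 2 x\<rfloor>" by simp
      then have "real (card Bd) \<le> r + real (nat \<lfloor>sqrt x\<rfloor>) * real (nat \<lfloor>log 2 x\<rfloor>)"
        unfolding r_def by (simp flip: of_nat_mult of_nat_add)
      also have "real (nat \<lfloor>sqrt x\<rfloor>) * real (nat \<lfloor>log 2 x\<rfloor>) \<le> sqrt x * (2 * l)"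
      proof (intro mult_mono)
        have lg: "log 2 x = l / ln 2" by (simp add: log_def l_def)
        have "l / ln 2 \<le> l / (1/2)" using l0 ln2_ge_two_thirds by (intro divide_left_mono) auto
        then have "log 2 x \<le> 2 * l" using lg by simp
        moreover have "log 2 x \<ge> 0" using lg l0 by simp
        ultimately show "real (nat \<lfloor>log 2 x\<rfloor>) \<le> 2 * l" by linarith
      qed (use x in auto)
      finally show "real (card Bd) \<le> r + sqrt x * (2 * l)" by simp
    qed (use l0 in simp)
    also have "\<dots> \<le> (864 + 72 * r) * x * l"
    proof -
      \<comment> \<open>With \<open>l <= 6 u\<close>, powers of \<open>l\<close> are traded for
        powers of \<open>u = x^(1/6)\<close>: 72 is \<open>2 * 36\<close> with
        \<open>l^2 <= 36 x\<close>, and 864 is \<open>4 * 216\<close> with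
        \<open>sqrt x * l^3 <= 216 x\<close>.\<close>
      define u where "u = x powr (1/6)"
      have u1: "u \<ge> 1" unfolding u_def using x by (intro ge_one_powr_ge_zero) auto
      have "l \<le> x powr (1/6) / (1/6)" unfolding l_def using x by (intro ln_powr_bound) auto
      then have lu: "l \<le> 6 * u" by (simp add: u_def)
      have u6: "u ^ 6 = x" using x by (simp add: u_def powr_powr flip: powr_realpow)
      have sq: "sqrt x = u ^ 3" using x by (simp add: u_def powr_powr powr_half_sqrt flip: powr_realpow)
      have "l ^ 3 \<le> (6 * u) ^ 3" "l ^ 2 \<le> (6 * u) ^ 2" using lu l0 by (intro power_mono; simp)+
      then have l3: "l ^ 3 \<le> 216 * u ^ 3" and l2: "l ^ 2 \<le> 36 * u ^ 2" by (simp_all add: power_mult_distrib)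
      have "u ^ 2 \<le> u ^ 6" using u1 by (intro power_increasing) auto
      then have l2': "l ^ 2 \<le> 36 * x" using l2 u6 by linarith
      have "(r + sqrt x * (2 * l)) * (2 * l ^ 3) = 2 * (r * l ^ 2) * l + 4 * (u ^ 3 * l ^ 3) * l"
        unfolding sq by (simp add: algebra_simps eval_nat_numeral)
      also have "\<dots> \<le> 2 * (r * (36 * x)) * l + 4 * (u ^ 3 * (216 * u ^ 3)) * l"
        using l2' l3 l0 u1 by (intro add_mono mult_right_mono mult_left_mono) (auto simp: r_def)
      also have "u ^ 3 * (216 * u ^ 3) = 216 * x" unfolding u6 [symmetric] by (simp add: eval_nat_numeral)
      finally show ?thesis by (simp add: algebra_simps)
    qed
    finally have Bd1: "(\<Sum>n\<in>Bd. ?f n) \<le> (864 + 72 * r) * x * l" .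
    have "\<bar>(\<Sum>n=1..N. ?f n) - x * l\<^sup>2\<bar> \<le> K * x * l" using psi[OF N] by (simp add: x_def l_def)
    also have "\<dots> \<le> \<bar>K\<bar> * x * l" using x l0 by (intro mult_right_mono) auto
    finally have "\<bar>(\<Sum>n=1..N. ?f n) - x * l\<^sup>2\<bar> \<le> \<bar>K\<bar> * x * l" .
    moreover have "K0 * x * l = \<bar>K\<bar> * x * l + (864 + 72 * r) * x * l" by (simp add: K0_def algebra_simps)
    ultimately show ?thesis unfolding x_def [symmetric] l_def [symmetric] using split Bd0 Bd1 by linarith
  qed
  moreover have "K0 \<ge> 0" by (simp add: K0_def r_def)
  ultimately show ?thesis by blast
qed

end

section \<open>Dirichlet series\<close>

text \<open>The index 0 is harmless, since \<open>0 powr (- s) = 0\<close>.\<close>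

definition dterm :: "(nat \<Rightarrow> real) \<Rightarrow> complex \<Rightarrow> nat \<Rightarrow> complex" where
  "dterm c s n = of_real (c n) * of_nat n powr (- s)"

definition dseries :: "(nat \<Rightarrow> real) \<Rightarrow> complex \<Rightarrow> complex" where
  "dseries c s = (\<Sum>n. dterm c s n)"

definition dconv :: "(nat \<Rightarrow> real) \<Rightarrow> bool" where
  "dconv c \<longleftrightarrow> (\<forall>\<sigma>>1. summable (\<lambda>n. \<bar>c n\<bar> * real n powr (- \<sigma>)))"

lemma norm_dterm: "norm (dterm c s n) = \<bar>c n\<bar> * real n powr (- Re s)"
  by (simp add: dterm_def norm_mult norm_powr_real_powr)

lemma dconv_summable_norm:
  assumes "dconv c" "Re s > 1" shows "summable (\<lambda>n. norm (dterm c s n))"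
  using assms by (simp add: norm_dterm dconv_def)

lemma dconv_summable:
  assumes "dconv c" "Re s > 1" shows "summable (dterm c s)"
  using dconv_summable_norm[OF assms] by (rule summable_norm_cancel)

lemma dconv_sums:
  assumes "dconv c" "Re s > 1" shows "dterm c s sums dseries c s"
  unfolding dseries_def using dconv_summable[OF assms] by (rule summable_sums)

lemma dconv_mono:
  assumes "dconv d" "\<And>n. n > 0 \<Longrightarrow> \<bar>c n\<bar> \<le> \<bar>d n\<bar>"
  shows "dconv c"
  unfolding dconv_def
proof (intro allI impI)
  fix \<sigma> :: real assume \<sigma>: "\<sigma> > 1"
  have "summable (\<lambda>n. \<bar>d n\<bar> * real n powr (- \<sigma>))" using assms(1) \<sigma> by (simp add: dconv_def)
  then show "summable (\<lambda>n. \<bar>c n\<bar> * real n powr (- \<sigma>))"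
  proof (rule summable_comparison_test'[where N = 0])
    fix n show "norm (\<bar>c n\<bar> * real n powr (- \<sigma>)) \<le> \<bar>d n\<bar> * real n powr (- \<sigma>)"
      using assms(2)[of n] by (cases "n = 0") (auto intro: mult_right_mono)
  qed
qed

text \<open>Half of the distance from \<open>\<sigma>\<close> to 1 pays for the logarithm, through
  \<open>ln n <= n powr \<delta> / \<delta>\<close>.\<close>

lemma dconv_ln:
  assumes "dconv c" shows "dconv (\<lambda>n. c n * ln (real n))"
  unfolding dconv_def
proof (intro allI impI)
  fix \<sigma> :: real assume \<sigma>: "\<sigma> > 1"
  define \<delta> where "\<delta> = (\<sigma> - 1) / 2"
  have \<delta>: "\<delta> > 0" "\<sigma> - \<delta> > 1" using \<sigma> by (auto simp: \<delta>_def field_simps)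
  have "summable (\<lambda>n. \<bar>c n\<bar> * real n powr (- (\<sigma> - \<delta>)))" using assms \<delta> unfolding dconv_def by blast
  then have "summable (\<lambda>n. 1 / \<delta> * (\<bar>c n\<bar> * real n powr (- (\<sigma> - \<delta>))))" by (rule summable_mult)
  then show "summable (\<lambda>n. \<bar>c n * ln (real n)\<bar> * real n powr (- \<sigma>))"
  proof (rule summable_comparison_test'[where N = 0])
    fix n
    show "norm (\<bar>c n * ln (real n)\<bar> * real n powr (- \<sigma>)) \<le> 1 / \<delta> * (\<bar>c n\<bar> * real n powr (- (\<sigma> - \<delta>)))"
    proof (cases "n = 0")
      case False
      then have "ln (real n) \<le> real n powr \<delta> / \<delta>" using \<delta> by (intro ln_powr_bound) auto
      moreover have "ln (real n) \<ge> 0" using False by simp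
      ultimately have "\<bar>c n * ln (real n)\<bar> * real n powr (- \<sigma>) \<le> \<bar>c n\<bar> * (real n powr \<delta> / \<delta>) * real n powr (- \<sigma>)"
        unfolding abs_mult by (intro mult_right_mono mult_left_mono) auto
      also have "\<dots> = 1 / \<delta> * (\<bar>c n\<bar> * (real n powr \<delta> * real n powr (- \<sigma>)))" by simp
      also have "real n powr \<delta> * real n powr (- \<sigma>) = real n powr (- (\<sigma> - \<delta>))"
        by (simp flip: powr_add)
      finally show ?thesis by simp
    qed simp
  qed
qed

lemma dconv_diff:
  assumes "dconv c" "dconv d" shows "dconv (\<lambda>n. c n - d n)"
  unfolding dconv_def
proof (intro allI impI)
  fix \<sigma> :: real assume \<sigma>: "\<sigma> > 1"
  have "summable (\<lambda>n. \<bar>c n\<bar> * real n powr (- \<sigma>) + \<bar>d n\<bar> * real n powr (- \<sigma>))"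
    using assms \<sigma> by (intro summable_add) (auto simp: dconv_def)
  then show "summable (\<lambda>n. \<bar>c n - d n\<bar> * real n powr (- \<sigma>))"
    by (rule summable_comparison_test'[where N = 0]) (auto simp: distrib_right [symmetric] intro!: mult_right_mono)
qed

lemma dconv_cmult:
  assumes "dconv c" shows "dconv (\<lambda>n. k * c n)"
  using assms by (simp add: dconv_def abs_mult mult.assoc summable_mult)

lemma dseries_diff:
  assumes "dconv c" "dconv d" "Re s > 1"
  shows "dseries (\<lambda>n. c n - d n) s = dseries c s - dseries d s"
proof -
  have "(\<lambda>n. dterm c s n - dterm d s n) sums (dseries c s - dseries d s)"
    using assms by (intro sums_diff dconv_sums)
  moreover have "(\<lambda>n. dterm c s n - dterm d s n) = dterm (\<lambda>n. c n - d n) s"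
    by (simp add: dterm_def fun_eq_iff algebra_simps)
  ultimately show ?thesis by (simp add: dseries_def sums_iff)
qed

lemma dseries_cmult:
  assumes "dconv c" "Re s > 1"
  shows "dseries (\<lambda>n. k * c n) s = of_real k * dseries c s"
proof -
  have "(\<lambda>n. of_real k * dterm c s n) sums (of_real k * dseries c s)"
    using assms by (intro sums_mult dconv_sums)
  moreover have "(\<lambda>n. of_real k * dterm c s n) = dterm (\<lambda>n. k * c n) s"
    by (simp add: dterm_def fun_eq_iff algebra_simps)
  ultimately show ?thesis by (simp add: dseries_def sums_iff)
qed

lemma has_field_derivative_dterm:
  "((\<lambda>s. dterm c s n) has_field_derivative - dterm (\<lambda>n. c n * ln (real n)) s n) (at s)"
proof (cases "n = 0")
  case False
  then have "((\<lambda>s. of_real (c n) * of_nat n powr (- s)) has_field_derivative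
      of_real (c n) * (Ln (of_nat n) * of_nat n powr (- s) * (- 1))) (at s)"
    by (intro DERIV_cmult DERIV_chain2[where f = "\<lambda>z. of_nat n powr z"] has_field_derivative_powr_right)
      (auto intro!: derivative_eq_intros)
  moreover have "Ln (of_nat n) = of_real (ln (real n))" using False Ln_of_real[of "real n"] by simp
  ultimately show ?thesis by (simp add: dterm_def mult_ac)
qed (simp add: dterm_def)

lemma open_Re_gt: "open {s::complex. Re s > x}"
  by (rule open_halfspace_Re_gt)

text \<open>Termwise differentiation by a Weierstrass majorant: on a ball whose radius
  \<open>d\<close> is half the distance to the line \<open>Re s = 1\<close>, the series is dominated
  by the one at \<open>1 + d\<close>.\<close>

lemma has_field_derivative_dseries:
  assumes c: "dconv c" and s: "Re s > 1"
  shows "(dseries c has_field_derivative - dseries (\<lambda>n. c n * ln (real n)) s) (at s)"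
proof -
  let ?S = "{s::complex. Re s > 1}" and ?c' = "\<lambda>n. c n * ln (real n)"
  have "\<exists>g g'. \<forall>x \<in> ?S. ((\<lambda>n. dterm c x n) sums g x) \<and> ((\<lambda>n. - dterm ?c' x n) sums g' x) \<and>
      (g has_field_derivative g' x) (at x)"
  proof (rule series_and_derivative_comparison_complex[OF open_Re_gt has_field_derivative_dterm])
    fix x :: complex assume "x \<in> ?S"
    then have x: "Re x > 1" by simp
    define d where "d = (Re x - 1) / 2"
    define h where "h n = complex_of_real (\<bar>c n\<bar> * real n powr (- (1 + d)))" for n
    have d: "d > 0" using x by (simp add: d_def)
    have "1 + d > 1" using d by simp
    then have "summable (\<lambda>n. \<bar>c n\<bar> * real n powr (- (1 + d)))" using c unfolding dconv_def by blast
    then have "summable h" unfolding h_def by (rule summable_of_real)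
    moreover have "range h \<subseteq> \<real>\<^sub>\<ge>\<^sub>0" by (auto simp: h_def)
    moreover have "cmod (dterm c y n) \<le> cmod (h n)" if y: "y \<in> ball x d \<inter> ?S" for y n
    proof (cases "n = 0")
      case False
      have "\<bar>Re (x - y)\<bar> \<le> cmod (x - y)" by (rule abs_Re_le_cmod)
      also have "\<dots> < d" using y by (simp add: dist_norm)
      finally have "Re x - Re y < d" by simp
      then have "Re y > 1 + d" by (simp add: d_def field_simps)
      then have "real n powr (- Re y) \<le> real n powr (- (1 + d))" using False by (intro powr_mono) auto
      then show ?thesis unfolding norm_dterm h_def norm_of_real by (simp add: abs_mult mult_left_mono)
    qed (simp add: dterm_def)
    ultimately show "\<exists>d h. 0 < d \<and> summable h \<and> range h \<subseteq> \<real>\<^sub>\<ge>\<^sub>0 \<and>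
        (\<forall>\<^sub>F n in sequentially. \<forall>y\<in>ball x d \<inter> ?S. cmod (dterm c y n) \<le> cmod (h n))"
      using d by (intro exI[of _ d] exI[of _ h]) auto
  qed
  then obtain g g' where g: "\<And>x. Re x > 1 \<Longrightarrow> (\<lambda>n. dterm c x n) sums g x"
    "\<And>x. Re x > 1 \<Longrightarrow> (\<lambda>n. - dterm ?c' x n) sums g' x"
    "\<And>x. Re x > 1 \<Longrightarrow> (g has_field_derivative g' x) (at x)" by auto
  have "g' s = - dseries ?c' s"
    using g(2)[OF s] sums_minus[OF dconv_sums[OF dconv_ln[OF c] s]] sums_unique2 by blast
  moreover have "g x = dseries c x" if "Re x > 1" for x
    using g(1)[OF that] by (simp add: dseries_def sums_iff)
  ultimately show ?thesis
    using has_field_derivative_transform_within_open[OF g(3)[OF s] open_Re_gt[of 1], of "dseries c"] s by simp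
qed

lemma holomorphic_dseries: "dconv c \<Longrightarrow> dseries c holomorphic_on {s. Re s > 1}"
  using has_field_derivative_dseries open_Re_gt holomorphic_on_open[of "{s. Re s > 1}" "dseries c"] by blast

lemma dterm_infsum:
  assumes "dconv c" "Re s > 1"
  shows "(\<lambda>n. norm (dterm c s n)) summable_on {1..}" "infsum (dterm c s) {1..} = dseries c s"
proof -
  have n: "summable (\<lambda>n. norm (norm (dterm c s n)))" using dconv_summable_norm[OF assms] by simp
  have "(\<lambda>n. norm (dterm c s n)) summable_on UNIV"
    using norm_summable_imp_summable_on[OF n] .
  then show "(\<lambda>n. norm (dterm c s n)) summable_on {1..}"
    by (rule summable_on_subset_banach) simp
  have "(dterm c s has_sum dseries c s) UNIV"
    by (rule norm_summable_imp_has_sum[OF dconv_summable_norm[OF assms] dconv_sums[OF assms]])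
  then have "infsum (dterm c s) UNIV = dseries c s" by (rule infsumI)
  moreover have "infsum (dterm c s) UNIV = infsum (dterm c s) {1..}"
    by (rule infsum_cong_neutral) (auto simp: dterm_def)
  ultimately show "infsum (dterm c s) {1..} = dseries c s" by simp
qed

text \<open>By absolute convergence the double sum over \<open>(n, m)\<close> may be regrouped along
  \<open>k = n * m\<close>, with \<open>n\<close> running over the divisors of
  \<open>k\<close>.\<close>

lemma dseries_mult:
  assumes c: "dconv c" and d: "dconv d" and s: "Re s > 1"
    and e: "\<And>n. n > 0 \<Longrightarrow> e n = (\<Sum>k | k dvd n. c k * d (n div k))" and ec: "dconv e"
  shows "dseries c s * dseries d s = dseries e s"
proof -
  let ?A = "{1::nat..}" and ?D = "\<lambda>k::nat. {m. m dvd k}"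
  define x where "x = dterm c s"
  define y where "y = dterm d s"
  define F where "F = (\<lambda>(n, m). x n * y m)"
  have xs: "(\<lambda>n. norm (x n)) summable_on ?A" and ys: "(\<lambda>n. norm (y n)) summable_on ?A"
    using dterm_infsum(1) c d s by (auto simp: x_def y_def)
  have Fs: "(\<lambda>p. norm (F p)) summable_on ?A \<times> ?A"
  proof (subst Infinite_Sum.abs_summable_on_Sigma_iff, intro conjI ballI)
    fix n :: nat assume "n \<in> ?A"
    show "(\<lambda>m. norm (F (n, m))) summable_on ?A"
      using ys by (simp add: F_def norm_mult summable_on_cmult_right)
  next
    have "infsum (\<lambda>m. norm (F (n, m))) ?A = norm (x n) * infsum (\<lambda>m. norm (y m)) ?A" for n
      by (simp add: F_def norm_mult infsum_cmult_right')
    then show "(\<lambda>n. norm (infsum (\<lambda>m. norm (F (n, m))) ?A)) summable_on ?A"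
      using xs by (simp add: abs_mult summable_on_cmult_left)
  qed
  have "infsum F (?A \<times> ?A) = (\<Sum>\<^sub>\<infinity>n\<in>?A. \<Sum>\<^sub>\<infinity>m\<in>?A. F (n, m))"
    by (rule infsum_Sigma_banach [symmetric]) (use Fs abs_summable_summable in blast)
  also have "\<dots> = infsum x ?A * infsum y ?A"
    by (simp add: F_def infsum_cmult_right' infsum_cmult_left')
  finally have prod: "infsum F (?A \<times> ?A) = dseries c s * dseries d s"
    using dterm_infsum(2) c d s by (simp add: x_def y_def)
  define g where "g = (\<lambda>(k::nat, m::nat). (m, k div m))"
  have bij: "bij_betw g (Sigma ?A ?D) (?A \<times> ?A)"
  proof (rule bij_betwI[where g = "\<lambda>(n, m). (n * m, n)"])
    show "g \<in> Sigma ?A ?D \<rightarrow> ?A \<times> ?A"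
      by (auto simp: g_def Suc_le_eq dvd_div_eq_0_iff intro!: Nat.gr0I)
    show "(\<lambda>(n, m). (n * m, n)) \<in> ?A \<times> ?A \<rightarrow> Sigma ?A ?D" by auto
  qed (auto simp: g_def)
  have Gs: "(\<lambda>p. norm ((F \<circ> g) p)) summable_on Sigma ?A ?D"
    using summable_on_reindex_bij_betw[OF bij, of "\<lambda>p. norm (F p)"] Fs by (simp add: o_def)
  have "infsum F (?A \<times> ?A) = infsum (F \<circ> g) (Sigma ?A ?D)"
    using infsum_reindex_bij_betw[OF bij, of F] by (simp add: o_def)
  also have "\<dots> = (\<Sum>\<^sub>\<infinity>k\<in>?A. \<Sum>\<^sub>\<infinity>m\<in>?D k. (F \<circ> g) (k, m))"
    by (rule infsum_Sigma_banach [symmetric]) (use Gs abs_summable_summable in blast)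
  also have "\<dots> = (\<Sum>\<^sub>\<infinity>k\<in>?A. dterm e s k)"
  proof (rule infsum_cong)
    fix k assume k: "k \<in> ?A"
    have "(\<Sum>\<^sub>\<infinity>m\<in>?D k. (F \<circ> g) (k, m)) = (\<Sum>m\<in>?D k. (F \<circ> g) (k, m))"
      using k by (intro infsum_finite) (auto intro: finite_divisors_nat)
    also have "\<dots> = (\<Sum>m\<in>?D k. of_real (c m * d (k div m)) * of_nat k powr (- s))"
    proof (rule sum.cong)
      fix m assume "m \<in> ?D k"
      then obtain l where l: "k = m * l" by auto
      then have "m > 0" using k by (auto intro: Nat.gr0I)
      then have kl: "k div m = l" using l by simp
      have "(of_nat k :: complex) powr (- s) = of_nat m powr (- s) * of_nat l powr (- s)"
        unfolding l of_nat_mult by (rule powr_times_real) auto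
      then show "(F \<circ> g) (k, m) = of_real (c m * d (k div m)) * of_nat k powr (- s)"
        by (simp add: F_def g_def x_def y_def dterm_def kl)
    qed simp
    also have "\<dots> = dterm e s k"
      using k e[of k] by (simp add: dterm_def sum_distrib_right)
    finally show "(\<Sum>\<^sub>\<infinity>m\<in>?D k. (F \<circ> g) (k, m)) = dterm e s k" .
  qed
  also have "\<dots> = dseries e s" using dterm_infsum(2)[OF ec s] .
  finally show ?thesis using prod by simp
qed

section \<open>Partial summation and estimates for powers\<close>

lemma abel_summation:
  fixes b u :: "nat \<Rightarrow> 'a::comm_ring_1"
  shows "(\<Sum>n=1..N. b n * u n) =
     (\<Sum>n=1..N. b n) * u (Suc N) + (\<Sum>n=1..N. (\<Sum>k=1..n. b k) * (u n - u (Suc n)))"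
  by (induction N) (simp_all add: algebra_simps)

text \<open>Abel summation of \<open>K - a n\<close>, whose partial sums are nonnegative, against
  decreasing nonnegative weights.\<close>

lemma sum_mult_antimono_le:
  fixes a u :: "nat \<Rightarrow> real"
  assumes A: "\<And>n. (\<Sum>k=1..n. a k) \<le> K * real n"
    and u: "\<And>n. n \<ge> 1 \<Longrightarrow> u (Suc n) \<le> u n" "\<And>n. u n \<ge> 0"
  shows "(\<Sum>n=1..N. a n * u n) \<le> K * (\<Sum>n=1..N. u n)"
proof -
  have B: "(\<Sum>k=1..n. K - a k) \<ge> 0" for n using A[of n] by (simp add: sum_subtractf mult.commute)
  have "(\<Sum>n=1..N. (K - a n) * u n) \<ge> 0"
    unfolding abel_summation[of "\<lambda>n. K - a n"]
    using B u by (intro add_nonneg_nonneg sum_nonneg[where f = "\<lambda>n. _ n * _ n"] mult_nonneg_nonneg) (simp_all add: B)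
  then show ?thesis by (simp add: algebra_simps sum_subtractf sum_distrib_left)
qed

lemma dconv_of_linear_growth:
  assumes a: "\<And>n. a n \<ge> 0" and A: "\<And>n. (\<Sum>k=1..n. a k) \<le> K * real n"
  shows "dconv a"
  unfolding dconv_def
proof (intro allI impI)
  fix \<sigma> :: real assume \<sigma>: "\<sigma> > 1"
  have K: "K \<ge> 0" using A[of 1] a[of 1] by simp
  have z: "summable (\<lambda>n. real n powr (- \<sigma>))" using \<sigma> by (simp add: summable_real_powr_iff)
  have "(\<Sum>n<N. a n * real n powr (- \<sigma>)) \<le> K * (\<Sum>n. real n powr (- \<sigma>))" for N
  proof -
    have "(\<Sum>n<N. a n * real n powr (- \<sigma>)) \<le> (\<Sum>n\<le>N. a n * real n powr (- \<sigma>))"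
      using a by (intro sum_mono2) auto
    also have "\<dots> = (\<Sum>n=1..N. a n * real n powr (- \<sigma>))"
      by (intro sum.mono_neutral_right) (auto simp: not_le)
    also have "\<dots> \<le> K * (\<Sum>n=1..N. real n powr (- \<sigma>))"
      by (intro sum_mult_antimono_le A) (use \<sigma> in \<open>auto intro!: powr_mono2'\<close>)
    also have "\<dots> \<le> K * (\<Sum>n. real n powr (- \<sigma>))"
      using K z by (intro mult_left_mono sum_le_suminf) auto
    finally show ?thesis .
  qed
  then have "summable (\<lambda>n. a n * real n powr (- \<sigma>))"
    using a by (intro summableI_nonneg_bounded) auto
  then show "summable (\<lambda>n. \<bar>a n\<bar> * real n powr (- \<sigma>))" using a by simp
qed

lemma powr_segment_bound:
  fixes s :: complex and x u :: real
  assumes x: "x > 0" "x \<le> u" and s: "Re s \<ge> 0"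
  shows "norm (of_real x powr (- s) - of_real u powr (- s)) \<le> norm s * x powr (- Re s - 1) * (u - x)"
proof -
  let ?S = "closed_segment (of_real x) (of_real u :: complex)"
  have S: "\<exists>v. z = of_real v \<and> x \<le> v" if "z \<in> ?S" for z
    using that x unfolding closed_segment_of_real by (auto simp: closed_segment_eq_real_ivl)
  have "norm (of_real x powr (- s) - of_real u powr (- s)) \<le>
      (norm s * x powr (- Re s - 1)) * norm (of_real x - of_real u :: complex)"
  proof (rule field_differentiable_bound[where S = ?S and f' = "\<lambda>z. (- s) * z powr (- s - 1)"])
    fix z assume "z \<in> ?S"
    then obtain v where v: "z = of_real v" "x \<le> v" using S by blast
    have "v > 0" using v x by linarith
    then have "z \<notin> \<real>\<^sub>\<le>\<^sub>0" unfolding v(1) by simp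
    then show "((\<lambda>z. z powr (- s)) has_field_derivative (- s) * z powr (- s - 1)) (at z within ?S)"
      by (rule has_field_derivative_at_within[OF has_field_derivative_powr])
    have "norm (z powr (- s - 1)) = v powr (- Re s - 1)"
      unfolding v(1) using \<open>v > 0\<close> by (simp add: norm_powr_real_powr)
    also have "\<dots> \<le> x powr (- Re s - 1)"
      using v x s by (intro powr_mono2') auto
    finally show "norm ((- s) * z powr (- s - 1)) \<le> norm s * x powr (- Re s - 1)"
      by (simp add: norm_mult mult_left_mono)
  qed auto
  also have "norm (of_real x - of_real u :: complex) = u - x"
    using x by (simp flip: of_real_diff)
  finally show ?thesis .
qed

text \<open>The difference \<open>n^(1-s) - (n+1)^(1-s)\<close> is \<open>s - 1\<close> times the
  integral of \<open>u^(-s)\<close> over \<open>[n, n+1]\<close>, so the left side compares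
  \<open>n^(-s)\<close> with an average. The function \<open>?f\<close> has derivative
  \<open>(s - 1) (n^(-s) - z^(-s))\<close>, and the mean value inequality for it takes the place of
  the integral.\<close>

lemma powr_primitive_bound:
  fixes s :: complex and n :: nat
  assumes n: "n > 0" and s: "Re s \<ge> 0"
  shows "norm ((s - 1) * of_nat n powr (- s) - (of_nat n powr (1 - s) - of_nat (Suc n) powr (1 - s))) \<le>
     norm (s - 1) * norm s * real n powr (- Re s - 1)"
proof -
  let ?x = "real n"
  let ?S = "closed_segment (of_real ?x) (of_real (?x + 1) :: complex)"
  let ?f = "\<lambda>z. (s - 1) * of_nat n powr (- s) * z + z powr (1 - s)"
  have S: "\<exists>v. z = of_real v \<and> ?x \<le> v \<and> v \<le> ?x + 1" if "z \<in> ?S" for z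
    using that unfolding closed_segment_of_real by (auto simp: closed_segment_eq_real_ivl)
  have "norm (?f (of_real (?x + 1)) - ?f (of_real ?x)) \<le>
      (norm (s - 1) * norm s * ?x powr (- Re s - 1)) * norm (of_real (?x + 1) - of_real ?x :: complex)"
  proof (rule field_differentiable_bound[where S = ?S and f' = "\<lambda>z. (s - 1) * (of_nat n powr (- s) - z powr (- s))"])
    fix z assume "z \<in> ?S"
    then obtain v where v: "z = of_real v" "?x \<le> v" "v \<le> ?x + 1" using S by blast
    have "z \<notin> \<real>\<^sub>\<le>\<^sub>0" using v n by (simp add: complex_nonpos_Reals_iff)
    from has_field_derivative_powr[OF this, of "1 - s"]
    have "((\<lambda>z. z powr (1 - s)) has_field_derivative (1 - s) * z powr (- s)) (at z)" by simp
    then have "(?f has_field_derivative (s - 1) * of_nat n powr (- s) * 1 + (1 - s) * z powr (- s)) (at z)"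
      by (intro DERIV_add DERIV_cmult DERIV_ident)
    then have "(?f has_field_derivative (s - 1) * (of_nat n powr (- s) - z powr (- s))) (at z)"
      by (simp add: algebra_simps)
    then show "(?f has_field_derivative (s - 1) * (of_nat n powr (- s) - z powr (- s))) (at z within ?S)"
      by (rule has_field_derivative_at_within)
    have "norm (of_nat n powr (- s) - z powr (- s)) \<le> norm s * ?x powr (- Re s - 1) * (v - ?x)"
      using powr_segment_bound[of ?x v s] v n s by simp
    also have "\<dots> \<le> norm s * ?x powr (- Re s - 1) * 1"
      using v by (intro mult_left_mono) auto
    finally show "norm ((s - 1) * (of_nat n powr (- s) - z powr (- s))) \<le> norm (s - 1) * norm s * ?x powr (- Re s - 1)"
      by (simp add: norm_mult mult.assoc mult_left_mono)
  qed auto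
  also have "?f (of_real (?x + 1)) - ?f (of_real ?x) =
     (s - 1) * of_nat n powr (- s) - (of_nat n powr (1 - s) - of_nat (Suc n) powr (1 - s))"
    by (simp add: algebra_simps)
  finally show ?thesis by simp
qed

section \<open>Continuation of the Dirichlet series to real part above 1/2\<close>

locale zeta_like =
  fixes a lam :: "nat \<Rightarrow> real" and \<rho> C :: real
  assumes a_nonneg: "\<And>n. a n \<ge> 0" and a_1: "a 1 = 1"
    and lam_nonneg: "\<And>n. lam n \<ge> 0" and lam_le: "\<And>n. n > 0 \<Longrightarrow> lam n \<le> 2 * ln (real n)"
    and lam_conv: "\<And>n. n > 0 \<Longrightarrow> (\<Sum>d | d dvd n. lam d * a (n div d)) = a n * ln (real n)"
    and rho_pos: "\<rho> > 0"
    and a_sum: "\<And>N. N \<ge> 1 \<Longrightarrow> \<bar>(\<Sum>n=1..N. a n) - \<rho> * real N\<bar> \<le> C * sqrt (real N)"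
begin

lemma C_nonneg: "C \<ge> 0"
  using a_sum[of 1] abs_ge_zero[of "(\<Sum>n=1..1. a n) - \<rho> * real 1"] by simp

definition B :: "nat \<Rightarrow> real" where "B n = (\<Sum>k=1..n. a k - \<rho>)"

lemma B_Suc: "B (Suc n) = B n + a (Suc n) - \<rho>"
  by (simp add: B_def)

lemma B_bound: "\<bar>B n\<bar> \<le> C * sqrt (real n)"
proof (cases "n = 0")
  case False
  then show ?thesis using a_sum[of n] by (simp add: B_def sum_subtractf mult.commute)
qed (simp add: B_def)

lemma a_sum_le: "(\<Sum>k=1..n. a k) \<le> (\<rho> + C) * real n"
proof (cases "n = 0")
  case False
  then have "(\<Sum>k=1..n. a k) \<le> \<rho> * real n + C * sqrt (real n)" using a_sum[of n] by linarith
  also have "C * sqrt (real n) \<le> C * real n"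
    using False C_nonneg by (intro mult_left_mono) (auto simp: real_le_lsqrt power2_eq_square)
  finally show ?thesis by (simp add: distrib_right)
qed simp

lemma dconv_a: "dconv a"
  using a_nonneg a_sum_le by (rule dconv_of_linear_growth)

lemma dconv_one: "dconv (\<lambda>_. 1)"
  by (rule dconv_of_linear_growth[where K = 1]) auto

lemma dconv_lam: "dconv lam"
proof (rule dconv_mono)
  show "dconv (\<lambda>n. 2 * (1 * ln (real n)))" by (intro dconv_cmult dconv_ln dconv_one)
qed (use lam_le lam_nonneg in \<open>auto simp: abs_mult\<close>)

text \<open>
  Abel summation of \<open>\<Sum> a n / n\<^sup>s\<close>, normalised so that the terms telescope against those of
  \<open>\<rho> / (s - 1)\<close>; this continues \<open>(s - 1) \<Sum> a n / n\<^sup>s\<close> to the half plane \<open>Re s > 1/2\<close>.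
\<close>

definition gterm :: "complex \<Rightarrow> nat \<Rightarrow> complex" where
  "gterm s n = (s - 1) * (of_real (B n) * (of_nat n powr (- s) - of_nat (Suc n) powr (- s)) + of_real \<rho> * of_nat n powr (- s))
     - of_real \<rho> * (of_nat n powr (1 - s) - of_nat (Suc n) powr (1 - s))"

definition G :: "complex \<Rightarrow> complex" where
  "G s = of_real \<rho> + (\<Sum>n. gterm s (Suc n))"

text \<open>\<open>B n = O(sqrt n)\<close> meets a difference of size \<open>n^(- Re s - 1)\<close>.
  This leaves the exponent \<open>- Re s - 1/2\<close>, which is summable for
  \<open>Re s > 1/2\<close>.\<close>

lemma norm_gterm:
  assumes n: "n > 0" and s: "Re s \<ge> 0"
  shows "norm (gterm s n) \<le> norm (s - 1) * norm s * (C + \<rho>) * real n powr (- Re s - 1/2)"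
proof -
  let ?d = "of_nat n powr (- s) - of_nat (Suc n) powr (- s)"
  let ?e = "(s - 1) * of_nat n powr (- s) - (of_nat n powr (1 - s) - of_nat (Suc n) powr (1 - s))"
  have "gterm s n = (s - 1) * of_real (B n) * ?d + of_real \<rho> * ?e"
    by (simp add: gterm_def algebra_simps)
  then have "norm (gterm s n) \<le> norm (s - 1) * \<bar>B n\<bar> * norm ?d + \<rho> * norm ?e"
    using norm_triangle_ineq[of "(s - 1) * of_real (B n) * ?d" "of_real \<rho> * ?e"] rho_pos by (simp add: norm_mult)
  also have "norm ?d \<le> norm s * real n powr (- Re s - 1)"
    using powr_segment_bound[of "real n" "real (Suc n)" s] n s by simp
  also have "norm ?e \<le> norm (s - 1) * norm s * real n powr (- Re s - 1)"
    using powr_primitive_bound[OF n s] .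
  also have "\<bar>B n\<bar> \<le> C * sqrt (real n)" by (rule B_bound)
  finally have "norm (gterm s n) \<le> norm (s - 1) * (C * sqrt (real n)) * (norm s * real n powr (- Re s - 1)) +
      \<rho> * (norm (s - 1) * norm s * real n powr (- Re s - 1))"
    using rho_pos by (simp add: mult_left_mono mult_right_mono)
  also have "\<dots> = norm (s - 1) * norm s * (C * sqrt (real n) + \<rho>) * real n powr (- Re s - 1)"
    by (simp add: algebra_simps)
  also have "\<dots> \<le> norm (s - 1) * norm s * ((C + \<rho>) * sqrt (real n)) * real n powr (- Re s - 1)"
  proof -
    have "1 \<le> sqrt (real n)" using n by simp
    then have "\<rho> * 1 \<le> \<rho> * sqrt (real n)" using rho_pos by (intro mult_left_mono) auto
    then show ?thesis by (intro mult_right_mono mult_left_mono) (auto simp: algebra_simps)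
  qed
  also have "\<dots> = norm (s - 1) * norm s * (C + \<rho>) * (real n powr (1/2) * real n powr (- Re s - 1))"
    using n by (simp add: powr_half_sqrt)
  also have "real n powr (1/2) * real n powr (- Re s - 1) = real n powr (- Re s - 1/2)"
    by (subst powr_add [symmetric], rule arg_cong[where f = "\<lambda>e. real n powr e"]) simp
  finally show ?thesis .
qed

text \<open>Both boundary terms are recorded: for \<open>Re s > 1\<close> they tend to 0, which
  identifies \<open>G\<close>, and for a cut-off \<open>N\<close> of size \<open>|s|^4\<close> they
  stay small enough to bound \<open>G\<close> near the line.\<close>

lemma gterm_partial_sum:
  "of_real \<rho> + (\<Sum>n=1..N. gterm s n) =
     (s - 1) * ((\<Sum>n=1..N. dterm a s n) - of_real (B N) * of_nat (Suc N) powr (- s)) + of_real \<rho> * of_nat (Suc N) powr (1 - s)"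
proof (induction N)
  case 0
  then show ?case by (simp add: B_def)
next
  case (Suc N)
  define X where "X = (\<Sum>n=1..N. dterm a s n)"
  have X: "(\<Sum>n=1..Suc N. dterm a s n) = X + dterm a s (Suc N)" by (simp add: X_def)
  have "of_real \<rho> + (\<Sum>n=1..Suc N. gterm s n) = (of_real \<rho> + (\<Sum>n=1..N. gterm s n)) + gterm s (Suc N)"
    by simp
  also have "\<dots> = (s - 1) * ((\<Sum>n=1..Suc N. dterm a s n) - of_real (B (Suc N)) * of_nat (Suc (Suc N)) powr (- s)) + of_real \<rho> * of_nat (Suc (Suc N)) powr (1 - s)"
    unfolding Suc X X_def [symmetric] by (simp add: gterm_def dterm_def B_Suc algebra_simps del: of_nat_Suc)
  finally show ?case .
qed

lemma summable_powr_shift: "e > 1 \<Longrightarrow> summable (\<lambda>n. real (Suc n) powr (- e))"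
  using summable_real_powr_iff[of "- e"] summable_Suc_iff[of "\<lambda>n. real n powr (- e)"] by simp

lemma summable_norm_gterm:
  assumes "Re s > 1/2" shows "summable (\<lambda>n. norm (gterm s (Suc n)))"
proof (rule summable_comparison_test'[where N = 0])
  show "summable (\<lambda>n. norm (s - 1) * norm s * (C + \<rho>) * real (Suc n) powr (- (Re s + 1/2)))"
    using assms by (intro summable_mult summable_powr_shift) auto
  show "norm (norm (gterm s (Suc n))) \<le> norm (s - 1) * norm s * (C + \<rho>) * real (Suc n) powr (- (Re s + 1/2))" for n
  proof -
    have "- (Re s + 1/2) = - Re s - 1/2" by simp
    then show ?thesis using norm_gterm[of "Suc n" s] assms by simp
  qed
qed

lemma gterm_sums: "Re s > 1/2 \<Longrightarrow> (\<lambda>n. gterm s (Suc n)) sums (G s - of_real \<rho>)"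
  unfolding G_def using summable_sums[OF summable_norm_cancel[OF summable_norm_gterm]] by simp

lemma G_1: "G 1 = of_real \<rho>"
proof -
  have "gterm 1 (Suc n) = 0" for n by (simp add: gterm_def del: of_nat_Suc)
  then show ?thesis by (simp add: G_def)
qed

lemma holomorphic_gterm: "n > 0 \<Longrightarrow> (\<lambda>s. gterm s n) holomorphic_on A"
  unfolding gterm_def by (intro holomorphic_intros) auto

lemma holomorphic_G: "G holomorphic_on {s. Re s > 1/2}"
proof -
  let ?S = "{s::complex. Re s > 1/2}"
  obtain g where g: "\<forall>x\<in>?S. (\<lambda>n. gterm x (Suc n)) sums g x \<and> g field_differentiable (at x)"
  proof (rule series_differentiable_comparison_complex[of ?S "\<lambda>n s. gterm s (Suc n)"])
    show "open ?S" by (rule open_Re_gt)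
    fix n and x :: complex assume "x \<in> ?S"
    show "(\<lambda>s. gterm s (Suc n)) field_differentiable at x"
      using holomorphic_gterm[of "Suc n" UNIV] by (auto simp: holomorphic_on_def)
  next
    fix x :: complex assume "x \<in> ?S"
    then have x: "Re x > 1/2" by simp
    define d where "d = (Re x - 1/2) / 2"
    define K where "K = (norm x + d + 1) * (norm x + d) * (C + \<rho>)"
    define h where "h n = complex_of_real (K * real (Suc n) powr (- (1 + d)))" for n
    have d: "d > 0" using x by (simp add: d_def)
    have K: "K \<ge> 0" using d C_nonneg rho_pos by (simp add: K_def)
    have "summable (\<lambda>n. K * real (Suc n) powr (- (1 + d)))" using d by (intro summable_mult summable_powr_shift) auto
    then have "summable h" unfolding h_def by (rule summable_of_real)
    moreover have "range h \<subseteq> \<real>\<^sub>\<ge>\<^sub>0" using K by (auto simp: h_def)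
    moreover have "cmod (gterm y (Suc n)) \<le> cmod (h n)" if y: "y \<in> ball x d \<inter> ?S" for y n
    proof -
      have xy: "cmod (x - y) < d" using y by (simp add: dist_norm)
      have "\<bar>Re (x - y)\<bar> \<le> cmod (x - y)" by (rule abs_Re_le_cmod)
      also note xy
      finally have "Re x - Re y < d" by simp
      then have Re: "Re y > 1/2 + d" by (simp add: d_def field_simps)
      have ny: "norm y \<le> norm x + d" using xy norm_triangle_ineq2[of y x] by (simp add: norm_minus_commute)
      have n1: "norm (y - 1) \<le> norm x + d + 1" using ny norm_triangle_ineq4[of y 1] by simp
      have "cmod (gterm y (Suc n)) \<le> norm (y - 1) * norm y * (C + \<rho>) * real (Suc n) powr (- Re y - 1/2)"
        using Re d by (intro norm_gterm) auto
      also have "\<dots> \<le> (norm x + d + 1) * (norm x + d) * (C + \<rho>) * real (Suc n) powr (- (1 + d))"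
        using ny n1 C_nonneg rho_pos Re d by (intro mult_mono powr_mono) auto
      finally show ?thesis using K by (simp add: h_def K_def norm_mult del: of_real_mult)
    qed
    ultimately show "\<exists>d h. 0 < d \<and> summable h \<and> range h \<subseteq> \<real>\<^sub>\<ge>\<^sub>0 \<and>
        (\<forall>\<^sub>F n in sequentially. \<forall>y\<in>ball x d \<inter> ?S. cmod (gterm y (Suc n)) \<le> cmod (h n))"
      using d by (intro exI[of _ d] exI[of _ h]) auto
  qed blast
  have "(\<lambda>s. of_real \<rho> + g s) holomorphic_on ?S"
    using g by (intro holomorphic_intros) (auto simp: holomorphic_on_def intro: field_differentiable_at_within)
  moreover have "of_real \<rho> + g s = G s" if "s \<in> ?S" for s
    using g that gterm_sums[of s] sums_unique2 by fastforce
  ultimately show ?thesis by (rule holomorphic_transform)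
qed

lemma G_eq:
  assumes s: "Re s > 1" shows "G s = (s - 1) * dseries a s"
proof -
  have "(\<lambda>N. of_real \<rho> + (\<Sum>n<N. gterm s (Suc n))) \<longlonglongrightarrow> of_real \<rho> + (G s - of_real \<rho>)"
    using gterm_sums[of s] s by (intro tendsto_intros) (auto simp: sums_def)
  note lim1 = this
  have eq: "(\<lambda>N. of_real \<rho> + (\<Sum>n<N. gterm s (Suc n))) =
      (\<lambda>N. (s - 1) * ((\<Sum>n\<le>N. dterm a s n) - of_real (B N) * of_nat (Suc N) powr (- s)) + of_real \<rho> * of_nat (Suc N) powr (1 - s))"
  proof
    fix N
    have "(\<Sum>n<N. gterm s (Suc n)) = (\<Sum>n=1..N. gterm s n)"
      by (simp add: sum.atLeast1_atMost_eq lessThan_def)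
    moreover have "(\<Sum>n\<le>N. dterm a s n) = (\<Sum>n=1..N. dterm a s n)"
      by (intro sum.mono_neutral_right) (auto simp: not_le dterm_def)
    ultimately show "of_real \<rho> + (\<Sum>n<N. gterm s (Suc n)) =
      (s - 1) * ((\<Sum>n\<le>N. dterm a s n) - of_real (B N) * of_nat (Suc N) powr (- s)) + of_real \<rho> * of_nat (Suc N) powr (1 - s)"
      using gterm_partial_sum[of s N] by simp
  qed
  have lim2: "(\<lambda>N. (s - 1) * ((\<Sum>n\<le>N. dterm a s n) - of_real (B N) * of_nat (Suc N) powr (- s)) + of_real \<rho> * of_nat (Suc N) powr (1 - s))
     \<longlonglongrightarrow> (s - 1) * (dseries a s - 0) + of_real \<rho> * 0"
  proof (intro tendsto_intros)
    show "(\<lambda>N. \<Sum>n\<le>N. dterm a s n) \<longlonglongrightarrow> dseries a s"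
      using dconv_sums[OF dconv_a s] by (simp add: sums_def_le)
    have "(\<lambda>N. real (Suc N) powr (1/2 - Re s)) \<longlonglongrightarrow> 0" using s by real_asymp
    then have lim0: "(\<lambda>N. C * real (Suc N) powr (1/2 - Re s)) \<longlonglongrightarrow> 0"
      by (rule tendsto_mult_right_zero)
    have "norm (of_real (B N) * of_nat (Suc N) powr (- s)) \<le> C * real (Suc N) powr (1/2 - Re s)" for N
    proof -
      have "norm (of_real (B N) * of_nat (Suc N) powr (- s)) = \<bar>B N\<bar> * real (Suc N) powr (- Re s)"
        by (simp add: norm_mult norm_powr_real_powr del: of_nat_Suc)
      also have "\<dots> \<le> (C * sqrt (real (Suc N))) * real (Suc N) powr (- Re s)"
      proof (intro mult_right_mono)
        have "\<bar>B N\<bar> \<le> C * sqrt (real N)" by (rule B_bound)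
        also have "\<dots> \<le> C * sqrt (real (Suc N))" using C_nonneg by (intro mult_left_mono) auto
        finally show "\<bar>B N\<bar> \<le> C * sqrt (real (Suc N))" .
      qed auto
      also have "\<dots> = C * (real (Suc N) powr (1/2) * real (Suc N) powr (- Re s))"
        by (simp add: powr_half_sqrt)
      also have "real (Suc N) powr (1/2) * real (Suc N) powr (- Re s) = real (Suc N) powr (1/2 - Re s)"
        by (simp flip: powr_add)
      finally show ?thesis .
    qed
    then show "(\<lambda>N. of_real (B N) * of_nat (Suc N) powr (- s)) \<longlonglongrightarrow> 0"
      by (intro Lim_null_comparison[OF always_eventually lim0] allI)
    have "(\<lambda>N. real (Suc N) powr (1 - Re s)) \<longlonglongrightarrow> 0" using s by real_asymp
    then show "(\<lambda>N. of_nat (Suc N) powr (1 - s)) \<longlonglongrightarrow> (0::complex)"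
      by (rule Lim_null_comparison[rotated]) (simp add: norm_powr_real_powr del: of_nat_Suc)
  qed
  have "of_real \<rho> + (G s - of_real \<rho>) = (s - 1) * (dseries a s - 0) + of_real \<rho> * 0"
    by (rule LIMSEQ_unique[OF lim1[unfolded eq] lim2])
  then show ?thesis by simp
qed

end

section \<open>Non-vanishing on the line of real part one\<close>

lemma dseries_cong: "(\<And>n. n > 0 \<Longrightarrow> c n = d n) \<Longrightarrow> dseries c s = dseries d s"
  unfolding dseries_def by (rule suminf_cong) (metis dterm_def gr0I mult_eq_0_iff of_nat_0 powr_0)

lemma dconv_ln_power: "dconv c \<Longrightarrow> dconv (\<lambda>n. c n * ln (real n) ^ j)"
proof (induction j)
  case (Suc j)
  then show ?case using dconv_ln[of "\<lambda>n. c n * ln (real n) ^ j"] by (simp add: mult_ac)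
qed simp

lemma higher_deriv_dseries:
  assumes c: "dconv c" and s: "Re s > 1"
  shows "(deriv ^^ j) (dseries c) s = (- 1) ^ j * dseries (\<lambda>n. c n * ln (real n) ^ j) s"
  using s
proof (induction j arbitrary: s)
  case (Suc j)
  let ?d = "\<lambda>n. c n * ln (real n) ^ j"
  have "((\<lambda>s. (- 1) ^ j * dseries ?d s) has_field_derivative (- 1) ^ j * (- dseries (\<lambda>n. ?d n * ln (real n)) s)) (at s)"
    using Suc.prems by (intro DERIV_cmult has_field_derivative_dseries dconv_ln_power c)
  then have "((deriv ^^ j) (dseries c) has_field_derivative (- 1) ^ j * (- dseries (\<lambda>n. ?d n * ln (real n)) s)) (at s)"
    by (rule has_field_derivative_transform_within_open[OF _ open_Re_gt[of 1]]) (use Suc in auto)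
  then have "deriv ((deriv ^^ j) (dseries c)) s = (- 1) ^ j * (- dseries (\<lambda>n. ?d n * ln (real n)) s)"
    by (rule DERIV_imp_deriv)
  then show ?case by (simp add: mult_ac)
qed simp

context zeta_like
begin

definition Z :: "complex \<Rightarrow> complex" where "Z s = G s / (s - 1)"

lemma Z_eq: "Re s > 1 \<Longrightarrow> Z s = dseries a s"
  using G_eq[of s] by (auto simp: Z_def)

lemma holomorphic_Z: "A \<subseteq> {s. Re s > 1/2} - {1} \<Longrightarrow> Z holomorphic_on A"
  unfolding Z_def by (intro holomorphic_intros holomorphic_on_subset[OF holomorphic_G]) auto

text \<open>The series for \<open>G\<close> is cut at \<open>N\<close> about \<open>|s|^4\<close>.
  The head is a finite Dirichlet sum, at most \<open>N^(2 d)\<close> times a convergent one, with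
  \<open>d = 1/800\<close>; and \<open>N^(2 d)\<close> is about \<open>|s|^(1/100)\<close>. In the
  tail, \<open>n^(-1/4) <= 1 / |s|\<close> removes one of the two factors of size
  \<open>|s|\<close>, and the other one, \<open>s - 1\<close>, is divided out in \<open>Z\<close>.
  The small exponent \<open>1/100\<close> leaves room for the fifteenth power in
  \<open>dseries_bcoef_far\<close>.\<close>

lemma Z_growth:
  "\<exists>K>0. \<forall>s. Re s \<ge> 1 - 1/800 \<longrightarrow> \<bar>Im s\<bar> \<ge> 1 \<longrightarrow> norm (Z s) \<le> K * norm s powr (1/100)"
proof -
  define \<delta> :: real where "\<delta> = 1/800"
  define K1 where "K1 = (\<Sum>n. a n * real n powr (- (1 + \<delta>)))"
  define K2 where "K2 = (\<Sum>n. real (Suc n) powr (- (6/5)))"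
  define K where "K = K1 + C + 2 * \<rho> + (C + \<rho>) * K2"
  have "1 + \<delta> > 1" by (simp add: \<delta>_def)
  then have "summable (\<lambda>n. \<bar>a n\<bar> * real n powr (- (1 + \<delta>)))" using dconv_a unfolding dconv_def by blast
  then have sum1: "summable (\<lambda>n. a n * real n powr (- (1 + \<delta>)))" using a_nonneg by simp
  have K1: "K1 \<ge> 0" unfolding K1_def using a_nonneg sum1 by (intro suminf_nonneg) auto
  have sum2: "summable (\<lambda>n. real (Suc n) powr (- (6/5)))" by (rule summable_powr_shift) simp
  have K2: "K2 \<ge> 0" unfolding K2_def using sum2 by (intro suminf_nonneg) auto
  have K: "K > 0" unfolding K_def using K1 K2 C_nonneg rho_pos by (simp add: add_nonneg_pos add_pos_nonneg)
  have "norm (Z s) \<le> (2 * K) * norm s powr (1/100)" if s: "Re s \<ge> 1 - \<delta>" "\<bar>Im s\<bar> \<ge> 1" for s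
  proof -
    have s1: "norm (s - 1) \<ge> 1" using s abs_Im_le_cmod[of "s - 1"] by simp
    have s0: "norm s \<ge> 1" using s abs_Im_le_cmod[of s] by simp
    define N where "N = nat \<lceil>norm s ^ 4\<rceil>"
    define W where "W = real N"
    have s4: "norm s ^ 4 \<ge> 1" using s0 by simp
    have WN: "W \<ge> norm s ^ 4" "W \<le> 2 * norm s ^ 4" unfolding W_def N_def using s4 by linarith+
    have W1: "W \<ge> 1" using WN s4 by linarith
    have Re: "Re s > 1/2" using s by (simp add: \<delta>_def)
    have T1: "norm (\<Sum>n=1..N. dterm a s n) \<le> W powr (2 * \<delta>) * K1"
    proof -
      have "norm (\<Sum>n=1..N. dterm a s n) \<le> (\<Sum>n=1..N. norm (dterm a s n))" by (rule norm_sum)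
      also have "\<dots> \<le> (\<Sum>n=1..N. W powr (2 * \<delta>) * (a n * real n powr (- (1 + \<delta>))))"
      proof (rule sum_mono)
        fix n assume n: "n \<in> {1..N}"
        have "real n powr (- Re s) \<le> real n powr (2 * \<delta> + (- (1 + \<delta>)))"
          using n s by (intro powr_mono) auto
        also have "\<dots> = real n powr (2 * \<delta>) * real n powr (- (1 + \<delta>))" by (rule powr_add)
        also have "\<dots> \<le> W powr (2 * \<delta>) * real n powr (- (1 + \<delta>))"
          using n by (intro mult_right_mono powr_mono2) (auto simp: W_def \<delta>_def)
        finally show "norm (dterm a s n) \<le> W powr (2 * \<delta>) * (a n * real n powr (- (1 + \<delta>)))"
          unfolding norm_dterm using a_nonneg[of n] by (simp add: mult_left_mono mult.left_commute)
      qed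
      also have "\<dots> = W powr (2 * \<delta>) * (\<Sum>n=1..N. a n * real n powr (- (1 + \<delta>)))"
        by (simp add: sum_distrib_left)
      also have "\<dots> \<le> W powr (2 * \<delta>) * K1"
        unfolding K1_def using a_nonneg sum1 by (intro mult_left_mono sum_le_suminf) auto
      finally show ?thesis .
    qed
    have T2: "norm (of_real (B N) * of_nat (Suc N) powr (- s)) \<le> C"
    proof -
      have "norm (of_real (B N) * of_nat (Suc N) powr (- s)) = \<bar>B N\<bar> * real (Suc N) powr (- Re s)"
        by (simp add: norm_mult norm_powr_real_powr del: of_nat_Suc)
      also have "\<dots> \<le> (C * sqrt (real (Suc N))) * real (Suc N) powr (- (1/2))"
      proof (intro mult_mono)
        have "C * sqrt (real N) \<le> C * sqrt (real (Suc N))" using C_nonneg by (intro mult_left_mono) auto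
        then show "\<bar>B N\<bar> \<le> C * sqrt (real (Suc N))" using B_bound[of N] by linarith
      qed (use Re C_nonneg in \<open>auto intro!: powr_mono\<close>)
      also have "\<dots> = C * (real (Suc N) powr (1/2) * real (Suc N) powr (- (1/2)))"
        by (simp add: powr_half_sqrt)
      also have "\<dots> = C" by (subst powr_add [symmetric]) simp
      finally show ?thesis .
    qed
    have W2: "W powr (2 * \<delta>) \<ge> 1" using W1 by (intro ge_one_powr_ge_zero) (auto simp: \<delta>_def)
    have T3: "norm (of_real \<rho> * of_nat (Suc N) powr (1 - s)) \<le> 2 * \<rho> * W powr (2 * \<delta>)"
    proof -
      have "norm (of_real \<rho> * of_nat (Suc N) powr (1 - s)) = \<rho> * real (Suc N) powr (1 - Re s)"
        using rho_pos by (simp add: norm_mult norm_powr_real_powr del: of_nat_Suc)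
      also have "real (Suc N) powr (1 - Re s) \<le> real (Suc N) powr \<delta>"
        using s by (intro powr_mono) auto
      also have "real (Suc N) powr \<delta> \<le> (2 * W) powr \<delta>"
        using W1 by (intro powr_mono2) (auto simp: W_def \<delta>_def)
      also have "(2 * W) powr \<delta> = 2 powr \<delta> * W powr \<delta>" using W1 by (simp add: powr_mult)
      also have "\<dots> \<le> 2 powr 1 * W powr (2 * \<delta>)"
        using W1 by (intro mult_mono powr_mono) (auto simp: \<delta>_def)
      finally show ?thesis using rho_pos by (simp add: mult_left_mono mult.left_commute)
    qed
    have T4: "norm (\<Sum>n. gterm s (Suc (n + N))) \<le> norm (s - 1) * ((C + \<rho>) * K2)"
    proof -
      have bound: "norm (gterm s (Suc (n + N))) \<le> norm (s - 1) * (C + \<rho>) * real (Suc n) powr (- (6/5))" for n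
      proof -
        have g: "norm (gterm s (Suc (n + N))) \<le> norm (s - 1) * norm s * (C + \<rho>) * real (Suc (n + N)) powr (- Re s - 1/2)"
          using Re by (intro norm_gterm) auto
        \<comment> \<open>Possible because \<open>Re s + 1/2 >= 3/2 - 1/800 > 1/4 + 6/5\<close>; the
          part \<open>6/5\<close> keeps the series convergent and \<open>1/4\<close> yields the
          factor \<open>1 / |s|\<close>.\<close>
        have "real (Suc (n + N)) powr (- Re s - 1/2) \<le> real (Suc (n + N)) powr (- (1/4) + (- (6/5)))"
          using s by (intro powr_mono) (auto simp: \<delta>_def)
        also have "\<dots> = real (Suc (n + N)) powr (- (1/4)) * real (Suc (n + N)) powr (- (6/5))"
          by (rule powr_add)
        also have "\<dots> \<le> inverse (norm s) * real (Suc n) powr (- (6/5))"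
        proof (intro mult_mono)
          have "real (Suc (n + N)) powr (- (1/4)) \<le> (norm s ^ 4) powr (- (1/4))"
            using WN(1) s0 by (intro powr_mono2') (auto simp: W_def)
          also have "\<dots> = (norm s powr 4) powr (- (1/4))" using s0 by (subst powr_numeral) auto
          also have "\<dots> = norm s powr (- 1)" unfolding powr_powr by simp
          also have "\<dots> = inverse (norm s)" using s0 by (simp add: powr_minus)
          finally show "real (Suc (n + N)) powr (- (1/4)) \<le> inverse (norm s)" .
        qed (auto intro!: powr_mono2')
        finally have "norm (s - 1) * norm s * (C + \<rho>) * real (Suc (n + N)) powr (- Re s - 1/2) \<le>
            norm (s - 1) * norm s * (C + \<rho>) * (inverse (norm s) * real (Suc n) powr (- (6/5)))"
          using C_nonneg rho_pos by (intro mult_left_mono) auto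
        also have "\<dots> = norm (s - 1) * (C + \<rho>) * real (Suc n) powr (- (6/5))"
        proof -
          have "norm s * inverse (norm s) = 1" using s0 by (intro right_inverse) linarith
          moreover have "norm (s - 1) * norm s * (C + \<rho>) * (inverse (norm s) * real (Suc n) powr (- (6/5))) =
              norm (s - 1) * (C + \<rho>) * real (Suc n) powr (- (6/5)) * (norm s * inverse (norm s))"
            by (simp only: mult_ac)
          ultimately show ?thesis by simp
        qed
        finally show ?thesis using g by linarith
      qed
      have "norm (\<Sum>n. gterm s (Suc (n + N))) \<le> (\<Sum>n. norm (s - 1) * (C + \<rho>) * real (Suc n) powr (- (6/5)))"
        using bound sum2 by (intro norm_suminf_le summable_mult) auto
      also have "\<dots> = norm (s - 1) * (C + \<rho>) * K2"
        unfolding K2_def using sum2 by (rule suminf_mult)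
      finally show ?thesis by (simp add: mult.assoc)
    qed
    have "G s = of_real \<rho> + ((\<Sum>n<N. gterm s (Suc n)) + (\<Sum>n. gterm s (Suc (n + N))))"
      unfolding G_def
      using suminf_split_initial_segment[OF summable_norm_cancel[OF summable_norm_gterm[OF Re]], of N]
      by (simp add: add.commute)
    also have "(\<Sum>n<N. gterm s (Suc n)) = (\<Sum>n=1..N. gterm s n)"
      by (simp add: sum.atLeast1_atMost_eq lessThan_def)
    finally have "G s = (of_real \<rho> + (\<Sum>n=1..N. gterm s n)) + (\<Sum>n. gterm s (Suc (n + N)))" by simp
    then have "norm (G s) \<le> norm (of_real \<rho> + (\<Sum>n=1..N. gterm s n)) + norm (\<Sum>n. gterm s (Suc (n + N)))"
      using norm_triangle_ineq by metis
    also have "norm (of_real \<rho> + (\<Sum>n=1..N. gterm s n)) \<le> norm (s - 1) * (W powr (2 * \<delta>) * K1 + C) + 2 * \<rho> * W powr (2 * \<delta>)"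
    proof -
      let ?X = "(\<Sum>n=1..N. dterm a s n)" and ?Y = "of_real (B N) * of_nat (Suc N) powr (- s)"
      have "norm ((s - 1) * (?X - ?Y)) = norm (s - 1) * norm (?X - ?Y)" by (rule norm_mult)
      also have "\<dots> \<le> norm (s - 1) * (W powr (2 * \<delta>) * K1 + C)"
        using T1 T2 norm_triangle_ineq4[of ?X ?Y] by (intro mult_left_mono norm_ge_zero) linarith
      finally show ?thesis unfolding gterm_partial_sum
        using T3 norm_triangle_ineq[of "(s - 1) * (?X - ?Y)" "of_real \<rho> * of_nat (Suc N) powr (1 - s)"] by linarith
    qed
    also note T4
    also have "norm (s - 1) * (W powr (2 * \<delta>) * K1 + C) + 2 * \<rho> * W powr (2 * \<delta>) + norm (s - 1) * ((C + \<rho>) * K2)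
       \<le> norm (s - 1) * (W powr (2 * \<delta>) * K)"
    proof -
      define V where "V = W powr (2 * \<delta>)"
      have V: "V \<ge> 1" using W2 by (simp add: V_def)
      have "1 * C \<le> V * C" "1 * ((C + \<rho>) * K2) \<le> V * ((C + \<rho>) * K2)" "1 * (2 * \<rho> * V) \<le> norm (s - 1) * (2 * \<rho> * V)"
        using V C_nonneg rho_pos K2 s1 by (intro mult_right_mono; simp)+
      then have *: "norm (s - 1) * C \<le> norm (s - 1) * (V * C)"
         "norm (s - 1) * ((C + \<rho>) * K2) \<le> norm (s - 1) * (V * ((C + \<rho>) * K2))" "2 * \<rho> * V \<le> norm (s - 1) * (2 * \<rho> * V)"
        by (auto intro!: mult_left_mono)
      have "norm (s - 1) * (V * K) = norm (s - 1) * (V * K1) + norm (s - 1) * (V * C) + norm (s - 1) * (2 * \<rho> * V) + norm (s - 1) * (V * ((C + \<rho>) * K2))"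
        by (simp add: K_def algebra_simps)
      moreover have "norm (s - 1) * (V * K1 + C) = norm (s - 1) * (V * K1) + norm (s - 1) * C" by (simp add: algebra_simps)
      ultimately show ?thesis using * unfolding V_def [symmetric] by linarith
    qed
    finally have "norm (G s) \<le> norm (s - 1) * (W powr (2 * \<delta>) * K)" by simp
    then have "norm (Z s) \<le> W powr (2 * \<delta>) * K"
      unfolding Z_def norm_divide using s1 by (subst pos_divide_le_eq) (auto simp: mult_ac)
    also have "\<dots> \<le> (2 * norm s powr (1/100)) * K"
    proof (intro mult_right_mono)
      have "W powr (2 * \<delta>) \<le> (2 * norm s ^ 4) powr (2 * \<delta>)"
        using WN W1 by (intro powr_mono2) (auto simp: \<delta>_def)
      also have "\<dots> = 2 powr (2 * \<delta>) * (norm s ^ 4) powr (2 * \<delta>)" using s0 by (simp add: powr_mult)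
      also have "(norm s ^ 4) powr (2 * \<delta>) = (norm s powr 4) powr (2 * \<delta>)" using s0 by (subst powr_numeral) auto
      also have "\<dots> = norm s powr (1/100)" unfolding powr_powr by (simp add: \<delta>_def)
      also have "2 powr (2 * \<delta>) * norm s powr (1/100) \<le> 2 powr 1 * norm s powr (1/100)"
        by (intro mult_right_mono powr_mono) (auto simp: \<delta>_def)
      finally show "W powr (2 * \<delta>) \<le> 2 * norm s powr (1/100)" by simp
    qed (use K in simp)
    finally show ?thesis by (simp add: mult_ac)
  qed
  then show ?thesis using K by (intro exI[of _ "2 * K"]) (auto simp: \<delta>_def)
qed

text \<open>Cauchy's estimate on discs of radius \<open>1/800\<close>, which stay inside the region
  of \<open>Z_growth\<close>, turns one growth bound into bounds for three derivatives. In
  \<open>K'\<close> the factor 18 is \<open>3!\<close> times the 3 that bounds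
  \<open>|w| / |Im s|\<close> on the disc.\<close>

lemma dseries_a_growth:
  "\<exists>K\<ge>1. \<forall>j\<le>3. \<forall>s. 1 < Re s \<longrightarrow> Re s \<le> 2 \<longrightarrow> \<bar>Im s\<bar> \<ge> 2 \<longrightarrow>
     norm (dseries (\<lambda>n. a n * ln (real n) ^ j) s) \<le> K * \<bar>Im s\<bar> powr (1/100)"
proof -
  define \<delta> :: real where "\<delta> = 1/800"
  obtain K where K: "K > 0" "\<And>s. Re s \<ge> 1 - \<delta> \<Longrightarrow> \<bar>Im s\<bar> \<ge> 1 \<Longrightarrow> norm (Z s) \<le> K * norm s powr (1/100)"
    using Z_growth unfolding \<delta>_def by blast
  define K' where "K' = 18 * K / \<delta> ^ 3 + 1"
  have "norm (dseries (\<lambda>n. a n * ln (real n) ^ j) s) \<le> K' * \<bar>Im s\<bar> powr (1/100)"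
    if j: "j \<le> 3" and s: "1 < Re s" "Re s \<le> 2" "\<bar>Im s\<bar> \<ge> 2" for j s
  proof -
    define T where "T = \<bar>Im s\<bar> powr (1/100)"
    have in_cball: "Re w \<ge> 1 - \<delta> \<and> \<bar>Im w\<bar> \<ge> 1 \<and> norm w \<le> 3 * \<bar>Im s\<bar>" if "norm (s - w) \<le> \<delta>" for w
    proof -
      have "\<bar>Re (s - w)\<bar> \<le> \<delta>" "\<bar>Im (s - w)\<bar> \<le> \<delta>"
        using that abs_Re_le_cmod[of "s - w"] abs_Im_le_cmod[of "s - w"] by linarith+
      moreover have "norm w \<le> norm s + \<delta>" using that norm_triangle_ineq2[of w s] by (simp add: norm_minus_commute)
      moreover have "norm s \<le> \<bar>Re s\<bar> + \<bar>Im s\<bar>" by (rule cmod_le)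
      moreover have "Re (s - w) = Re s - Re w" "Im (s - w) = Im s - Im w" by simp_all
      moreover have "\<bar>Im s\<bar> \<le> \<bar>Im w\<bar> + \<bar>Im s - Im w\<bar>" by linarith
      ultimately show ?thesis using s unfolding \<delta>_def by (intro conjI) linarith+
    qed
    have sub: "cball s \<delta> \<subseteq> {s. Re s > 1/2} - {1}"
    proof
      fix w assume "w \<in> cball s \<delta>"
      then have "norm (s - w) \<le> \<delta>" by (simp add: dist_norm)
      from in_cball[OF this] show "w \<in> {s. Re s > 1/2} - {1}" by (auto simp: \<delta>_def)
    qed
    have hol: "Z holomorphic_on cball s \<delta>" by (rule holomorphic_Z[OF sub])
    have "norm ((deriv ^^ j) Z s) \<le> fact j * (3 * K * T) / \<delta> ^ j"
    proof (rule Cauchy_inequality)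
      show "Z holomorphic_on ball s \<delta>" using hol by (rule holomorphic_on_subset) auto
      show "continuous_on (cball s \<delta>) Z" using hol by (rule holomorphic_on_imp_continuous_on)
      show "\<delta> > 0" by (simp add: \<delta>_def)
      fix w assume "norm (s - w) = \<delta>"
      then have w: "Re w \<ge> 1 - \<delta>" "\<bar>Im w\<bar> \<ge> 1" "norm w \<le> 3 * \<bar>Im s\<bar>" using in_cball[of w] by auto
      have "norm (Z w) \<le> K * norm w powr (1/100)" using K(2) w by blast
      also have "\<dots> \<le> K * (3 * \<bar>Im s\<bar>) powr (1/100)" using K(1) w by (intro mult_left_mono powr_mono2) auto
      also have "(3 * \<bar>Im s\<bar>) powr (1/100) = 3 powr (1/100) * T" by (simp add: powr_mult T_def)
      also have "\<dots> \<le> 3 powr 1 * T" by (intro mult_right_mono powr_mono) (auto simp: T_def)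
      finally show "norm (Z w) \<le> 3 * K * T" using K(1) by (simp add: mult_left_mono mult_ac)
    qed
    also have "\<dots> \<le> 6 * (3 * K * T) / \<delta> ^ 3"
    proof (intro frac_le mult_right_mono)
      have "j = 0 \<or> j = 1 \<or> j = 2 \<or> j = 3" using j by auto
      then show "fact j \<le> (6::real)" by (auto simp: fact_numeral)
      show "\<delta> ^ 3 \<le> \<delta> ^ j" using j by (intro power_decreasing) (auto simp: \<delta>_def)
    qed (use K(1) in \<open>auto simp: T_def \<delta>_def\<close>)
    also have "\<dots> \<le> K' * T" by (simp add: K'_def T_def algebra_simps)
    finally have "norm ((deriv ^^ j) Z s) \<le> K' * T" .
    moreover have "(deriv ^^ j) Z s = (deriv ^^ j) (dseries a) s"
    proof (rule higher_deriv_transform_within_open)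
      show "Z holomorphic_on {s. Re s > 1}" by (rule holomorphic_Z) auto
      show "dseries a holomorphic_on {s. Re s > 1}" by (rule holomorphic_dseries[OF dconv_a])
    qed (use s open_Re_gt[of 1] Z_eq in auto)
    moreover have "norm ((deriv ^^ j) (dseries a) s) = norm (dseries (\<lambda>n. a n * ln (real n) ^ j) s)"
      using higher_deriv_dseries[OF dconv_a s(1), of j] by (simp add: norm_mult norm_power)
    ultimately show ?thesis by (simp add: T_def)
  qed
  moreover have "K' \<ge> 1" using K(1) by (simp add: K'_def \<delta>_def)
  ultimately show ?thesis by blast
qed

end

section \<open>The inequality \<open>3 + 4 cos t + cos 2t >= 0\<close> and lower bounds near the
  line\<close>

lemma Re_dterm:
  "Re (dterm c (Complex \<sigma> t) n) = c n * real n powr (- \<sigma>) * cos (t * ln (real n))"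
proof (cases "n = 0")
  case False
  then have "of_nat n powr (- Complex \<sigma> t) = exp (- Complex \<sigma> t * of_real (ln (real n)))"
    using Ln_of_real[of "real n"] by (simp add: powr_def)
  then have "Re (of_nat n powr (- Complex \<sigma> t)) = exp (- \<sigma> * ln (real n)) * cos (- t * ln (real n))"
    by (simp add: Re_exp)
  then show ?thesis using False by (simp add: dterm_def powr_def)
qed (simp add: dterm_def)

lemma dseries_eq_deriv:
  assumes f: "(f has_field_derivative f') (at s)" and g: "(g has_field_derivative g') (at s)"
    and s: "Re s > 1" and eq: "\<And>w. Re w > 1 \<Longrightarrow> f w = g w"
  shows "f' = g'"
proof -
  have "(g has_field_derivative f') (at s)"
    by (rule has_field_derivative_transform_within_open[OF f open_Re_gt[of 1]]) (use s eq in auto)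
  then show ?thesis using g DERIV_unique by blast
qed

context zeta_like
begin

text \<open>Coefficients of the logarithm of the Dirichlet series. At \<open>n = 1\<close> the
  division by \<open>ln 1 = 0\<close> gives 0, in agreement with \<open>lam 1 = 0\<close>.\<close>

definition kap :: "nat \<Rightarrow> real" where "kap n = lam n / ln (real n)"

lemma kap_nonneg: "kap n \<ge> 0"
proof (cases "n = 0")
  case False
  then show ?thesis using lam_nonneg[of n] by (simp add: kap_def)
qed (simp add: kap_def)

lemma kap_le: "n > 0 \<Longrightarrow> kap n \<le> 2"
proof (cases "n = 1")
  case False
  assume "n > 0"
  then have "ln (real n) > 0" using False by simp
  then show ?thesis using lam_le[of n] \<open>n > 0\<close> by (simp add: kap_def field_simps)
qed (simp add: kap_def)

lemma kap_ln: "n > 0 \<Longrightarrow> kap n * ln (real n) = lam n"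
  using lam_le[of n] lam_nonneg[of n] by (cases "n = 1") (auto simp: kap_def)

lemma dconv_kap: "dconv kap"
  by (rule dconv_mono[OF dconv_cmult[OF dconv_one, of 2]]) (use kap_nonneg kap_le in auto)

lemma dseries_lam_a:
  assumes "Re s > 1"
  shows "dseries lam s * dseries a s = dseries (\<lambda>n. a n * ln (real n)) s"
  by (rule dseries_mult[OF dconv_lam dconv_a assms _ dconv_ln[OF dconv_a]]) (use lam_conv in auto)

text \<open>In place of a branch of the logarithm, the product
  \<open>dseries a s * exp (- dseries kap s)\<close> is shown to have derivative 0, hence to be
  constant on the half plane. The constant is nonzero because at \<open>s = 2\<close> the series has
  nonnegative terms and the term at \<open>n = 1\<close> is 1.\<close>

lemma dseries_a_exp:
  "\<exists>c0. c0 \<noteq> 0 \<and> (\<forall>s. Re s > 1 \<longrightarrow> dseries a s = c0 * exp (dseries kap s))"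
proof -
  let ?S = "{s::complex. Re s > 1}"
  let ?H = "\<lambda>s. dseries a s * exp (- dseries kap s)"
  have "(?H has_field_derivative 0) (at s within ?S)" if "s \<in> ?S" for s
  proof -
    have s: "Re s > 1" using that by simp
    have k: "dseries (\<lambda>n. kap n * ln (real n)) s = dseries lam s"
      by (rule dseries_cong) (rule kap_ln)
    have "(?H has_field_derivative (- dseries (\<lambda>n. a n * ln (real n)) s) * exp (- dseries kap s) +
        exp (- dseries kap s) * - (- dseries (\<lambda>n. kap n * ln (real n)) s) * dseries a s) (at s)"
      by (intro DERIV_mult DERIV_fun_exp DERIV_minus has_field_derivative_dseries dconv_a dconv_kap s)
    moreover have "(- dseries (\<lambda>n. a n * ln (real n)) s) * exp (- dseries kap s) +
        exp (- dseries kap s) * - (- dseries (\<lambda>n. kap n * ln (real n)) s) * dseries a s = 0"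
      unfolding k dseries_lam_a[OF s, symmetric] by simp
    ultimately show ?thesis by (metis has_field_derivative_at_within)
  qed
  then obtain c0 where c0: "\<And>s. s \<in> ?S \<Longrightarrow> ?H s = c0"
    using has_field_derivative_zero_constant[OF convex_halfspace_Re_gt[of 1], of ?H] by auto
  have eq: "dseries a s = c0 * exp (dseries kap s)" if "Re s > 1" for s
    using c0[of s] that by (auto simp: exp_minus field_simps)
  have "c0 \<noteq> 0"
  proof
    assume "c0 = 0"
    then have z: "dseries a (Complex 2 0) = 0" using eq[of "Complex 2 0"] by simp
    have sums: "(\<lambda>n. Re (dterm a (Complex 2 0) n)) sums Re (dseries a (Complex 2 0))"
      by (intro sums_Re dconv_sums dconv_a) simp
    have "(\<Sum>n\<in>{1}. Re (dterm a (Complex 2 0) n)) \<le> (\<Sum>n. Re (dterm a (Complex 2 0) n))"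
      using sums a_nonneg by (intro sum_le_suminf) (auto simp: Re_dterm sums_iff)
    also have "\<dots> = 0" using sums z by (simp add: sums_iff)
    finally show False using a_1 by (simp add: Re_dterm)
  qed
  then show ?thesis using eq by blast
qed

text \<open>With \<open>y = cos (t ln n)\<close> the combination
  \<open>3 + 4 y + (2 y^2 - 1)\<close> is \<open>2 (1 + y)^2\<close>, so the exponents of the three
  factors add up to something nonnegative; the multiplicities \<open>3 + 4 + 1\<close> of
  \<open>c0\<close> give the bound \<open>norm c0 ^ 8\<close>.\<close>

lemma three_four_one:
  "\<exists>c1>0. \<forall>\<sigma> t. \<sigma> > 1 \<longrightarrow> c1 \<le> norm (dseries a (Complex \<sigma> 0)) ^ 3 * norm (dseries a (Complex \<sigma> t)) ^ 4 *
      norm (dseries a (Complex \<sigma> (2 * t)))"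
proof -
  obtain c0 where c0: "c0 \<noteq> 0" "\<And>s. Re s > 1 \<Longrightarrow> dseries a s = c0 * exp (dseries kap s)"
    using dseries_a_exp by blast
  have "norm c0 ^ 8 \<le> norm (dseries a (Complex \<sigma> 0)) ^ 3 * norm (dseries a (Complex \<sigma> t)) ^ 4 *
      norm (dseries a (Complex \<sigma> (2 * t)))" if \<sigma>: "\<sigma> > 1" for \<sigma> t
  proof -
    let ?l = "\<lambda>u. Re (dseries kap (Complex \<sigma> u))"
    have nrm: "norm (dseries a (Complex \<sigma> u)) = norm c0 * exp (?l u)" for u
      using c0(2)[of "Complex \<sigma> u"] \<sigma> by (simp add: norm_mult)
    have sm: "(\<lambda>n. 3 * Re (dterm kap (Complex \<sigma> 0) n) + 4 * Re (dterm kap (Complex \<sigma> t) n) + Re (dterm kap (Complex \<sigma> (2 * t)) n))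
        sums (3 * ?l 0 + 4 * ?l t + ?l (2 * t))"
      using \<sigma> by (intro sums_add sums_mult sums_Re dconv_sums dconv_kap) auto
    have pos: "0 \<le> 3 * Re (dterm kap (Complex \<sigma> 0) n) + 4 * Re (dterm kap (Complex \<sigma> t) n) + Re (dterm kap (Complex \<sigma> (2 * t)) n)" for n
    proof -
      define y where "y = cos (t * ln (real n))"
      have c2: "cos (2 * t * ln (real n)) = 2 * y\<^sup>2 - 1"
        unfolding y_def using cos_double_cos[of "t * ln (real n)"] by (simp add: mult.assoc)
      have "3 * Re (dterm kap (Complex \<sigma> 0) n) + 4 * Re (dterm kap (Complex \<sigma> t) n) + Re (dterm kap (Complex \<sigma> (2 * t)) n)
          = kap n * real n powr (- \<sigma>) * (2 * (1 + y)\<^sup>2)"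
        unfolding Re_dterm c2 y_def [symmetric] by (simp add: power2_eq_square algebra_simps)
      also have "\<dots> \<ge> 0" using kap_nonneg by simp
      finally show ?thesis .
    qed
    have "0 \<le> 3 * ?l 0 + 4 * ?l t + ?l (2 * t)"
      by (rule sums_le[OF pos sums_zero sm])
    then have "norm c0 ^ 8 * 1 \<le> norm c0 ^ 8 * exp (3 * ?l 0 + 4 * ?l t + ?l (2 * t))"
      by (intro mult_left_mono) auto
    also have "exp (3 * ?l 0 + 4 * ?l t + ?l (2 * t)) = exp (?l 0) ^ 3 * exp (?l t) ^ 4 * exp (?l (2 * t))"
      by (simp add: exp_add flip: exp_of_nat_mult)
    also have "norm c0 ^ 8 * (exp (?l 0) ^ 3 * exp (?l t) ^ 4 * exp (?l (2 * t))) =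
        (norm c0 * exp (?l 0)) ^ 3 * (norm c0 * exp (?l t)) ^ 4 * (norm c0 * exp (?l (2 * t)))"
      by (simp add: power_mult_distrib eval_nat_numeral mult_ac)
    finally show ?thesis unfolding nrm by simp
  qed
  then show ?thesis using c0(1) by (intro exI[of _ "norm c0 ^ 8"]) auto
qed

text \<open>The pole is the factor \<open>1 / (s - 1)\<close>, and \<open>G\<close> is bounded on
  the segment from 1 to 2 by compactness.\<close>

lemma dseries_a_near_1: "\<exists>K\<ge>1. \<forall>\<sigma>. 1 < \<sigma> \<longrightarrow> \<sigma> \<le> 2 \<longrightarrow> norm (dseries a (Complex \<sigma> 0)) \<le> K / (\<sigma> - 1)"
proof -
  let ?S = "closed_segment 1 (2::complex)"
  have S: "w = of_real (Re w) \<and> 1 \<le> Re w \<and> Re w \<le> 2" if "w \<in> ?S" for w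
  proof -
    have "w \<in> closed_segment (of_real 1) (of_real 2)" using that by simp
    then obtain x where "w = of_real x" "x \<in> closed_segment 1 (2::real)"
      unfolding closed_segment_of_real by blast
    then show ?thesis by (auto simp: closed_segment_eq_real_ivl)
  qed
  have "?S \<subseteq> {s. Re s > 1/2}" using S by force
  then have "continuous_on ?S G"
    using holomorphic_on_imp_continuous_on[OF holomorphic_G] continuous_on_subset by blast
  then have "bounded (G ` ?S)" by (intro compact_imp_bounded compact_continuous_image) auto
  then obtain K where K: "\<And>w. w \<in> ?S \<Longrightarrow> norm (G w) \<le> K" by (auto simp: bounded_iff)
  have "norm (dseries a (Complex \<sigma> 0)) \<le> max K 1 / (\<sigma> - 1)" if \<sigma>: "1 < \<sigma>" "\<sigma> \<le> 2" for \<sigma>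
  proof -
    have "of_real \<sigma> \<in> closed_segment (of_real 1) (of_real 2 :: complex)"
      unfolding closed_segment_of_real using \<sigma> by (auto simp: closed_segment_eq_real_ivl)
    then have "norm (G (of_real \<sigma>)) \<le> K" using K by simp
    moreover have "G (of_real \<sigma>) = of_real (\<sigma> - 1) * dseries a (Complex \<sigma> 0)"
      using G_eq[of "of_real \<sigma>"] \<sigma> by (simp flip: complex_of_real_def)
    ultimately have "(\<sigma> - 1) * norm (dseries a (Complex \<sigma> 0)) \<le> K"
      using \<sigma> by (simp add: norm_mult del: of_real_diff)
    then show ?thesis using \<sigma> by (simp add: field_simps)
  qed
  then show ?thesis by (intro exI[of _ "max K 1"]) auto
qed

text \<open>For \<open>\<sigma> >= 1 + \<eta>\<close> the inequality \<open>three_four_one\<close>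
  gives the bound \<open>2 e^4 / M^4\<close>, since the pole at 1 costs at most
  \<open>(K / \<eta>)^3\<close>. For smaller \<open>\<sigma>\<close> the point is moved horizontally
  to \<open>1 + \<eta>\<close>, and the derivative bound \<open>M\<close> loses at most
  \<open>M * \<eta>\<close>.\<close>

lemma dseries_a_lower:
  "\<exists>c>0. \<forall>t M. M \<ge> 1 \<longrightarrow>
     (\<forall>\<sigma>. 1 < \<sigma> \<longrightarrow> \<sigma> \<le> 2 \<longrightarrow> norm (dseries a (Complex \<sigma> (2 * t))) \<le> M \<and>
        norm (dseries (\<lambda>n. a n * ln (real n)) (Complex \<sigma> t)) \<le> M) \<longrightarrow>
     (\<forall>\<sigma>. 1 < \<sigma> \<longrightarrow> \<sigma> \<le> 2 \<longrightarrow> c / M ^ 4 \<le> norm (dseries a (Complex \<sigma> t)))"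
proof -
  obtain c1 where c1: "c1 > 0" "\<And>\<sigma> t. \<sigma> > 1 \<Longrightarrow> c1 \<le> norm (dseries a (Complex \<sigma> 0)) ^ 3 * norm (dseries a (Complex \<sigma> t)) ^ 4 *
      norm (dseries a (Complex \<sigma> (2 * t)))" using three_four_one by blast
  obtain K where K: "K \<ge> 1" "\<And>\<sigma>. 1 < \<sigma> \<Longrightarrow> \<sigma> \<le> 2 \<Longrightarrow> norm (dseries a (Complex \<sigma> 0)) \<le> K / (\<sigma> - 1)"
    using dseries_a_near_1 by blast
  define q where "q = c1 / K ^ 3"
  have q: "q > 0" using c1 K by (simp add: q_def)
  \<comment> \<open>Ensures \<open>(2 e)^4 <= q\<close>, where \<open>q\<close> is the constant of
    \<open>three_four_one\<close> after division by the pole constant \<open>K^3\<close>, and keeps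
    \<open>e\<close> small.\<close>
  define e where "e = min 1 (q powr (1/4)) / 2"
  have e: "e > 0" "e \<le> 1/2" using q by (auto simp: e_def)
  have "(2 * e) ^ 4 \<le> (q powr (1/4)) ^ 4" using e by (intro power_mono) (auto simp: e_def)
  also have "\<dots> = q" using q by (simp flip: powr_realpow add: powr_powr)
  finally have eq: "(2 * e) ^ 4 \<le> q" .
  have "e ^ 4 / M ^ 4 \<le> norm (dseries a (Complex \<sigma> t))"
    if M: "M \<ge> 1" and bd: "\<And>\<sigma>. 1 < \<sigma> \<Longrightarrow> \<sigma> \<le> 2 \<Longrightarrow> norm (dseries a (Complex \<sigma> (2 * t))) \<le> M"
        "\<And>\<sigma>. 1 < \<sigma> \<Longrightarrow> \<sigma> \<le> 2 \<Longrightarrow> norm (dseries (\<lambda>n. a n * ln (real n)) (Complex \<sigma> t)) \<le> M"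
      and \<sigma>: "1 < \<sigma>" "\<sigma> \<le> 2" for t M \<sigma>
  proof -
    \<comment> \<open>Chosen so that the loss \<open>M * \<eta> = e^4 / M^4\<close> is half of the
      bound at \<open>1 + \<eta>\<close>, while \<open>(2 e)^4 * \<eta>^3 / M\<close> is the fourth
      power of \<open>2 e^4 / M^4\<close>.\<close>
    define \<eta> where "\<eta> = e ^ 4 / M ^ 5"
    have \<eta>0: "\<eta> > 0" using e M by (simp add: \<eta>_def)
    have \<eta>1: "\<eta> \<le> 1"
    proof -
      have "e ^ 4 \<le> 1" using e by (intro power_le_one) auto
      moreover have "M ^ 5 \<ge> 1" using M by simp
      ultimately have "e ^ 4 \<le> 1 * M ^ 5" by linarith
      then show ?thesis unfolding \<eta>_def using M by (subst pos_divide_le_eq) auto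
    qed
    have far: "2 * e ^ 4 / M ^ 4 \<le> norm (dseries a (Complex \<tau> t))" if \<tau>: "1 + \<eta> \<le> \<tau>" "\<tau> \<le> 2" for \<tau>
    proof -
      define y where "y = norm (dseries a (Complex \<tau> t))"
      have \<tau>1: "\<tau> > 1" using \<tau> \<eta>0 by linarith
      have "c1 \<le> norm (dseries a (Complex \<tau> 0)) ^ 3 * y ^ 4 * norm (dseries a (Complex \<tau> (2 * t)))"
        using c1(2)[OF \<tau>1] by (simp add: y_def)
      also have "\<dots> \<le> (K / (\<tau> - 1)) ^ 3 * y ^ 4 * M"
        using \<tau> \<tau>1 K M bd(1) by (intro mult_mono power_mono) (auto simp: y_def)
      also have "\<dots> \<le> (K / \<eta>) ^ 3 * y ^ 4 * M"
        using \<tau> \<tau>1 \<eta>0 K M by (intro mult_right_mono power_mono divide_left_mono) (auto simp: y_def)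
      finally have "c1 \<le> (K / \<eta>) ^ 3 * y ^ 4 * M" .
      then have "q * \<eta> ^ 3 / M \<le> y ^ 4"
        using K \<eta>0 M by (simp add: q_def field_simps power_divide)
      moreover have "(2 * e) ^ 4 * \<eta> ^ 3 / M \<le> q * \<eta> ^ 3 / M"
        using eq \<eta>0 M by (intro divide_right_mono mult_right_mono) auto
      moreover have "(2 * e) ^ 4 * \<eta> ^ 3 / M = (2 * e ^ 4 / M ^ 4) ^ 4"
        using M by (simp add: \<eta>_def power_divide power_mult_distrib field_simps flip: power_mult power_add power_Suc)
      ultimately have "(2 * e ^ 4 / M ^ 4) ^ 4 \<le> y ^ 4" by linarith
      then have "(2 * e ^ 4 / M ^ 4) ^ Suc 3 \<le> y ^ Suc 3" by simp
      then have "2 * e ^ 4 / M ^ 4 \<le> y" by (rule power_le_imp_le_base) (simp add: y_def)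
      then show ?thesis by (simp add: y_def)
    qed
    show ?thesis
    proof (cases "\<sigma> \<ge> 1 + \<eta>")
      case True
      have "e ^ 4 / M ^ 4 \<le> 2 * e ^ 4 / M ^ 4" using e M by (intro divide_right_mono) auto
      then show ?thesis using far[OF True \<sigma>(2)] by linarith
    next
      case False
      let ?S = "{s. Re s > 1} \<inter> {s. Re s \<le> 2} \<inter> {s. Im s \<le> t} \<inter> {s. Im s \<ge> t}"
      have "norm (dseries a (Complex (1 + \<eta>) t) - dseries a (Complex \<sigma> t)) \<le> M * norm (Complex (1 + \<eta>) t - Complex \<sigma> t)"
      proof (rule field_differentiable_bound[where S = ?S])
        show "convex ?S"
          by (intro convex_Int convex_halfspace_Re_gt convex_halfspace_Re_le convex_halfspace_Im_le convex_halfspace_Im_ge)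
        fix z assume z: "z \<in> ?S"
        then show "(dseries a has_field_derivative - dseries (\<lambda>n. a n * ln (real n)) z) (at z within ?S)"
          by (intro has_field_derivative_at_within[OF has_field_derivative_dseries] dconv_a) auto
        have zt: "Complex (Re z) t = z" using z by (auto simp: complex_eq_iff)
        have "norm (dseries (\<lambda>n. a n * ln (real n)) (Complex (Re z) t)) \<le> M" using bd(2)[of "Re z"] z by simp
        then show "norm (- dseries (\<lambda>n. a n * ln (real n)) z) \<le> M" unfolding zt by simp
      qed (use \<sigma> \<eta>0 \<eta>1 in auto)
      also have "norm (Complex (1 + \<eta>) t - Complex \<sigma> t) = 1 + \<eta> - \<sigma>"
        using False by (simp add: complex_diff cmod_def)
      also have "M * (1 + \<eta> - \<sigma>) \<le> M * \<eta>" using \<sigma> M by (intro mult_left_mono) auto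
      also have "M * \<eta> = e ^ 4 / M ^ 4" using M by (simp add: \<eta>_def field_simps flip: power_Suc)
      finally have "norm (dseries a (Complex (1 + \<eta>) t) - dseries a (Complex \<sigma> t)) \<le> e ^ 4 / M ^ 4" using M by simp
      moreover have "2 * e ^ 4 / M ^ 4 \<le> norm (dseries a (Complex (1 + \<eta>) t))" using far[of "1 + \<eta>"] \<eta>1 by simp
      moreover have "norm (dseries a (Complex (1 + \<eta>) t)) \<le> norm (dseries a (Complex (1 + \<eta>) t) - dseries a (Complex \<sigma> t)) + norm (dseries a (Complex \<sigma> t))"
        using norm_triangle_ineq[of "dseries a (Complex (1 + \<eta>) t) - dseries a (Complex \<sigma> t)" "dseries a (Complex \<sigma> t)"] by simp
      ultimately show ?thesis by simp
    qed
  qed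
  then show ?thesis using e by (intro exI[of _ "e ^ 4"]) auto
qed

end

lemma dseries_nth_log: "(\<lambda>n. (c n * ln (real n) ^ j) * ln (real n)) = (\<lambda>n. c n * ln (real n) ^ Suc j)"
  by (simp add: mult_ac)

context zeta_like
begin

text \<open>Compactness of the horizontal segments at heights \<open>t\<close> and
  \<open>2 t\<close>, which avoid the pole, supplies \<open>M\<close> for
  \<open>dseries_a_lower\<close>. The resulting bound does not depend on \<open>\<sigma>\<close> and
  survives the limit \<open>\<sigma>\<close> to 1.\<close>

lemma Z_nonzero_line:
  assumes t: "t \<noteq> 0" shows "Z (Complex 1 t) \<noteq> 0"
proof -
  obtain c where c: "c > 0" "\<And>t M. M \<ge> 1 \<Longrightarrow>
     (\<forall>\<sigma>. 1 < \<sigma> \<longrightarrow> \<sigma> \<le> 2 \<longrightarrow> norm (dseries a (Complex \<sigma> (2 * t))) \<le> M \<and>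
        norm (dseries (\<lambda>n. a n * ln (real n)) (Complex \<sigma> t)) \<le> M) \<Longrightarrow>
     (\<forall>\<sigma>. 1 < \<sigma> \<longrightarrow> \<sigma> \<le> 2 \<longrightarrow> c / M ^ 4 \<le> norm (dseries a (Complex \<sigma> t)))"
    using dseries_a_lower by blast
  let ?S = "{s::complex. Re s > 1/2} - {1}"
  have op: "open ?S" by (intro open_Diff open_Re_gt) auto
  have hol: "Z holomorphic_on ?S" by (rule holomorphic_Z) simp
  have hol': "deriv Z holomorphic_on ?S" by (rule holomorphic_deriv[OF hol op])
  define Q where "Q = (\<lambda>\<sigma>. Complex \<sigma> (2 * t)) ` {1..2} \<union> (\<lambda>\<sigma>. Complex \<sigma> t) ` {1..2}"
  have cont_line: "continuous_on A (\<lambda>\<sigma>. Complex \<sigma> u)" for A u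
    unfolding Complex_eq by (intro continuous_intros)
  have Q: "compact Q" unfolding Q_def
    by (intro compact_Un compact_continuous_image cont_line) auto
  have QS: "Q \<subseteq> ?S" using t by (auto simp: Q_def complex_eq_iff)
  have "bounded (Z ` Q)" "bounded (deriv Z ` Q)"
    using holomorphic_on_imp_continuous_on[OF hol] holomorphic_on_imp_continuous_on[OF hol'] QS Q
    by (auto intro!: compact_imp_bounded compact_continuous_image intro: continuous_on_subset)
  then obtain M1 M2 where M12: "\<And>w. w \<in> Q \<Longrightarrow> norm (Z w) \<le> M1" "\<And>w. w \<in> Q \<Longrightarrow> norm (deriv Z w) \<le> M2"
    unfolding bounded_iff by blast
  define M where "M = max 1 (max M1 M2)"
  have dZ: "deriv Z s = - dseries (\<lambda>n. a n * ln (real n)) s" if "Re s > 1" for s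
  proof -
    have "(Z has_field_derivative - dseries (\<lambda>n. a n * ln (real n)) s) (at s)"
      by (rule has_field_derivative_transform_within_open[OF has_field_derivative_dseries[OF dconv_a that] open_Re_gt[of 1]])
        (use that Z_eq in auto)
    then show ?thesis by (rule DERIV_imp_deriv)
  qed
  have "norm (dseries a (Complex \<sigma> (2 * t))) \<le> M \<and> norm (dseries (\<lambda>n. a n * ln (real n)) (Complex \<sigma> t)) \<le> M"
    if \<sigma>: "1 < \<sigma>" "\<sigma> \<le> 2" for \<sigma>
  proof -
    have "Complex \<sigma> (2 * t) \<in> Q" "Complex \<sigma> t \<in> Q" using \<sigma> by (auto simp: Q_def)
    then show ?thesis using M12(1)[of "Complex \<sigma> (2 * t)"] M12(2)[of "Complex \<sigma> t"] \<sigma>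
        Z_eq[of "Complex \<sigma> (2 * t)"] dZ[of "Complex \<sigma> t"] by (auto simp: M_def)
  qed
  moreover have M1: "M \<ge> 1" by (simp add: M_def)
  ultimately have low: "c / M ^ 4 \<le> norm (dseries a (Complex \<sigma> t))" if "1 < \<sigma>" "\<sigma> \<le> 2" for \<sigma>
    using c(2)[of M t] that by blast
  have "isCont Z (Complex 1 t)"
    using hol op t by (intro field_differentiable_imp_continuous_at holomorphic_on_imp_differentiable_at[OF hol op])
      (auto simp: complex_eq_iff)
  moreover have "(\<lambda>n. Complex (1 + inverse (real (Suc n))) t) \<longlonglongrightarrow> Complex (1 + 0) t"
    by (intro tendsto_Complex tendsto_intros LIMSEQ_inverse_real_of_nat)
  ultimately have "(\<lambda>n. Z (Complex (1 + inverse (real (Suc n))) t)) \<longlonglongrightarrow> Z (Complex 1 t)"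
    using isCont_tendsto_compose[of "Complex 1 t" Z] by simp
  then have "(\<lambda>n. norm (Z (Complex (1 + inverse (real (Suc n))) t))) \<longlonglongrightarrow> norm (Z (Complex 1 t))"
    by (rule tendsto_norm)
  moreover have "c / M ^ 4 \<le> norm (Z (Complex (1 + inverse (real (Suc n))) t))" for n
  proof -
    have "inverse (real (Suc n)) \<le> 1" by (simp add: inverse_le_1_iff)
    then show ?thesis using low[of "1 + inverse (real (Suc n))"] Z_eq[of "Complex (1 + inverse (real (Suc n))) t"] by simp
  qed
  ultimately have "c / M ^ 4 \<le> norm (Z (Complex 1 t))"
    by (intro LIMSEQ_le_const[where a = "c / M ^ 4"]) auto
  moreover have "c / M ^ 4 > 0" using c(1) M1 by simp
  ultimately show ?thesis by auto
qed

lemma G_nonzero: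
  assumes "Re s \<ge> 1" shows "G s \<noteq> 0"
proof (cases "Re s = 1")
  case True
  show ?thesis
  proof (cases "Im s = 0")
    case True
    then have "s = 1" using \<open>Re s = 1\<close> by (simp add: complex_eq_iff)
    then show ?thesis using G_1 rho_pos by simp
  next
    case False
    have "s = Complex 1 (Im s)" using True by (simp add: complex_eq_iff)
    then have "Z s \<noteq> 0" using Z_nonzero_line[OF False] by simp
    then show ?thesis by (auto simp: Z_def)
  qed
next
  case False
  then have s: "Re s > 1" using assms by simp
  obtain c0 where "c0 \<noteq> 0" "dseries a s = c0 * exp (dseries kap s)" using dseries_a_exp s by blast
  then have "dseries a s \<noteq> 0" by simp
  moreover have "s \<noteq> 1" using s by auto
  ultimately show ?thesis using G_eq[OF s] by simp
qed

text \<open>The first relation is \<open>lam_conv\<close> for series; two differentiations by the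
  product rule give the others. Each derivative multiplies the coefficients by
  \<open>- ln n\<close>, and the signs cancel.\<close>

lemma dseries_lam_log_identities:
  assumes s: "Re s > 1"
  defines "D \<equiv> \<lambda>j. dseries (\<lambda>n. a n * ln (real n) ^ j) s"
    and "L \<equiv> \<lambda>j. dseries (\<lambda>n. lam n * ln (real n) ^ j) s"
  shows "L 0 * D 0 = D 1" "L 1 * D 0 + L 0 * D 1 = D 2" "L 2 * D 0 + 2 * (L 1 * D 1) + L 0 * D 2 = D 3"
proof -
  let ?a = "\<lambda>j s. dseries (\<lambda>n. a n * ln (real n) ^ j) s"
  let ?l = "\<lambda>j s. dseries (\<lambda>n. lam n * ln (real n) ^ j) s"
  have da: "(?a j has_field_derivative - ?a (Suc j) w) (at w)" if "Re w > 1" for j w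
    using has_field_derivative_dseries[OF dconv_ln_power[OF dconv_a, of j] that] unfolding dseries_nth_log .
  have dl: "(?l j has_field_derivative - ?l (Suc j) w) (at w)" if "Re w > 1" for j w
    using has_field_derivative_dseries[OF dconv_ln_power[OF dconv_lam, of j] that] unfolding dseries_nth_log .
  have 0: "?l 0 w * ?a 0 w = ?a 1 w" if "Re w > 1" for w using dseries_lam_a[OF that] by simp
  have 1: "?l 1 w * ?a 0 w + ?l 0 w * ?a 1 w = ?a 2 w" if w: "Re w > 1" for w
  proof -
    have "- ?l (Suc 0) w * ?a 0 w + - ?a (Suc 0) w * ?l 0 w = - ?a (Suc 1) w"
      by (rule dseries_eq_deriv[OF DERIV_mult[OF dl[OF w] da[OF w]] da[OF w] w 0])
    then show ?thesis by (simp add: numeral_2_eq_2 algebra_simps add_eq_0_iff)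
  qed
  have 2: "?l 2 w * ?a 0 w + 2 * (?l 1 w * ?a 1 w) + ?l 0 w * ?a 2 w = ?a 3 w" if w: "Re w > 1" for w
  proof -
    have "(- ?l (Suc 1) w * ?a 0 w + - ?a (Suc 0) w * ?l 1 w) + (- ?l (Suc 0) w * ?a 1 w + - ?a (Suc 1) w * ?l 0 w) = - ?a (Suc 2) w"
      by (rule dseries_eq_deriv[OF DERIV_add[OF DERIV_mult[OF dl[OF w] da[OF w]] DERIV_mult[OF dl[OF w] da[OF w]]] da[OF w] w 1])
    then have "?l 2 w * ?a 0 w + ?a 1 w * ?l 1 w + (?l 1 w * ?a 1 w + ?a 2 w * ?l 0 w) = ?a 3 w"
      by (simp add: numeral_2_eq_2 numeral_3_eq_3 algebra_simps add_eq_0_iff)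
    then show ?thesis by (simp add: algebra_simps)
  qed
  show "L 0 * D 0 = D 1" "L 1 * D 0 + L 0 * D 1 = D 2" "L 2 * D 0 + 2 * (L 1 * D 1) + L 0 * D 2 = D 3"
    unfolding D_def L_def using 0[OF s] 1[OF s] 2[OF s] by blast+
qed

text \<open>Forward substitution in a triangular system, with a division by \<open>D0\<close> in
  each step: for \<open>r = M / m\<close> the three unknowns are at most \<open>r\<close>,
  \<open>2 r^2\<close> and \<open>6 r^3\<close>.\<close>

lemma quotient_bounds:
  fixes D0 D1 D2 D3 L0 L1 L2 :: complex
  assumes eqs: "L0 * D0 = D1" "L1 * D0 + L0 * D1 = D2" "L2 * D0 + 2 * (L1 * D1) + L0 * D2 = D3"
    and m: "0 < m" "m \<le> 1" "m \<le> norm D0" and M: "1 \<le> M" "norm D1 \<le> M" "norm D2 \<le> M" "norm D3 \<le> M"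
  shows "norm L2 \<le> 6 * (M / m) ^ 3"
proof -
  define r where "r = M / m"
  have r: "r \<ge> 1" using m M by (simp add: r_def)
  have Mr: "M \<le> r" using m M by (simp add: r_def field_simps mult_left_le)
  have div: "norm x \<le> B / m" if "norm (x * D0) \<le> B" for x :: complex and B
  proof -
    have "m * norm x \<le> norm D0 * norm x" using m by (intro mult_right_mono) auto
    also have "\<dots> \<le> B" using that by (simp add: norm_mult mult.commute)
    finally show ?thesis using m by (simp add: field_simps)
  qed
  have L0: "norm L0 \<le> r" using div[of L0 M] eqs(1) M by (simp add: r_def)
  have "L1 * D0 = D2 - L0 * D1" using eqs(2) by (simp add: algebra_simps)
  then have "norm (L1 * D0) \<le> norm D2 + norm L0 * norm D1" by (metis norm_mult norm_triangle_ineq4)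
  also have "\<dots> \<le> M + r * M" using L0 M r by (intro add_mono mult_mono) auto
  also have "\<dots> \<le> (2 * r) * M" using r M by (simp add: algebra_simps)
  finally have "norm L1 \<le> (2 * r) * M / m" by (rule div)
  then have L1: "norm L1 \<le> 2 * r\<^sup>2" by (simp add: r_def power2_eq_square)
  have "L2 * D0 = D3 - 2 * (L1 * D1) - L0 * D2" using eqs(3) by (simp add: algebra_simps)
  then have "norm (L2 * D0) \<le> norm D3 + norm (2 * (L1 * D1)) + norm (L0 * D2)"
    using norm_triangle_ineq4[of "D3 - 2 * (L1 * D1)" "L0 * D2"] norm_triangle_ineq4[of D3 "2 * (L1 * D1)"] by simp
  also have "\<dots> = norm D3 + 2 * (norm L1 * norm D1) + norm L0 * norm D2" by (simp add: norm_mult)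
  also have "\<dots> \<le> M + 2 * ((2 * r\<^sup>2) * M) + r * M" using L0 L1 M r by (intro add_mono mult_left_mono mult_mono) auto
  also have "\<dots> = (1 + 4 * r\<^sup>2 + r) * M" by (simp add: algebra_simps)
  also have "\<dots> \<le> (6 * r\<^sup>2) * M"
  proof (intro mult_right_mono)
    have "1 \<le> r\<^sup>2" using r by (simp add: one_le_power)
    moreover have "r \<le> r\<^sup>2" using r by (simp add: power2_eq_square)
    ultimately show "1 + 4 * r\<^sup>2 + r \<le> 6 * r\<^sup>2" by linarith
  qed (use M in simp)
  finally have "norm L2 \<le> (6 * r\<^sup>2) * M / m" by (rule div)
  also have "\<dots> = 6 * r ^ 3" by (simp add: r_def power2_eq_square power3_eq_cube)
  finally show ?thesis by (simp add: r_def)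
qed

text \<open>
  Subtracting \<open>a / \<rho>\<close> removes the pole at \<open>1\<close>. The factor \<open>(ln n)\<^sup>2\<close> takes two derivatives, and it
  gains the saving of a logarithm in the prime ideal theorem without shifting contours to the
  left of \<open>Re s = 1\<close>.
\<close>

definition bcoef :: "nat \<Rightarrow> real" where "bcoef n = (lam n - 1 / \<rho> * a n) * ln (real n) ^ 2"

lemma dconv_bcoef: "dconv bcoef"
  unfolding bcoef_def by (intro dconv_ln_power dconv_diff dconv_cmult dconv_lam dconv_a)

lemma dseries_bcoef:
  assumes "Re s > 1"
  shows "dseries bcoef s = dseries (\<lambda>n. lam n * ln (real n) ^ 2) s - of_real (1 / \<rho>) * dseries (\<lambda>n. a n * ln (real n) ^ 2) s"
proof -
  have b: "bcoef = (\<lambda>n. lam n * ln (real n) ^ 2 - 1 / \<rho> * (a n * ln (real n) ^ 2))"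
    by (simp add: bcoef_def fun_eq_iff algebra_simps)
  show ?thesis unfolding b
    by (subst dseries_diff, intro dconv_ln_power dconv_lam, intro dconv_cmult dconv_ln_power dconv_a, rule assms,
        subst dseries_cmult, intro dconv_ln_power dconv_a, rule assms, rule refl)
qed

text \<open>\<open>M\<close> is of order \<open>|t|^(1/100)\<close>; it bounds the derivatives at
  height \<open>t\<close> and the series at height \<open>2 t\<close>. The lower bound
  \<open>c' / M^4\<close> makes the ratio in \<open>quotient_bounds\<close> of order
  \<open>M^5\<close>, and its cube is of order \<open>|t|^(15/100)\<close>, which is below
  \<open>|t|^(1/2)\<close>.\<close>

lemma dseries_bcoef_far:
  "\<exists>K. \<forall>s. 1 < Re s \<longrightarrow> Re s \<le> 2 \<longrightarrow> \<bar>Im s\<bar> \<ge> 2 \<longrightarrow> norm (dseries bcoef s) \<le> K * \<bar>Im s\<bar> powr (1/2)"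
proof -
  obtain K where K: "K \<ge> 1" "\<And>j s. j \<le> 3 \<Longrightarrow> 1 < Re s \<Longrightarrow> Re s \<le> 2 \<Longrightarrow> \<bar>Im s\<bar> \<ge> 2 \<Longrightarrow>
     norm (dseries (\<lambda>n. a n * ln (real n) ^ j) s) \<le> K * \<bar>Im s\<bar> powr (1/100)"
    using dseries_a_growth by blast
  obtain c where c: "c > 0" "\<And>t M. M \<ge> 1 \<Longrightarrow>
     (\<forall>\<sigma>. 1 < \<sigma> \<longrightarrow> \<sigma> \<le> 2 \<longrightarrow> norm (dseries a (Complex \<sigma> (2 * t))) \<le> M \<and>
        norm (dseries (\<lambda>n. a n * ln (real n)) (Complex \<sigma> t)) \<le> M) \<Longrightarrow>
     (\<forall>\<sigma>. 1 < \<sigma> \<longrightarrow> \<sigma> \<le> 2 \<longrightarrow> c / M ^ 4 \<le> norm (dseries a (Complex \<sigma> t)))"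
    using dseries_a_lower by blast
  define c' where "c' = min c 1"
  have c': "c' > 0" "c' \<le> 1" "c' \<le> c" using c(1) by (auto simp: c'_def)
  define K' where "K' = 6 * ((2 * K) ^ 5 / c') ^ 3 + 1 / \<rho> * (2 * K)"
  have "norm (dseries bcoef s) \<le> K' * \<bar>Im s\<bar> powr (1/2)"
    if s: "1 < Re s" "Re s \<le> 2" "\<bar>Im s\<bar> \<ge> 2" for s
  proof -
    define t where "t = Im s"
    define u where "u = \<bar>t\<bar> powr (1/100)"
    define M where "M = 2 * K * u"
    have t: "\<bar>t\<bar> \<ge> 2" using s by (simp add: t_def)
    have u: "u \<ge> 1" unfolding u_def using t by (intro ge_one_powr_ge_zero) auto
    have "1 * 1 \<le> (2 * K) * u" using u K(1) by (intro mult_mono) auto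
    then have M: "M \<ge> 1" by (simp add: M_def)
    have DM: "norm (dseries (\<lambda>n. a n * ln (real n) ^ j) (Complex \<sigma> t)) \<le> M" if "j \<le> 3" "1 < \<sigma>" "\<sigma> \<le> 2" for j \<sigma>
    proof -
      have "norm (dseries (\<lambda>n. a n * ln (real n) ^ j) (Complex \<sigma> t)) \<le> K * u"
        using K(2)[of j "Complex \<sigma> t"] that t by (simp add: u_def)
      also have "\<dots> \<le> M" using K(1) u by (simp add: M_def)
      finally show ?thesis .
    qed
    have "norm (dseries a (Complex \<sigma> (2 * t))) \<le> M" if "1 < \<sigma>" "\<sigma> \<le> 2" for \<sigma>
    proof -
      have "norm (dseries a (Complex \<sigma> (2 * t))) \<le> K * \<bar>2 * t\<bar> powr (1/100)"
        using K(2)[of 0 "Complex \<sigma> (2 * t)"] that t by simp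
      also have "\<bar>2 * t\<bar> powr (1/100) = 2 powr (1/100) * u" by (simp add: u_def powr_mult abs_mult)
      also have "K * (2 powr (1/100) * u) \<le> K * (2 powr 1 * u)"
        using K(1) u by (intro mult_left_mono mult_right_mono powr_mono) auto
      also have "\<dots> = M" by (simp add: M_def)
      finally show ?thesis .
    qed
    moreover have "norm (dseries (\<lambda>n. a n * ln (real n)) (Complex \<sigma> t)) \<le> M" if "1 < \<sigma>" "\<sigma> \<le> 2" for \<sigma>
      using DM[of 1 \<sigma>] that by simp
    ultimately have low: "c / M ^ 4 \<le> norm (dseries a (Complex \<sigma> t))" if "1 < \<sigma>" "\<sigma> \<le> 2" for \<sigma>
      using c(2)[OF M, of t] that by blast
    have s_eq: "Complex (Re s) t = s" by (simp add: t_def)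
    have Ds: "norm (dseries (\<lambda>n. a n * ln (real n) ^ j) s) \<le> M" if "j \<le> 3" for j
      using DM[OF that s(1,2)] unfolding s_eq .
    have m: "c' / M ^ 4 > 0" "c' / M ^ 4 \<le> 1" "c' / M ^ 4 \<le> norm (dseries a s)"
    proof -
      show "c' / M ^ 4 > 0" using c' M by simp
      have "M ^ 4 \<ge> 1" using M by simp
      then have "c' \<le> 1 * M ^ 4" using c' by linarith
      then show "c' / M ^ 4 \<le> 1" using M by (subst pos_divide_le_eq) auto
      have "c' / M ^ 4 \<le> c / M ^ 4" using c' M by (intro divide_right_mono) auto
      then show "c' / M ^ 4 \<le> norm (dseries a s)" using low[OF s(1,2)] unfolding s_eq by simp
    qed
    have "norm (dseries (\<lambda>n. lam n * ln (real n) ^ 2) s) \<le> 6 * (M / (c' / M ^ 4)) ^ 3"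
      by (rule quotient_bounds[OF dseries_lam_log_identities[OF s(1)] m(1,2) _ M])
        (use m(3) Ds[of 1] Ds[of 2] Ds[of 3] in auto)
    also have "M / (c' / M ^ 4) = (2 * K) ^ 5 / c' * u ^ 5"
      by (simp add: M_def power_mult_distrib eval_nat_numeral)
    also have "6 * ((2 * K) ^ 5 / c' * u ^ 5) ^ 3 = 6 * ((2 * K) ^ 5 / c') ^ 3 * u ^ 15"
    proof -
      have "(X * u ^ 5) ^ 3 = X ^ 3 * u ^ 15" for X :: real by (simp add: power_mult_distrib flip: power_mult)
      then show ?thesis by (simp only: mult.assoc)
    qed
    finally have L: "norm (dseries (\<lambda>n. lam n * ln (real n) ^ 2) s) \<le> 6 * ((2 * K) ^ 5 / c') ^ 3 * u ^ 15" .
    have "norm (of_real (1 / \<rho>) * dseries (\<lambda>n. a n * ln (real n) ^ 2) s) \<le> 1 / \<rho> * M"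
      unfolding norm_mult norm_of_real using rho_pos Ds[of 2] by (intro mult_mono) auto
    also have "\<dots> \<le> 1 / \<rho> * (2 * K) * u ^ 15"
    proof -
      have "u \<le> u ^ 15" using u power_increasing[of 1 15 u] by simp
      then show ?thesis using K(1) rho_pos by (simp add: M_def divide_right_mono mult_left_mono)
    qed
    finally have D: "norm (of_real (1 / \<rho>) * dseries (\<lambda>n. a n * ln (real n) ^ 2) s) \<le> 1 / \<rho> * (2 * K) * u ^ 15" .
    have "norm (dseries bcoef s) \<le> 6 * ((2 * K) ^ 5 / c') ^ 3 * u ^ 15 + 1 / \<rho> * (2 * K) * u ^ 15"
      unfolding dseries_bcoef[OF s(1)] using L D norm_triangle_ineq4 order_trans add_mono by meson
    also have "\<dots> = K' * u ^ 15" by (simp add: K'_def algebra_simps)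
    also have "\<dots> \<le> K' * \<bar>t\<bar> powr (1/2)"
    proof (intro mult_left_mono)
      have "u ^ 15 = \<bar>t\<bar> powr (15/100)" using t by (simp add: u_def powr_powr flip: powr_realpow)
      also have "\<dots> \<le> \<bar>t\<bar> powr (1/2)" using t by (intro powr_mono) auto
      finally show "u ^ 15 \<le> \<bar>t\<bar> powr (1/2)" .
      show "K' \<ge> 0" using K(1) c' rho_pos by (auto simp: K'_def intro!: add_nonneg_nonneg mult_nonneg_nonneg)
    qed
    finally show ?thesis by (simp add: t_def)
  qed
  then show ?thesis by blast
qed

text \<open>Near the real axis the poles have to cancel. The series of \<open>lam\<close> is
  \<open>1 / (s - 1) - G' / G\<close>, and the series of \<open>a\<close> is
  \<open>\<rho> / (s - 1) + h\<close> with the difference quotient \<open>h\<close> of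
  \<open>G\<close> at 1. So \<open>E\<close> continues the series of \<open>lam - a / \<rho>\<close>
  to a neighbourhood of the compact box \<open>Q\<close>, where its second derivative is
  bounded.\<close>

lemma dseries_bcoef_near:
  "\<exists>K. \<forall>s. 1 < Re s \<longrightarrow> Re s \<le> 2 \<longrightarrow> \<bar>Im s\<bar> \<le> 2 \<longrightarrow> norm (dseries bcoef s) \<le> K"
proof -
  let ?S = "{s::complex. Re s > 1/2}"
  define U where "U = {s \<in> ?S. G s \<noteq> 0}"
  have opS: "open ?S" by (rule open_Re_gt)
  have U: "open U"
  proof -
    have "open (?S \<inter> G -` (- {0}))"
      using holomorphic_on_imp_continuous_on[OF holomorphic_G] opS
      by (rule continuous_open_preimage) auto
    moreover have "?S \<inter> G -` (- {0}) = U" by (auto simp: U_def)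
    ultimately show ?thesis by simp
  qed
  define h where "h = (\<lambda>z. if z = 1 then deriv G 1 else (G z - G 1) / (z - 1))"
  define E where "E = (\<lambda>s. - (deriv G s / G s) - of_real (1 / \<rho>) * h s)"
  have h: "h holomorphic_on ?S" unfolding h_def by (rule pole_lemma_open[OF holomorphic_G opS])
  have US: "U \<subseteq> ?S" by (auto simp: U_def)
  have E: "E holomorphic_on U" unfolding E_def
    by (intro holomorphic_intros holomorphic_on_subset[OF h US] holomorphic_on_subset[OF holomorphic_G US]
        holomorphic_on_subset[OF holomorphic_deriv[OF holomorphic_G opS] US]) (auto simp: U_def)
  have E_eq: "E s = dseries (\<lambda>n. lam n - 1 / \<rho> * a n) s" if s: "Re s > 1" for s
  proof -
    have s1: "s - 1 \<noteq> 0" using s by auto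
    let ?D = "dseries a s" and ?D1 = "dseries (\<lambda>n. a n * ln (real n)) s"
    have "((\<lambda>s. (s - 1) * dseries a s) has_field_derivative (1 - 0) * ?D + (- ?D1) * (s - 1)) (at s)"
      by (intro DERIV_mult DERIV_diff DERIV_ident DERIV_const has_field_derivative_dseries dconv_a s)
    then have "(G has_field_derivative (1 - 0) * ?D + (- ?D1) * (s - 1)) (at s)"
      by (rule has_field_derivative_transform_within_open[OF _ open_Re_gt[of 1]]) (use s G_eq in auto)
    then have dG: "deriv G s = ?D - (s - 1) * ?D1" by (auto dest!: DERIV_imp_deriv simp: algebra_simps)
    have D0: "?D \<noteq> 0" using G_nonzero[of s] G_eq[OF s] s by auto
    have D1: "?D1 = dseries lam s * ?D" using dseries_lam_a[OF s] by simp
    have "deriv G s / G s = 1 / (s - 1) - dseries lam s"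
      unfolding dG D1 G_eq[OF s] using D0 s1 by (simp add: field_simps)
    moreover have "h s = ?D - of_real \<rho> / (s - 1)"
      using s1 by (simp add: h_def G_eq[OF s] G_1 field_simps)
    moreover have "complex_of_real (1 / \<rho>) * (of_real \<rho> / (s - 1)) = 1 / (s - 1)" using rho_pos by simp
    ultimately have "E s = dseries lam s - of_real (1 / \<rho>) * ?D"
      by (simp only: E_def right_diff_distrib) simp
    also have "\<dots> = dseries (\<lambda>n. lam n - 1 / \<rho> * a n) s"
      using s by (simp only: dseries_diff dseries_cmult dconv_cmult dconv_lam dconv_a)
    finally show ?thesis .
  qed
  define Q where "Q = cbox (Complex 1 (-2)) (Complex 2 2)"
  have QU: "Q \<subseteq> U" using G_nonzero by (auto simp: Q_def U_def in_cbox_complex_iff)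
  have "(deriv ^^ 2) E holomorphic_on U" by (rule holomorphic_higher_deriv[OF E U])
  then have "continuous_on Q ((deriv ^^ 2) E)"
    using QU holomorphic_on_imp_continuous_on continuous_on_subset by blast
  then have "bounded ((deriv ^^ 2) E ` Q)"
    by (intro compact_imp_bounded compact_continuous_image) (auto simp: Q_def)
  then obtain K where K: "\<And>w. w \<in> Q \<Longrightarrow> norm ((deriv ^^ 2) E w) \<le> K" by (auto simp: bounded_iff)
  have "norm (dseries bcoef s) \<le> K" if s: "1 < Re s" "Re s \<le> 2" "\<bar>Im s\<bar> \<le> 2" for s
  proof -
    have cv: "dconv (\<lambda>n. lam n - 1 / \<rho> * a n)" by (intro dconv_diff dconv_cmult dconv_lam dconv_a)
    have sub: "{s. Re s > 1} \<subseteq> U" using G_nonzero by (auto simp: U_def)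
    have "(deriv ^^ 2) E s = (deriv ^^ 2) (dseries (\<lambda>n. lam n - 1 / \<rho> * a n)) s"
      by (rule higher_deriv_transform_within_open[OF holomorphic_on_subset[OF E sub] holomorphic_dseries[OF cv] open_Re_gt[of 1]])
        (use s E_eq in auto)
    also have "\<dots> = dseries bcoef s"
      using higher_deriv_dseries[OF cv s(1), of 2] by (simp add: bcoef_def [abs_def])
    finally show ?thesis using K[of s] s by (auto simp: Q_def in_cbox_complex_iff abs_le_iff)
  qed
  then show ?thesis by blast
qed

lemma dseries_bcoef_growth:
  "\<exists>K\<ge>0. \<forall>s. 1 < Re s \<longrightarrow> Re s \<le> 2 \<longrightarrow> norm (dseries bcoef s) \<le> K * (1 + \<bar>Im s\<bar>) powr (1/2)"
proof -
  obtain K1 K2 where K: "\<And>s. 1 < Re s \<Longrightarrow> Re s \<le> 2 \<Longrightarrow> \<bar>Im s\<bar> \<ge> 2 \<Longrightarrow> norm (dseries bcoef s) \<le> K1 * \<bar>Im s\<bar> powr (1/2)"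
    "\<And>s. 1 < Re s \<Longrightarrow> Re s \<le> 2 \<Longrightarrow> \<bar>Im s\<bar> \<le> 2 \<Longrightarrow> norm (dseries bcoef s) \<le> K2"
    using dseries_bcoef_far dseries_bcoef_near by metis
  have "norm (dseries bcoef s) \<le> (\<bar>K1\<bar> + \<bar>K2\<bar>) * (1 + \<bar>Im s\<bar>) powr (1/2)" if s: "1 < Re s" "Re s \<le> 2" for s
  proof -
    have ge1: "(1 + \<bar>Im s\<bar>) powr (1/2) \<ge> 1" by (intro ge_one_powr_ge_zero) auto
    show ?thesis
    proof (cases "\<bar>Im s\<bar> \<ge> 2")
      case True
      have "norm (dseries bcoef s) \<le> K1 * \<bar>Im s\<bar> powr (1/2)" using K(1) s True by blast
      also have "\<dots> \<le> (\<bar>K1\<bar> + \<bar>K2\<bar>) * (1 + \<bar>Im s\<bar>) powr (1/2)" by (intro mult_mono powr_mono2) auto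
      finally show ?thesis .
    next
      case False
      then have "norm (dseries bcoef s) \<le> K2" using K(2) s by simp
      also have "\<dots> \<le> (\<bar>K1\<bar> + \<bar>K2\<bar>) * 1" by simp
      also have "\<dots> \<le> (\<bar>K1\<bar> + \<bar>K2\<bar>) * (1 + \<bar>Im s\<bar>) powr (1/2)" using ge1 by (intro mult_left_mono) auto
      finally show ?thesis .
    qed
  qed
  then show ?thesis by (intro exI[of _ "\<bar>K1\<bar> + \<bar>K2\<bar>"]) auto
qed

end

section \<open>Perron's formula\<close>

lemma norm_minus_add3_le:
  fixes p q r :: "'a::real_normed_vector"
  assumes "norm p \<le> A" "norm q \<le> B" "norm r \<le> C"
  shows "norm (- (p + q + r)) \<le> A + B + C"
  using norm_triangle_ineq[of "p + q" r] norm_triangle_ineq[of p q] assms unfolding norm_minus_cancel by linarith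

lemma contour_integral_rectpath_split:
  assumes cont: "continuous_on (path_image (rectpath a b)) g" and le: "Re a \<le> Re b" "Im a \<le> Im b"
  shows "contour_integral (rectpath a b) g =
     contour_integral (linepath a (Complex (Re b) (Im a))) g +
     contour_integral (linepath (Complex (Re b) (Im a)) b) g +
     contour_integral (linepath b (Complex (Re a) (Im b))) g +
     contour_integral (linepath (Complex (Re a) (Im b)) a) g"
proof -
  define a2 a4 where "a2 = Complex (Re b) (Im a)" and "a4 = Complex (Re a) (Im b)"
  have im: "path_image (rectpath a b) = closed_segment a a2 \<union> closed_segment a2 b \<union> closed_segment b a4 \<union> closed_segment a4 a"
    by (simp add: rectpath_def Let_def path_image_join a2_def a4_def Un_assoc)
  have int: "g contour_integrable_on linepath a a2" "g contour_integrable_on linepath a2 b"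
    "g contour_integrable_on linepath b a4" "g contour_integrable_on linepath a4 a"
    using cont unfolding im by (auto intro!: contour_integrable_continuous_linepath elim: continuous_on_subset)
  show ?thesis
    unfolding rectpath_def Let_def a2_def [symmetric] a4_def [symmetric]
    using int by (simp add: contour_integrable_joinI)
qed

section \<open>The kernel \<open>y^s / (s (s + 1))\<close>\<close>

lemma norm_kernel_le:
  fixes y :: real and s :: complex
  assumes y: "y > 0" and e: "y powr Re s \<le> Y" and s: "norm s \<ge> r" "norm (s + 1) \<ge> r'" and r: "r > 0" "r' > 0"
  shows "norm (of_real y powr s / (s * (s + 1))) \<le> Y / (r * r')"
proof -
  have "norm (of_real y powr s / (s * (s + 1))) = y powr Re s / (norm s * norm (s + 1))"
    using y by (simp add: norm_divide norm_mult norm_powr_real_powr)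
  also have "\<dots> \<le> Y / (r * r')"
    using e s r by (intro frac_le mult_mono) (auto intro: order_trans[OF powr_ge_zero])
  finally show ?thesis .
qed

lemma kernel_continuous: "y > 0 \<Longrightarrow> continuous_on (- {0, -1}) (\<lambda>s. of_real y powr s / (s * (s + 1)) :: complex)"
  by (intro holomorphic_on_imp_continuous_on holomorphic_intros) (auto simp: add_eq_0_iff2)

lemma segment_same_Im: "z \<in> closed_segment (Complex x u) (Complex x' u) \<Longrightarrow> x \<le> x' \<Longrightarrow> Im z = u \<and> x \<le> Re z \<and> Re z \<le> x'"
  by (auto simp: closed_segment_same_Im closed_segment_eq_real_ivl)

lemma segment_same_Re: "z \<in> closed_segment (Complex x u) (Complex x u') \<Longrightarrow> u \<le> u' \<Longrightarrow> Re z = x \<and> u \<le> Im z \<and> Im z \<le> u'"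
  by (auto simp: closed_segment_same_Re closed_segment_eq_real_ivl)

text \<open>For \<open>y >= 1\<close> the contour is closed on the left, where
  \<open>y powr Re s <= y powr \<sigma>\<close>. Writing \<open>1 / (s (s + 1))\<close> as
  \<open>1 / s - 1 / (s + 1)\<close>, Cauchy's formula at 0 and -1 gives \<open>1 - 1 / y\<close>.
  The quadratic decay of the kernel makes the three other sides \<open>O(1 / R)\<close>.\<close>

lemma perron_kernel_ge:
  assumes y: "y \<ge> 1" and \<sigma>: "1 < \<sigma>" "\<sigma> \<le> 2" and R: "R \<ge> 4"
  shows "norm (contour_integral (linepath (Complex \<sigma> (- R)) (Complex \<sigma> R)) (\<lambda>s. of_real y powr s / (s * (s + 1))) -
      2 * of_real pi * \<i> * of_real (1 - 1 / y)) \<le> 8 * y powr \<sigma> / R"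
proof -
  let ?g = "\<lambda>s. of_real y powr s / (s * (s + 1)) :: complex"
  let ?f = "\<lambda>s. of_real y powr s :: complex"
  define a b where "a = Complex (- R) (- R)" and "b = Complex \<sigma> R"
  have le: "Re a \<le> Re b" "Im a \<le> Im b" using R \<sigma> by (auto simp: a_def b_def)
  have y0: "y > 0" using y by simp
  have notin: "0 \<notin> path_image (rectpath a b)" "-1 \<notin> path_image (rectpath a b)"
    using R \<sigma> by (auto simp: path_image_rectpath[OF le], auto simp: a_def b_def)
  have w: "winding_number (rectpath a b) 0 = 1" "winding_number (rectpath a b) (-1) = 1"
    using R \<sigma> by (auto intro!: winding_number_rectpath simp: in_box_complex_iff a_def b_def)
  have hol: "?f holomorphic_on UNIV" by (intro holomorphic_intros)
  have 1: "((\<lambda>s. ?f s / (s - 0)) has_contour_integral (2 * pi * \<i> * winding_number (rectpath a b) 0 * ?f 0)) (rectpath a b)"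
    using notin by (intro Cauchy_integral_formula_convex_simple[OF _ hol]) auto
  have 2: "((\<lambda>s. ?f s / (s - (-1))) has_contour_integral (2 * pi * \<i> * winding_number (rectpath a b) (-1) * ?f (-1))) (rectpath a b)"
    using notin by (intro Cauchy_integral_formula_convex_simple[OF _ hol]) auto
  have "((\<lambda>s. ?f s / (s - 0) - ?f s / (s - (-1))) has_contour_integral
      (2 * pi * \<i> * winding_number (rectpath a b) 0 * ?f 0 - 2 * pi * \<i> * winding_number (rectpath a b) (-1) * ?f (-1))) (rectpath a b)"
    by (rule has_contour_integral_diff[OF 1 2])
  moreover have "?f s / (s - 0) - ?f s / (s - (-1)) = ?g s" if "s \<in> path_image (rectpath a b)" for s
  proof -
    have "s \<noteq> 0" "s + 1 \<noteq> 0" using that notin by (auto simp: add_eq_0_iff2)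
    then show ?thesis by (simp add: field_simps)
  qed
  ultimately have "(?g has_contour_integral
      (2 * pi * \<i> * winding_number (rectpath a b) 0 * ?f 0 - 2 * pi * \<i> * winding_number (rectpath a b) (-1) * ?f (-1))) (rectpath a b)"
    by (rule has_contour_integral_eq)
  moreover have "?f (-1) = of_real (1 / y)" using y0 by (simp add: powr_minus divide_inverse)
  moreover have "?f 0 = 1" using y0 by simp
  ultimately have "contour_integral (rectpath a b) ?g = 2 * pi * \<i> * 1 * 1 - 2 * pi * \<i> * 1 * of_real (1 / y)"
    unfolding w by (simp add: contour_integral_unique)
  then have tot: "contour_integral (rectpath a b) ?g = 2 * of_real pi * \<i> * of_real (1 - 1 / y)"
    by (simp add: algebra_simps)
  have cont: "continuous_on (path_image (rectpath a b)) ?g"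
    using kernel_continuous[OF y0] by (rule continuous_on_subset) (use notin in auto)
  have ybd: "y powr Re s \<le> y powr \<sigma>" if "Re s \<le> \<sigma>" for s using y that by (intro powr_mono) auto
  have im: "closed_segment a (Complex \<sigma> (- R)) \<subseteq> path_image (rectpath a b)"
    "closed_segment b (Complex (- R) R) \<subseteq> path_image (rectpath a b)"
    "closed_segment (Complex (- R) R) a \<subseteq> path_image (rectpath a b)"
    by (auto simp: rectpath_def Let_def path_image_join a_def b_def)
  have hb: "norm (?g s) \<le> y powr \<sigma> / (R * R)" if "\<bar>Im s\<bar> = R" "Re s \<le> \<sigma>" for s
    using R that abs_Im_le_cmod[of s] abs_Im_le_cmod[of "s + 1"] by (intro norm_kernel_le y0 ybd) auto
  have bot: "norm (contour_integral (linepath a (Complex \<sigma> (- R))) ?g) \<le> y powr \<sigma> / (R * R) * norm (Complex \<sigma> (- R) - a)"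
  proof (rule contour_integral_bound_linepath)
    show "?g contour_integrable_on linepath a (Complex \<sigma> (- R))"
      by (rule contour_integrable_continuous_linepath[OF continuous_on_subset[OF cont im(1)]])
    fix s assume "s \<in> closed_segment a (Complex \<sigma> (- R))"
    then have "Im s = - R \<and> - R \<le> Re s \<and> Re s \<le> \<sigma>" unfolding a_def using R \<sigma> by (intro segment_same_Im) auto
    then show "norm (?g s) \<le> y powr \<sigma> / (R * R)" using R by (intro hb) auto
  qed (use R in auto)
  have top: "norm (contour_integral (linepath b (Complex (- R) R)) ?g) \<le> y powr \<sigma> / (R * R) * norm (Complex (- R) R - b)"
  proof (rule contour_integral_bound_linepath)
    show "?g contour_integrable_on linepath b (Complex (- R) R)"
      by (rule contour_integrable_continuous_linepath[OF continuous_on_subset[OF cont im(2)]])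
    fix s assume "s \<in> closed_segment b (Complex (- R) R)"
    then have "s \<in> closed_segment (Complex (- R) R) (Complex \<sigma> R)" by (simp add: b_def closed_segment_commute)
    then have "Im s = R \<and> - R \<le> Re s \<and> Re s \<le> \<sigma>" using R \<sigma> by (intro segment_same_Im) auto
    then show "norm (?g s) \<le> y powr \<sigma> / (R * R)" using R by (intro hb) auto
  qed (use R in auto)
  have left: "norm (contour_integral (linepath (Complex (- R) R) a) ?g) \<le> y powr \<sigma> / (R * (R / 2)) * norm (a - Complex (- R) R)"
  proof (rule contour_integral_bound_linepath)
    show "?g contour_integrable_on linepath (Complex (- R) R) a"
      by (rule contour_integrable_continuous_linepath[OF continuous_on_subset[OF cont im(3)]])
    fix s assume "s \<in> closed_segment (Complex (- R) R) a"
    then have "s \<in> closed_segment (Complex (- R) (- R)) (Complex (- R) R)" by (simp add: a_def closed_segment_commute)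
    then have s: "Re s = - R" using R segment_same_Re by fastforce
    show "norm (?g s) \<le> y powr \<sigma> / (R * (R / 2))"
      using R s \<sigma> abs_Re_le_cmod[of s] abs_Re_le_cmod[of "s + 1"] by (intro norm_kernel_le y0 ybd) auto
  qed (use R in auto)
  have len: "norm (Complex \<sigma> (- R) - a) = \<sigma> + R" "norm (Complex (- R) R - b) = \<sigma> + R" "norm (a - Complex (- R) R) = 2 * R"
    using R \<sigma> by (auto simp: a_def b_def cmod_def real_sqrt_mult)
  define V where "V = y powr \<sigma>"
  have V: "V \<ge> 0" by (simp add: V_def)
  have "V / (R * R) * (\<sigma> + R) \<le> V / (R * R) * (2 * R)" using R \<sigma> V by (intro mult_left_mono) auto
  moreover have "V / (R * R) * (2 * R) = 2 * V / R" using R by (simp add: field_simps)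
  ultimately have *: "V / (R * R) * (\<sigma> + R) \<le> 2 * V / R" by linarith
  have **: "V / (R * (R / 2)) * (2 * R) = 4 * V / R" using R by (simp add: field_simps)
  have "contour_integral (rectpath a b) ?g = contour_integral (linepath a (Complex \<sigma> (- R))) ?g +
     contour_integral (linepath (Complex \<sigma> (- R)) (Complex \<sigma> R)) ?g +
     contour_integral (linepath b (Complex (- R) R)) ?g + contour_integral (linepath (Complex (- R) R) a) ?g"
    using contour_integral_rectpath_split[OF cont le] by (simp add: a_def b_def)
  then have split: "contour_integral (linepath (Complex \<sigma> (- R)) (Complex \<sigma> R)) ?g - 2 * of_real pi * \<i> * of_real (1 - 1 / y) =
     - (contour_integral (linepath a (Complex \<sigma> (- R))) ?g + contour_integral (linepath b (Complex (- R) R)) ?g + contour_integral (linepath (Complex (- R) R) a) ?g)"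
    unfolding tot by (simp add: algebra_simps)
  have "norm (contour_integral (linepath a (Complex \<sigma> (- R))) ?g) \<le> 2 * V / R"
    using bot * unfolding len(1) V_def by (rule order_trans)
  moreover have "norm (contour_integral (linepath b (Complex (- R) R)) ?g) \<le> 2 * V / R"
    using top * unfolding len(2) V_def by (rule order_trans)
  moreover have "norm (contour_integral (linepath (Complex (- R) R) a) ?g) \<le> 4 * V / R"
    using left ** unfolding len(3) V_def by (rule ord_le_eq_trans)
  ultimately have "norm (- (contour_integral (linepath a (Complex \<sigma> (- R))) ?g + contour_integral (linepath b (Complex (- R) R)) ?g + contour_integral (linepath (Complex (- R) R) a) ?g)) \<le> 2 * V / R + 2 * V / R + 4 * V / R"
    by (rule norm_minus_add3_le)
  then show ?thesis unfolding split V_def by (simp add: field_simps)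
qed

text \<open>For \<open>y < 1\<close> the contour is closed on the right, where
  \<open>y powr Re s <= y powr \<sigma>\<close> and the kernel has no pole.\<close>

lemma perron_kernel_less:
  assumes y: "0 < y" "y < 1" and \<sigma>: "1 < \<sigma>" "\<sigma> \<le> 2" and R: "R \<ge> 4"
  shows "norm (contour_integral (linepath (Complex \<sigma> (- R)) (Complex \<sigma> R)) (\<lambda>s. of_real y powr s / (s * (s + 1)))) \<le> 8 * y powr \<sigma> / R"
proof -
  let ?g = "\<lambda>s. of_real y powr s / (s * (s + 1)) :: complex"
  define a b where "a = Complex \<sigma> (- R)" and "b = Complex R R"
  have le: "Re a \<le> Re b" "Im a \<le> Im b" using R \<sigma> by (auto simp: a_def b_def)
  have pos: "path_image (rectpath a b) \<subseteq> {s. Re s > 0}"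
    using R \<sigma> by (auto simp: path_image_rectpath[OF le], auto simp: a_def b_def)
  have hol: "?g holomorphic_on {s. Re s > 0}"
    using y by (intro holomorphic_intros) (auto simp: add_eq_0_iff2)
  have "(?g has_contour_integral 0) (rectpath a b)"
    by (rule Cauchy_theorem_convex_simple[OF hol convex_halfspace_Re_gt _ pos]) auto
  then have tot: "contour_integral (rectpath a b) ?g = 0" by (rule contour_integral_unique)
  have cont: "continuous_on (path_image (rectpath a b)) ?g"
    using holomorphic_on_imp_continuous_on[OF hol] pos by (rule continuous_on_subset)
  have ybd: "y powr Re s \<le> y powr \<sigma>" if "Re s \<ge> \<sigma>" for s using y that by (intro powr_mono') auto
  have im: "closed_segment a (Complex R (- R)) \<subseteq> path_image (rectpath a b)"
    "closed_segment (Complex R (- R)) b \<subseteq> path_image (rectpath a b)"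
    "closed_segment b (Complex \<sigma> R) \<subseteq> path_image (rectpath a b)"
    by (auto simp: rectpath_def Let_def path_image_join a_def b_def)
  have hb: "norm (?g s) \<le> y powr \<sigma> / (R * R)" if "\<bar>Im s\<bar> = R \<or> Re s = R" "Re s \<ge> \<sigma>" for s
    using R that abs_Im_le_cmod[of s] abs_Im_le_cmod[of "s + 1"] abs_Re_le_cmod[of s] abs_Re_le_cmod[of "s + 1"]
    by (intro norm_kernel_le y(1) ybd) auto
  have bot: "norm (contour_integral (linepath a (Complex R (- R))) ?g) \<le> y powr \<sigma> / (R * R) * norm (Complex R (- R) - a)"
  proof (rule contour_integral_bound_linepath)
    show "?g contour_integrable_on linepath a (Complex R (- R))"
      by (rule contour_integrable_continuous_linepath[OF continuous_on_subset[OF cont im(1)]])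
    fix s assume "s \<in> closed_segment a (Complex R (- R))"
    then have "Im s = - R \<and> \<sigma> \<le> Re s \<and> Re s \<le> R" unfolding a_def using R \<sigma> by (intro segment_same_Im) auto
    then show "norm (?g s) \<le> y powr \<sigma> / (R * R)" using R by (intro hb) auto
  qed (use R in auto)
  have right: "norm (contour_integral (linepath (Complex R (- R)) b) ?g) \<le> y powr \<sigma> / (R * R) * norm (b - Complex R (- R))"
  proof (rule contour_integral_bound_linepath)
    show "?g contour_integrable_on linepath (Complex R (- R)) b"
      by (rule contour_integrable_continuous_linepath[OF continuous_on_subset[OF cont im(2)]])
    fix s assume "s \<in> closed_segment (Complex R (- R)) b"
    then have "Re s = R" unfolding b_def using R segment_same_Re by fastforce
    then show "norm (?g s) \<le> y powr \<sigma> / (R * R)" using R \<sigma> by (intro hb) auto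
  qed (use R in auto)
  have top: "norm (contour_integral (linepath b (Complex \<sigma> R)) ?g) \<le> y powr \<sigma> / (R * R) * norm (Complex \<sigma> R - b)"
  proof (rule contour_integral_bound_linepath)
    show "?g contour_integrable_on linepath b (Complex \<sigma> R)"
      by (rule contour_integrable_continuous_linepath[OF continuous_on_subset[OF cont im(3)]])
    fix s assume "s \<in> closed_segment b (Complex \<sigma> R)"
    then have "s \<in> closed_segment (Complex \<sigma> R) (Complex R R)" by (simp add: b_def closed_segment_commute)
    then have "Im s = R \<and> \<sigma> \<le> Re s \<and> Re s \<le> R" using R \<sigma> by (intro segment_same_Im) auto
    then show "norm (?g s) \<le> y powr \<sigma> / (R * R)" using R by (intro hb) auto
  qed (use R in auto)
  have len: "norm (Complex R (- R) - a) = R - \<sigma>" "norm (Complex \<sigma> R - b) = R - \<sigma>" "norm (b - Complex R (- R)) = 2 * R"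
    using R \<sigma> by (auto simp: a_def b_def cmod_def real_sqrt_mult)
  define V where "V = y powr \<sigma>"
  have V: "V \<ge> 0" by (simp add: V_def)
  have "V / (R * R) * (R - \<sigma>) \<le> V / (R * R) * (2 * R)" using R \<sigma> V by (intro mult_left_mono) auto
  moreover have "V / (R * R) * (2 * R) = 2 * V / R" using R by (simp add: field_simps)
  ultimately have *: "V / (R * R) * (R - \<sigma>) \<le> 2 * V / R" by linarith
  have **: "V / (R * R) * (2 * R) = 2 * V / R" using R by (simp add: field_simps)
  have "contour_integral (rectpath a b) ?g = contour_integral (linepath a (Complex R (- R))) ?g +
     contour_integral (linepath (Complex R (- R)) b) ?g +
     contour_integral (linepath b (Complex \<sigma> R)) ?g + contour_integral (linepath (Complex \<sigma> R) (Complex \<sigma> (- R))) ?g"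
    using contour_integral_rectpath_split[OF cont le] by (simp add: a_def b_def)
  moreover have "contour_integral (linepath (Complex \<sigma> R) (Complex \<sigma> (- R))) ?g = - contour_integral (linepath (Complex \<sigma> (- R)) (Complex \<sigma> R)) ?g"
    using contour_integral_reversepath[of "linepath (Complex \<sigma> (- R)) (Complex \<sigma> R)" ?g] by simp
  ultimately have split: "contour_integral (linepath (Complex \<sigma> (- R)) (Complex \<sigma> R)) ?g =
     contour_integral (linepath a (Complex R (- R))) ?g + contour_integral (linepath (Complex R (- R)) b) ?g + contour_integral (linepath b (Complex \<sigma> R)) ?g"
    unfolding tot by (simp add: algebra_simps)
  have "norm (contour_integral (linepath a (Complex R (- R))) ?g) \<le> 2 * V / R"
    using bot * unfolding len(1) V_def by (rule order_trans)
  moreover have "norm (contour_integral (linepath (Complex R (- R)) b) ?g) \<le> 2 * V / R"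
    using right ** unfolding len(3) V_def by (rule ord_le_eq_trans)
  moreover have "norm (contour_integral (linepath b (Complex \<sigma> R)) ?g) \<le> 2 * V / R"
    using top * unfolding len(2) V_def by (rule order_trans)
  ultimately have "norm (- (contour_integral (linepath a (Complex R (- R))) ?g + contour_integral (linepath (Complex R (- R)) b) ?g + contour_integral (linepath b (Complex \<sigma> R)) ?g)) \<le> 2 * V / R + 2 * V / R + 2 * V / R"
    by (rule norm_minus_add3_le)
  then have "norm (contour_integral (linepath (Complex \<sigma> (- R)) (Complex \<sigma> R)) ?g) \<le> 2 * V / R + 2 * V / R + 2 * V / R"
    unfolding split norm_minus_cancel .
  moreover have "V / R \<ge> 0" using V R by simp
  ultimately show ?thesis unfolding V_def [symmetric] by simp
qed

lemma perron_kernel: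
  assumes y: "0 < y" and \<sigma>: "1 < \<sigma>" "\<sigma> \<le> 2" and R: "R \<ge> 4"
  shows "norm (contour_integral (linepath (Complex \<sigma> (- R)) (Complex \<sigma> R)) (\<lambda>s. of_real y powr s / (s * (s + 1))) -
      2 * of_real pi * \<i> * of_real (max 0 (1 - 1 / y))) \<le> 8 * y powr \<sigma> / R"
proof (cases "y \<ge> 1")
  case True
  then have "max 0 (1 - 1 / y) = 1 - 1 / y" by simp
  then show ?thesis using perron_kernel_ge[OF True \<sigma> R] by simp
next
  case False
  then have "max 0 (1 - 1 / y) = 0" using y by (simp add: field_simps)
  then show ?thesis using perron_kernel_less[OF y _ \<sigma> R] False by simp
qed

section \<open>The prime ideal theorem\<close>

text \<open>Split at 0, where the absolute value has a corner; the total stays below 4 for all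
  \<open>R\<close>.\<close>

lemma has_integral_powr_tail:
  fixes R :: real assumes R: "R > 0"
  shows "((\<lambda>t. (1 + \<bar>t\<bar>) powr (- (3/2))) has_integral (4 - 4 * (1 + R) powr (- (1/2)))) {- R..R}"
proof -
  have 1: "((\<lambda>t. (1 + \<bar>t\<bar>) powr (- (3/2))) has_integral (- 2 * (1 + R) powr (- (1/2)) - (- 2 * (1 + 0) powr (- (1/2))))) {0..R}"
  proof (rule fundamental_theorem_of_calculus)
    fix t assume t: "t \<in> {0..R}"
    then have "((\<lambda>t. - 2 * (1 + t) powr (- (1/2))) has_real_derivative - 2 * ((- (1/2)) * (1 + t) powr (- (1/2) - 1) * 1)) (at t)"
      by (auto intro!: derivative_eq_intros)
    moreover have "- (1/2) - 1 = (- (3/2) :: real)" by simp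
    ultimately show "((\<lambda>t. - 2 * (1 + t) powr (- (1/2))) has_vector_derivative (1 + \<bar>t\<bar>) powr (- (3/2))) (at t within {0..R})"
      using t by (intro has_vector_derivative_at_within[OF iffD1[OF has_real_derivative_iff_has_vector_derivative]]) simp
  qed (use R in auto)
  have 2: "((\<lambda>t. (1 + \<bar>t\<bar>) powr (- (3/2))) has_integral (2 * (1 - 0) powr (- (1/2)) - 2 * (1 - (- R)) powr (- (1/2)))) {- R..0}"
  proof (rule fundamental_theorem_of_calculus)
    fix t assume t: "t \<in> {- R..0}"
    then have "((\<lambda>t. 2 * (1 - t) powr (- (1/2))) has_real_derivative 2 * ((- (1/2)) * (1 - t) powr (- (1/2) - 1) * (- 1))) (at t)"
      by (auto intro!: derivative_eq_intros)
    moreover have "- (1/2) - 1 = (- (3/2) :: real)" by simp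
    ultimately show "((\<lambda>t. 2 * (1 - t) powr (- (1/2))) has_vector_derivative (1 + \<bar>t\<bar>) powr (- (3/2))) (at t within {- R..0})"
      using t by (intro has_vector_derivative_at_within[OF iffD1[OF has_real_derivative_iff_has_vector_derivative]]) simp
  qed (use R in auto)
  show ?thesis using has_integral_combine[OF _ _ 2 1] R by simp
qed

lemma powr_quotient:
  assumes "x > 0" "n > 0"
  shows "(of_real (x / real n) :: complex) powr s = of_real x powr s * of_nat n powr (- s)"
proof -
  have "x / real n > 0" using assms by simp
  then have "(of_real (x / real n) :: complex) powr s = exp (s * of_real (ln (x / real n)))"
    using Ln_of_real[of "x / real n"] assms by (simp add: powr_def del: of_real_divide)
  also have "ln (x / real n) = ln x - ln (real n)" using assms by (simp add: ln_div)
  also have "exp (s * of_real (ln x - ln (real n))) = exp (s * of_real (ln x)) * exp (- s * of_real (ln (real n)))"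
    by (simp add: algebra_simps flip: exp_add)
  also have "exp (s * of_real (ln x)) = of_real x powr s" using assms Ln_of_real[of x] by (simp add: powr_def)
  also have "exp (- s * of_real (ln (real n))) = of_nat n powr (- s)" using assms Ln_of_real[of "real n"] by (simp add: powr_def)
  finally show ?thesis .
qed

text \<open>Uniform convergence on the finite segment permits termwise integration; the kernel at
  \<open>y = X / n\<close> produces the weight \<open>1 - n / X\<close> for \<open>n <= X\<close>
  and 0 beyond. The error of the \<open>n\<close>-th term carries
  \<open>n powr (- \<sigma>)\<close>, so the errors are summable and vanish as \<open>R\<close>
  grows.\<close>

lemma perron_series:
  assumes b: "dconv b" and \<sigma>: "1 < \<sigma>" "\<sigma> \<le> 2" and R: "R \<ge> 4" and X: "X \<ge> (1::nat)"
  shows "norm (contour_integral (linepath (Complex \<sigma> (- R)) (Complex \<sigma> R))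
            (\<lambda>s. dseries b s * (of_real (real X) powr s / (s * (s + 1)))) -
          2 * of_real pi * \<i> * of_real (\<Sum>n=1..X. b n * (1 - real n / real X))) \<le>
        8 * real X powr \<sigma> * (\<Sum>n. \<bar>b n\<bar> * real n powr (- \<sigma>)) / R"
proof -
  define \<gamma> where "\<gamma> = linepath (Complex \<sigma> (- R)) (Complex \<sigma> R)"
  define x where "x = real X"
  define k where "k = (\<lambda>s::complex. of_real x powr s / (s * (s + 1)))"
  define f where "f = (\<lambda>n s. dterm b s n * k s)"
  define J where "J = (\<lambda>n::nat. contour_integral \<gamma> (\<lambda>s. of_real (x / real n) powr s / (s * (s + 1))))"
  define Kb where "Kb = (\<Sum>n. \<bar>b n\<bar> * real n powr (- \<sigma>))"
  have x: "x > 0" using X by (simp add: x_def)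
  have pi\<gamma>: "path_image \<gamma> = closed_segment (Complex \<sigma> (- R)) (Complex \<sigma> R)" by (simp add: \<gamma>_def)
  have Re: "Re s = \<sigma>" if "s \<in> path_image \<gamma>" for s
    using that segment_same_Re[of s \<sigma> "- R" R] R unfolding pi\<gamma> by auto
  have sumb: "summable (\<lambda>n. \<bar>b n\<bar> * real n powr (- \<sigma>))" using b \<sigma> unfolding dconv_def by blast
  have knorm: "norm (k s) \<le> x powr \<sigma>" if "s \<in> path_image \<gamma>" for s
  proof -
    have "norm s \<ge> 1" "norm (s + 1) \<ge> 1"
      using Re[OF that] \<sigma> abs_Re_le_cmod[of s] abs_Re_le_cmod[of "s + 1"] by auto
    then show ?thesis using norm_kernel_le[of x s "x powr \<sigma>" 1 1] x Re[OF that] by (simp add: k_def)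
  qed
  have ul: "uniform_limit (path_image \<gamma>) (\<lambda>N s. \<Sum>n<N. f n s) (\<lambda>s. \<Sum>n. f n s) sequentially"
  proof (rule Weierstrass_m_test)
    show "summable (\<lambda>n. \<bar>b n\<bar> * real n powr (- \<sigma>) * x powr \<sigma>)" by (rule summable_mult2[OF sumb])
    fix n s assume "s \<in> path_image \<gamma>"
    then show "norm (f n s) \<le> \<bar>b n\<bar> * real n powr (- \<sigma>) * x powr \<sigma>"
      using knorm Re by (simp add: f_def norm_mult norm_dterm mult_left_mono)
  qed
  have ker_int: "(\<lambda>s. of_real y powr s / (s * (s + 1))) contour_integrable_on \<gamma>" if "y > 0" for y :: real
    unfolding \<gamma>_def
  proof (rule contour_integrable_continuous_linepath[OF continuous_on_subset[OF kernel_continuous[OF that]]])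
    show "closed_segment (Complex \<sigma> (- R)) (Complex \<sigma> R) \<subseteq> - {0, - 1}"
      using Re \<sigma> unfolding pi\<gamma> by force
  qed
  have f_eq: "f n = (\<lambda>s. of_real (b n) * (of_real (x / real n) powr s / (s * (s + 1))))" if "n > 0" for n
    unfolding f_def k_def dterm_def powr_quotient[OF x that] by (simp add: fun_eq_iff)
  have f0: "f 0 = (\<lambda>s. 0)" by (simp add: f_def dterm_def)
  have f_int: "f n contour_integrable_on \<gamma>" for n
  proof (cases "n = 0")
    case False
    then have n: "n > 0" by simp
    show ?thesis unfolding f_eq[OF n] using n x by (intro contour_integrable_lmul ker_int) simp
  qed (auto simp: f0 contour_integrable_on_def intro: has_contour_integral_0)
  have f_val: "contour_integral \<gamma> (f n) = of_real (b n) * J n" if "n > 0" for n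
    unfolding f_eq[OF that] J_def using that x by (intro contour_integral_lmul ker_int) simp
  have f_val0: "contour_integral \<gamma> (f 0) = 0" by (simp add: f0)
  have lim: "(\<lambda>N. contour_integral \<gamma> (\<lambda>s. \<Sum>n<N. f n s)) \<longlonglongrightarrow> contour_integral \<gamma> (\<lambda>s. \<Sum>n. f n s)"
  proof (rule contour_integral_uniform_limit(2)[OF _ ul])
    show "\<forall>\<^sub>F N in sequentially. (\<lambda>s. \<Sum>n<N. f n s) contour_integrable_on \<gamma>"
      by (intro always_eventually allI contour_integrable_sum) (auto simp: f_int)
    show "norm (vector_derivative \<gamma> (at t)) \<le> norm (Complex \<sigma> R - Complex \<sigma> (- R))" for t
      by (simp add: \<gamma>_def)
  qed (auto simp: \<gamma>_def)
  have sum_eq: "contour_integral \<gamma> (\<lambda>s. \<Sum>n<N. f n s) = (\<Sum>n<N. contour_integral \<gamma> (f n))" for N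
    by (rule contour_integral_sum) (auto simp: f_int)
  define S where "S = (\<Sum>n=1..X. b n * (1 - real n / real X))"
  have bound: "norm ((\<Sum>n<N. contour_integral \<gamma> (f n)) - 2 * of_real pi * \<i> * of_real S) \<le> 8 * x powr \<sigma> * Kb / R" if N: "N > X" for N
  proof -
    define m where "m = (\<lambda>n::nat. if n = 0 then 0 else b n * max 0 (1 - 1 / (x / real n)))"
    have "(\<Sum>n<N. m n) = (\<Sum>n=1..X. m n)"
    proof (rule sum.mono_neutral_right)
      show "\<forall>n\<in>{..<N} - {1..X}. m n = 0"
      proof
        fix n assume "n \<in> {..<N} - {1..X}"
        then have "n = 0 \<or> n > X" by auto
        then show "m n = 0" using X by (auto simp: m_def x_def field_simps)
      qed
    qed (use N in auto)
    also have "\<dots> = S" unfolding S_def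
    proof (rule sum.cong)
      fix n assume "n \<in> {1..X}"
      then show "m n = b n * (1 - real n / real X)" by (simp add: m_def x_def)
    qed simp
    finally have S: "S = (\<Sum>n<N. m n)" by simp
    have "(\<Sum>n<N. contour_integral \<gamma> (f n)) - 2 * of_real pi * \<i> * of_real S =
        (\<Sum>n<N. contour_integral \<gamma> (f n) - 2 * of_real pi * \<i> * of_real (m n))"
      unfolding S by (simp add: sum_subtractf sum_distrib_left)
    also have "norm \<dots> \<le> (\<Sum>n<N. 8 * x powr \<sigma> / R * (\<bar>b n\<bar> * real n powr (- \<sigma>)))"
    proof (rule sum_norm_le)
      fix n assume "n \<in> {..<N}"
      show "norm (contour_integral \<gamma> (f n) - 2 * of_real pi * \<i> * of_real (m n)) \<le> 8 * x powr \<sigma> / R * (\<bar>b n\<bar> * real n powr (- \<sigma>))"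
      proof (cases "n = 0")
        case False
        then have n: "n > 0" by simp
        have "contour_integral \<gamma> (f n) - 2 * of_real pi * \<i> * of_real (m n) =
            of_real (b n) * (J n - 2 * of_real pi * \<i> * of_real (max 0 (1 - 1 / (x / real n))))"
          unfolding f_val[OF n] m_def using n by (simp add: algebra_simps)
        also have "norm \<dots> = \<bar>b n\<bar> * norm (J n - 2 * of_real pi * \<i> * of_real (max 0 (1 - 1 / (x / real n))))"
          by (simp only: norm_mult norm_of_real)
        also have "\<dots> \<le> \<bar>b n\<bar> * (8 * (x / real n) powr \<sigma> / R)"
          unfolding J_def \<gamma>_def using n x by (intro mult_left_mono perron_kernel \<sigma> R) auto
        also have "(x / real n) powr \<sigma> = x powr \<sigma> * real n powr (- \<sigma>)"
          using x n by (subst powr_divide) (auto simp: powr_minus divide_inverse)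
        finally show ?thesis by (simp add: mult_ac)
      qed (simp add: f_val0 m_def)
    qed
    also have "\<dots> = 8 * x powr \<sigma> / R * (\<Sum>n<N. \<bar>b n\<bar> * real n powr (- \<sigma>))" by (simp add: sum_distrib_left)
    also have "\<dots> \<le> 8 * x powr \<sigma> / R * Kb" unfolding Kb_def using R sumb
      by (intro mult_left_mono sum_le_suminf) auto
    finally show ?thesis by simp
  qed
  have "(\<lambda>N. (\<Sum>n<N. contour_integral \<gamma> (f n)) - 2 * of_real pi * \<i> * of_real S) \<longlonglongrightarrow>
      contour_integral \<gamma> (\<lambda>s. \<Sum>n. f n s) - 2 * of_real pi * \<i> * of_real S"
    using lim unfolding sum_eq by (intro tendsto_intros)
  then have "norm (contour_integral \<gamma> (\<lambda>s. \<Sum>n. f n s) - 2 * of_real pi * \<i> * of_real S) \<le> 8 * x powr \<sigma> * Kb / R"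
    by (rule Lim_norm_ubound[rotated]) (auto intro!: eventually_sequentiallyI[of "Suc X"] bound)
  moreover have "contour_integral \<gamma> (\<lambda>s. \<Sum>n. f n s) = contour_integral \<gamma> (\<lambda>s. dseries b s * k s)"
  proof (rule contour_integral_eq)
    fix s assume "s \<in> path_image \<gamma>"
    then have "summable (dterm b s)" using Re \<sigma> by (intro dconv_summable b) auto
    then show "(\<Sum>n. f n s) = dseries b s * k s" unfolding f_def dseries_def by (rule suminf_mult2 [symmetric])
  qed
  ultimately show ?thesis unfolding S_def k_def Kb_def x_def \<gamma>_def by simp
qed

text \<open>Growth of order \<open>(1 + |t|)^(1/2)\<close> against a kernel of size at most
  \<open>4 x^\<sigma> / (1 + |t|)^2\<close> leaves the integrable \<open>(1 + |t|)^(-3/2)\<close>,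
  whose integral is at most 4. The bound is uniform in \<open>R\<close> and depends on
  \<open>\<sigma>\<close> only through \<open>x powr \<sigma>\<close>.\<close>

lemma perron_integral_bound:
  assumes b: "dconv b" and F: "\<And>s. 1 < Re s \<Longrightarrow> Re s \<le> 2 \<Longrightarrow> norm (dseries b s) \<le> K * (1 + \<bar>Im s\<bar>) powr (1/2)"
    and \<sigma>: "1 < \<sigma>" "\<sigma> \<le> 2" and R: "R \<ge> 4" and x: "x > 0" and K: "K \<ge> 0"
  shows "norm (contour_integral (linepath (Complex \<sigma> (- R)) (Complex \<sigma> R))
            (\<lambda>s. dseries b s * (of_real x powr s / (s * (s + 1))))) \<le> 16 * K * x powr \<sigma>"
proof -
  let ?g = "\<lambda>s. dseries b s * (of_real x powr s / (s * (s + 1)))"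
  let ?h = "\<lambda>t. 4 * K * x powr \<sigma> * (1 + \<bar>t\<bar>) powr (- (3/2))"
  have "contour_integral (linepath (Complex \<sigma> (- R)) (Complex \<sigma> R)) ?g = \<i> * integral {- R..R} (\<lambda>t. ?g (Complex \<sigma> t))"
    using R by (intro contour_integral_linepath_same_Re) auto
  then have "norm (contour_integral (linepath (Complex \<sigma> (- R)) (Complex \<sigma> R)) ?g) = norm (integral {- R..R} (\<lambda>t. ?g (Complex \<sigma> t)))"
    by (simp add: norm_mult)
  also have "\<dots> \<le> integral {- R..R} ?h"
  proof (rule integral_norm_bound_integral)
    have "?g holomorphic_on {s. Re s > 1}"
      using x by (intro holomorphic_intros holomorphic_dseries b) (auto simp: add_eq_0_iff2)
    then have "continuous_on {s. Re s > 1} ?g" by (rule holomorphic_on_imp_continuous_on)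
    moreover have "continuous_on {- R..R} (\<lambda>t. Complex \<sigma> t)" unfolding Complex_eq by (intro continuous_intros)
    ultimately have "continuous_on {- R..R} (\<lambda>t. ?g (Complex \<sigma> t))"
      by (rule continuous_on_compose2) (use \<sigma> in auto)
    then show "(\<lambda>t. ?g (Complex \<sigma> t)) integrable_on {- R..R}" by (rule integrable_continuous_real)
    show "?h integrable_on {- R..R}"
      using has_integral_mult_right[OF has_integral_powr_tail[of R]] R by (auto simp: integrable_on_def)
    fix t assume "t \<in> {- R..R}"
    define s where "s = Complex \<sigma> t"
    have low: "norm s \<ge> (1 + \<bar>t\<bar>) / 2" "norm (s + 1) \<ge> (1 + \<bar>t\<bar>) / 2"
      using \<sigma> abs_Re_le_cmod[of s] abs_Re_le_cmod[of "s + 1"] abs_Im_le_cmod[of s] abs_Im_le_cmod[of "s + 1"]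
      by (auto simp: s_def)
    have "norm (?g s) \<le> (K * (1 + \<bar>t\<bar>) powr (1/2)) * (x powr \<sigma> / ((1 + \<bar>t\<bar>) / 2 * ((1 + \<bar>t\<bar>) / 2)))"
      unfolding norm_mult using F[of s] \<sigma> x low K
      by (intro mult_mono norm_kernel_le) (auto simp: s_def)
    also have "\<dots> = 4 * K * x powr \<sigma> * ((1 + \<bar>t\<bar>) powr (1/2) / (1 + \<bar>t\<bar>)\<^sup>2)"
      by (simp add: power2_eq_square field_simps)
    also have "(1 + \<bar>t\<bar>) powr (1/2) / (1 + \<bar>t\<bar>)\<^sup>2 = (1 + \<bar>t\<bar>) powr (- (3/2))"
      using powr_diff[of "1 + \<bar>t\<bar>" "1/2" 2] by simp
    finally show "norm (?g (Complex \<sigma> t)) \<le> ?h t" by (simp add: s_def)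
  qed
  also have "\<dots> = 4 * K * x powr \<sigma> * (4 - 4 * (1 + R) powr (- (1/2)))"
    by (rule integral_unique[OF has_integral_mult_right[OF has_integral_powr_tail]]) (use R in auto)
  also have "\<dots> \<le> 4 * K * x powr \<sigma> * 4" using K by (intro mult_left_mono) auto
  finally show ?thesis by simp
qed

text \<open>First \<open>R\<close> tends to infinity for fixed \<open>\<sigma>\<close>, which
  removes the truncation error although \<open>Kb\<close> depends on \<open>\<sigma>\<close>. Then
  \<open>\<sigma>\<close> tends to 1 and \<open>X powr \<sigma>\<close> becomes \<open>X\<close>,
  because \<open>K\<close> is uniform in \<open>\<sigma>\<close>.\<close>

lemma perron_conclusion:
  assumes b: "dconv b" and F: "\<And>s. 1 < Re s \<Longrightarrow> Re s \<le> 2 \<Longrightarrow> norm (dseries b s) \<le> K * (1 + \<bar>Im s\<bar>) powr (1/2)"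
    and K: "K \<ge> 0" and X: "X \<ge> (1::nat)"
  shows "\<bar>\<Sum>n=1..X. b n * (1 - real n / real X)\<bar> \<le> 16 * K * real X"
proof -
  define S where "S = (\<Sum>n=1..X. b n * (1 - real n / real X))"
  have x: "real X > 0" using X by simp
  have "\<bar>S\<bar> \<le> 16 * K * real X powr \<sigma>" if \<sigma>: "1 < \<sigma>" "\<sigma> \<le> 2" for \<sigma>
  proof -
    define Kb where "Kb = (\<Sum>n. \<bar>b n\<bar> * real n powr (- \<sigma>))"
    have "2 * pi * \<bar>S\<bar> \<le> 16 * K * real X powr \<sigma> + 8 * real X powr \<sigma> * Kb / R" if R: "R \<ge> 4" for R
    proof -
      let ?I = "contour_integral (linepath (Complex \<sigma> (- R)) (Complex \<sigma> R)) (\<lambda>s. dseries b s * (of_real (real X) powr s / (s * (s + 1))))"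
      have "norm (2 * of_real pi * \<i> * of_real S) \<le> norm ?I + norm (?I - 2 * of_real pi * \<i> * of_real S)"
        using norm_triangle_ineq4[of ?I "?I - 2 * of_real pi * \<i> * of_real S"] by simp
      also have "norm (2 * of_real pi * \<i> * of_real S) = 2 * pi * \<bar>S\<bar>" by (simp add: norm_mult)
      finally show ?thesis
        using perron_series[OF b \<sigma> R X] perron_integral_bound[OF b F \<sigma> R x K] unfolding S_def Kb_def by linarith
    qed
    then have "2 * pi * \<bar>S\<bar> \<le> 16 * K * real X powr \<sigma> + 8 * real X powr \<sigma> * Kb / real n" if "n \<ge> 4" for n :: nat
      using that by simp
    moreover have "(\<lambda>n. 16 * K * real X powr \<sigma> + 8 * real X powr \<sigma> * Kb / real n) \<longlonglongrightarrow> 16 * K * real X powr \<sigma> + 0"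
      by (intro tendsto_intros lim_const_over_n)
    ultimately have "2 * pi * \<bar>S\<bar> \<le> 16 * K * real X powr \<sigma> + 0"
      by (intro LIMSEQ_le_const) auto
    moreover have "1 * \<bar>S\<bar> \<le> (2 * pi) * \<bar>S\<bar>" using pi_gt3 by (intro mult_right_mono) auto
    ultimately show ?thesis by linarith
  qed
  then have "\<bar>S\<bar> \<le> 16 * K * real X powr (1 + inverse (real (Suc n)))" for n
    by (simp add: inverse_le_1_iff)
  moreover have "(\<lambda>n. 16 * K * real X powr (1 + inverse (real (Suc n)))) \<longlonglongrightarrow> 16 * K * real X powr (1 + 0)"
    using x by (intro tendsto_intros LIMSEQ_inverse_real_of_nat) auto
  ultimately have "\<bar>S\<bar> \<le> 16 * K * real X powr (1 + 0)" by (intro LIMSEQ_le_const) auto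
  then show ?thesis using x by (simp add: S_def)
qed

section \<open>From the smoothed sum to a sharp one\<close>

context zeta_like
begin

definition Psi :: "nat \<Rightarrow> real" where "Psi N = (\<Sum>n=1..N. lam n * (ln (real n))\<^sup>2)"
definition Phi :: "nat \<Rightarrow> real" where "Phi N = (\<Sum>n=1..N. a n / \<rho> * (ln (real n))\<^sup>2)"
text \<open>This is \<open>N\<close> times the smoothed sum of \<open>perron_conclusion\<close>,
  hence \<open>O(N^2)\<close>; its first differences are \<open>Psi - Phi\<close>.\<close>

definition Tsum :: "nat \<Rightarrow> real" where "Tsum N = (\<Sum>n=1..N. bcoef n * (real N - real n))"

lemma Psi_mono: "m \<le> n \<Longrightarrow> Psi m \<le> Psi n"
  unfolding Psi_def using lam_nonneg by (intro sum_mono2) auto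

lemma Phi_mono: "m \<le> n \<Longrightarrow> Phi m \<le> Phi n"
  unfolding Phi_def using a_nonneg rho_pos by (intro sum_mono2) auto

lemma Tsum_Suc: "Tsum (Suc N) = Tsum N + (Psi N - Phi N)"
proof -
  have "Tsum (Suc N) = (\<Sum>n=1..N. bcoef n * (real N - real n) + bcoef n)"
    by (simp add: Tsum_def algebra_simps)
  also have "\<dots> = Tsum N + (\<Sum>n=1..N. bcoef n)" by (simp add: Tsum_def sum.distrib)
  also have "(\<Sum>n=1..N. bcoef n) = Psi N - Phi N"
    by (simp add: bcoef_def Psi_def Phi_def sum_subtractf [symmetric] algebra_simps)
  finally show ?thesis .
qed

lemma Tsum_diff: "(\<Sum>j\<in>{N..<N + H}. Psi j) = (\<Sum>j\<in>{N..<N + H}. Phi j) + (Tsum (N + H) - Tsum N)"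
  by (induction H) (simp_all add: Tsum_Suc)

lemma Tsum_bound: "\<exists>K\<ge>0. \<forall>N. \<bar>Tsum N\<bar> \<le> K * (real N)\<^sup>2"
proof -
  obtain K where K: "K \<ge> 0" "\<And>s. 1 < Re s \<Longrightarrow> Re s \<le> 2 \<Longrightarrow> norm (dseries bcoef s) \<le> K * (1 + \<bar>Im s\<bar>) powr (1/2)"
    using dseries_bcoef_growth by blast
  have "\<bar>Tsum N\<bar> \<le> 16 * K * (real N)\<^sup>2" for N
  proof (cases "N = 0")
    case False
    then have N: "N \<ge> 1" by simp
    have "Tsum N = real N * (\<Sum>n=1..N. bcoef n * (1 - real n / real N))"
      unfolding Tsum_def sum_distrib_left using False by (intro sum.cong) (auto simp: field_simps)
    then have "\<bar>Tsum N\<bar> = real N * \<bar>\<Sum>n=1..N. bcoef n * (1 - real n / real N)\<bar>" by (simp add: abs_mult)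
    also have "\<dots> \<le> real N * (16 * K * real N)"
      using perron_conclusion[OF dconv_bcoef K(2) K(1) N] by (intro mult_left_mono) auto
    finally show ?thesis by (simp add: power2_eq_square mult_ac)
  qed (simp add: Tsum_def)
  then show ?thesis using K(1) by (intro exI[of _ "16 * K"]) auto
qed

lemma ln_le_2_sqrt: "n \<ge> 1 \<Longrightarrow> ln (real n) \<le> 2 * sqrt (real n)"
proof -
  assume n: "n \<ge> 1"
  have "ln (sqrt (real n)) \<le> sqrt (real n) - 1" using n by (intro ln_le_minus_one) auto
  moreover have "ln (sqrt (real n)) = ln (real n) / 2" using n by (simp add: ln_sqrt)
  ultimately show ?thesis by linarith
qed

text \<open>Bounding \<open>ln n\<close> by \<open>ln N\<close> gives \<open>A N (ln N)^2\<close>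
  from above, and Abel summation shows that this loses only \<open>O(N ln N)\<close>. The error
  \<open>C sqrt N\<close> of \<open>A N\<close> is absorbed by
  \<open>ln N <= 2 sqrt N\<close>.\<close>

lemma Phi_asymp: "\<exists>K\<ge>0. \<forall>N\<ge>1. \<bar>Phi N - real N * (ln (real N))\<^sup>2\<bar> \<le> K * real N * ln (real N)"
proof -
  define A where "A n = (\<Sum>k=1..n. a k)" for n
  define K where "K = (2 * C + 4 * (\<rho> + C)) / \<rho>"
  have K0: "K \<ge> 0" using C_nonneg rho_pos by (simp add: K_def)
  have main: "\<bar>\<rho> * Phi N - \<rho> * (real N * (ln (real N))\<^sup>2)\<bar> \<le> (2 * C + 4 * (\<rho> + C)) * real N * ln (real N)" if N: "N \<ge> 2" for N
  proof -
    define l where "l = ln (real N)"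
    have l: "l \<ge> 0" using N by (simp add: l_def)
    have rP: "\<rho> * Phi N = (\<Sum>n=1..N. a n * (ln (real n))\<^sup>2)"
      unfolding Phi_def sum_distrib_left using rho_pos by (intro sum.cong) auto
    have AN: "\<bar>A N - \<rho> * real N\<bar> \<le> C * sqrt (real N)" using a_sum[of N] N by (simp add: A_def)
    have err: "\<bar>A N * l\<^sup>2 - \<rho> * (real N * l\<^sup>2)\<bar> \<le> 2 * C * real N * l"
    proof -
      have "A N * l\<^sup>2 - \<rho> * (real N * l\<^sup>2) = (A N - \<rho> * real N) * l\<^sup>2" by (simp add: algebra_simps)
      then have "\<bar>A N * l\<^sup>2 - \<rho> * (real N * l\<^sup>2)\<bar> \<le> C * sqrt (real N) * l\<^sup>2"
        using AN by (simp add: abs_mult mult_right_mono)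
      also have "\<dots> = C * sqrt (real N) * l * l" by (simp add: power2_eq_square)
      also have "\<dots> \<le> C * sqrt (real N) * (2 * sqrt (real N)) * l"
        using ln_le_2_sqrt[of N] N C_nonneg l by (intro mult_right_mono mult_left_mono) (auto simp: l_def)
      also have "\<dots> = 2 * C * (sqrt (real N) * sqrt (real N)) * l" by (simp only: mult_ac)
      finally show ?thesis by simp
    qed
    have "\<rho> * Phi N \<le> (\<Sum>n=1..N. a n * l\<^sup>2)"
      unfolding rP l_def using a_nonneg N by (intro sum_mono mult_left_mono power_mono) auto
    also have "\<dots> = A N * l\<^sup>2" by (simp add: A_def sum_distrib_right)
    finally have up: "\<rho> * Phi N \<le> A N * l\<^sup>2" .
    have "(\<Sum>n=1..N. A n * ((ln (real (Suc n)))\<^sup>2 - (ln (real n))\<^sup>2)) \<le> (\<Sum>n=1..N. (\<rho> + C) * (4 * l))"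
    proof (rule sum_mono)
      fix n assume n: "n \<in> {1..N}"
      define p q where "p = ln (real (Suc n))" and "q = ln (real n)"
      have pq: "0 \<le> q" "q \<le> p" using n by (auto simp: p_def q_def)
      have "1 + 1 / real n = real (Suc n) / real n" using n by (simp add: field_simps)
      then have "ln (1 + 1 / real n) = ln (real (Suc n) / real n)" by (rule arg_cong)
      also have "\<dots> = p - q" unfolding p_def q_def using n by (subst ln_div) auto
      finally have "p - q = ln (1 + 1 / real n)" by (rule sym)
      also have "\<dots> \<le> 1 / real n" using n by (intro ln_add_one_self_le_self) auto
      finally have d: "p - q \<le> 1 / real n" .
      have "p \<le> ln (2 * real N)" using n by (simp add: p_def)
      also have "\<dots> = ln 2 + l" using N by (simp add: ln_mult l_def)
      also have "ln 2 \<le> l" using N by (simp add: l_def)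
      finally have p2: "p \<le> 2 * l" by simp
      have "p\<^sup>2 - q\<^sup>2 = (p - q) * (p + q)" by (simp add: power2_eq_square algebra_simps)
      also have "\<dots> \<le> (1 / real n) * (4 * l)" using d p2 pq n l by (intro mult_mono) auto
      finally have "A n * (p\<^sup>2 - q\<^sup>2) \<le> A n * ((1 / real n) * (4 * l))"
        using a_nonneg by (intro mult_left_mono) (auto simp: A_def intro: sum_nonneg)
      also have "\<dots> \<le> ((\<rho> + C) * real n) * ((1 / real n) * (4 * l))"
        using a_sum_le[of n] l by (intro mult_right_mono) (auto simp: A_def)
      also have "\<dots> = (\<rho> + C) * (4 * l)" using n by simp
      finally show "A n * ((ln (real (Suc n)))\<^sup>2 - (ln (real n))\<^sup>2) \<le> (\<rho> + C) * (4 * l)"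
        by (simp add: p_def q_def)
    qed
    also have "\<dots> = 4 * (\<rho> + C) * real N * l" by simp
    finally have s: "(\<Sum>n=1..N. A n * ((ln (real (Suc n)))\<^sup>2 - (ln (real n))\<^sup>2)) \<le> 4 * (\<rho> + C) * real N * l" .
    have "\<rho> * Phi N = A N * (ln (real (Suc N)))\<^sup>2 - (\<Sum>n=1..N. A n * ((ln (real (Suc n)))\<^sup>2 - (ln (real n))\<^sup>2))"
      unfolding rP abel_summation[of a "\<lambda>n. (ln (real n))\<^sup>2"] A_def
      by (simp add: sum_negf [symmetric] right_diff_distrib sum_subtractf del: of_nat_Suc)
    moreover have "A N * l\<^sup>2 \<le> A N * (ln (real (Suc N)))\<^sup>2"
      using a_nonneg N by (intro mult_left_mono power_mono) (auto simp: l_def A_def intro: sum_nonneg)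
    ultimately have low: "\<rho> * Phi N \<ge> A N * l\<^sup>2 - 4 * (\<rho> + C) * real N * l" using s by linarith
    have "0 \<le> 4 * (\<rho> + C) * real N * l" using l C_nonneg rho_pos by simp
    moreover have "(2 * C + 4 * (\<rho> + C)) * real N * l = 2 * C * real N * l + 4 * (\<rho> + C) * real N * l"
      by (simp add: algebra_simps)
    ultimately show ?thesis using err up low unfolding l_def [symmetric] by linarith
  qed
  have "\<bar>Phi N - real N * (ln (real N))\<^sup>2\<bar> \<le> K * real N * ln (real N)" if "N \<ge> 1" for N
  proof (cases "N = 1")
    case False
    then have "\<bar>\<rho> * Phi N - \<rho> * (real N * (ln (real N))\<^sup>2)\<bar> \<le> (2 * C + 4 * (\<rho> + C)) * real N * ln (real N)"
      using main that by simp
    then have "\<rho> * \<bar>Phi N - real N * (ln (real N))\<^sup>2\<bar> \<le> (2 * C + 4 * (\<rho> + C)) * real N * ln (real N)"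
      using rho_pos by (simp add: abs_mult flip: right_diff_distrib)
    then show ?thesis using rho_pos by (simp add: K_def field_simps)
  qed (simp add: Phi_def)
  then show ?thesis using K0 by blast
qed

text \<open>\<open>Tsum\<close> controls averages of \<open>Psi - Phi\<close>, and monotonicity of
  \<open>Psi\<close> passes from averages to values. A window of length \<open>H\<close> costs
  \<open>N^2 / H\<close> from \<open>Tsum\<close> and \<open>H (ln N)^2\<close> from the variation
  of \<open>Phi\<close>; \<open>H\<close> about \<open>N / ln N\<close> makes both of order
  \<open>N ln N\<close>.\<close>

theorem Psi_asymp: "\<exists>K. \<forall>N\<ge>3. \<bar>Psi N - real N * (ln (real N))\<^sup>2\<bar> \<le> K * real N * ln (real N)"
proof -
  obtain K1 where K1: "K1 \<ge> 0" "\<And>N. \<bar>Tsum N\<bar> \<le> K1 * (real N)\<^sup>2" using Tsum_bound by blast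
  obtain K2 where K2: "K2 \<ge> 0" "\<And>N. N \<ge> 1 \<Longrightarrow> \<bar>Phi N - real N * (ln (real N))\<^sup>2\<bar> \<le> K2 * real N * ln (real N)"
    using Phi_asymp by blast
  define K where "K = 5 * K1 + 26 + 6 * K2"
  have "\<bar>Psi N - real N * (ln (real N))\<^sup>2\<bar> \<le> K * real N * ln (real N)" if N: "N \<ge> 3" for N
  proof -
    define x where "x = real N"
    define l where "l = ln x"
    define H where "H = nat \<lceil>x / l\<rceil>"
    define h where "h = real H"
    have x: "x \<ge> 3" using N by (simp add: x_def)
    have "exp 1 < (3::real)" using e_less_272 by simp
    then have "ln (exp 1) < l" unfolding l_def using x by (subst ln_less_cancel_iff) auto
    then have l1: "l > 1" by simp
    have lx: "l \<le> x" unfolding l_def using x ln_le_minus_one[of x] by linarith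
    have xl: "x / l \<ge> 1" using lx l1 by simp
    have h: "h \<ge> x / l" "h \<le> x / l + 1" unfolding h_def H_def using xl by linarith+
    have h2: "h \<le> 2 * x / l" using h xl by simp
    have h0: "h > 0" using h xl by linarith
    have "x / l \<le> x" using x l1 by (simp add: field_simps)
    then have HN: "H \<le> N" unfolding H_def x_def by (simp add: ceiling_le_iff)
    then have hx: "h \<le> x" by (simp add: h_def x_def)
    have hl: "x * x / h \<le> x * l"
    proof -
      have "x \<le> h * l" using h(1) l1 by (simp add: field_simps)
      then have "x * x \<le> x * (h * l)" using x by (intro mult_left_mono) auto
      then show ?thesis using h0 by (simp add: field_simps)
    qed
    have xxl: "x \<le> x * l" using x l1 by simp
    \<comment> \<open>Averaging the monotone function over a window of length about \<open>N / ln N\<close> loses only a factor \<open>1 + O(1 / ln N)\<close>.\<close>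
    have upper: "Psi N \<le> x * l\<^sup>2 + K * x * l"
    proof -
      have "h * Psi N = (\<Sum>j\<in>{N..<N + H}. Psi N)" by (simp add: h_def)
      also have "\<dots> \<le> (\<Sum>j\<in>{N..<N + H}. Psi j)" by (intro sum_mono Psi_mono) auto
      also have "\<dots> = (\<Sum>j\<in>{N..<N + H}. Phi j) + (Tsum (N + H) - Tsum N)" by (rule Tsum_diff)
      also have "(\<Sum>j\<in>{N..<N + H}. Phi j) \<le> (\<Sum>j\<in>{N..<N + H}. Phi (N + H))" by (intro sum_mono Phi_mono) auto
      also have "\<dots> = h * Phi (N + H)" by (simp add: h_def)
      also have "Tsum (N + H) - Tsum N \<le> 5 * K1 * (x * x)"
      proof -
        have "\<bar>Tsum (N + H)\<bar> \<le> K1 * (real (N + H))\<^sup>2" by (rule K1(2))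
        also have "\<dots> \<le> K1 * (2 * x)\<^sup>2" using hx h0 x K1(1) by (intro mult_left_mono power_mono) (auto simp: h_def x_def)
        finally show ?thesis using K1(2)[of N] by (simp add: x_def power2_eq_square algebra_simps)
      qed
      finally have "h * Psi N \<le> h * Phi (N + H) + 5 * K1 * (x * x)" by simp
      then have "Psi N \<le> Phi (N + H) + 5 * K1 * (x * x / h)" using h0 by (simp add: field_simps)
      also have "5 * K1 * (x * x / h) \<le> 5 * K1 * (x * l)" using hl K1(1) by (intro mult_left_mono) auto
      finally have 1: "Psi N \<le> Phi (N + H) + 5 * K1 * (x * l)" by simp
      define l' where "l' = ln (x + h)"
      have "l' = l + ln (1 + h / x)"
      proof -
        have "x + h = x * (1 + h / x)" using x by (simp add: field_simps)
        moreover have "1 + h / x > 0" using x h0 by (simp add: add_pos_pos)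
        ultimately show ?thesis unfolding l'_def l_def using x by (metis ln_mult_pos less_le_trans zero_less_numeral)
      qed
      also have "ln (1 + h / x) \<le> h / x" using h0 x by (intro ln_add_one_self_le_self) auto
      also have "h / x \<le> 2 / l" using h2 x by (simp add: field_simps)
      finally have l': "l' \<le> l + 2 / l" by simp
      have l'0: "l' \<ge> 0" unfolding l'_def using x h0 by (intro ln_ge_zero) auto
      have l2: "2 / l \<le> 2 * l"
      proof -
        have "1 * 1 \<le> l * l" using l1 by (intro mult_mono) auto
        then show ?thesis using l1 by (simp add: field_simps)
      qed
      have il: "2 / l \<le> 2" using l1 by (simp add: field_simps)
      have sq: "l'\<^sup>2 \<le> l\<^sup>2 + 8"
      proof -
        have "l'\<^sup>2 \<le> (l + 2 / l)\<^sup>2" using l' l'0 by (intro power_mono)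
        also have "\<dots> = l\<^sup>2 + 4 + (2 / l)\<^sup>2" using l1 by (simp add: power2_eq_square algebra_simps)
        also have "(2 / l)\<^sup>2 \<le> 2\<^sup>2" using il l1 by (intro power_mono) auto
        finally show ?thesis by simp
      qed
      have "Phi (N + H) \<le> (x + h) * l'\<^sup>2 + K2 * (x + h) * l'"
        using K2(2)[of "N + H"] N unfolding l'_def by (simp add: x_def h_def)
      also have "(x + h) * l'\<^sup>2 \<le> x * l\<^sup>2 + 26 * (x * l)"
      proof -
        have "(x + h) * l'\<^sup>2 \<le> (x + h) * (l\<^sup>2 + 8)" using sq x h0 by (intro mult_left_mono) auto
        also have "\<dots> = x * l\<^sup>2 + 8 * x + h * l\<^sup>2 + 8 * h" by (simp add: algebra_simps)
        finally have "(x + h) * l'\<^sup>2 \<le> x * l\<^sup>2 + 8 * x + h * l\<^sup>2 + 8 * h" .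
        moreover have "h * l\<^sup>2 \<le> (2 * x / l) * l\<^sup>2" using h2 by (intro mult_right_mono) auto
        moreover have "(2 * x / l) * l\<^sup>2 = 2 * (x * l)" using l1 by (simp add: power2_eq_square)
        ultimately show ?thesis using hx xxl x by linarith
      qed
      also have "K2 * (x + h) * l' \<le> K2 * (2 * x) * (3 * l)"
        using K2(1) hx x h0 l' l2 l'0 l1 by (intro mult_mono) auto
      finally have "Phi (N + H) \<le> x * l\<^sup>2 + 26 * (x * l) + 6 * K2 * (x * l)" by (simp add: mult_ac)
      then show ?thesis using 1 by (simp add: K_def algebra_simps)
    qed
    have lower: "x * l\<^sup>2 - K * x * l \<le> Psi N"
    \<comment> \<open>For \<open>l < 4\<close> the claim is trivial, as
      \<open>x l^2 <= 4 x l\<close> and \<open>K >= 4\<close>. For \<open>l >= 4\<close> one has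
      \<open>h <= x / 2\<close>, so the window to the left of \<open>N\<close> stays away from
      0.\<close>
    proof (cases "l \<ge> 4")
      case False
      have "x * l\<^sup>2 \<le> 4 * (x * l)"
      proof -
        have "x * l * l \<le> x * l * 4" using False x l1 by (intro mult_left_mono) auto
        then show ?thesis by (simp add: power2_eq_square mult_ac)
      qed
      also have "\<dots> \<le> K * (x * l)" using K1(1) K2(1) x l1 by (intro mult_right_mono) (auto simp: K_def)
      finally have "x * l\<^sup>2 \<le> K * (x * l)" .
      moreover have "0 \<le> Psi N" using lam_nonneg by (auto simp: Psi_def intro!: sum_nonneg)
      ultimately show ?thesis by (simp add: mult.assoc)
    next
      case True
      have hx2: "h \<le> x / 2"
      proof -
        have "2 * x / l \<le> 2 * x / 4" using True x by (intro divide_left_mono) auto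
        then show ?thesis using h2 by simp
      qed
      have NH: "N - H \<ge> 1" using hx2 x by (auto simp: h_def x_def)
      have rNH: "real (N - H) = x - h" using HN by (simp add: x_def h_def)
      have "(\<Sum>j\<in>{N - H..<N - H + H}. Psi j) \<le> (\<Sum>j\<in>{N - H..<N - H + H}. Psi N)" using HN by (intro sum_mono Psi_mono) auto
      also have "\<dots> = h * Psi N" by (simp add: h_def)
      finally have "h * Psi N \<ge> (\<Sum>j\<in>{N - H..<N - H + H}. Phi j) + (Tsum N - Tsum (N - H))"
        using Tsum_diff[of "N - H" H] HN by simp
      moreover have "(\<Sum>j\<in>{N - H..<N - H + H}. Phi j) \<ge> (\<Sum>j\<in>{N - H..<N - H + H}. Phi (N - H))" by (intro sum_mono Phi_mono) auto
      moreover have "(\<Sum>j\<in>{N - H..<N - H + H}. Phi (N - H)) = h * Phi (N - H)" by (simp add: h_def)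
      moreover have "Tsum N - Tsum (N - H) \<ge> - (2 * K1 * (x * x))"
      proof -
        have "\<bar>Tsum (N - H)\<bar> \<le> K1 * (real (N - H))\<^sup>2" by (rule K1(2))
        also have "\<dots> \<le> K1 * x\<^sup>2" using K1(1) by (intro mult_left_mono power_mono) (auto simp: x_def)
        finally show ?thesis using K1(2)[of N] by (simp add: x_def power2_eq_square algebra_simps)
      qed
      ultimately have "h * Psi N \<ge> h * Phi (N - H) - 2 * K1 * (x * x)" by linarith
      then have "Psi N \<ge> Phi (N - H) - 2 * K1 * (x * x / h)" using h0 by (simp add: field_simps)
      moreover have "2 * K1 * (x * x / h) \<le> 2 * K1 * (x * l)" using hl K1(1) by (intro mult_left_mono) auto
      ultimately have 1: "Psi N \<ge> Phi (N - H) - 2 * K1 * (x * l)" by linarith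
      define l' where "l' = ln (x - h)"
      have xh: "x - h > 0" "x - h \<ge> 1" using hx2 x by linarith+
      have l'l: "l' \<le> l" unfolding l'_def l_def using xh h0 by (subst ln_le_cancel_iff) auto
      have l'0: "l' \<ge> 0" unfolding l'_def using xh by (intro ln_ge_zero) auto
      have "l - l' = ln (x / (x - h))" unfolding l_def l'_def using x xh by (simp add: ln_div)
      also have "\<dots> \<le> x / (x - h) - 1" using x xh by (intro ln_le_minus_one) auto
      also have "\<dots> = h / (x - h)" using xh by (simp add: field_simps)
      also have "\<dots> \<le> h / (x / 2)" using hx2 xh x h0 by (intro divide_left_mono) auto
      also have "\<dots> \<le> (2 * x / l) / (x / 2)" using h2 x by (intro divide_right_mono) auto
      also have "\<dots> = 4 / l" using x by (simp add: field_simps)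
      finally have l': "l' \<ge> l - 4 / l" by simp
      have pos4: "l - 4 / l \<ge> 0"
      proof -
        have "4 * 4 \<le> l * l" using True by (intro mult_mono) auto
        then show ?thesis using True by (simp add: field_simps)
      qed
      have sq: "l'\<^sup>2 \<ge> l\<^sup>2 - 8"
      proof -
        have "(l - 4 / l)\<^sup>2 \<le> l'\<^sup>2" using l' pos4 by (intro power_mono)
        moreover have "(l - 4 / l)\<^sup>2 = l\<^sup>2 - 8 + (4 / l)\<^sup>2" using True by (simp add: power2_eq_square algebra_simps)
        moreover have "(4 / l)\<^sup>2 \<ge> 0" by simp
        ultimately show ?thesis by linarith
      qed
      have "Phi (N - H) \<ge> (x - h) * l'\<^sup>2 - K2 * (x - h) * l'"
        using K2(2)[OF NH] unfolding rNH l'_def by simp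
      moreover have "(x - h) * l'\<^sup>2 \<ge> x * l\<^sup>2 - 10 * (x * l)"
      proof -
        have "(x - h) * (l\<^sup>2 - 8) \<le> (x - h) * l'\<^sup>2" using sq xh by (intro mult_left_mono) auto
        moreover have "(x - h) * (l\<^sup>2 - 8) = x * l\<^sup>2 - 8 * x - h * l\<^sup>2 + 8 * h" by (simp add: algebra_simps)
        moreover have "h * l\<^sup>2 \<le> (2 * x / l) * l\<^sup>2" using h2 by (intro mult_right_mono) auto
        moreover have "(2 * x / l) * l\<^sup>2 = 2 * (x * l)" using l1 by (simp add: power2_eq_square)
        ultimately show ?thesis using h0 xxl x by linarith
      qed
      moreover have "K2 * (x - h) * l' \<le> K2 * x * l"
        using K2(1) h0 xh l'l l'0 by (intro mult_mono) auto
      ultimately have "Psi N \<ge> x * l\<^sup>2 - 10 * (x * l) - K2 * x * l - 2 * K1 * (x * l)" using 1 by linarith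
      moreover have "10 * (x * l) + K2 * x * l + 2 * K1 * (x * l) \<le> K * (x * l)"
      proof -
        have "(10 + K2 + 2 * K1) * (x * l) \<le> K * (x * l)"
          using K1(1) K2(1) x l1 by (intro mult_right_mono) (auto simp: K_def)
        then show ?thesis by (simp add: algebra_simps)
      qed
      ultimately show ?thesis by (simp add: mult.assoc)
    qed
    show ?thesis using upper lower unfolding x_def l_def by simp
  qed
  then show ?thesis by blast
qed

end

section \<open>Sums over split primes\<close>

text \<open>The summand \<open>2 ln q ^ 3\<close> is the value of \<open>lam q (ln q)^2\<close> at a
  split prime.\<close>

locale prime_density =
  fixes P :: "nat set" and K0 :: real
  assumes P_ge_2: "\<And>q. q \<in> P \<Longrightarrow> q \<ge> 2"
    and K0_nonneg: "K0 \<ge> 0"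
    and theta: "\<And>N. N \<ge> 3 \<Longrightarrow> \<bar>(\<Sum>q\<in>{q\<in>P. q \<le> N}. 2 * ln (real q) ^ 3) - real N * ln (real N) ^ 2\<bar> \<le> K0 * real N * ln (real N)"
begin

definition upto :: "real \<Rightarrow> nat set" where "upto u = {q \<in> P. real q \<le> u}"
definition piP :: "real \<Rightarrow> real" where "piP u = real (card (upto u))"
definition thP :: "real \<Rightarrow> real" where "thP u = (\<Sum>q\<in>upto u. 2 * ln (real q) ^ 3)"
definition Qsum :: "real \<Rightarrow> real" where "Qsum u = (\<Sum>q\<in>upto u. real q)"
definition Rsum :: "real \<Rightarrow> real" where "Rsum u = (\<Sum>q\<in>upto u. u - real q)"

lemma upto_subset: "u \<ge> 0 \<Longrightarrow> upto u \<subseteq> {1..nat \<lfloor>u\<rfloor>}"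
  using P_ge_2 by (force simp: upto_def le_nat_iff le_floor_iff)

lemma finite_upto: "finite (upto u)"
proof (cases "u \<ge> 0")
  case True
  then show ?thesis using upto_subset finite_subset by blast
next
  case False
  then have "upto u = {}" by (auto simp: upto_def)
  then show ?thesis by simp
qed

lemma upto_mono: "u \<le> v \<Longrightarrow> upto u \<subseteq> upto v"
  by (auto simp: upto_def)

lemma upto_floor: "u \<ge> 0 \<Longrightarrow> upto u = {q \<in> P. q \<le> nat \<lfloor>u\<rfloor>}"
  by (auto simp: upto_def le_nat_iff le_floor_iff)

lemma piP_le: "u \<ge> 0 \<Longrightarrow> piP u \<le> u"
proof -
  assume u: "u \<ge> 0"
  have "card (upto u) \<le> card {1..nat \<lfloor>u\<rfloor>}" using u by (intro card_mono upto_subset) auto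
  then have "piP u \<le> real (nat \<lfloor>u\<rfloor>)" by (simp add: piP_def)
  also have "\<dots> \<le> u" using u by simp
  finally show ?thesis .
qed

lemma thP_asymp: "\<exists>K\<ge>0. \<forall>\<^sub>F u in at_top. \<bar>thP u - u * ln u ^ 2\<bar> \<le> K * u * ln u"
proof -
  have "\<forall>\<^sub>F u :: real in at_top. (u - 1) * ln (u - 1) ^ 2 \<ge> u * ln u ^ 2 - 1 * u * ln u" by real_asymp
  then have "\<forall>\<^sub>F u in at_top. \<bar>thP u - u * ln u ^ 2\<bar> \<le> (K0 + 1) * u * ln u"
    using eventually_ge_at_top[of 5]
  proof eventually_elim
    case (elim u)
    define N where "N = nat \<lfloor>u\<rfloor>"
    have N: "real N \<le> u" "u - 1 \<le> real N" "N \<ge> 3" using elim unfolding N_def by linarith+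
    have "upto u = {q \<in> P. q \<le> N}" using upto_floor[of u] elim by (simp add: N_def)
    then have th: "\<bar>thP u - real N * ln (real N) ^ 2\<bar> \<le> K0 * real N * ln (real N)"
      using theta[OF N(3)] by (simp add: thP_def)
    have up: "real N * ln (real N) ^ 2 \<le> u * ln u ^ 2"
      using N by (intro mult_mono power_mono) auto
    have "(u - 1) * ln (u - 1) ^ 2 \<le> real N * ln (real N) ^ 2"
      using N elim by (intro mult_mono power_mono) auto
    then have low: "u * ln u ^ 2 - 1 * u * ln u \<le> real N * ln (real N) ^ 2" using elim by linarith
    have e: "K0 * real N * ln (real N) \<le> K0 * u * ln u" using N K0_nonneg by (intro mult_mono) auto
    have "u * ln u \<ge> 0" using elim by simp
    then show ?case using th up low e by (simp add: algebra_simps abs_le_iff)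
  qed
  then show ?thesis using K0_nonneg by (intro exI[of _ "K0 + 1"]) auto
qed

lemma piP_lower: "u > 1 \<Longrightarrow> thP u / (2 * ln u ^ 3) \<le> piP u"
proof -
  assume u: "u > 1"
  have "thP u \<le> (\<Sum>q\<in>upto u. 2 * ln u ^ 3)"
    unfolding thP_def using P_ge_2 by (intro sum_mono mult_left_mono power_mono) (fastforce simp: upto_def)+
  then show ?thesis using u by (simp add: piP_def field_simps)
qed

text \<open>Primes up to \<open>v\<close> are counted trivially by \<open>v\<close>; above
  \<open>v\<close> every summand of \<open>thP\<close> is at least
  \<open>2 (ln v)^3\<close>.\<close>

lemma piP_upper:
  assumes v: "v > 1" "v \<le> u"
  shows "piP u \<le> v + thP u / (2 * ln v ^ 3)"
proof -
  have "card (upto u) = card (upto v) + card (upto u - upto v)"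
    using v finite_upto upto_mono[of v u] by (subst card_Diff_subset) (auto simp: card_mono)
  then have "piP u = piP v + real (card (upto u - upto v))" by (simp add: piP_def)
  moreover have "piP v \<le> v" using v by (intro piP_le) auto
  moreover have "real (card (upto u - upto v)) \<le> thP u / (2 * ln v ^ 3)"
  proof -
    have "real (card (upto u - upto v)) * (2 * ln v ^ 3) = (\<Sum>q\<in>upto u - upto v. 2 * ln v ^ 3)" by simp
    also have "\<dots> \<le> (\<Sum>q\<in>upto u - upto v. 2 * ln (real q) ^ 3)"
      using v by (intro sum_mono mult_left_mono power_mono) (auto simp: upto_def)
    also have "\<dots> \<le> thP u" unfolding thP_def
    proof (rule sum_mono2[OF finite_upto])
      fix q assume "q \<in> upto u - (upto u - upto v)"
      then have "real q \<ge> 1" using P_ge_2[of q] by (auto simp: upto_def)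
      then show "0 \<le> 2 * ln (real q) ^ 3" by simp
    qed auto
    finally show ?thesis using v by (simp add: pos_le_divide_eq)
  qed
  ultimately show ?thesis by linarith
qed

definition eps :: "real \<Rightarrow> real" where "eps Y = ln (ln Y) / ln Y"

text \<open>Throughout the range \<open>ln u\<close> is \<open>ln Y + O(ln ln Y)\<close>, so
  replacing it by \<open>ln Y\<close> costs a relative error of order \<open>eps Y\<close>; this is
  one source of the final error term. The exponent 5 makes the range wide enough for the double sums
  in \<open>window_sums\<close>.\<close>

lemma window:
  "\<exists>K>0. \<forall>\<^sub>F Y in at_top. \<forall>u. Y / ln Y ^ 5 \<le> u \<longrightarrow> u \<le> 2 * Y \<longrightarrow>
     u / (2 * ln Y) * (1 - K * eps Y) \<le> piP u \<and> piP u \<le> u / (2 * ln Y) * (1 + K * eps Y)"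
proof -
  obtain K where K: "K \<ge> 0" "\<forall>\<^sub>F u in at_top. \<bar>thP u - u * ln u ^ 2\<bar> \<le> K * u * ln u" using thP_asymp by blast
  then obtain U where U: "\<And>u. u \<ge> U \<Longrightarrow> \<bar>thP u - u * ln u ^ 2\<bar> \<le> K * u * ln u"
    by (auto simp: eventually_at_top_linorder)
  have "(\<lambda>Y. (ln (2 * Y) ^ 2 + K * ln (2 * Y)) * ln Y / (ln Y - 7 * ln (ln Y)) ^ 3 - 1) \<in> O(\<lambda>Y::real. ln (ln Y) / ln Y)"
    by real_asymp
  then obtain c1 where c1: "c1 > 0" "\<forall>\<^sub>F Y in at_top. \<bar>(ln (2 * Y) ^ 2 + K * ln (2 * Y)) * ln Y / (ln Y - 7 * ln (ln Y)) ^ 3 - 1\<bar> \<le> c1 * \<bar>ln (ln Y) / ln Y\<bar>"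
    by (elim landau_o.bigE) auto
  define K' where "K' = c1 + 2 + 2 * K"
  have lim: "filterlim (\<lambda>Y::real. Y / ln Y ^ 5) at_top at_top" by real_asymp
  have "\<forall>\<^sub>F Y in at_top. Y / ln Y ^ 5 \<ge> U" using lim by (simp add: filterlim_at_top)
  moreover note c1(2)
  moreover have "\<forall>\<^sub>F Y :: real in at_top. Y / ln Y ^ 7 > 1" by real_asymp
  moreover have "\<forall>\<^sub>F Y :: real in at_top. ln Y - 7 * ln (ln Y) > 0" by real_asymp
  moreover have "\<forall>\<^sub>F Y :: real in at_top. ln (ln Y) \<ge> 1" by real_asymp
  moreover have "\<forall>\<^sub>F Y :: real in at_top. ln Y \<ge> 1" by real_asymp
  moreover have "\<forall>\<^sub>F Y :: real in at_top. Y / ln Y ^ 5 \<ge> sqrt Y" by real_asymp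
  moreover have "\<forall>\<^sub>F Y :: real in at_top. Y \<ge> 3" by (rule eventually_ge_at_top)
  ultimately have "\<forall>\<^sub>F Y in at_top. \<forall>u. Y / ln Y ^ 5 \<le> u \<longrightarrow> u \<le> 2 * Y \<longrightarrow>
     u / (2 * ln Y) * (1 - K' * eps Y) \<le> piP u \<and> piP u \<le> u / (2 * ln Y) * (1 + K' * eps Y)"
  proof eventually_elim
    case (elim Y)
    define l where "l = ln Y"
    have l: "l \<ge> 1" "ln l \<ge> 1" "l - 7 * ln l > 0" using elim by (auto simp: l_def)
    have Y: "Y \<ge> 3" using elim by simp
    have e: "eps Y = ln l / l" by (simp add: eps_def l_def)
    have e0: "1 / l \<le> eps Y" using l by (simp add: e divide_right_mono)
    show ?case
    proof (intro allI impI conjI)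
      fix u assume u: "Y / ln Y ^ 5 \<le> u" "u \<le> 2 * Y"
      have uU: "u \<ge> U" using u elim by linarith
      have us: "u \<ge> sqrt Y" using u elim by linarith
      have s1: "sqrt Y > 1" using Y by simp
      have u1: "u > 1" using us s1 by linarith
      define m where "m = ln u"
      have "ln (sqrt Y) \<le> m" unfolding m_def using us s1 u1 by (subst ln_le_cancel_iff) auto
      then have m: "m \<ge> l / 2" using Y by (simp add: ln_sqrt l_def)
      have m0: "m > 0" using m l by linarith
      have m2: "m \<le> ln (2 * Y)" unfolding m_def using u u1 by (subst ln_le_cancel_iff) auto
      have l2: "ln (2 * Y) = ln 2 + l" using Y by (simp add: ln_mult l_def)
      have ln2: "ln 2 \<le> (1::real)" using ln_2_less_1 by simp
      have th: "\<bar>thP u - u * m ^ 2\<bar> \<le> K * u * m" using U[OF uU] by (simp add: m_def)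
      show "u / (2 * ln Y) * (1 - K' * eps Y) \<le> piP u"
      proof -
        have "u / (2 * m) * (1 - K / m) = (u * m ^ 2 - K * u * m) / (2 * m ^ 3)"
          using m0 by (simp add: field_simps power2_eq_square power3_eq_cube)
        also have "\<dots> \<le> thP u / (2 * m ^ 3)" using th m0 by (intro divide_right_mono) auto
        also have "\<dots> \<le> piP u" using piP_lower[OF u1] by (simp add: m_def)
        finally have 1: "u / (2 * m) * (1 - K / m) \<le> piP u" .
        show ?thesis
        proof (cases "K' * eps Y \<ge> 1")
          case True
          then have "u / (2 * ln Y) * (1 - K' * eps Y) \<le> 0" using u1 l by (intro mult_nonneg_nonpos) (auto simp: l_def)
          also have "0 \<le> piP u" by (simp add: piP_def)
          finally show ?thesis .
        next
          case False
          have "K / m \<le> K / (l / 2)" using m m0 l K(1) by (intro divide_left_mono) auto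
          then have a: "1 - K / m \<ge> 1 - 2 * K / l" by (simp add: mult.commute)
          have "2 * K / l + 1 / l \<le> K' * eps Y"
          proof -
            have "2 * K / l + 1 / l = (2 * K + 1) * (1 / l)" by (simp add: add_divide_distrib)
            also have "\<dots> \<le> (2 * K + 1) * eps Y" using e0 K(1) by (intro mult_left_mono) auto
            also have "\<dots> \<le> K' * eps Y" using c1(1) e0 l by (intro mult_right_mono) (auto simp: K'_def e)
            finally show ?thesis .
          qed
          then have b: "1 - K' * eps Y \<le> (1 - 1 / l) * (1 - 2 * K / l)"
          proof -
            have "(1 - s) * (1 - t) = 1 - s - t + s * t" for s t :: real by (simp add: algebra_simps)
            from this[of "1 / l" "2 * K / l"] have "(1 - 1 / l) * (1 - 2 * K / l) = 1 - 1 / l - 2 * K / l + (1 / l) * (2 * K / l)" .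
            moreover have "(1 / l) * (2 * K / l) \<ge> 0" using K(1) l by simp
            ultimately show ?thesis using \<open>2 * K / l + 1 / l \<le> K' * eps Y\<close> by linarith
          qed
          have pos: "1 - 2 * K / l \<ge> 0"
          proof -
            have "1 / l > 0" using l by simp
            then show ?thesis using \<open>2 * K / l + 1 / l \<le> K' * eps Y\<close> False by linarith
          qed
          have "u / (2 * l) * (1 - K' * eps Y) \<le> u / (2 * l) * ((1 - 1 / l) * (1 - 2 * K / l))"
            using b u1 l by (intro mult_left_mono) auto
          also have "\<dots> = (u / 2) * ((1 - 1 / l) / l) * (1 - 2 * K / l)" by (simp add: field_simps)
          also have "\<dots> \<le> (u / 2) * (1 / m) * (1 - K / m)"
          proof (intro mult_mono)
            have "(1 - 1 / l) * m \<le> (1 - 1 / l) * (1 + l)" using m2 l2 ln2 l by (intro mult_left_mono) auto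
            also have "\<dots> = l - 1 / l" using l by (simp add: field_simps)
            also have "\<dots> \<le> l" using l by simp
            finally show "(1 - 1 / l) / l \<le> 1 / m" using l m0 by (simp add: field_simps)
          qed (use a pos u1 m0 l in auto)
          also have "\<dots> = u / (2 * m) * (1 - K / m)" by simp
          finally show ?thesis using 1 by (simp add: l_def)
        qed
      qed
      show "piP u \<le> u / (2 * ln Y) * (1 + K' * eps Y)"
      proof -
        \<comment> \<open>\<open>v\<close> lies below \<open>u / l^2\<close>, so counting the primes
          up to \<open>v\<close> trivially costs at most \<open>u / l * eps Y\<close>, while
          \<open>ln v = l - 7 ln l\<close> still agrees with \<open>l\<close> up to a factor
          \<open>1 + O(eps Y)\<close>.\<close>
        define v where "v = Y / l ^ 7"
        have v1: "v > 1" using elim by (simp add: v_def l_def)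
        have lv: "ln v = l - 7 * ln l" using Y l by (simp add: v_def l_def ln_div ln_realpow)
        have vu: "v \<le> u / l ^ 2"
        proof -
          have "v = (Y / l ^ 5) / l ^ 2" by (simp add: v_def flip: power_add)
          also have "\<dots> \<le> u / l ^ 2" using u by (intro divide_right_mono) (auto simp: l_def)
          finally show ?thesis .
        qed
        have "u / l ^ 2 \<le> u / 1" using u1 l by (intro divide_left_mono) auto
        then have vu': "v \<le> u" using vu by simp
        have "piP u \<le> v + thP u / (2 * ln v ^ 3)" by (rule piP_upper[OF v1 vu'])
        also have "thP u / (2 * ln v ^ 3) \<le> (u * (ln (2 * Y) ^ 2 + K * ln (2 * Y))) / (2 * ln v ^ 3)"
        proof (intro divide_right_mono)
          have "thP u \<le> u * m ^ 2 + K * u * m" using th by linarith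
          also have "\<dots> = u * (m ^ 2 + K * m)" by (simp add: algebra_simps)
          also have "\<dots> \<le> u * (ln (2 * Y) ^ 2 + K * ln (2 * Y))"
            using m2 m0 K(1) u1 by (intro mult_left_mono add_mono power_mono) auto
          finally show "thP u \<le> u * (ln (2 * Y) ^ 2 + K * ln (2 * Y))" .
        qed (use l lv in auto)
        also have "\<dots> = u / (2 * l) * ((ln (2 * Y) ^ 2 + K * ln (2 * Y)) * l / (l - 7 * ln l) ^ 3)"
          unfolding lv using l by simp
        also have "\<dots> \<le> u / (2 * l) * (1 + c1 * eps Y)"
        proof (intro mult_left_mono)
          have "\<bar>(ln (2 * Y) ^ 2 + K * ln (2 * Y)) * l / (l - 7 * ln l) ^ 3 - 1\<bar> \<le> c1 * \<bar>ln l / l\<bar>"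
            using elim by (simp add: l_def)
          then show "(ln (2 * Y) ^ 2 + K * ln (2 * Y)) * l / (l - 7 * ln l) ^ 3 \<le> 1 + c1 * eps Y"
            using l by (simp add: e)
        qed (use u1 l in auto)
        finally have "piP u \<le> v + u / (2 * l) * (1 + c1 * eps Y)" by simp
        also have "v \<le> u / (2 * l) * (2 * eps Y)"
        proof -
          have "u / l ^ 2 = u / l * (1 / l)" by (simp add: power2_eq_square)
          also have "\<dots> \<le> u / l * eps Y" using e0 u1 l by (intro mult_left_mono) auto
          finally show ?thesis using vu by simp
        qed
        finally have "piP u \<le> u / (2 * l) * (2 * eps Y) + u / (2 * l) * (1 + c1 * eps Y)" by simp
        also have "\<dots> = u / (2 * l) * (1 + (2 + c1) * eps Y)" by (simp add: algebra_simps add_divide_distrib)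
        also have "\<dots> \<le> u / (2 * l) * (1 + K' * eps Y)"
        proof -
          have "eps Y \<ge> 0" using l by (simp add: e)
          then have "(2 + c1) * eps Y \<le> K' * eps Y" using K(1) by (intro mult_right_mono) (auto simp: K'_def)
          then show ?thesis using u1 l by (intro mult_left_mono) auto
        qed
        finally show ?thesis by (simp add: l_def)
      qed
    qed
  qed
  moreover have "K' > 0" using c1 K by (simp add: K'_def)
  ultimately show ?thesis by blast
qed

text \<open>A prime \<open>q\<close> is counted once for each \<open>m\<close> from \<open>q\<close>
  to \<open>M\<close>.\<close>

lemma sum_piP: "(\<Sum>m=1..M. piP (real m)) = (\<Sum>q\<in>upto (real M). real M - real q + 1)"
proof (induction M)
  case 0
  have "upto (real 0) = {}" using P_ge_2 by (force simp: upto_def)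
  then show ?case by simp
next
  case (Suc M)
  have "upto (real (Suc M)) = (if Suc M \<in> P then insert (Suc M) (upto (real M)) else upto (real M))"
    by (auto simp: upto_def le_Suc_eq simp del: of_nat_Suc)
  moreover have "Suc M \<notin> upto (real M)" by (auto simp: upto_def)
  ultimately have "(\<Sum>q\<in>upto (real (Suc M)). real (Suc M) - real q + 1) =
      (\<Sum>q\<in>upto (real M). real M - real q + 1) + piP (real (Suc M))"
    using finite_upto by (simp add: piP_def sum.distrib sum_subtractf algebra_simps)
  then show ?case using Suc by simp
qed

text \<open>Below the window, for \<open>m < a\<close>, the trivial \<open>piP m <= m\<close> is
  used; these \<open>m\<close> contribute at most \<open>a^2\<close> in total.\<close>

lemma sum_piP_window:
  assumes Y: "ln Y \<ge> 1" and a: "a \<ge> 0" and z: "real M \<le> z" "e \<ge> 0" "e \<le> 1"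
    and win: "\<And>u. a \<le> u \<Longrightarrow> u \<le> z \<Longrightarrow> u / (2 * ln Y) * (1 - e) \<le> piP u \<and> piP u \<le> u / (2 * ln Y) * (1 + e)"
  shows "(\<Sum>m=1..M. piP (real m)) \<le> real M * (real M + 1) / (4 * ln Y) * (1 + e) + a\<^sup>2"
    and "real M * (real M + 1) / (4 * ln Y) * (1 - e) - a\<^sup>2 \<le> (\<Sum>m=1..M. piP (real m))"
proof -
  define r where "r m = (if real m < a then real m else 0)" for m :: nat
  have rsum: "(\<Sum>m=1..M. r m) \<le> a\<^sup>2"
  proof -
    let ?A = "{m\<in>{1..M}. real m < a}"
    have sub: "?A \<subseteq> {1..nat \<lfloor>a\<rfloor>}" by (auto simp: le_nat_iff le_floor_iff)
    then have "card ?A \<le> nat \<lfloor>a\<rfloor>" using card_mono[OF _ sub] by simp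
    then have c: "real (card ?A) \<le> a" using a by linarith
    have "(\<Sum>m=1..M. r m) = (\<Sum>m\<in>?A. real m)" unfolding r_def by (rule sum.inter_filter [symmetric]) simp
    also have "\<dots> \<le> (\<Sum>m\<in>?A. a)" by (intro sum_mono) auto
    also have "\<dots> = real (card ?A) * a" by simp
    also have "\<dots> \<le> a * a" using c a by (intro mult_right_mono) auto
    finally show ?thesis by (simp add: power2_eq_square)
  qed
  have gs: "(\<Sum>m=1..M. real m) = real M * (real M + 1) / 2"
    by (induction M) (auto simp: field_simps)
  have sums: "(\<Sum>m=1..M. real m / (2 * ln Y) * k) = real M * (real M + 1) / (4 * ln Y) * k" for k
  proof -
    have "(\<Sum>m=1..M. real m / (2 * ln Y) * k) = (\<Sum>m=1..M. real m) / (2 * ln Y) * k"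
      by (simp add: sum_divide_distrib sum_distrib_right)
    then show ?thesis unfolding gs by simp
  qed
  have up: "piP (real m) \<le> real m / (2 * ln Y) * (1 + e) + r m" if "m \<in> {1..M}" for m
  proof (cases "real m < a")
    case True
    have "0 \<le> real m / (2 * ln Y) * (1 + e)" using Y z by simp
    then show ?thesis using piP_le[of "real m"] True by (simp add: r_def)
  next
    case False
    then show ?thesis using win[of "real m"] that z by (auto simp: r_def)
  qed
  have low: "real m / (2 * ln Y) * (1 - e) - r m \<le> piP (real m)" if "m \<in> {1..M}" for m
  proof (cases "real m < a")
    case True
    have "real m / (2 * ln Y) * (1 - e) \<le> real m / 1 * 1"
      using Y z by (intro mult_mono frac_le) auto
    then have "real m / (2 * ln Y) * (1 - e) - r m \<le> 0" using True by (simp add: r_def)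
    also have "0 \<le> piP (real m)" by (simp add: piP_def)
    finally show ?thesis .
  next
    case False
    then show ?thesis using win[of "real m"] that z by (auto simp: r_def)
  qed
  have "(\<Sum>m=1..M. piP (real m)) \<le> (\<Sum>m=1..M. real m / (2 * ln Y) * (1 + e) + r m)" by (intro sum_mono up)
  then show "(\<Sum>m=1..M. piP (real m)) \<le> real M * (real M + 1) / (4 * ln Y) * (1 + e) + a\<^sup>2"
    using rsum sums[of "1 + e"] by (simp add: sum.distrib)
  have "(\<Sum>m=1..M. real m / (2 * ln Y) * (1 - e) - r m) \<le> (\<Sum>m=1..M. piP (real m))" by (intro sum_mono low)
  then show "real M * (real M + 1) / (4 * ln Y) * (1 - e) - a\<^sup>2 \<le> (\<Sum>m=1..M. piP (real m))"
    using rsum sums[of "1 - e"] by (simp add: sum_subtractf)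
qed

text \<open>Both weighted sums come from the sum of \<open>piP m\<close> over \<open>m <= z\<close>:
  it bounds \<open>Rsum z\<close>, and \<open>Qsum z\<close> equals \<open>(M + 1) piP z\<close>
  minus it. The range below \<open>a = Y / l^5\<close> costs \<open>a^2\<close>; since
  \<open>z >= Y / (4 l^2)\<close>, this is at most \<open>64 / l^5\<close> times
  \<open>z^2 / (4 l)\<close>.\<close>

lemma window_sums:
  "\<exists>K>0. \<forall>\<^sub>F Y in at_top. \<forall>z. Y / (4 * ln Y ^ 2) \<le> z \<longrightarrow> z \<le> 2 * Y \<longrightarrow>
     z / (2 * ln Y) * (1 - K * eps Y) \<le> piP z \<and>
     Rsum z \<le> z\<^sup>2 / (4 * ln Y) * (1 + K * eps Y) \<and> Qsum z \<le> z\<^sup>2 / (4 * ln Y) * (1 + K * eps Y)"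
proof -
  obtain K where K: "K > 0" "\<forall>\<^sub>F Y in at_top. \<forall>u. Y / ln Y ^ 5 \<le> u \<longrightarrow> u \<le> 2 * Y \<longrightarrow>
     u / (2 * ln Y) * (1 - K * eps Y) \<le> piP u \<and> piP u \<le> u / (2 * ln Y) * (1 + K * eps Y)"
    using window by blast
  define K' where "K' = 5 * K + 70"
  have "((\<lambda>Y. K * eps Y) \<longlongrightarrow> 0) at_top" unfolding eps_def by real_asymp
  then have "\<forall>\<^sub>F Y in at_top. K * eps Y < 1" by (rule order_tendstoD) simp
  moreover have "\<forall>\<^sub>F Y in at_top. eps Y \<le> 1" unfolding eps_def by real_asymp
  moreover have "\<forall>\<^sub>F Y in at_top. 1 / ln Y \<le> eps Y" unfolding eps_def by real_asymp
  moreover have "\<forall>\<^sub>F Y :: real in at_top. ln Y \<ge> 1" by real_asymp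
  moreover have "\<forall>\<^sub>F Y :: real in at_top. 4 * ln Y ^ 2 / Y \<le> 1 / ln Y" by real_asymp
  moreover have "\<forall>\<^sub>F Y :: real in at_top. Y / ln Y ^ 5 \<le> Y / (4 * ln Y ^ 2)" by real_asymp
  moreover have "\<forall>\<^sub>F Y :: real in at_top. Y \<ge> 1" by (rule eventually_ge_at_top)
  moreover note K(2)
  ultimately have "\<forall>\<^sub>F Y in at_top. \<forall>z. Y / (4 * ln Y ^ 2) \<le> z \<longrightarrow> z \<le> 2 * Y \<longrightarrow>
     z / (2 * ln Y) * (1 - K' * eps Y) \<le> piP z \<and>
     Rsum z \<le> z\<^sup>2 / (4 * ln Y) * (1 + K' * eps Y) \<and> Qsum z \<le> z\<^sup>2 / (4 * ln Y) * (1 + K' * eps Y)"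
  proof eventually_elim
    case (elim Y)
    define l where "l = ln Y"
    define e where "e = eps Y"
    define a where "a = Y / l ^ 5"
    have l: "l \<ge> 1" and e1: "e \<le> 1" "1 / l \<le> e" "K * e < 1" using elim by (auto simp: l_def e_def)
    have e0: "e \<ge> 0" using e1 l by (meson divide_nonneg_nonneg le_numeral_extra(1) order_trans zero_le_one)
    have Ke: "0 \<le> K * e" "K * e \<le> 1" using K(1) e0 e1 by auto
    have a0: "a \<ge> 0" using elim l by (simp add: a_def)
    show ?case
    proof (intro allI impI)
      fix z assume z: "Y / (4 * ln Y ^ 2) \<le> z" "z \<le> 2 * Y"
      have Ylz: "Y \<le> 4 * l\<^sup>2 * z" using z l by (simp add: l_def field_simps)
      have z0: "z > 0"
      proof -
        have "Y > 0" "4 * ln Y ^ 2 > 0" using elim l by (auto simp: l_def)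
        then have "Y / (4 * ln Y ^ 2) > 0" by (rule divide_pos_pos)
        then show ?thesis using z by linarith
      qed
      have az: "a \<le> z" using elim z by (simp add: a_def l_def)
      have win: "u / (2 * l) * (1 - K * e) \<le> piP u \<and> piP u \<le> u / (2 * l) * (1 + K * e)" if "a \<le> u" "u \<le> z" for u
        using elim that z by (auto simp: a_def l_def e_def)
      define w where "w = z\<^sup>2 / (4 * l)"
      have w0: "w \<ge> 0" using l by (simp add: w_def)
      have iz: "1 / z \<le> e"
      proof -
        have "1 / z \<le> 4 * l\<^sup>2 / Y" using Ylz z0 elim by (simp add: field_simps)
        also have "\<dots> \<le> 1 / l" using elim by (simp add: l_def)
        finally show ?thesis using e1 by linarith
      qed
      have a2: "a\<^sup>2 \<le> w * (64 * e)"
      proof -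
        have "a\<^sup>2 \<le> (4 * l\<^sup>2 * z / l ^ 5)\<^sup>2" unfolding a_def using Ylz elim l by (intro power_mono divide_right_mono) auto
        also have "\<dots> = w * (64 / l ^ 5)" using l by (simp add: w_def field_simps eval_nat_numeral)
        also have "64 / l ^ 5 \<le> 64 * e"
        proof -
          have "l \<le> l ^ 5" using l power_increasing[of 1 5 l] by simp
          then have "64 / l ^ 5 \<le> 64 / l" using l by (intro divide_left_mono) auto
          then show ?thesis using e1 by simp
        qed
        finally show ?thesis using w0 by (simp add: mult_left_mono)
      qed
      define M where "M = nat \<lfloor>z\<rfloor>"
      have M: "real M \<le> z" "z \<le> real M + 1" unfolding M_def using z0 by linarith+
      have uM: "upto z = upto (real M)" using z0 by (simp add: upto_floor M_def)
      have MM: "real M * (real M + 1) / (4 * l) \<le> w * (1 + e)"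
      proof -
        have "real M * (real M + 1) \<le> z * (z + 1)" using M z0 by (intro mult_mono) auto
        also have "\<dots> = z\<^sup>2 * (1 + 1 / z)" using z0 by (simp add: power2_eq_square algebra_simps)
        also have "\<dots> \<le> z\<^sup>2 * (1 + e)" using iz by (intro mult_left_mono) auto
        finally have "real M * (real M + 1) / (4 * l) \<le> z\<^sup>2 * (1 + e) / (4 * l)" using l by (intro divide_right_mono) auto
        then show ?thesis by (simp add: w_def)
      qed
      have MM': "w * (1 - e) \<le> real M * (real M + 1) / (4 * l)"
      proof -
        have "z\<^sup>2 * (1 - e) \<le> z\<^sup>2 * (1 - 1 / z)" using iz by (intro mult_left_mono) auto
        also have "\<dots> = (z - 1) * z" using z0 by (simp add: power2_eq_square algebra_simps)
        also have "\<dots> \<le> real M * (real M + 1)"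
        proof (cases "z \<ge> 1")
          case False
          then have "(z - 1) * z \<le> 0" using z0 by (intro mult_nonpos_nonneg) auto
          also have "0 \<le> real M * (real M + 1)" by simp
          finally show ?thesis .
        qed (use M z0 in \<open>auto intro!: mult_mono\<close>)
        finally have "z\<^sup>2 * (1 - e) / (4 * l) \<le> real M * (real M + 1) / (4 * l)" using l by (intro divide_right_mono) auto
        then show ?thesis by (simp add: w_def)
      qed
      have lY: "ln Y \<ge> 1" using l by (simp add: l_def)
      note S = sum_piP_window[OF lY a0 M(1) Ke win[unfolded l_def], folded l_def]
      have KK: "e * (K * e) \<le> K * e" "K * e * e \<le> K * e" using Ke e0 e1 K(1) by (auto intro: mult_left_le_one_le mult_left_le)
      have Sup: "(\<Sum>m=1..M. piP (real m)) \<le> w * (1 + (2 * K + 65) * e)"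
      proof -
        have "real M * (real M + 1) / (4 * l) * (1 + K * e) \<le> w * (1 + e) * (1 + K * e)"
          using MM Ke by (intro mult_right_mono) auto
        also have "\<dots> = w * (1 + e + K * e + e * (K * e))" by (simp add: algebra_simps)
        also have "\<dots> \<le> w * (1 + e + K * e + K * e)" using KK w0 by (intro mult_left_mono) auto
        finally show ?thesis using S(1) a2 by (simp add: algebra_simps)
      qed
      have Slow: "w * (1 - (K + 65) * e) \<le> (\<Sum>m=1..M. piP (real m))"
      proof -
        have "w * (1 - e - K * e) \<le> w * (1 - e - K * e + e * (K * e))"
          using Ke e0 w0 by (intro mult_left_mono) auto
        also have "\<dots> = w * (1 - e) * (1 - K * e)" by (simp add: algebra_simps)
        also have "\<dots> \<le> real M * (real M + 1) / (4 * l) * (1 - K * e)"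
          using MM' Ke by (intro mult_right_mono) auto
        finally show ?thesis using S(2) a2 by (simp add: algebra_simps)
      qed
      have pi_low: "z / (2 * l) * (1 - K' * e) \<le> piP z"
      proof -
        have "K * e \<le> K' * e" using K(1) e0 by (intro mult_right_mono) (auto simp: K'_def)
        then have "z / (2 * l) * (1 - K' * e) \<le> z / (2 * l) * (1 - K * e)" using z0 l by (intro mult_left_mono) auto
        then show ?thesis using win[OF az order_refl] by linarith
      qed
      have "Rsum z = (\<Sum>q\<in>upto (real M). z - real q)" by (simp add: Rsum_def uM)
      also have "\<dots> \<le> (\<Sum>q\<in>upto (real M). real M - real q + 1)" using M by (intro sum_mono) auto
      also have "\<dots> = (\<Sum>m=1..M. piP (real m))" by (rule sum_piP [symmetric])
      also note Sup
      also have "w * (1 + (2 * K + 65) * e) \<le> w * (1 + K' * e)"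
        using w0 K(1) e0 by (intro mult_left_mono add_left_mono mult_right_mono) (auto simp: K'_def)
      finally have R: "Rsum z \<le> w * (1 + K' * e)" .
      have SQ: "(\<Sum>m=1..M. piP (real m)) = (real M + 1) * piP z - Qsum z"
        by (subst sum_piP) (simp add: Qsum_def uM piP_def sum.distrib sum_subtractf algebra_simps)
      have "(real M + 1) * piP z \<le> (z + 1) * (z / (2 * l) * (1 + K * e))"
        using M win[OF az order_refl] z0 by (intro mult_mono) (auto simp: piP_def)
      also have "(z + 1) * (z / (2 * l) * (1 + K * e)) = w * (2 * (1 + 1 / z) * (1 + K * e))"
        using z0 l by (simp add: w_def field_simps power2_eq_square)
      also have "\<dots> \<le> w * (2 * (1 + e) * (1 + K * e))"
        using iz w0 Ke by (intro mult_left_mono mult_right_mono) auto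
      also have "\<dots> = w * (2 + 2 * e + 2 * (K * e) + 2 * (e * (K * e)))" by (simp add: algebra_simps)
      also have "\<dots> \<le> w * (2 + 2 * e + 2 * (K * e) + 2 * (K * e))" using KK w0 by (intro mult_left_mono) auto
      finally have "Qsum z \<le> w * (2 + 2 * e + 2 * (K * e) + 2 * (K * e)) - w * (1 - (K + 65) * e)" using Slow SQ by linarith
      also have "\<dots> = w * (1 + (5 * K + 67) * e)" by (simp add: algebra_simps)
      also have "\<dots> \<le> w * (1 + K' * e)"
        using w0 K(1) e0 by (intro mult_left_mono add_left_mono mult_right_mono) (auto simp: K'_def)
      finally have Q: "Qsum z \<le> w * (1 + K' * e)" .
      show "z / (2 * ln Y) * (1 - K' * eps Y) \<le> piP z \<and>
          Rsum z \<le> z\<^sup>2 / (4 * ln Y) * (1 + K' * eps Y) \<and> Qsum z \<le> z\<^sup>2 / (4 * ln Y) * (1 + K' * eps Y)"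
        using pi_low R Q by (simp add: w_def l_def e_def)
    qed
  qed
  moreover have "K' > 0" using K by (simp add: K'_def)
  ultimately show ?thesis by blast
qed

end

section \<open>The upper bound\<close>

text \<open>The gain in \<open>ln (b + 1)\<close> when the exponent \<open>b\<close> grows from
  \<open>l - 1\<close> to \<open>l\<close>.\<close>

definition lc :: "nat \<Rightarrow> real" where "lc l = ln (1 + 1 / real l)"

definition lcS :: real where "lcS = (\<Sum>l. (ln (1 + 1 / real (Suc l)))\<^sup>2)"

lemma lc_bounds:
  assumes "l \<ge> 1" shows "1 / (2 * real l) \<le> lc l" "lc l \<le> 1 / real l" "lc l > 0"
proof -
  show "lc l > 0" unfolding lc_def using assms by (intro ln_gt_zero) auto
  show "lc l \<le> 1 / real l" unfolding lc_def using assms by (intro ln_add_one_self_le_self) auto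
  have "ln (real l / (real l + 1)) \<le> real l / (real l + 1) - 1" using assms by (intro ln_le_minus_one) auto
  moreover have "lc l = - ln (real l / (real l + 1))"
  proof -
    have "1 + 1 / real l = inverse (real l / (real l + 1))" using assms by (simp add: field_simps)
    then show ?thesis using assms by (simp add: lc_def ln_inverse del: inverse_divide)
  qed
  moreover have "real l / (real l + 1) - 1 = - (1 / (real l + 1))" using assms by (simp add: field_simps)
  moreover have "1 / (2 * real l) \<le> 1 / (real l + 1)" using assms by (intro divide_left_mono) auto
  ultimately show "1 / (2 * real l) \<le> lc l" by linarith
qed

lemma lc_antimono: "1 \<le> l \<Longrightarrow> l \<le> m \<Longrightarrow> lc m \<le> lc l"
  unfolding lc_def by (intro ln_mono add_mono divide_left_mono) (auto simp: add_pos_nonneg)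

lemma sum_lc: "(\<Sum>l=1..b. lc l) = ln (real b + 1)"
proof (induction b)
  case (Suc b)
  have "1 + 1 / real (Suc b) = (real (Suc b) + 1) / real (Suc b)" by (simp add: field_simps)
  then have "lc (Suc b) = ln ((real (Suc b) + 1) / real (Suc b))" unfolding lc_def by (rule arg_cong)
  also have "\<dots> = ln (real (Suc b) + 1) - ln (real (Suc b))" by (rule ln_divide_pos) auto
  finally show ?case using Suc by (simp add: add.commute)
qed simp

lemma sum_lc_sq_le: "(\<Sum>l=1..L. (lc l)\<^sup>2) \<le> lcS"
proof -
  have "(\<Sum>l=1..L. (lc l)\<^sup>2) = (\<Sum>l<L. (ln (1 + 1 / real (Suc l)))\<^sup>2)"
    by (simp add: lc_def sum.atLeast1_atMost_eq lessThan_def)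
  also have "\<dots> \<le> lcS" unfolding lcS_def by (intro sum_le_suminf summable_ln_sq) auto
  finally show ?thesis .
qed

lemma lcS_pos: "lcS > 0"
proof -
  have "(lc 1)\<^sup>2 > 0" using lc_bounds(3)[of 1] by simp
  also have "(lc 1)\<^sup>2 \<le> lcS" using sum_lc_sq_le[of 1] by simp
  finally show ?thesis .
qed

lemma sum_inverse_squares_tail: "L1 \<ge> 1 \<Longrightarrow> (\<Sum>l\<in>{L1<..L}. 1 / (real l)\<^sup>2) \<le> 1 / real L1"
proof -
  assume L1: "L1 \<ge> 1"
  have "(\<Sum>l\<in>{L1<..L1 + d}. 1 / (real l)\<^sup>2) \<le> 1 / real L1 - 1 / real (L1 + d)" for d
  proof (induction d)
    case (Suc d)
    have "{L1<..L1 + Suc d} = insert (L1 + Suc d) {L1<..L1 + d}" by auto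
    then have "(\<Sum>l\<in>{L1<..L1 + Suc d}. 1 / (real l)\<^sup>2) = 1 / (real (L1 + Suc d))\<^sup>2 + (\<Sum>l\<in>{L1<..L1 + d}. 1 / (real l)\<^sup>2)" by simp
    moreover have "1 / (real (L1 + Suc d))\<^sup>2 \<le> 1 / real (L1 + d) - 1 / real (L1 + Suc d)"
    proof -
      define t where "t = real (L1 + d)"
      have t: "t \<ge> 1" using L1 by (simp add: t_def)
      have "1 / (t + 1)\<^sup>2 \<le> 1 / (t * (t + 1))" using t by (intro divide_left_mono) (auto simp: power2_eq_square)
      also have "\<dots> = 1 / t - 1 / (t + 1)" using t by (simp add: field_simps)
      finally show ?thesis by (simp add: t_def add.commute)
    qed
    ultimately show ?case using Suc by linarith
  qed simp
  from this[of "L - L1"] show ?thesis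
  proof (cases "L1 \<le> L")
    case True
    then show ?thesis using \<open>(\<Sum>l\<in>{L1<..L1 + (L - L1)}. 1 / (real l)\<^sup>2) \<le> 1 / real L1 - 1 / real (L1 + (L - L1))\<close>
      by (smt (verit) divide_nonneg_nonneg le_add_diff_inverse of_nat_0_le_iff)
  qed (simp add: L1)
qed

lemma sum_split_at:
  fixes h :: "nat \<Rightarrow> real"
  shows "(\<Sum>l=1..L. h l) = (\<Sum>l\<in>{1..min L L1}. h l) + (\<Sum>l\<in>{L1<..L}. h l)"
proof -
  have "{1..L} = {1..min L L1} \<union> {L1<..L}" by auto
  moreover have "{1..min L L1} \<inter> {L1<..L} = {}" by auto
  ultimately show ?thesis by (simp add: sum.union_disjoint)
qed

lemma lcS_le: "L1 \<ge> 1 \<Longrightarrow> lcS \<le> (\<Sum>l=1..L1. (lc l)\<^sup>2) + 1 / real L1"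
proof -
  assume L1: "L1 \<ge> 1"
  have "(\<Sum>l<L. (ln (1 + 1 / real (Suc l)))\<^sup>2) \<le> (\<Sum>l=1..L1. (lc l)\<^sup>2) + 1 / real L1" for L
  proof -
    have "(\<Sum>l<L. (ln (1 + 1 / real (Suc l)))\<^sup>2) = (\<Sum>l=1..L. (lc l)\<^sup>2)"
      by (simp add: lc_def sum.atLeast1_atMost_eq lessThan_def)
    also have "\<dots> = (\<Sum>l\<in>{1..min L L1}. (lc l)\<^sup>2) + (\<Sum>l\<in>{L1<..L}. (lc l)\<^sup>2)" by (rule sum_split_at)
    also have "(\<Sum>l\<in>{1..min L L1}. (lc l)\<^sup>2) \<le> (\<Sum>l=1..L1. (lc l)\<^sup>2)" by (intro sum_mono2) auto
    also have "(\<Sum>l\<in>{L1<..L}. (lc l)\<^sup>2) \<le> (\<Sum>l\<in>{L1<..L}. 1 / (real l)\<^sup>2)"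
    proof (intro sum_mono)
      fix l assume "l \<in> {L1<..L}"
      then have "(lc l)\<^sup>2 \<le> (1 / real l)\<^sup>2" using lc_bounds[of l] L1 by (intro power_mono) auto
      then show "(lc l)\<^sup>2 \<le> 1 / (real l)\<^sup>2" by (simp add: power_divide)
    qed
    also have "\<dots> \<le> 1 / real L1" by (rule sum_inverse_squares_tail[OF L1])
    finally show ?thesis by simp
  qed
  then show ?thesis unfolding lcS_def by (intro suminf_le_const summable_ln_sq)
qed

text \<open>Serves for \<open>H\<close> built from \<open>Rsum\<close> and from \<open>Qsum\<close>.
  Up to \<open>L1\<close>, about \<open>t^2\<close>, the asymptotic bound holds and its sum is
  governed by \<open>lcS\<close>. Beyond \<open>L1\<close> the crude bound sums to at most
  \<open>4 Y^2 * 2 / t^2\<close>, which is \<open>32 / t\<close> in units of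
  \<open>Y^2 / (4 t)\<close>.\<close>

lemma profile_sum:
  assumes Y: "Y > 0" "t \<ge> 2" and L1: "L1 = nat \<lfloor>t ^ 2\<rfloor>" and k: "k \<ge> 0"
    and main: "\<And>l. 1 \<le> l \<Longrightarrow> l \<le> L1 \<Longrightarrow> l \<le> L \<Longrightarrow> H l \<le> (Y * lc l)\<^sup>2 / (4 * t) * (1 + k)"
    and tail: "\<And>l. 1 \<le> l \<Longrightarrow> l \<le> L \<Longrightarrow> H l \<le> 4 * Y\<^sup>2 / (real l)\<^sup>2"
  shows "(\<Sum>l=1..L. H l) \<le> Y\<^sup>2 / (4 * t) * (lcS * (1 + k) + 32 / t)"
proof -
  have Y0: "0 \<le> Y\<^sup>2 / (4 * t)" by (intro divide_nonneg_nonneg zero_le_power2) (use Y in linarith)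
  have l4: "t ^ 2 \<ge> 4" using power_mono[OF Y(2), of 2] by simp
  have L1b: "real L1 \<ge> t ^ 2 / 2" "L1 \<ge> 1" unfolding L1 using l4 by linarith+
  have "(\<Sum>l\<in>{1..min L L1}. H l) \<le> (\<Sum>l\<in>{1..min L L1}. (Y * lc l)\<^sup>2 / (4 * t) * (1 + k))"
    by (intro sum_mono main) auto
  also have "\<dots> = Y\<^sup>2 / (4 * t) * ((\<Sum>l\<in>{1..min L L1}. (lc l)\<^sup>2) * (1 + k))"
    by (simp add: sum_distrib_left sum_distrib_right power_mult_distrib mult_ac)
  also have "\<dots> \<le> Y\<^sup>2 / (4 * t) * (lcS * (1 + k))"
    using k sum_lc_sq_le[of "min L L1"] Y0 by (intro mult_left_mono mult_right_mono) auto
  finally have 1: "(\<Sum>l\<in>{1..min L L1}. H l) \<le> Y\<^sup>2 / (4 * t) * (lcS * (1 + k))" .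
  have "(\<Sum>l\<in>{L1<..L}. H l) \<le> (\<Sum>l\<in>{L1<..L}. 4 * Y\<^sup>2 * (1 / (real l)\<^sup>2))"
    using tail L1b by (intro sum_mono) force
  also have "\<dots> = 4 * Y\<^sup>2 * (\<Sum>l\<in>{L1<..L}. 1 / (real l)\<^sup>2)" by (simp only: sum_distrib_left)
  also have "\<dots> \<le> 4 * Y\<^sup>2 * (1 / real L1)" by (intro mult_left_mono sum_inverse_squares_tail L1b) auto
  also have "\<dots> \<le> 4 * Y\<^sup>2 * (1 / (t ^ 2 / 2))" using L1b Y by (intro mult_left_mono divide_left_mono) auto
  also have "\<dots> = Y\<^sup>2 / (4 * t) * (32 / t)" using Y by (simp add: field_simps power2_eq_square)
  finally have 2: "(\<Sum>l\<in>{L1<..L}. H l) \<le> Y\<^sup>2 / (4 * t) * (32 / t)" .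
  show ?thesis unfolding sum_split_at[of H L L1] using 1 2 by (simp add: distrib_left)
qed

section \<open>Prime factors of an integer and their cost\<close>

lemma prod_ge_1_plus_sum:
  fixes y :: "'a \<Rightarrow> real"
  assumes "finite A" "\<And>i. i \<in> A \<Longrightarrow> y i \<ge> 0"
  shows "1 + (\<Sum>i\<in>A. y i) \<le> (\<Prod>i\<in>A. 1 + y i)"
  using assms
proof (induction A rule: finite_induct)
  case (insert i A)
  have "1 + (\<Sum>i\<in>insert i A. y i) \<le> (1 + y i) * (1 + (\<Sum>i\<in>A. y i))"
    using insert by (auto simp: algebra_simps intro!: mult_nonneg_nonneg sum_nonneg)
  also have "\<dots> \<le> (1 + y i) * (\<Prod>i\<in>A. 1 + y i)" using insert by (intro mult_left_mono) auto
  finally show ?case using insert by simp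
qed simp

lemma real_prod_prime_factors:
  assumes "k > 0" shows "real k = (\<Prod>q\<in>prime_factors k. real q ^ multiplicity q k)"
  using assms prime_factorization_nat[of k] by (metis (mono_tags, lifting) of_nat_prod of_nat_power prod.cong)

lemma prime_factors_real_ge_2: "q \<in> prime_factors k \<Longrightarrow> real q \<ge> 2"
  by (metis in_prime_factors_iff of_nat_le_iff of_nat_numeral prime_ge_2_nat)

lemma ln_eq_sum_prime_factors:
  assumes "k > 0" shows "ln (real k) = (\<Sum>q\<in>prime_factors k. real (multiplicity q k) * ln (real q))"
proof -
  have "ln (real k) = ln (\<Prod>q\<in>prime_factors k. real q ^ multiplicity q k)"
    using real_prod_prime_factors[OF assms] by simp
  also have "\<dots> = (\<Sum>q\<in>prime_factors k. ln (real q ^ multiplicity q k))"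
    by (intro ln_prod) (auto simp: in_prime_factors_iff prime_gt_0_nat)
  also have "\<dots> = (\<Sum>q\<in>prime_factors k. real (multiplicity q k) * ln (real q))"
    by (intro sum.cong refl ln_realpow)
  finally show ?thesis .
qed

text \<open>An exponent \<open>k - 1\<close> in \<open>n\<close> creates the factor \<open>k\<close>
  of \<open>f n\<close>; it costs at least as much as creating each prime factor \<open>q\<close> of
  \<open>k\<close> separately by an exponent \<open>q - 1\<close>. Bernoulli's inequality handles
  the power of one prime, and a product of numbers \<open>1 + y\<close> is at least 1 plus their
  sum.\<close>

lemma sum_multiplicity_le:
  assumes "k > 0" shows "(\<Sum>q\<in>prime_factors k. real (multiplicity q k) * (real q - 1)) \<le> real k - 1"
proof -
  have "1 + (\<Sum>q\<in>prime_factors k. real (multiplicity q k) * (real q - 1)) \<le>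
      (\<Prod>q\<in>prime_factors k. 1 + real (multiplicity q k) * (real q - 1))"
    using prime_factors_real_ge_2 by (intro prod_ge_1_plus_sum) force+
  also have "\<dots> \<le> (\<Prod>q\<in>prime_factors k. real q ^ multiplicity q k)"
  proof (rule prod_mono, intro conjI)
    fix q assume "q \<in> prime_factors k"
    then have q: "real q \<ge> 2" by (rule prime_factors_real_ge_2)
    then show "0 \<le> 1 + real (multiplicity q k) * (real q - 1)" by (simp add: add_nonneg_nonneg)
    show "1 + real (multiplicity q k) * (real q - 1) \<le> real q ^ multiplicity q k"
      using Bernoulli_inequality[of "real q - 1" "multiplicity q k"] q by simp
  qed
  also have "\<dots> = real k" using real_prod_prime_factors[OF assms] by simp
  finally show ?thesis by simp
qed

lemma sum_multiplicity_restrict: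
  fixes h :: "nat \<Rightarrow> real"
  assumes "finite B" "\<And>q. q \<in> B \<Longrightarrow> prime q" "\<And>q. q \<in> prime_factors k \<Longrightarrow> h q \<ge> 0" "k > 0"
  shows "(\<Sum>q\<in>B. real (multiplicity q k) * h q) \<le> (\<Sum>q\<in>prime_factors k. real (multiplicity q k) * h q)"
proof -
  have "(\<Sum>q\<in>B. real (multiplicity q k) * h q) = (\<Sum>q\<in>B \<inter> prime_factors k. real (multiplicity q k) * h q)"
  proof (rule sum.mono_neutral_right)
    show "\<forall>q\<in>B - B \<inter> prime_factors k. real (multiplicity q k) * h q = 0"
    proof
      fix q assume q: "q \<in> B - B \<inter> prime_factors k"
      then have "\<not> q dvd k" using assms by (auto simp: in_prime_factors_iff)
      then show "real (multiplicity q k) * h q = 0" by (simp add: not_dvd_imp_multiplicity_0)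
    qed
  qed (use assms in auto)
  also have "\<dots> \<le> (\<Sum>q\<in>prime_factors k. real (multiplicity q k) * h q)"
    using assms by (intro sum_mono2) auto
  finally show ?thesis .
qed

text \<open>\<open>F_eq\<close> is restricted to nonzero values because an odd exponent at an inert
  prime makes \<open>F n\<close> vanish, which a product over split primes cannot show.\<close>

locale split_count = prime_density +
  fixes F :: "nat \<Rightarrow> nat"
  assumes P_prime: "\<And>q. q \<in> P \<Longrightarrow> prime q"
    and F_0: "F 0 = 1"
    and F_eq: "\<And>n. n > 0 \<Longrightarrow> F n \<noteq> 0 \<Longrightarrow> F n = (\<Prod>p\<in>prime_factors n \<inter> P. multiplicity p n + 1)"
    and F_split: "\<And>n. n > 0 \<Longrightarrow> prime_factors n \<subseteq> P \<Longrightarrow> F n = (\<Prod>p\<in>prime_factors n. multiplicity p n + 1)"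
begin

lemma Rsum_le: "u \<ge> 0 \<Longrightarrow> Rsum u \<le> u\<^sup>2"
proof -
  assume u: "u \<ge> 0"
  have "Rsum u \<le> (\<Sum>q\<in>upto u. u)" unfolding Rsum_def by (intro sum_mono) auto
  also have "\<dots> = piP u * u" by (simp add: piP_def)
  also have "\<dots> \<le> u * u" using piP_le[OF u] u by (intro mult_right_mono) auto
  finally show ?thesis by (simp add: power2_eq_square)
qed

lemma Qsum_le: "u \<ge> 0 \<Longrightarrow> Qsum u \<le> u\<^sup>2"
proof -
  assume u: "u \<ge> 0"
  have "Qsum u \<le> (\<Sum>q\<in>upto u. u)" unfolding Qsum_def by (intro sum_mono) (auto simp: upto_def)
  also have "\<dots> = piP u * u" by (simp add: piP_def)
  also have "\<dots> \<le> u * u" using piP_le[OF u] u by (intro mult_right_mono) auto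
  finally show ?thesis by (simp add: power2_eq_square)
qed

lemma sum_max_le_Rsum:
  assumes "finite B" "B \<subseteq> P" shows "(\<Sum>q\<in>B. max 0 (u - real q)) \<le> Rsum u"
proof -
  have "(\<Sum>q\<in>B. max 0 (u - real q)) = (\<Sum>q\<in>B \<inter> upto u. max 0 (u - real q))"
    using assms by (intro sum.mono_neutral_right) (auto simp: upto_def)
  also have "\<dots> = (\<Sum>q\<in>B \<inter> upto u. u - real q)" by (intro sum.cong) (auto simp: upto_def)
  also have "\<dots> \<le> Rsum u" unfolding Rsum_def using finite_upto by (intro sum_mono2) (auto simp: upto_def)
  finally show ?thesis .
qed

text \<open>Lagrangian duality with multiplier \<open>1 / Y\<close> for the concave problem of maximising
  \<open>\<Sum> ln (b\<^sub>q + 1)\<close> under a bound on \<open>\<Sum> b\<^sub>q (q - 1)\<close>.\<close>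

lemma ln_Suc_dual:
  assumes Y: "Y \<ge> 1" and q: "q \<ge> 2"
  shows "ln (real b + 1) \<le> real b * (real q - 1) / Y + (1 / Y) * (\<Sum>l=1..nat \<lfloor>Y\<rfloor>. max 0 (Y * lc l + 1 - real q))"
proof -
  let ?L = "nat \<lfloor>Y\<rfloor>" and ?m = "\<lambda>l. max 0 (Y * lc l + 1 - real q)"
  have "ln (real b + 1) = (\<Sum>l=1..b. lc l)" by (rule sum_lc [symmetric])
  also have "\<dots> \<le> (\<Sum>l=1..b. (real q - 1) / Y + (1 / Y) * ?m l)"
  proof (rule sum_mono)
    fix l
    have "lc l = (real q - 1) / Y + (1 / Y) * (Y * lc l + 1 - real q)" using Y by (simp add: field_simps)
    also have "\<dots> \<le> (real q - 1) / Y + (1 / Y) * ?m l" using Y by (intro add_left_mono mult_left_mono) auto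
    finally show "lc l \<le> (real q - 1) / Y + (1 / Y) * ?m l" .
  qed
  also have "\<dots> = real b * (real q - 1) / Y + (1 / Y) * (\<Sum>l=1..b. ?m l)"
    by (simp add: sum.distrib sum_distrib_left)
  also have "(\<Sum>l=1..b. ?m l) \<le> (\<Sum>l=1..?L. ?m l)"
  proof -
    have "(\<Sum>l=1..b. ?m l) \<le> (\<Sum>l=1..max b ?L. ?m l)" by (intro sum_mono2) auto
    also have "\<dots> = (\<Sum>l=1..?L. ?m l)"
    proof (rule sum.mono_neutral_right)
      show "\<forall>l\<in>{1..max b ?L} - {1..?L}. ?m l = 0"
      proof
        fix l assume l: "l \<in> {1..max b ?L} - {1..?L}"
        then have "real l > Y" using Y by auto linarith
        then have "Y * (1 / real l) \<le> 1" using Y by simp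
        moreover have "Y * lc l \<le> Y * (1 / real l)" using l lc_bounds(2)[of l] Y by (intro mult_left_mono) auto
        moreover have "real q \<ge> 2" using q by simp
        ultimately show "?m l = 0" by (simp add: max_def)
      qed
    qed auto
    finally show ?thesis .
  qed
  finally show ?thesis using Y by (simp add: divide_right_mono)
qed

text \<open>The split primes of \<open>n\<close> are cut at \<open>y0\<close>. Above
  \<open>y0\<close> the exponents sum to at most \<open>X / ln y0\<close>, and
  \<open>sum_multiplicity_le\<close> turns this into the linear budget of the dual inequality. Up to
  \<open>y0\<close> there are at most \<open>y0\<close> primes, and each \<open>e p + 1\<close> has
  at most \<open>ln (2 X + 1) / ln 2\<close> prime factors with multiplicity.\<close>

lemma upper_core:
  assumes n: "n \<ge> 1" and X: "ln (real n) \<le> X" and y0: "y0 > 1" and Y: "Y \<ge> 1"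
    and nz: "F n \<noteq> 0" "F (F n) \<noteq> 0"
  shows "ln (real (F (F n))) \<le> X / ln y0 / Y + (1 / Y) * (\<Sum>l=1..nat \<lfloor>Y\<rfloor>. Rsum (Y * lc l + 1)) +
     y0 * ln (2 * X + 1) / ln 2"
proof -
  define A where "A = prime_factors n \<inter> P"
  define e where "e p = multiplicity p n" for p
  define m where "m = F n"
  define B where "B = prime_factors m \<inter> P"
  define A1 where "A1 = {p \<in> A. real p \<le> y0}"
  define A2 where "A2 = {p \<in> A. real p > y0}"
  define av where "av q = (\<Sum>p\<in>A1. multiplicity q (e p + 1))" for q
  define bv where "bv q = (\<Sum>p\<in>A2. multiplicity q (e p + 1))" for q
  have n0: "n > 0" using n by simp
  have finA: "finite A" "finite A1" "finite A2" "finite B" by (auto simp: A_def A1_def A2_def B_def)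
  have A12: "A = A1 \<union> A2" "A1 \<inter> A2 = {}" by (auto simp: A1_def A2_def)
  have Aprime: "prime p" if "p \<in> A" for p using that by (auto simp: A_def)
  have Bprime: "prime q" if "q \<in> B" for q using that by (auto simp: B_def)
  have B2: "real q \<ge> 2" if "q \<in> B" for q using prime_ge_2_nat[OF Bprime[OF that]] by simp
  have m_eq: "m = (\<Prod>p\<in>A. e p + 1)" unfolding m_def A_def e_def by (rule F_eq[OF n0 nz(1)])
  have m0: "m > 0" using nz by (simp add: m_def)
  have X0: "X \<ge> 0"
  proof -
    have "0 \<le> ln (real n)" using n by simp
    then show ?thesis using X by linarith
  qed
  have vq: "multiplicity q m = av q + bv q" if "q \<in> B" for q
  proof -
    have "multiplicity q m = (\<Sum>p\<in>A. multiplicity q (e p + 1))"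
      unfolding m_eq using Bprime[OF that] finA by (intro prime_elem_multiplicity_prod_distrib) auto
    also have "\<dots> = av q + bv q" unfolding av_def bv_def A12(1) using finA A12(2) by (intro sum.union_disjoint)
    finally show ?thesis .
  qed
  have "ln (real (F m)) = ln (\<Prod>q\<in>B. real (multiplicity q m) + 1)"
  proof -
    have "F m = (\<Prod>q\<in>B. multiplicity q m + 1)" unfolding B_def using m0 nz by (intro F_eq) (auto simp: m_def)
    then have "real (F m) = (\<Prod>q\<in>B. real (multiplicity q m) + 1)" by (simp add: add.commute)
    then show ?thesis by simp
  qed
  also have "\<dots> = (\<Sum>q\<in>B. ln (real (multiplicity q m) + 1))"
    using finA by (intro ln_prod) (auto intro: add_nonneg_pos)
  also have "\<dots> \<le> (\<Sum>q\<in>B. ln (real (bv q) + 1) + real (av q))"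
  proof (rule sum_mono)
    fix q assume q: "q \<in> B"
    \<comment> \<open>Splits off the part \<open>av q\<close> that small primes create, so that the
      dual inequality is applied to \<open>bv q\<close> alone.\<close>
    have "real (multiplicity q m) + 1 \<le> (real (bv q) + 1) * (real (av q) + 1)"
      unfolding vq[OF q] by (simp add: algebra_simps)
    then have "ln (real (multiplicity q m) + 1) \<le> ln ((real (bv q) + 1) * (real (av q) + 1))"
      by (intro ln_mono) (auto intro: add_nonneg_pos mult_pos_pos)
    also have "\<dots> = ln (real (bv q) + 1) + ln (1 + real (av q))"
      by (subst ln_mult_pos) (auto simp: add.commute)
    also have "ln (1 + real (av q)) \<le> real (av q)" by (intro ln_add_one_self_le_self) auto
    finally show "ln (real (multiplicity q m) + 1) \<le> ln (real (bv q) + 1) + real (av q)" by simp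
  qed
  also have "\<dots> = (\<Sum>q\<in>B. ln (real (bv q) + 1)) + (\<Sum>q\<in>B. real (av q))" by (rule sum.distrib)
  also have "(\<Sum>q\<in>B. real (av q)) \<le> y0 * ln (2 * X + 1) / ln 2"
  proof -
    have "(\<Sum>q\<in>B. real (av q)) = (\<Sum>p\<in>A1. \<Sum>q\<in>B. real (multiplicity q (e p + 1)))"
      unfolding av_def by (simp only: of_nat_sum) (rule sum.swap)
    also have "\<dots> \<le> (\<Sum>p\<in>A1. ln (2 * X + 1) / ln 2)"
    proof (rule sum_mono)
      fix p assume p: "p \<in> A1"
      then have pA: "p \<in> A" by (simp add: A1_def)
      have "(\<Sum>q\<in>B. real (multiplicity q (e p + 1)) * 1) \<le> (\<Sum>q\<in>prime_factors (e p + 1). real (multiplicity q (e p + 1)) * 1)"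
        using finA Bprime by (intro sum_multiplicity_restrict) auto
      moreover have "(\<Sum>q\<in>prime_factors (e p + 1). real (multiplicity q (e p + 1)) * 1) * ln 2 \<le> ln (real (e p + 1))"
      proof -
        have "(\<Sum>q\<in>prime_factors (e p + 1). real (multiplicity q (e p + 1)) * 1) * ln 2 =
            (\<Sum>q\<in>prime_factors (e p + 1). real (multiplicity q (e p + 1)) * ln 2)" by (simp add: sum_distrib_right)
        also have "\<dots> \<le> (\<Sum>q\<in>prime_factors (e p + 1). real (multiplicity q (e p + 1)) * ln (real q))"
          using prime_factors_real_ge_2 by (intro sum_mono mult_left_mono ln_mono) force+
        also have "\<dots> = ln (real (e p + 1))" by (rule ln_eq_sum_prime_factors [symmetric]) simp
        finally show ?thesis .
      qed
      moreover have "ln (real (e p + 1)) \<le> ln (2 * X + 1)"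
      proof -
        have "real (e p) * ln (real p) \<le> (\<Sum>p\<in>prime_factors n. real (multiplicity p n) * ln (real p))"
          unfolding e_def using pA prime_factors_real_ge_2[of _ n]
          by (intro member_le_sum) (force simp: A_def intro!: mult_nonneg_nonneg ln_ge_zero)+
        also have "\<dots> = ln (real n)" by (rule ln_eq_sum_prime_factors[OF n0, symmetric])
        finally have 1: "real (e p) * ln (real p) \<le> X" using X by linarith
        have "real p \<ge> 2" using prime_ge_2_nat[OF Aprime[OF pA]] by simp
        then have "ln 2 \<le> ln (real p)" by (intro ln_mono) auto
        then have "1 / 2 \<le> ln (real p)" using ln2_ge_two_thirds by linarith
        then have "real (e p) * (1 / 2) \<le> real (e p) * ln (real p)" by (intro mult_left_mono) auto
        then have "real (e p) \<le> 2 * X" using 1 by linarith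
        then show ?thesis by (intro ln_mono) (auto intro: add_nonneg_pos)
      qed
      ultimately have "(\<Sum>q\<in>B. real (multiplicity q (e p + 1))) * ln 2 \<le> ln (2 * X + 1)"
        by (smt (verit) ln_gt_zero mult_right_mono mult.right_neutral sum.cong)
      then show "(\<Sum>q\<in>B. real (multiplicity q (e p + 1))) \<le> ln (2 * X + 1) / ln 2"
        by (simp add: pos_le_divide_eq)
    qed
    also have "\<dots> = real (card A1) * (ln (2 * X + 1) / ln 2)" by simp
    also have "\<dots> \<le> y0 * (ln (2 * X + 1) / ln 2)"
    proof (intro mult_right_mono)
      have "A1 \<subseteq> upto y0" by (auto simp: A1_def A_def upto_def)
      then have "real (card A1) \<le> piP y0" unfolding piP_def using finite_upto by (simp add: card_mono)
      also have "\<dots> \<le> y0" using y0 by (intro piP_le) auto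
      finally show "real (card A1) \<le> y0" .
      show "0 \<le> ln (2 * X + 1) / ln 2" using X0 by (intro divide_nonneg_nonneg ln_ge_zero) auto
    qed
    finally show ?thesis by simp
  qed
  also have "(\<Sum>q\<in>B. ln (real (bv q) + 1)) \<le> X / ln y0 / Y + (1 / Y) * (\<Sum>l=1..nat \<lfloor>Y\<rfloor>. Rsum (Y * lc l + 1))"
  proof -
    let ?m = "\<lambda>l q. max 0 (Y * lc l + 1 - real q)"
    have "(\<Sum>q\<in>B. ln (real (bv q) + 1)) \<le> (\<Sum>q\<in>B. real (bv q) * (real q - 1) / Y + (1 / Y) * (\<Sum>l=1..nat \<lfloor>Y\<rfloor>. ?m l q))"
      using Bprime prime_ge_2_nat by (intro sum_mono ln_Suc_dual Y) auto
    also have "\<dots> = (\<Sum>q\<in>B. real (bv q) * (real q - 1)) / Y + (1 / Y) * (\<Sum>q\<in>B. \<Sum>l=1..nat \<lfloor>Y\<rfloor>. ?m l q)"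
      by (simp add: sum.distrib sum_divide_distrib)
    also have "(\<Sum>q\<in>B. \<Sum>l=1..nat \<lfloor>Y\<rfloor>. ?m l q) = (\<Sum>l=1..nat \<lfloor>Y\<rfloor>. \<Sum>q\<in>B. ?m l q)" by (rule sum.swap)
    also have "(\<Sum>q\<in>B. real (bv q) * (real q - 1)) / Y + (1 / Y) * (\<Sum>l=1..nat \<lfloor>Y\<rfloor>. \<Sum>q\<in>B. ?m l q) \<le>
        X / ln y0 / Y + (1 / Y) * (\<Sum>l=1..nat \<lfloor>Y\<rfloor>. Rsum (Y * lc l + 1))"
    proof (intro add_mono divide_right_mono mult_left_mono sum_mono)
      show "(\<Sum>q\<in>B. ?m l q) \<le> Rsum (Y * lc l + 1)" for l
        using finA by (intro sum_max_le_Rsum) (auto simp: B_def)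
      have "(\<Sum>q\<in>B. real (bv q) * (real q - 1)) = (\<Sum>q\<in>B. \<Sum>p\<in>A2. real (multiplicity q (e p + 1)) * (real q - 1))"
        unfolding bv_def by (simp add: sum_distrib_right)
      also have "\<dots> = (\<Sum>p\<in>A2. \<Sum>q\<in>B. real (multiplicity q (e p + 1)) * (real q - 1))" by (rule sum.swap)
      also have "\<dots> \<le> (\<Sum>p\<in>A2. real (e p))"
      proof (rule sum_mono)
        fix p
        have "(\<Sum>q\<in>B. real (multiplicity q (e p + 1)) * (real q - 1)) \<le>
            (\<Sum>q\<in>prime_factors (e p + 1). real (multiplicity q (e p + 1)) * (real q - 1))"
          using finA Bprime prime_factors_real_ge_2 by (intro sum_multiplicity_restrict) force+
        also have "\<dots> \<le> real (e p + 1) - 1" by (rule sum_multiplicity_le) simp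
        finally show "(\<Sum>q\<in>B. real (multiplicity q (e p + 1)) * (real q - 1)) \<le> real (e p)" by simp
      qed
      finally have 1: "(\<Sum>q\<in>B. real (bv q) * (real q - 1)) \<le> (\<Sum>p\<in>A2. real (e p))" .
      have "(\<Sum>p\<in>A2. real (e p)) * ln y0 = (\<Sum>p\<in>A2. real (e p) * ln y0)" by (simp add: sum_distrib_right)
      also have "\<dots> \<le> (\<Sum>p\<in>A2. real (e p) * ln (real p))"
        using y0 by (intro sum_mono mult_left_mono ln_mono) (auto simp: A2_def)
      also have "\<dots> \<le> (\<Sum>p\<in>prime_factors n. real (e p) * ln (real p))"
        using prime_factors_real_ge_2[of _ n]
        by (intro sum_mono2) (force simp: A2_def A_def intro!: mult_nonneg_nonneg ln_ge_zero)+
      also have "\<dots> = ln (real n)" unfolding e_def by (rule ln_eq_sum_prime_factors[OF n0, symmetric])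
      finally have "(\<Sum>p\<in>A2. real (e p)) * ln y0 \<le> X" using X by linarith
      then have "(\<Sum>p\<in>A2. real (e p)) \<le> X / ln y0" using y0 by (simp add: pos_le_divide_eq)
      then show "(\<Sum>q\<in>B. real (bv q) * (real q - 1)) \<le> X / ln y0" using 1 by linarith
    qed (use Y in auto)
    finally show ?thesis .
  qed
  finally show ?thesis by (simp add: m_def)
qed

text \<open>The 1 in \<open>Y * lc l + 1\<close> comes from the cost \<open>q - 1\<close>. For
  \<open>l <= t^2\<close> one has \<open>Y * lc l >= Y / (2 t^2)\<close>, so this 1 is absorbed by a
  factor \<open>1 + d\<close> with \<open>d = 2 t^2 / Y\<close>.\<close>

lemma sum_Rsum_bound:
  "\<exists>K>0. \<forall>\<^sub>F Y in at_top. (\<Sum>l=1..nat \<lfloor>Y\<rfloor>. Rsum (Y * lc l + 1)) \<le>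
      Y\<^sup>2 / (4 * ln Y) * (lcS * ((1 + 2 * ln Y ^ 2 / Y)\<^sup>2 * (1 + K * eps Y)) + 32 / ln Y)"
proof -
  obtain K where K: "K > 0" "\<forall>\<^sub>F Y in at_top. \<forall>z. Y / (4 * ln Y ^ 2) \<le> z \<longrightarrow> z \<le> 2 * Y \<longrightarrow>
     z / (2 * ln Y) * (1 - K * eps Y) \<le> piP z \<and>
     Rsum z \<le> z\<^sup>2 / (4 * ln Y) * (1 + K * eps Y) \<and> Qsum z \<le> z\<^sup>2 / (4 * ln Y) * (1 + K * eps Y)"
    using window_sums by blast
  have "\<forall>\<^sub>F Y :: real in at_top. ln Y \<ge> 2" by real_asymp
  moreover have "\<forall>\<^sub>F Y in at_top. eps Y \<ge> 0" unfolding eps_def by real_asymp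
  moreover have "\<forall>\<^sub>F Y :: real in at_top. Y \<ge> 1" by (rule eventually_ge_at_top)
  moreover note K(2)
  ultimately have "\<forall>\<^sub>F Y in at_top. (\<Sum>l=1..nat \<lfloor>Y\<rfloor>. Rsum (Y * lc l + 1)) \<le>
      Y\<^sup>2 / (4 * ln Y) * (lcS * ((1 + 2 * ln Y ^ 2 / Y)\<^sup>2 * (1 + K * eps Y)) + 32 / ln Y)"
  proof eventually_elim
    case (elim Y)
    define t where "t = ln Y"
    define d where "d = 2 * t ^ 2 / Y"
    define k where "k = (1 + d)\<^sup>2 * (1 + K * eps Y) - 1"
    have t: "t \<ge> 2" and Y: "Y \<ge> 1" "Y > 0" and e: "eps Y \<ge> 0" using elim by (auto simp: t_def)
    have d0: "d \<ge> 0" using Y by (simp add: d_def)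
    have Ke: "K * eps Y \<ge> 0" using K(1) e by simp
    have "1 * 1 \<le> (1 + d)\<^sup>2 * (1 + K * eps Y)" using d0 Ke by (intro mult_mono) (auto simp: one_le_power)
    then have k0: "k \<ge> 0" by (simp add: k_def)
    have "(\<Sum>l=1..nat \<lfloor>Y\<rfloor>. Rsum (Y * lc l + 1)) \<le> Y\<^sup>2 / (4 * t) * (lcS * (1 + k) + 32 / t)"
    proof (rule profile_sum[OF Y(2) t refl k0])
      fix l assume l: "1 \<le> l" "l \<le> nat \<lfloor>t ^ 2\<rfloor>" "l \<le> nat \<lfloor>Y\<rfloor>"
      have lt: "real l \<le> t ^ 2" using l(2) by (simp add: le_nat_iff le_floor_iff)
      define z where "z = Y * lc l"
      have zl: "z \<ge> Y / (2 * real l)"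
        using mult_left_mono[OF lc_bounds(1)[OF l(1)], of Y] Y by (simp add: z_def)
      have "Y / (2 * t ^ 2) \<le> Y / (2 * real l)" using lt l Y t by (intro divide_left_mono) auto
      then have zt: "Y / (2 * t ^ 2) \<le> z" using zl by linarith
      have z0: "z > 0" using Y lc_bounds(3)[OF l(1)] by (simp add: z_def)
      have "z \<le> Y * (1 / real l)" unfolding z_def using lc_bounds(2)[OF l(1)] Y by (intro mult_left_mono) auto
      also have "\<dots> \<le> Y * 1" using l Y by (intro mult_left_mono) auto
      finally have zY: "z + 1 \<le> 2 * Y" using Y by simp
      have "Y / (4 * t ^ 2) \<le> Y / (2 * t ^ 2)" using Y t by (intro divide_left_mono) auto
      then have "Y / (4 * ln Y ^ 2) \<le> z + 1" using zt unfolding t_def by linarith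
      then have "Rsum (z + 1) \<le> (z + 1)\<^sup>2 / (4 * t) * (1 + K * eps Y)" using elim zY by (simp add: t_def)
      also have "\<dots> \<le> (z * (1 + d))\<^sup>2 / (4 * t) * (1 + K * eps Y)"
      proof (intro mult_right_mono divide_right_mono power_mono)
        have "Y \<le> z * (2 * t ^ 2)" using zt t by (simp add: field_simps)
        then have "1 \<le> z * d" using Y by (simp add: d_def field_simps)
        then show "z + 1 \<le> z * (1 + d)" by (simp add: algebra_simps)
      qed (use z0 t Ke in auto)
      also have "\<dots> = z\<^sup>2 / (4 * t) * (1 + k)" by (simp add: k_def power_mult_distrib)
      finally show "Rsum (Y * lc l + 1) \<le> (Y * lc l)\<^sup>2 / (4 * t) * (1 + k)" by (simp add: z_def)
    next
      fix l assume l: "1 \<le> l" "l \<le> nat \<lfloor>Y\<rfloor>"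
      have lY: "real l \<le> Y" using l Y by (simp add: le_nat_iff le_floor_iff)
      have z0: "Y * lc l \<ge> 0" using Y lc_bounds(3)[OF l(1)] by simp
      have "Y * lc l \<le> Y * (1 / real l)" using lc_bounds(2)[OF l(1)] Y by (intro mult_left_mono) auto
      moreover have "1 \<le> Y / real l" using lY l by simp
      ultimately have u: "Y * lc l + 1 \<le> 2 * Y / real l" by simp
      have "Rsum (Y * lc l + 1) \<le> (Y * lc l + 1)\<^sup>2" using z0 by (intro Rsum_le) auto
      also have "\<dots> \<le> (2 * Y / real l)\<^sup>2" using u z0 by (intro power_mono) auto
      also have "\<dots> = 4 * Y\<^sup>2 / (real l)\<^sup>2" by (simp add: power_divide power_mult_distrib)
      finally show "Rsum (Y * lc l + 1) \<le> 4 * Y\<^sup>2 / (real l)\<^sup>2" .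
    qed
    then show ?case by (simp add: k_def d_def t_def)
  qed
  then show ?thesis using K(1) by blast
qed

lemma upper_bound:
  "\<exists>K>0. \<forall>\<^sub>F w in at_top. \<forall>n\<ge>1. ln (real n) \<le> w\<^sup>2 \<longrightarrow> F (F n) \<noteq> 0 \<longrightarrow>
     ln (real (F (F n))) \<le> w / (2 * ln w) * (2 * sqrt lcS + K * (ln (ln w) / ln w))"
proof -
  define s where "s = sqrt lcS"
  have s: "s > 0" "s\<^sup>2 = lcS" using lcS_pos by (auto simp: s_def)
  \<comment> \<open>With \<open>Y = a * w\<close> the main terms \<open>w^2 / (Y ln w)\<close> and
    \<open>lcS * Y / (4 ln Y)\<close> agree asymptotically, which is where their sum is least; each
    is about \<open>s * w / (2 ln w)\<close>.\<close>
  define a where "a = 2 / s"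
  have a: "a > 0" using s by (simp add: a_def)
  obtain K where K: "K > 0" "\<forall>\<^sub>F Y in at_top. (\<Sum>l=1..nat \<lfloor>Y\<rfloor>. Rsum (Y * lc l + 1)) \<le>
      Y\<^sup>2 / (4 * ln Y) * (lcS * ((1 + 2 * ln Y ^ 2 / Y)\<^sup>2 * (1 + K * eps Y)) + 32 / ln Y)"
    using sum_Rsum_bound by blast
  let ?\<eta> = "\<lambda>w::real. ln (ln w) / ln w"
  \<comment> \<open>The four error sources: \<open>y0\<close> in place of \<open>w\<close> under the
    logarithm, the asymptotics of \<open>Rsum\<close>, its tail in \<open>l\<close>, and the small
    primes.\<close>
  have O1: "(\<lambda>w. ln w / ln (w / (2 * ln w) ^ 3) - 1) \<in> O(?\<eta>)" by real_asymp
  have O2: "(\<lambda>w. ln w / ln (a * w) * ((1 + 2 * ln (a * w) ^ 2 / (a * w))\<^sup>2 * (1 + K * (ln (ln (a * w)) / ln (a * w)))) - 1) \<in> O(?\<eta>)"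
    using a by real_asymp
  have O3: "(\<lambda>w. ln w / ln (a * w) * (32 / ln (a * w))) \<in> O(?\<eta>)" using a by real_asymp
  have O4: "(\<lambda>w. (w / (2 * ln w) ^ 3 * ln (2 * w\<^sup>2 + 1) / ln 2) * (2 * ln w) / w) \<in> O(?\<eta>)" by real_asymp
  obtain c1 where c1: "c1 > 0" "\<forall>\<^sub>F w in at_top. \<bar>ln w / ln (w / (2 * ln w) ^ 3) - 1\<bar> \<le> c1 * \<bar>?\<eta> w\<bar>"
    using O1 by (elim landau_o.bigE) auto
  obtain c2 where c2: "c2 > 0" "\<forall>\<^sub>F w in at_top. \<bar>ln w / ln (a * w) * ((1 + 2 * ln (a * w) ^ 2 / (a * w))\<^sup>2 * (1 + K * (ln (ln (a * w)) / ln (a * w)))) - 1\<bar> \<le> c2 * \<bar>?\<eta> w\<bar>"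
    using O2 by (elim landau_o.bigE) auto
  obtain c3 where c3: "c3 > 0" "\<forall>\<^sub>F w in at_top. \<bar>ln w / ln (a * w) * (32 / ln (a * w))\<bar> \<le> c3 * \<bar>?\<eta> w\<bar>"
    using O3 by (elim landau_o.bigE) auto
  obtain c4 where c4: "c4 > 0" "\<forall>\<^sub>F w in at_top. \<bar>(w / (2 * ln w) ^ 3 * ln (2 * w\<^sup>2 + 1) / ln 2) * (2 * ln w) / w\<bar> \<le> c4 * \<bar>?\<eta> w\<bar>"
    using O4 by (elim landau_o.bigE) auto
  define K' where "K' = s * c1 + s * c2 + c3 / s + c4"
  have K': "K' > 0" using s c1 c2 c3 c4 by (simp add: K'_def add_pos_pos)
  have "filterlim (\<lambda>w. a * w) at_top at_top" using a by real_asymp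
  from eventually_compose_filterlim[OF K(2) this]
  have "\<forall>\<^sub>F w in at_top. (\<Sum>l=1..nat \<lfloor>a * w\<rfloor>. Rsum (a * w * lc l + 1)) \<le>
      (a * w)\<^sup>2 / (4 * ln (a * w)) * (lcS * ((1 + 2 * ln (a * w) ^ 2 / (a * w))\<^sup>2 * (1 + K * eps (a * w))) + 32 / ln (a * w))" .
  moreover have "\<forall>\<^sub>F w in at_top. a * w \<ge> 1" using a by real_asymp
  moreover have "\<forall>\<^sub>F w :: real in at_top. w / (2 * ln w) ^ 3 > 1" by real_asymp
  moreover have "\<forall>\<^sub>F w :: real in at_top. ?\<eta> w \<ge> 0" by real_asymp
  moreover have "\<forall>\<^sub>F w :: real in at_top. ln w \<ge> 1" by real_asymp
  moreover have "\<forall>\<^sub>F w :: real in at_top. w \<ge> 1" by (rule eventually_ge_at_top)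
  moreover note c1(2) c2(2) c3(2) c4(2)
  ultimately have "\<forall>\<^sub>F w in at_top. \<forall>n\<ge>1. ln (real n) \<le> w\<^sup>2 \<longrightarrow> F (F n) \<noteq> 0 \<longrightarrow>
     ln (real (F (F n))) \<le> w / (2 * ln w) * (2 * s + K' * ?\<eta> w)"
  proof eventually_elim
    case (elim w)
    define g where "g = ?\<eta> w"
    define r where "r = w / (2 * ln w)"
    \<comment> \<open>The exponent 3 makes the contribution of the primes up to \<open>y0\<close> of
      order \<open>w / (ln w)^2\<close>, while \<open>ln y0\<close> stays within
      \<open>O(ln ln w)\<close> of \<open>ln w\<close>.\<close>
    define y0 where "y0 = w / (2 * ln w) ^ 3"
    have g0: "g \<ge> 0" and lw: "ln w \<ge> 1" and w: "w \<ge> 1" using elim by (auto simp: g_def)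
    have lw0: "ln w > 0" using lw by linarith
    have r0: "r > 0" unfolding r_def using w lw0 by (intro divide_pos_pos) auto
    show ?case
    proof (intro allI impI)
      fix n :: nat assume n: "1 \<le> n" "ln (real n) \<le> w\<^sup>2" "F (F n) \<noteq> 0"
      have pos: "0 \<le> r * (2 * s + K' * g)" using r0 s K' g0 by (intro mult_nonneg_nonneg add_nonneg_nonneg) auto
      show "ln (real (F (F n))) \<le> w / (2 * ln w) * (2 * s + K' * ?\<eta> w)"
      proof (cases "F n = 0")
        \<comment> \<open>Here \<open>F (F n) = F 0 = 1\<close>, whose logarithm is 0.\<close>
        case True
        then show ?thesis using F_0 pos by (simp add: r_def g_def)
      next
        case False
        have "ln (real (F (F n))) \<le> w\<^sup>2 / ln y0 / (a * w) + (1 / (a * w)) * (\<Sum>l=1..nat \<lfloor>a * w\<rfloor>. Rsum (a * w * lc l + 1)) +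
            y0 * ln (2 * w\<^sup>2 + 1) / ln 2"
          using elim n False by (intro upper_core) (auto simp: y0_def)
        also have "w\<^sup>2 / ln y0 / (a * w) \<le> r * (s * (1 + c1 * g))"
        proof -
          have "w\<^sup>2 / ln y0 / (a * w) = r * (s * (ln w / ln y0))"
            using w lw0 s by (simp add: r_def a_def power2_eq_square)
          also have "\<dots> \<le> r * (s * (1 + c1 * g))"
          proof (intro mult_left_mono)
            show "ln w / ln y0 \<le> 1 + c1 * g" using elim g0 by (simp add: y0_def g_def abs_le_iff)
          qed (use r0 s in auto)
          finally show ?thesis .
        qed
        also have "(1 / (a * w)) * (\<Sum>l=1..nat \<lfloor>a * w\<rfloor>. Rsum (a * w * lc l + 1)) \<le> r * (s * (1 + c2 * g) + c3 * g / s)"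
        proof -
          define E where "E = (1 + 2 * ln (a * w) ^ 2 / (a * w))\<^sup>2 * (1 + K * eps (a * w))"
          define t where "t = ln (a * w)"
          have "(1 / (a * w)) * (\<Sum>l=1..nat \<lfloor>a * w\<rfloor>. Rsum (a * w * lc l + 1)) \<le>
              (1 / (a * w)) * ((a * w)\<^sup>2 / (4 * t) * (s\<^sup>2 * E + 32 / t))"
            using elim a w unfolding s(2) E_def t_def by (intro mult_left_mono) auto
          also have "\<dots> = r * (s * (ln w / t * E) + (ln w / t * (32 / t)) / s)"
          proof -
            have "(1 / (a * w)) * ((a * w)\<^sup>2 / (4 * t) * (s\<^sup>2 * E + 32 / t)) = (a * w) / (4 * t) * (s\<^sup>2 * E + 32 / t)"
              using a w by (simp add: power2_eq_square)
            also have "(a * w) / (4 * t) = r * (ln w / (t * s))" using lw0 by (simp add: r_def a_def)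
            also have "r * (ln w / (t * s)) * (s\<^sup>2 * E + 32 / t) = r * (ln w / (t * s) * (s\<^sup>2 * E) + ln w / (t * s) * (32 / t))"
              by (simp add: algebra_simps)
            also have "ln w / (t * s) * (s\<^sup>2 * E) = s * (ln w / t * E)" using s(1) by (simp add: power2_eq_square)
            also have "ln w / (t * s) * (32 / t) = (ln w / t * (32 / t)) / s" by simp
            finally show ?thesis .
          qed
          also have "\<dots> \<le> r * (s * (1 + c2 * g) + c3 * g / s)"
          proof (intro mult_left_mono add_mono divide_right_mono)
            show "ln w / t * E \<le> 1 + c2 * g" using elim g0 by (simp add: t_def E_def eps_def g_def abs_le_iff)
            show "ln w / t * (32 / t) \<le> c3 * g" using elim g0 by (simp add: t_def g_def abs_le_iff)
          qed (use r0 s in auto)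
          finally show ?thesis .
        qed
        also have "y0 * ln (2 * w\<^sup>2 + 1) / ln 2 \<le> r * (c4 * g)"
        proof -
          have "y0 * ln (2 * w\<^sup>2 + 1) / ln 2 = r * ((y0 * ln (2 * w\<^sup>2 + 1) / ln 2) * (2 * ln w) / w)"
            using w lw0 by (simp add: r_def)
          also have "\<dots> \<le> r * (c4 * g)"
            using elim g0 r0 by (intro mult_left_mono) (auto simp: y0_def g_def abs_le_iff)
          finally show ?thesis .
        qed
        finally have "ln (real (F (F n))) \<le> r * (s * (1 + c1 * g)) + r * (s * (1 + c2 * g) + c3 * g / s) + r * (c4 * g)" by simp
        also have "\<dots> = r * (2 * s + K' * g)" by (simp add: K'_def algebra_simps add_divide_distrib)
        finally show ?thesis by (simp add: r_def g_def)
      qed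
    qed
  qed
  then show ?thesis using K' unfolding s_def by blast
qed

end

section \<open>The lower bound\<close>

lemma down_closed_eq:
  fixes T :: "nat set"
  assumes "finite T" "\<And>l. l \<in> T \<Longrightarrow> l \<ge> 1" "\<And>l l'. l \<in> T \<Longrightarrow> 1 \<le> l' \<Longrightarrow> l' \<le> l \<Longrightarrow> l' \<in> T"
  shows "T = {1..card T}"
proof (cases "T = {}")
  case False
  have "T = {1..Max T}"
  proof (intro equalityI subsetI)
    fix l assume "l \<in> T"
    then show "l \<in> {1..Max T}" using assms(1,2) by simp
  next
    fix l assume "l \<in> {1..Max T}"
    then show "l \<in> T" using assms(3)[OF Max_in[OF assms(1) False]] by simp
  qed
  then have "card T = card {1..Max T}" by (rule arg_cong)
  then have "card T = Max T" by simp
  then show ?thesis using \<open>T = {1..Max T}\<close> by simp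
qed simp

context split_count
begin

text \<open>
  The extremal exponent of \<open>q\<close> in \<open>F n\<close> is \<open>card (mult_q Y q)\<close>: the \<open>l\<close>-th factor \<open>q\<close> gains
  \<open>ln (1 + 1 / l)\<close> and costs \<open>q / Y\<close>.
\<close>

definition mult_q :: "real \<Rightarrow> nat \<Rightarrow> nat set" where
  "mult_q Y q = {l \<in> {1..nat \<lfloor>Y\<rfloor>}. real q \<le> Y * lc l}"

lemma mult_q_eq:
  assumes "Y \<ge> 0" shows "mult_q Y q = {1..card (mult_q Y q)}"
proof (rule down_closed_eq)
  fix l l' assume l: "l \<in> mult_q Y q" "1 \<le> l'" "l' \<le> l"
  have "Y * lc l \<le> Y * lc l'" using lc_antimono[OF l(2,3)] assms by (intro mult_left_mono)
  then show "l' \<in> mult_q Y q" using l by (auto simp: mult_q_def)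
qed (auto simp: mult_q_def)

text \<open>A prime counted for some \<open>l\<close> satisfies \<open>q <= Y * lc l <= Y\<close>,
  so the exchange of sums loses no \<open>q\<close>.\<close>

lemma sum_mult_q_swap:
  fixes h :: "nat \<Rightarrow> nat \<Rightarrow> real"
  assumes Y: "Y \<ge> 0"
  shows "(\<Sum>q\<in>upto Y. \<Sum>l\<in>mult_q Y q. h q l) = (\<Sum>l=1..nat \<lfloor>Y\<rfloor>. \<Sum>q\<in>upto (Y * lc l). h q l)"
proof -
  have "(\<Sum>q\<in>upto Y. \<Sum>l\<in>mult_q Y q. h q l) = (\<Sum>l=1..nat \<lfloor>Y\<rfloor>. \<Sum>q | q \<in> upto Y \<and> real q \<le> Y * lc l. h q l)"
    unfolding mult_q_def by (rule sum.swap_restrict[OF finite_upto]) simp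
  also have "\<dots> = (\<Sum>l=1..nat \<lfloor>Y\<rfloor>. \<Sum>q\<in>upto (Y * lc l). h q l)"
  proof (rule sum.cong)
    fix l assume "l \<in> {1..nat \<lfloor>Y\<rfloor>}"
    then have l: "l \<ge> 1" by simp
    have "Y * lc l \<le> Y * (1 / real l)" using lc_bounds(2)[OF l] Y by (intro mult_left_mono)
    also have "\<dots> \<le> Y * 1" using l Y by (intro mult_left_mono) auto
    finally have "{q. q \<in> upto Y \<and> real q \<le> Y * lc l} = upto (Y * lc l)" by (auto simp: upto_def)
    then show "(\<Sum>q | q \<in> upto Y \<and> real q \<le> Y * lc l. h q l) = (\<Sum>q\<in>upto (Y * lc l). h q l)" by simp
  qed simp
  finally show ?thesis .
qed

text \<open>Zero exponents are allowed and contribute the factor 1; in \<open>lower_core\<close>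
  they occur for primes above \<open>Y * lc 1\<close>.\<close>

lemma F_prod_prime_powers:
  assumes S: "finite S" "S \<subseteq> P"
  shows "F (\<Prod>p\<in>S. p ^ e p) = (\<Prod>p\<in>S. e p + 1)"
proof -
  define n where "n = (\<Prod>p\<in>S. p ^ e p)"
  have pr: "prime p" if "p \<in> S" for p using that S P_prime by blast
  have n0: "n > 0" unfolding n_def using pr by (intro prod_pos) (auto simp: prime_gt_0_nat)
  have mult: "multiplicity p n = (if p \<in> S then e p else 0)" if "prime p" for p
    unfolding n_def by (rule multiplicity_prod_prime_powers[OF S(1) pr that])
  have pf: "prime_factors n = {p \<in> S. e p > 0}"
    using mult pr n0 by (auto simp: prime_factors_multiplicity split: if_splits)
  have "F n = (\<Prod>p\<in>prime_factors n. multiplicity p n + 1)"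
    using pf S by (intro F_split n0) auto
  also have "\<dots> = (\<Prod>p\<in>{p \<in> S. e p > 0}. e p + 1)"
    unfolding pf using mult pr by (intro prod.cong) auto
  also have "\<dots> = (\<Prod>p\<in>S. e p + 1)" using S(1) by (intro prod.mono_neutral_left) auto
  finally show ?thesis by (simp add: n_def)
qed

text \<open>\<open>J\<close> holds one pair \<open>(q, i)\<close> for every copy of \<open>q\<close>
  wanted in \<open>F n\<close>. An injection sends the pairs to distinct split primes up to
  \<open>B0\<close>, and each image gets the exponent \<open>q - 1\<close>, so that it contributes
  exactly the factor \<open>q\<close> to \<open>F n\<close>. Then \<open>F n\<close> is a product of
  powers of split primes, and applying \<open>F\<close> again gives the product of the numbers
  \<open>aq q + 1\<close>. One pair costs at most \<open>q ln B0\<close>.\<close>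

lemma lower_core:
  assumes Y: "Y \<ge> 1" and B0: "B0 \<ge> 1" and count: "(\<Sum>l=1..nat \<lfloor>Y\<rfloor>. piP (Y * lc l)) \<le> piP B0"
  shows "\<exists>n\<ge>1. ln (real n) \<le> ln B0 * (\<Sum>l=1..nat \<lfloor>Y\<rfloor>. Qsum (Y * lc l)) \<and> F (F n) \<noteq> 0 \<and>
     ln (real (F (F n))) = (\<Sum>l=1..nat \<lfloor>Y\<rfloor>. lc l * piP (Y * lc l))"
proof -
  have Y0: "Y \<ge> 0" using Y by simp
  define aq where "aq q = card (mult_q Y q)" for q
  define J where "J = (SIGMA q:upto Y. {..<aq q})"
  have finJ: "finite J" unfolding J_def using finite_upto by auto
  have "real (card J) = (\<Sum>q\<in>upto Y. \<Sum>l\<in>mult_q Y q. 1)"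
    unfolding J_def using finite_upto by (simp add: card_SigmaI aq_def)
  also have "\<dots> = (\<Sum>l=1..nat \<lfloor>Y\<rfloor>. \<Sum>q\<in>upto (Y * lc l). 1)" by (rule sum_mult_q_swap[OF Y0])
  also have "\<dots> = (\<Sum>l=1..nat \<lfloor>Y\<rfloor>. piP (Y * lc l))" by (simp add: piP_def)
  finally have "real (card J) \<le> real (card (upto B0))" using count by (simp add: piP_def)
  then have "card J \<le> card (upto B0)" by simp
  then obtain \<phi> where \<phi>: "\<phi> ` J \<subseteq> upto B0" "inj_on \<phi> J"
    using card_le_inj[OF finJ finite_upto] by blast
  define ex where "ex p = fst (the_inv_into J \<phi> p) - 1" for p
  define n where "n = (\<Prod>p\<in>\<phi> ` J. p ^ ex p)"
  have ex: "ex (\<phi> j) = fst j - 1" if "j \<in> J" for j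
    unfolding ex_def using the_inv_into_f_f[OF \<phi>(2) that] by simp
  have q2: "fst j \<ge> 2" if "j \<in> J" for j using that P_ge_2 by (auto simp: J_def upto_def)
  have \<phi>P: "\<phi> j \<in> P" "real (\<phi> j) \<le> B0" "\<phi> j \<ge> 2" if "j \<in> J" for j
    using \<phi>(1) that P_ge_2 by (auto simp: upto_def)
  have "F n = (\<Prod>p\<in>\<phi> ` J. ex p + 1)"
    unfolding n_def using finJ \<phi>P by (intro F_prod_prime_powers) auto
  also have "\<dots> = (\<Prod>j\<in>J. ex (\<phi> j) + 1)" by (simp add: prod.reindex[OF \<phi>(2)])
  also have "\<dots> = (\<Prod>j\<in>J. fst j)" using ex q2 by (intro prod.cong) force+
  also have "\<dots> = (\<Prod>q\<in>upto Y. \<Prod>i<aq q. q)"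
    unfolding J_def using finite_upto by (subst prod.Sigma) (auto simp: case_prod_unfold)
  also have "\<dots> = (\<Prod>q\<in>upto Y. q ^ aq q)" by simp
  finally have Fn: "F n = (\<Prod>q\<in>upto Y. q ^ aq q)" .
  have FFn: "F (F n) = (\<Prod>q\<in>upto Y. aq q + 1)"
    unfolding Fn using finite_upto by (intro F_prod_prime_powers) (auto simp: upto_def)
  have nz: "F (F n) \<noteq> 0" unfolding FFn using finite_upto by simp
  have "ln (real (F (F n))) = ln (\<Prod>q\<in>upto Y. real (aq q) + 1)" unfolding FFn by (simp add: add.commute)
  also have "\<dots> = (\<Sum>q\<in>upto Y. ln (real (aq q) + 1))"
    using finite_upto by (intro ln_prod) (auto intro: add_nonneg_pos)
  also have "\<dots> = (\<Sum>q\<in>upto Y. \<Sum>l\<in>mult_q Y q. lc l)"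
  proof (rule sum.cong)
    fix q
    have "ln (real (aq q) + 1) = (\<Sum>l=1..aq q. lc l)" by (rule sum_lc [symmetric])
    also have "{1..aq q} = mult_q Y q" unfolding aq_def using mult_q_eq[OF Y0] by blast
    finally show "ln (real (aq q) + 1) = (\<Sum>l\<in>mult_q Y q. lc l)" .
  qed simp
  also have "\<dots> = (\<Sum>l=1..nat \<lfloor>Y\<rfloor>. \<Sum>q\<in>upto (Y * lc l). lc l)" by (rule sum_mult_q_swap[OF Y0])
  also have "\<dots> = (\<Sum>l=1..nat \<lfloor>Y\<rfloor>. lc l * piP (Y * lc l))" by (simp add: piP_def mult.commute)
  finally have val: "ln (real (F (F n))) = (\<Sum>l=1..nat \<lfloor>Y\<rfloor>. lc l * piP (Y * lc l))" .
  have n1: "n \<ge> 1"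
  proof -
    have "n > 0" unfolding n_def using \<phi>P by (intro prod_pos) force
    then show ?thesis by simp
  qed
  have "real n = (\<Prod>j\<in>J. real (\<phi> j) ^ (fst j - 1))"
    unfolding n_def using ex by (simp add: prod.reindex[OF \<phi>(2)])
  then have "ln (real n) = ln (\<Prod>j\<in>J. real (\<phi> j) ^ (fst j - 1))" by (rule arg_cong)
  also have "\<dots> = (\<Sum>j\<in>J. ln (real (\<phi> j) ^ (fst j - 1)))"
    using finJ \<phi>P(3) by (intro ln_prod) fastforce+
  also have "\<dots> \<le> (\<Sum>j\<in>J. ln B0 * real (fst j))"
  proof (rule sum_mono)
    fix j assume j: "j \<in> J"
    have p: "real (\<phi> j) \<ge> 2" using \<phi>P(3)[OF j] by simp
    have "ln (real (\<phi> j) ^ (fst j - 1)) = real (fst j - 1) * ln (real (\<phi> j))"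
      using p by (simp add: ln_realpow)
    also have "\<dots> \<le> real (fst j) * ln B0"
      using \<phi>P(2)[OF j] p by (intro mult_mono ln_mono) auto
    finally show "ln (real (\<phi> j) ^ (fst j - 1)) \<le> ln B0 * real (fst j)" by (simp add: mult.commute)
  qed
  also have "\<dots> = ln B0 * (\<Sum>j\<in>J. real (fst j))" by (simp add: sum_distrib_left)
  also have "(\<Sum>j\<in>J. real (fst j)) = (\<Sum>q\<in>upto Y. \<Sum>i<aq q. real q)"
    unfolding J_def using finite_upto by (subst sum.Sigma) (auto simp: case_prod_unfold)
  also have "\<dots> = (\<Sum>q\<in>upto Y. \<Sum>l\<in>mult_q Y q. real q)" by (simp add: aq_def)
  also have "\<dots> = (\<Sum>l=1..nat \<lfloor>Y\<rfloor>. \<Sum>q\<in>upto (Y * lc l). real q)" by (rule sum_mult_q_swap[OF Y0])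
  also have "\<dots> = (\<Sum>l=1..nat \<lfloor>Y\<rfloor>. Qsum (Y * lc l))" by (simp add: Qsum_def)
  finally show ?thesis using n1 nz val by blast
qed

text \<open>The number of factors wanted is at most \<open>Y\<close> times the telescoping sum of
  \<open>lc l\<close>, about \<open>Y ln Y\<close>, whereas about \<open>Y (ln Y)^2 / 2\<close>
  split primes lie below \<open>Y (ln Y)^3\<close>.\<close>

lemma count_bound: "\<forall>\<^sub>F Y in at_top. (\<Sum>l=1..nat \<lfloor>Y\<rfloor>. piP (Y * lc l)) \<le> piP (Y * ln Y ^ 3)"
proof -
  obtain K where K: "K > 0" "\<forall>\<^sub>F Y in at_top. \<forall>u. Y / ln Y ^ 5 \<le> u \<longrightarrow> u \<le> 2 * Y \<longrightarrow>
     u / (2 * ln Y) * (1 - K * eps Y) \<le> piP u \<and> piP u \<le> u / (2 * ln Y) * (1 + K * eps Y)"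
    using window by blast
  have "((\<lambda>Y. K * eps Y) \<longlongrightarrow> 0) at_top" unfolding eps_def by real_asymp
  then have "\<forall>\<^sub>F Y in at_top. K * eps Y < 1/2" by (rule order_tendstoD) simp
  moreover have "\<forall>\<^sub>F Y :: real in at_top. ln Y \<ge> 1" by real_asymp
  moreover have "\<forall>\<^sub>F Y :: real in at_top. Y \<ge> 1" by (rule eventually_ge_at_top)
  moreover note K(2)
  ultimately have low: "\<forall>\<^sub>F B in at_top. B / (4 * ln B) \<le> piP B"
  proof eventually_elim
    case (elim B)
    have lB1: "ln B \<ge> 1" using elim by simp
    have lB: "ln B > 0" using lB1 by linarith
    have lB5: "1 \<le> ln B ^ 5" by (rule one_le_power[OF lB1])
    have "B / ln B ^ 5 \<le> B / 1" using elim lB lB5 by (intro divide_left_mono) auto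
    then have "B / (2 * ln B) * (1 - K * eps B) \<le> piP B" using elim by auto
    moreover have "B / (2 * ln B) * (1/2) \<le> B / (2 * ln B) * (1 - K * eps B)"
      using elim lB by (intro mult_left_mono divide_nonneg_nonneg) auto
    ultimately show ?case by simp
  qed
  have "filterlim (\<lambda>Y::real. Y * ln Y ^ 3) at_top at_top" by real_asymp
  from eventually_compose_filterlim[OF low this]
  have "\<forall>\<^sub>F Y in at_top. Y * ln Y ^ 3 / (4 * ln (Y * ln Y ^ 3)) \<le> piP (Y * ln Y ^ 3)" .
  moreover have "\<forall>\<^sub>F Y :: real in at_top. (Y * ln Y ^ 3) / (4 * ln (Y * ln Y ^ 3)) \<ge> 2 * Y * ln (Y + 1)" by real_asymp
  moreover have "\<forall>\<^sub>F Y :: real in at_top. Y \<ge> 1" by (rule eventually_ge_at_top)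
  ultimately show ?thesis
  proof eventually_elim
    case (elim Y)
    have "(\<Sum>l=1..nat \<lfloor>Y\<rfloor>. piP (Y * lc l)) \<le> (\<Sum>l=1..nat \<lfloor>Y\<rfloor>. Y * lc l)"
    proof (intro sum_mono piP_le)
      fix l assume "l \<in> {1..nat \<lfloor>Y\<rfloor>}"
      then show "Y * lc l \<ge> 0" using lc_bounds(3)[of l] elim by simp
    qed
    also have "\<dots> = Y * ln (real (nat \<lfloor>Y\<rfloor>) + 1)" by (simp only: sum_distrib_left [symmetric] sum_lc)
    also have "\<dots> \<le> Y * ln (Y + 1)" by (intro mult_left_mono ln_mono) (use elim in linarith)+
    also have "\<dots> \<le> 2 * Y * ln (Y + 1)"
    proof -
      have "Y * ln (Y + 1) \<ge> 0" using elim by simp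
      then show ?thesis by simp
    qed
    finally show ?case using elim by linarith
  qed
qed

text \<open>The first part bounds the cost, the second the value. For the value only
  \<open>l\<close> up to \<open>L1\<close>, about \<open>(ln Y)^2\<close>, are kept; the part of
  \<open>lcS\<close> dropped in this way is at most \<open>1 / L1 <= 2 / (ln Y)^2\<close>.\<close>

lemma sum_Qsum_bound:
  "\<exists>K>0. \<forall>\<^sub>F Y in at_top. (\<Sum>l=1..nat \<lfloor>Y\<rfloor>. Qsum (Y * lc l)) \<le> Y\<^sup>2 / (4 * ln Y) * (lcS * (1 + K * eps Y) + 32 / ln Y) \<and>
     Y / (2 * ln Y) * (1 - K * eps Y) * (lcS - 2 / ln Y ^ 2) \<le> (\<Sum>l=1..nat \<lfloor>Y\<rfloor>. lc l * piP (Y * lc l))"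
proof -
  obtain K where K: "K > 0" "\<forall>\<^sub>F Y in at_top. \<forall>z. Y / (4 * ln Y ^ 2) \<le> z \<longrightarrow> z \<le> 2 * Y \<longrightarrow>
     z / (2 * ln Y) * (1 - K * eps Y) \<le> piP z \<and>
     Rsum z \<le> z\<^sup>2 / (4 * ln Y) * (1 + K * eps Y) \<and> Qsum z \<le> z\<^sup>2 / (4 * ln Y) * (1 + K * eps Y)"
    using window_sums by blast
  have "((\<lambda>Y. K * eps Y) \<longlongrightarrow> 0) at_top" unfolding eps_def by real_asymp
  then have "\<forall>\<^sub>F Y in at_top. K * eps Y < 1" by (rule order_tendstoD) simp
  moreover have "\<forall>\<^sub>F Y :: real in at_top. ln Y \<ge> 2" by real_asymp
  moreover have "\<forall>\<^sub>F Y :: real in at_top. ln Y ^ 2 \<le> Y" by real_asymp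
  moreover have "\<forall>\<^sub>F Y in at_top. eps Y \<ge> 0" unfolding eps_def by real_asymp
  moreover have "\<forall>\<^sub>F Y :: real in at_top. Y \<ge> 1" by (rule eventually_ge_at_top)
  moreover note K(2)
  ultimately have "\<forall>\<^sub>F Y in at_top. (\<Sum>l=1..nat \<lfloor>Y\<rfloor>. Qsum (Y * lc l)) \<le> Y\<^sup>2 / (4 * ln Y) * (lcS * (1 + K * eps Y) + 32 / ln Y) \<and>
     Y / (2 * ln Y) * (1 - K * eps Y) * (lcS - 2 / ln Y ^ 2) \<le> (\<Sum>l=1..nat \<lfloor>Y\<rfloor>. lc l * piP (Y * lc l))"
  proof eventually_elim
    case (elim Y)
    define t where "t = ln Y"
    define L1 where "L1 = nat \<lfloor>t ^ 2\<rfloor>"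
    have t: "t \<ge> 2" and Y: "Y \<ge> 1" "Y > 0" and e: "eps Y \<ge> 0" using elim by (auto simp: t_def)
    have Ke: "K * eps Y \<ge> 0" "1 - K * eps Y \<ge> 0" using K(1) e elim by auto
    have t4: "t ^ 2 \<ge> 4" using power_mono[OF t, of 2] by simp
    have L1b: "real L1 \<ge> t ^ 2 / 2" "L1 \<ge> 1" unfolding L1_def using t4 by linarith+
    have L1Y: "L1 \<le> nat \<lfloor>Y\<rfloor>" unfolding L1_def using elim by (intro nat_mono floor_mono) (simp add: t_def)
    have win: "Y * lc l / (2 * t) * (1 - K * eps Y) \<le> piP (Y * lc l) \<and> Qsum (Y * lc l) \<le> (Y * lc l)\<^sup>2 / (4 * t) * (1 + K * eps Y)"
      if l: "1 \<le> l" "l \<le> L1" for l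
    proof -
      have "0 \<le> t ^ 2" by simp
      then have lt: "real l \<le> t ^ 2" using l(2) unfolding L1_def by (simp add: le_nat_iff le_floor_iff)
      define z where "z = Y * lc l"
      have "Y * (1 / (2 * real l)) \<le> z" unfolding z_def using lc_bounds(1)[OF l(1)] Y by (intro mult_left_mono) auto
      then have zl: "z \<ge> Y / (2 * real l)" by simp
      have "Y / (4 * t ^ 2) \<le> Y / (2 * real l)" using lt l Y t by (intro divide_left_mono) auto
      then have zt: "Y / (4 * t ^ 2) \<le> z" using zl by linarith
      have "z \<le> Y * (1 / real l)" unfolding z_def using lc_bounds(2)[OF l(1)] Y by (intro mult_left_mono) auto
      also have "\<dots> \<le> Y * 1" using l Y by (intro mult_left_mono) auto
      finally have zY: "z \<le> 2 * Y" using Y by simp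
      show ?thesis using elim zt zY unfolding t_def z_def by blast
    qed
    have 1: "(\<Sum>l=1..nat \<lfloor>Y\<rfloor>. Qsum (Y * lc l)) \<le> Y\<^sup>2 / (4 * t) * (lcS * (1 + K * eps Y) + 32 / t)"
    proof (rule profile_sum[OF Y(2) t refl Ke(1)])
      fix l assume l: "1 \<le> l" "l \<le> nat \<lfloor>t ^ 2\<rfloor>" "l \<le> nat \<lfloor>Y\<rfloor>"
      then show "Qsum (Y * lc l) \<le> (Y * lc l)\<^sup>2 / (4 * t) * (1 + K * eps Y)" using win[of l] by (simp add: L1_def)
    next
      fix l assume l: "1 \<le> l" "l \<le> nat \<lfloor>Y\<rfloor>"
      have z0: "Y * lc l \<ge> 0" using Y lc_bounds(3)[OF l(1)] by simp
      have "Y * lc l \<le> Y * (1 / real l)" using lc_bounds(2)[OF l(1)] Y by (intro mult_left_mono) auto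
      also have "\<dots> \<le> 2 * Y / real l" using Y by (simp add: divide_right_mono)
      finally have u: "Y * lc l \<le> 2 * Y / real l" .
      have "Qsum (Y * lc l) \<le> (Y * lc l)\<^sup>2" using z0 by (intro Qsum_le) auto
      also have "\<dots> \<le> (2 * Y / real l)\<^sup>2" using u z0 by (intro power_mono) auto
      also have "\<dots> = 4 * Y\<^sup>2 / (real l)\<^sup>2" by (simp add: power_divide power_mult_distrib)
      finally show "Qsum (Y * lc l) \<le> 4 * Y\<^sup>2 / (real l)\<^sup>2" .
    qed
    have 2: "Y / (2 * t) * (1 - K * eps Y) * (lcS - 2 / t ^ 2) \<le> (\<Sum>l=1..nat \<lfloor>Y\<rfloor>. lc l * piP (Y * lc l))"
    proof -
      have "1 / real L1 \<le> 1 / (t ^ 2 / 2)" using L1b t by (intro divide_left_mono) auto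
      then have "lcS - 2 / t ^ 2 \<le> (\<Sum>l=1..L1. (lc l)\<^sup>2)" using lcS_le[OF L1b(2)] by simp
      then have "Y / (2 * t) * (1 - K * eps Y) * (lcS - 2 / t ^ 2) \<le> Y / (2 * t) * (1 - K * eps Y) * (\<Sum>l=1..L1. (lc l)\<^sup>2)"
        using Y t Ke by (intro mult_left_mono mult_nonneg_nonneg) auto
      also have "\<dots> = (\<Sum>l=1..L1. lc l * (Y * lc l / (2 * t) * (1 - K * eps Y)))"
        by (simp add: sum_distrib_left sum_divide_distrib power2_eq_square mult_ac)
      also have "\<dots> \<le> (\<Sum>l=1..L1. lc l * piP (Y * lc l))"
      proof (rule sum_mono)
        fix l assume "l \<in> {1..L1}"
        then show "lc l * (Y * lc l / (2 * t) * (1 - K * eps Y)) \<le> lc l * piP (Y * lc l)"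
          using win[of l] lc_bounds(3)[of l] by (intro mult_left_mono) auto
      qed
      also have "\<dots> \<le> (\<Sum>l=1..nat \<lfloor>Y\<rfloor>. lc l * piP (Y * lc l))"
      proof (rule sum_mono2)
        fix l assume "l \<in> {1..nat \<lfloor>Y\<rfloor>} - {1..L1}"
        then show "0 \<le> lc l * piP (Y * lc l)" using lc_bounds(3)[of l] by (simp add: piP_def)
      qed (use L1Y in auto)
      finally show ?thesis .
    qed
    show ?case using 1 2 by (simp add: t_def)
  qed
  then show ?thesis using K(1) by blast
qed

lemma lower_bound:
  "\<exists>K>0. \<forall>\<^sub>F w in at_top. \<exists>n\<ge>1. ln (real n) \<le> w\<^sup>2 \<and> F (F n) \<noteq> 0 \<and>
     w / (2 * ln w) * (2 * sqrt lcS - K * (ln (ln w) / ln w)) \<le> ln (real (F (F n)))"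
proof -
  define s where "s = sqrt lcS"
  have s: "s > 0" "s\<^sup>2 = lcS" using lcS_pos by (auto simp: s_def)
  define a where "a = 2 / s"
  have a: "a > 0" using s by (simp add: a_def)
  let ?\<eta> = "\<lambda>w::real. ln (ln w) / ln w"
  obtain K where K: "K > 0" "\<forall>\<^sub>F Y in at_top. (\<Sum>l=1..nat \<lfloor>Y\<rfloor>. Qsum (Y * lc l)) \<le> Y\<^sup>2 / (4 * ln Y) * (lcS * (1 + K * eps Y) + 32 / ln Y) \<and>
     Y / (2 * ln Y) * (1 - K * eps Y) * (lcS - 2 / ln Y ^ 2) \<le> (\<Sum>l=1..nat \<lfloor>Y\<rfloor>. lc l * piP (Y * lc l))"
    using sum_Qsum_bound by blast
  \<comment> \<open>\<open>K2\<close> gathers every loss in the cost: the bound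
    \<open>Y (ln Y)^3\<close> on the primes, the error of \<open>Qsum\<close> and the tail in
    \<open>l\<close>.\<close>
  have "(\<lambda>Y. ln (Y * ln Y ^ 3) / ln Y * ((1 + K * (ln (ln Y) / ln Y)) + 32 / lcS / ln Y) - 1) \<in> O(?\<eta>)" by real_asymp
  then obtain K2 where K2: "K2 > 0" "\<forall>\<^sub>F Y in at_top. \<bar>ln (Y * ln Y ^ 3) / ln Y * ((1 + K * (ln (ln Y) / ln Y)) + 32 / lcS / ln Y) - 1\<bar> \<le> K2 * \<bar>?\<eta> Y\<bar>"
    by (elim landau_o.bigE) auto
  \<comment> \<open>\<open>Y\<close> has to be a little smaller than \<open>a * w\<close> for the
    cost to stay within \<open>w^2\<close>. Writing \<open>g\<close> for
    \<open>ln (ln w) / ln w\<close>, the bound \<open>eps Y <= 4 g\<close> makes the cost factor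
    \<open>1 + K2 * eps Y\<close> at most \<open>1 + 2 * K3 * g <= (1 + K3 * g)^2\<close>, which the
    denominator of \<open>Yf\<close> cancels.\<close>
  define K3 where "K3 = 2 * K2"
  have K3: "K3 > 0" using K2 by (simp add: K3_def)
  define Yf where "Yf w = a * w / (1 + K3 * ?\<eta> w)" for w
  have limY: "filterlim Yf at_top at_top" unfolding Yf_def using a K3 by real_asymp
  have "\<forall>\<^sub>F Y in at_top. \<exists>n\<ge>1. ln (real n) \<le> Y\<^sup>2 / 4 * (lcS * (1 + K2 * eps Y)) \<and> F (F n) \<noteq> 0 \<and>
     Y / (2 * ln Y) * (1 - K * eps Y) * (lcS - 2 / ln Y ^ 2) \<le> ln (real (F (F n)))"
  proof -
    have "\<forall>\<^sub>F Y :: real in at_top. ln Y \<ge> 2" by real_asymp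
    moreover have "\<forall>\<^sub>F Y in at_top. eps Y \<ge> 0" unfolding eps_def by real_asymp
    moreover have "\<forall>\<^sub>F Y :: real in at_top. Y \<ge> 1" by (rule eventually_ge_at_top)
    moreover have "\<forall>\<^sub>F Y :: real in at_top. Y * ln Y ^ 3 \<ge> 1" by real_asymp
    moreover note K(2) K2(2) count_bound
    ultimately show ?thesis
    proof eventually_elim
      case (elim Y)
      define t where "t = ln Y"
      define b where "b = ln (Y * ln Y ^ 3)"
      have t: "t \<ge> 2" and e: "eps Y \<ge> 0" using elim by (auto simp: t_def)
      have b0: "b \<ge> 0" unfolding b_def using elim by (intro ln_ge_zero) auto
      obtain n where n: "n \<ge> 1" "ln (real n) \<le> b * (\<Sum>l=1..nat \<lfloor>Y\<rfloor>. Qsum (Y * lc l))" "F (F n) \<noteq> 0"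
        "ln (real (F (F n))) = (\<Sum>l=1..nat \<lfloor>Y\<rfloor>. lc l * piP (Y * lc l))"
        using lower_core[of Y "Y * ln Y ^ 3"] elim unfolding b_def by blast
      note n(2)
      also have "b * (\<Sum>l=1..nat \<lfloor>Y\<rfloor>. Qsum (Y * lc l)) \<le> b * (Y\<^sup>2 / (4 * t) * (lcS * (1 + K * eps Y) + 32 / t))"
        using elim b0 by (intro mult_left_mono) (auto simp: t_def)
      also have "\<dots> = Y\<^sup>2 / 4 * (lcS * (b / t * ((1 + K * eps Y) + 32 / lcS / t)))"
        using lcS_pos t by (simp add: field_simps)
      also have "\<dots> \<le> Y\<^sup>2 / 4 * (lcS * (1 + K2 * eps Y))"
      proof (intro mult_left_mono)
        have "\<bar>b / t * ((1 + K * eps Y) + 32 / lcS / t) - 1\<bar> \<le> K2 * \<bar>eps Y\<bar>"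
          using elim by (simp add: b_def t_def eps_def)
        then show "b / t * ((1 + K * eps Y) + 32 / lcS / t) \<le> 1 + K2 * eps Y" using e by (simp add: abs_le_iff)
      qed (use lcS_pos in auto)
      finally have "ln (real n) \<le> Y\<^sup>2 / 4 * (lcS * (1 + K2 * eps Y))" .
      then show ?case using n elim by auto
    qed
  qed
  from eventually_compose_filterlim[OF this limY]
  have ev: "\<forall>\<^sub>F w in at_top. \<exists>n\<ge>1. ln (real n) \<le> (Yf w)\<^sup>2 / 4 * (lcS * (1 + K2 * eps (Yf w))) \<and> F (F n) \<noteq> 0 \<and>
     Yf w / (2 * ln (Yf w)) * (1 - K * eps (Yf w)) * (lcS - 2 / ln (Yf w) ^ 2) \<le> ln (real (F (F n)))" .
  have O1: "(\<lambda>w. (1 / (1 + K3 * ?\<eta> w)) * (ln w / ln (Yf w)) * (1 - K * (ln (ln (Yf w)) / ln (Yf w))) - 1) \<in> O(?\<eta>)"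
    unfolding Yf_def using a K3 by real_asymp
  have O2: "(\<lambda>w. ln w / ln (Yf w) * (2 / ln (Yf w) ^ 2)) \<in> O(?\<eta>)"
    unfolding Yf_def using a K3 by real_asymp
  obtain c1 where c1: "c1 > 0" "\<forall>\<^sub>F w in at_top. \<bar>(1 / (1 + K3 * ?\<eta> w)) * (ln w / ln (Yf w)) * (1 - K * (ln (ln (Yf w)) / ln (Yf w))) - 1\<bar> \<le> c1 * \<bar>?\<eta> w\<bar>"
    using O1 by (elim landau_o.bigE) auto
  obtain c2 where c2: "c2 > 0" "\<forall>\<^sub>F w in at_top. \<bar>ln w / ln (Yf w) * (2 / ln (Yf w) ^ 2)\<bar> \<le> c2 * \<bar>?\<eta> w\<bar>"
    using O2 by (elim landau_o.bigE) auto
  define K' where "K' = 2 * s * c1 + a * c2"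
  have K': "K' > 0" using s a c1 c2 by (simp add: K'_def add_pos_pos)
  have "((\<lambda>Y. K * eps Y) \<longlongrightarrow> 0) at_top" unfolding eps_def by real_asymp
  then have "\<forall>\<^sub>F Y in at_top. K * eps Y < 1" by (rule order_tendstoD) simp
  from eventually_compose_filterlim[OF this limY] have "\<forall>\<^sub>F w in at_top. K * eps (Yf w) < 1" .
  moreover have "\<forall>\<^sub>F Y in at_top. eps Y \<ge> 0" unfolding eps_def by real_asymp
  note eventually_compose_filterlim[OF this limY]
  moreover have "\<forall>\<^sub>F w in at_top. sqrt w \<le> Yf w" unfolding Yf_def using a K3 by real_asymp
  moreover have "\<forall>\<^sub>F w in at_top. Yf w \<le> w\<^sup>2" unfolding Yf_def using a K3 by real_asymp
  moreover have "\<forall>\<^sub>F w in at_top. ln (Yf w) \<ge> 1" unfolding Yf_def using a K3 by real_asymp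
  moreover have "\<forall>\<^sub>F w :: real in at_top. ln (ln w) \<ge> 1" by real_asymp
  moreover have "\<forall>\<^sub>F w :: real in at_top. ln w \<ge> 1" by real_asymp
  moreover have "\<forall>\<^sub>F w :: real in at_top. w \<ge> 1" by (rule eventually_ge_at_top)
  moreover note ev c1(2) c2(2)
  ultimately have "\<forall>\<^sub>F w in at_top. \<exists>n\<ge>1. ln (real n) \<le> w\<^sup>2 \<and> F (F n) \<noteq> 0 \<and>
     w / (2 * ln w) * (2 * s - K' * ?\<eta> w) \<le> ln (real (F (F n)))"
  proof eventually_elim
    case (elim w)
    define Y where "Y = Yf w"
    define t where "t = ln Y"
    define g where "g = ?\<eta> w"
    define v where "v = ln w"
    define r where "r = w / (2 * v)"
    have v: "v \<ge> 1" "ln v \<ge> 1" and t1: "t \<ge> 1" and w: "w \<ge> 1" and e: "eps Y \<ge> 0" "K * eps Y < 1"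
      using elim by (auto simp: v_def t_def Y_def)
    have g: "g \<ge> 0" using v by (simp add: g_def v_def [symmetric])
    have Y0: "Y > 0"
    proof -
      have "sqrt w > 0" using w by simp
      then show ?thesis using elim unfolding Y_def by linarith
    qed
    have r0: "r > 0" unfolding r_def using w v by (intro divide_pos_pos) auto
    have Yeq: "Y = a * w / (1 + K3 * g)" by (simp add: Y_def Yf_def g_def)
    have g1: "1 + K3 * g \<ge> 1" using K3 g by simp
    have "ln (sqrt w) \<le> t" unfolding t_def using elim w Y0 by (intro ln_mono) (auto simp: Y_def)
    then have tv: "v / 2 \<le> t" using w by (simp add: ln_sqrt v_def)
    have "t \<le> ln (w\<^sup>2)" unfolding t_def using elim w Y0 by (intro ln_mono) (auto simp: Y_def)
    then have tv2: "t \<le> 2 * v" using w by (simp add: ln_realpow v_def)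
    \<comment> \<open>From \<open>sqrt w <= Y <= w^2\<close> the logarithm \<open>t\<close> of
      \<open>Y\<close> lies between \<open>v / 2\<close> and \<open>2 v\<close>; each of the two
      bounds costs a factor 2.\<close>
    have eps4: "eps Y \<le> 4 * g"
    proof -
      have "ln t \<le> ln (2 * v)" using tv2 t1 by (intro ln_mono) auto
      also have "\<dots> = ln 2 + ln v" using v by (simp add: ln_mult)
      also have "ln 2 \<le> ln v" using v ln_2_less_1 by linarith
      finally have "ln t \<le> 2 * ln v" by simp
      then have "ln t / t \<le> 2 * ln v / (v / 2)" using tv v t1 by (intro frac_le) auto
      also have "\<dots> = 4 * g" by (simp add: g_def v_def)
      finally show ?thesis by (simp add: eps_def t_def)
    qed
    obtain n where n: "n \<ge> 1" "ln (real n) \<le> Y\<^sup>2 / 4 * (lcS * (1 + K2 * eps Y))" "F (F n) \<noteq> 0"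
      "Y / (2 * t) * (1 - K * eps Y) * (lcS - 2 / t ^ 2) \<le> ln (real (F (F n)))"
      using elim unfolding Y_def t_def by blast
    have "ln (real n) \<le> w\<^sup>2"
    proof -
      have "1 + K2 * eps Y \<le> 1 + K2 * (4 * g)" using eps4 K2(1) by (intro add_left_mono mult_left_mono) auto
      also have "\<dots> = 1 + 2 * (K3 * g)" by (simp add: K3_def)
      also have "\<dots> \<le> (1 + K3 * g)\<^sup>2" unfolding power2_sum by simp
      finally have "Y\<^sup>2 / 4 * (lcS * (1 + K2 * eps Y)) \<le> Y\<^sup>2 / 4 * (lcS * (1 + K3 * g)\<^sup>2)"
        using lcS_pos by (intro mult_left_mono) auto
      also have "\<dots> = (Y * (1 + K3 * g))\<^sup>2 * s\<^sup>2 / 4" unfolding s(2) by (simp add: power_mult_distrib)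
      also have "Y * (1 + K3 * g) = a * w" using g1 by (simp add: Yeq)
      also have "(a * w)\<^sup>2 * s\<^sup>2 / 4 = w\<^sup>2" using s(1) by (simp add: a_def power_mult_distrib power_divide)
      finally show ?thesis using n(2) by linarith
    qed
    moreover have "r * (2 * s - K' * g) \<le> ln (real (F (F n)))"
    proof -
      define p where "p = 1 / (1 + K3 * g)"
      have p: "0 < p" "p \<le> 1" using g1 by (auto simp: p_def)
      have vt0: "v / t \<ge> 0" using v t1 by simp
      have Yt: "Y / (2 * t) = r * a * (p * (v / t))" using v t1 by (simp add: Yeq p_def r_def mult_ac)
      have gen: "(A * (p' * q)) * u * (S - z) = A * S * (p' * q * u) - A * ((p' * u) * (q * z))" for A p' q u S z :: real
        by (simp add: algebra_simps)
      have eq: "Y / (2 * t) * (1 - K * eps Y) * (lcS - 2 / t ^ 2) =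
          r * a * lcS * (p * (v / t) * (1 - K * eps Y)) - r * a * ((p * (1 - K * eps Y)) * (v / t * (2 / t ^ 2)))"
        unfolding Yt by (rule gen)
      have x1: "1 - c1 * g \<le> p * (v / t) * (1 - K * eps Y)"
        using elim g unfolding p_def g_def v_def t_def Y_def eps_def by (simp add: abs_le_iff)
      have x2: "v / t * (2 / t ^ 2) \<le> c2 * g"
        using elim g unfolding g_def v_def t_def Y_def by (simp add: abs_le_iff)
      have "(p * (1 - K * eps Y)) * (v / t * (2 / t ^ 2)) \<le> 1 * (v / t * (2 / t ^ 2))"
      proof (intro mult_right_mono)
        have "p * (1 - K * eps Y) \<le> 1 * 1" using p e K(1) by (intro mult_mono) auto
        then show "p * (1 - K * eps Y) \<le> 1" by simp
        show "0 \<le> v / t * (2 / t ^ 2)" using vt0 by (rule mult_nonneg_nonneg) simp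
      qed
      then have x3: "(p * (1 - K * eps Y)) * (v / t * (2 / t ^ 2)) \<le> c2 * g" using x2 by linarith
      have aS: "a * lcS = 2 * s" using s by (simp add: a_def power2_eq_square flip: s(2))
      have "r * (2 * s - K' * g) = r * a * lcS * (1 - c1 * g) - r * a * (c2 * g)"
      proof -
        have "r * a * lcS * (1 - c1 * g) = r * (2 * s) * (1 - c1 * g)" using aS by (simp add: mult.assoc)
        then show ?thesis by (simp add: K'_def algebra_simps)
      qed
      also have "\<dots> \<le> r * a * lcS * (p * (v / t) * (1 - K * eps Y)) - r * a * ((p * (1 - K * eps Y)) * (v / t * (2 / t ^ 2)))"
        using x1 x3 r0 a lcS_pos by (intro diff_mono mult_left_mono) auto
      finally show ?thesis using n(4) eq by linarith
    qed
    ultimately show ?case using n unfolding r_def g_def v_def by blast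
  qed
  then show ?thesis using K' unfolding s_def by blast
qed

end

section \<open>The four families of forms\<close>

context quadratic_form
begin

text \<open>\<open>(4 c - b^2) y^2 = 4 nrm w - (tr w)^2\<close> is divisible by \<open>p\<close>,
  where \<open>y\<close> is the second coordinate of \<open>w\<close>. If \<open>p\<close> divided
  \<open>y\<close>, it would divide \<open>w\<close>, and the norm \<open>p\<close> of
  \<open>w\<close> would be divisible by \<open>p^2\<close>.\<close>

lemma ramified_dvd_discriminant:
  assumes p: "prime p" "p \<notin> split_primes" "p \<notin> inert_primes"
  shows "int p dvd 4 * c - b\<^sup>2"
proof -
  obtain w where w: "prime (int p)" "nrm w = int p" "int p dvd tr w"
    using p by (auto simp: split_primes_def inert_primes_def)
  have "(4 * c - b\<^sup>2) * (snd w)\<^sup>2 = 4 * nrm w - (tr w)\<^sup>2"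
    by (simp add: nrm_def tr_def power2_eq_square algebra_simps)
  also have "int p dvd \<dots>" using w by (simp add: power2_eq_square)
  finally have "int p dvd 4 * c - b\<^sup>2 \<or> int p dvd snd w"
    using w(1) by (meson prime_dvd_mult_iff prime_dvd_power)
  moreover have "\<not> int p dvd snd w"
  proof
    assume "int p dvd snd w"
    then obtain u where "w = scale (int p) u" using dvd_nrm_prime_snd[OF w(1), of w] w(2) by auto
    then have "int p * (int p * nrm u) = int p * 1" using w(2) by (simp add: nrm_scale power2_eq_square)
    moreover have "int p \<noteq> 0" using w(1) by auto
    ultimately have "int p * nrm u = 1" by simp
    then have "int p dvd 1" by (metis dvd_triv_left)
    then show False using w(1) not_prime_unit by blast
  qed
  ultimately show ?thesis by blast
qed

lemma finite_ramified: "finite {p. prime p \<and> p \<notin> split_primes \<and> p \<notin> inert_primes}"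
proof (rule finite_subset)
  show "{p. prime p \<and> p \<notin> split_primes \<and> p \<notin> inert_primes} \<subseteq> {..nat (4 * c - b\<^sup>2)}"
  proof
    fix p assume "p \<in> {p. prime p \<and> p \<notin> split_primes \<and> p \<notin> inert_primes}"
    then have "int p dvd 4 * c - b\<^sup>2" using ramified_dvd_discriminant by blast
    then have "int p \<le> 4 * c - b\<^sup>2" using definite by (intro zdvd_imp_le) auto
    then show "p \<in> {..nat (4 * c - b\<^sup>2)}" by simp
  qed
qed simp

lemma split_multiplicative_rep_density: "split_multiplicative rep_density split_primes inert_primes"
proof
  show "prime p" if "p \<in> split_primes" for p using that by (simp add: split_primes_def)
  show "split_primes \<inter> inert_primes = {}" by (auto simp: split_primes_def inert_primes_def)
qed (use rep_density_1 rep_density_split rep_density_inert rep_density_ramified in auto)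

lemma split_primes_density: "\<exists>K0. prime_density split_primes K0"
proof -
  interpret sm: split_multiplicative rep_density split_primes inert_primes
    by (rule split_multiplicative_rep_density)
  obtain \<rho> C where rho: "\<rho> > 0" "\<And>N. N \<ge> 1 \<Longrightarrow> \<bar>(\<Sum>n=1..N. rep_density n) - \<rho> * real N\<bar> \<le> C * sqrt (real N)"
    using sum_rep_density_asymp by blast
  interpret zl: zeta_like rep_density sm.lam \<rho> C
    by unfold_locales (use rep_density_nonneg rep_density_1 sm.lam_nonneg sm.lam_le sm.lam_convolution rho in auto)
  obtain K where K: "\<And>N. N \<ge> 3 \<Longrightarrow> \<bar>zl.Psi N - real N * (ln (real N))\<^sup>2\<bar> \<le> K * real N * ln (real N)"
    using zl.Psi_asymp by blast
  have "finite sm.ramified" unfolding sm.ramified_def by (rule finite_ramified)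
  from sm.theta_of_psi[OF this K[unfolded zl.Psi_def]]
  obtain K0 where "K0 \<ge> 0" "\<And>N. N \<ge> 3 \<Longrightarrow> \<bar>(\<Sum>q\<in>{q\<in>split_primes. q \<le> N}. 2 * ln (real q) ^ 3) - real N * ln (real N) ^ 2\<bar> \<le> K0 * real N * ln (real N)"
    by blast
  then have "prime_density split_primes K0"
    by unfold_locales (auto simp: split_primes_def intro: prime_ge_2_nat)
  then show ?thesis by blast
qed

lemma iterate_bounds:
  fixes F :: "nat \<Rightarrow> nat"
  assumes F0: "F 0 = 1" and F: "\<And>n. n > 0 \<Longrightarrow> real (F n) = rep_density n"
  shows "\<exists>K>0. \<forall>\<^sub>F w in at_top.
     (\<forall>n\<ge>1. ln (real n) \<le> w\<^sup>2 \<longrightarrow> F (F n) \<noteq> 0 \<longrightarrow>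
       ln (real (F (F n))) \<le> w / (2 * ln w) * (2 * sqrt lcS + K * (ln (ln w) / ln w))) \<and>
     (\<exists>n\<ge>1. ln (real n) \<le> w\<^sup>2 \<and> F (F n) \<noteq> 0 \<and>
       w / (2 * ln w) * (2 * sqrt lcS - K * (ln (ln w) / ln w)) \<le> ln (real (F (F n))))"
proof -
  interpret sm: split_multiplicative rep_density split_primes inert_primes
    by (rule split_multiplicative_rep_density)
  obtain K0 where "prime_density split_primes K0" using split_primes_density by blast
  then interpret pd: prime_density split_primes K0 .
  interpret sc: split_count split_primes K0 F
  proof
    show "prime q" if "q \<in> split_primes" for q using that by (simp add: split_primes_def)
    show "F 0 = 1" by (rule F0)
    fix n :: nat assume n: "n > 0"
    show "F n = (\<Prod>p\<in>prime_factors n \<inter> split_primes. multiplicity p n + 1)" if "F n \<noteq> 0"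
    proof -
      have "rep_density n \<noteq> 0" using that F[OF n] by simp
      then have "real (F n) = real (\<Prod>p\<in>prime_factors n \<inter> split_primes. multiplicity p n + 1)"
        using sm.g_eq_prod[OF n] F[OF n] by (simp add: add.commute)
      then show ?thesis by (simp only: of_nat_eq_iff)
    qed
    show "F n = (\<Prod>p\<in>prime_factors n. multiplicity p n + 1)" if "prime_factors n \<subseteq> split_primes"
    proof -
      have "real (F n) = real (\<Prod>p\<in>prime_factors n. multiplicity p n + 1)"
        using sm.g_eq_prod_split[OF n that] F[OF n] by (simp add: add.commute)
      then show ?thesis by (simp only: of_nat_eq_iff)
    qed
  qed
  obtain K1 where K1: "K1 > 0" "\<forall>\<^sub>F w in at_top. \<forall>n\<ge>1. ln (real n) \<le> w\<^sup>2 \<longrightarrow> F (F n) \<noteq> 0 \<longrightarrow>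
       ln (real (F (F n))) \<le> w / (2 * ln w) * (2 * sqrt lcS + K1 * (ln (ln w) / ln w))"
    using sc.upper_bound by blast
  obtain K2 where K2: "K2 > 0" "\<forall>\<^sub>F w in at_top. \<exists>n\<ge>1. ln (real n) \<le> w\<^sup>2 \<and> F (F n) \<noteq> 0 \<and>
       w / (2 * ln w) * (2 * sqrt lcS - K2 * (ln (ln w) / ln w)) \<le> ln (real (F (F n)))"
    using sc.lower_bound by blast
  define K where "K = max K1 K2"
  have "\<forall>\<^sub>F w :: real in at_top. ln (ln w) / ln w \<ge> 0" by real_asymp
  moreover have "\<forall>\<^sub>F w :: real in at_top. w / (2 * ln w) \<ge> 0" by real_asymp
  moreover note K1(2) K2(2)
  ultimately have "\<forall>\<^sub>F w in at_top.
     (\<forall>n\<ge>1. ln (real n) \<le> w\<^sup>2 \<longrightarrow> F (F n) \<noteq> 0 \<longrightarrow>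
       ln (real (F (F n))) \<le> w / (2 * ln w) * (2 * sqrt lcS + K * (ln (ln w) / ln w))) \<and>
     (\<exists>n\<ge>1. ln (real n) \<le> w\<^sup>2 \<and> F (F n) \<noteq> 0 \<and>
       w / (2 * ln w) * (2 * sqrt lcS - K * (ln (ln w) / ln w)) \<le> ln (real (F (F n))))"
  proof eventually_elim
    case (elim w)
    let ?g = "ln (ln w) / ln w" and ?r = "w / (2 * ln w)"
    have "K1 * ?g \<le> K * ?g" "K2 * ?g \<le> K * ?g" using elim(1) by (intro mult_right_mono; simp add: K_def)+
    then have "?r * (2 * sqrt lcS + K1 * ?g) \<le> ?r * (2 * sqrt lcS + K * ?g)"
      "?r * (2 * sqrt lcS - K * ?g) \<le> ?r * (2 * sqrt lcS - K2 * ?g)"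
      using elim(2) by (intro mult_left_mono; simp)+
    then show ?case using elim(3,4) by (meson order_trans)
  qed
  moreover have "K > 0" using K1 by (simp add: K_def)
  ultimately show ?thesis by blast
qed

text \<open>Substitution of \<open>w = sqrt (ln x)\<close>, for which
  \<open>2 ln w = ln (ln x)\<close>. For large \<open>x\<close> the finite range contains some
  \<open>n\<close> with \<open>F (F n)\<close> nonzero, so the maximum is a real number in spite of
  the values at minus infinity.\<close>

lemma max_iterate_asymp:
  fixes f :: "nat \<Rightarrow> rat"
  assumes f0: "f 0 = 1" and f_Nats: "\<And>n. f n \<in> \<nat>"
    and f: "\<And>n. n > 0 \<Longrightarrow> f n = of_nat (card (reps (int n))) / of_nat (card (reps 1))"
  shows "\<exists>E :: real \<Rightarrow> real.
           E \<in> O[at_top](\<lambda>x. (ln ^^ 3) x / (ln ^^ 2) x) \<and>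
           (\<forall>\<^sub>F x in at_top.
              (MAX n \<in> {n::nat. 1 \<le> n \<and> real n \<le> x}. elog (of_rat (f (nat_of_rat (f n))))) =
              ereal (sqrt (ln x) / (ln ^^ 2) x * (2 * sqrt lcS + E x)))"
proof -
  define F where "F n = nat_of_rat (f n)" for n
  have of_F: "of_nat (F n) = f n" for n
    using f_Nats[of n] by (auto simp: F_def elim!: Nats_cases)
  have "F 0 = 1" using nat_of_rat_of_nat[of 1] by (simp add: F_def f0)
  moreover have "real (F n) = rep_density n" if "n > 0" for n
  proof -
    have "real (F n) = of_rat (f n)" by (simp flip: of_F)
    also have "\<dots> = rep_density n" by (simp add: f[OF that] of_rat_divide rep_density_def)
    finally show ?thesis .
  qed
  ultimately obtain K where K: "K > 0" "\<forall>\<^sub>F w in at_top.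
     (\<forall>n\<ge>1. ln (real n) \<le> w\<^sup>2 \<longrightarrow> F (F n) \<noteq> 0 \<longrightarrow>
       ln (real (F (F n))) \<le> w / (2 * ln w) * (2 * sqrt lcS + K * (ln (ln w) / ln w))) \<and>
     (\<exists>n\<ge>1. ln (real n) \<le> w\<^sup>2 \<and> F (F n) \<noteq> 0 \<and>
       w / (2 * ln w) * (2 * sqrt lcS - K * (ln (ln w) / ln w)) \<le> ln (real (F (F n))))"
    using iterate_bounds[of F] by blast
  define M where "M x = (MAX n \<in> {n::nat. 1 \<le> n \<and> real n \<le> x}. elog (real (F (F n))))" for x
  define r where "r x = sqrt (ln x) / ln (ln x)" for x :: real
  \<comment> \<open>The asserted equation solved for the error; \<open>real_of_ereal\<close> is
    applied to a finite value once \<open>x\<close> is large.\<close>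
  define E where "E x = real_of_ereal (M x) / r x - 2 * sqrt lcS" for x
  have "filterlim (\<lambda>x::real. sqrt (ln x)) at_top at_top" by real_asymp
  note K' = eventually_compose_filterlim[OF K(2) this]
  have ev: "\<forall>\<^sub>F x in at_top. M x = ereal (r x * (2 * sqrt lcS + E x)) \<and>
      \<bar>E x\<bar> \<le> 2 * K * (ln (ln (ln x)) / ln (ln x))"
    using K' eventually_gt_at_top[of "exp (exp 1)"]
  proof eventually_elim
    case (elim x)
    define w where "w = sqrt (ln x)"
    define S where "S = {n::nat. 1 \<le> n \<and> real n \<le> x}"
    have x0: "x > 0" using elim(2) by (meson exp_gt_zero less_trans)
    have lnx: "ln x > exp 1" using ln_less_cancel_iff[of "exp (exp 1)" x] elim(2) x0 by simp
    then have lnx0: "ln x > 0" by (meson exp_gt_zero less_trans)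
    have llx: "ln (ln x) > 1" using ln_less_cancel_iff[of "exp 1" "ln x"] lnx lnx0 by simp
    have w2: "w\<^sup>2 = ln x" using lnx0 by (simp add: w_def)
    have lnw: "ln w = ln (ln x) / 2" unfolding w_def using lnx0 by (simp add: ln_sqrt)
    have rw: "w / (2 * ln w) = r x" unfolding lnw r_def by (simp add: w_def)
    have r0: "r x > 0" unfolding r_def using llx lnx0 by (intro divide_pos_pos real_sqrt_gt_zero) linarith+
    let ?g = "ln (ln w) / ln w" and ?h = "ln (ln (ln x)) / ln (ln x)"
    \<comment> \<open>The factor 2 comes from the denominator
      \<open>ln w = ln (ln x) / 2\<close>.\<close>
    have gh: "?g \<le> 2 * ?h"
    proof -
      have "ln (ln (ln x) / 2) \<le> ln (ln (ln x))" using llx by (intro ln_mono) auto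
      then show ?thesis unfolding lnw using llx by (simp add: field_simps)
    qed
    have inS: "n \<in> S \<longleftrightarrow> n \<ge> 1 \<and> ln (real n) \<le> w\<^sup>2" for n
    proof (cases "n \<ge> 1")
      case True
      then show ?thesis using x0 by (simp add: S_def w2)
    qed (simp add: S_def)
    have fin: "finite S"
      by (rule finite_subset[of _ "{..nat \<lfloor>x\<rfloor>}"]) (auto simp: S_def le_nat_iff le_floor_iff)
    have up: "elog (real (F (F n))) \<le> ereal (r x * (2 * sqrt lcS + K * ?g))" if "n \<in> S" for n
      using elim(1) that unfolding w_def[symmetric] rw inS by (auto simp: elog_def)
    obtain n where n: "n \<in> S" "F (F n) \<noteq> 0" "r x * (2 * sqrt lcS - K * ?g) \<le> ln (real (F (F n)))"
      using elim(1) unfolding w_def[symmetric] rw inS by blast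
    have Mmax: "M x = Max ((\<lambda>n. elog (real (F (F n)))) ` S)" by (simp add: M_def S_def)
    have "ereal (r x * (2 * sqrt lcS - K * ?g)) \<le> elog (real (F (F n)))" using n by (simp add: elog_def)
    also have "\<dots> \<le> M x" unfolding Mmax using n fin by (intro Max_ge) auto
    finally have lo: "ereal (r x * (2 * sqrt lcS - K * ?g)) \<le> M x" .
    have hi: "M x \<le> ereal (r x * (2 * sqrt lcS + K * ?g))"
      unfolding Mmax using up n(1) fin by (subst Max_le_iff) auto
    obtain m where m: "M x = ereal m" using lo hi by (cases "M x") auto
    have Em: "r x * (2 * sqrt lcS + E x) = m" using r0 by (simp add: E_def m field_simps)
    have "\<bar>E x\<bar> \<le> K * ?g"
    proof -
      have "r x * (2 * sqrt lcS - K * ?g) \<le> r x * (2 * sqrt lcS + E x)"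
        "r x * (2 * sqrt lcS + E x) \<le> r x * (2 * sqrt lcS + K * ?g)"
        using lo hi unfolding m Em by simp_all
      then show ?thesis using r0 by simp
    qed
    also have "\<dots> \<le> K * (2 * ?h)" using gh K(1) by (intro mult_left_mono) auto
    finally show ?case using m Em by (simp add: mult_ac)
  qed
  have iter: "(ln ^^ 3) x = ln (ln (ln x))" "(ln ^^ 2) x = ln (ln x)" for x :: real
    by (simp_all add: numeral_eq_Suc)
  have "E \<in> O[at_top](\<lambda>x. (ln ^^ 3) x / (ln ^^ 2) x)"
  proof (rule bigoI)
    show "\<forall>\<^sub>F x in at_top. norm (E x) \<le> 2 * K * norm ((ln ^^ 3) x / (ln ^^ 2) x)"
      using ev
    proof eventually_elim
      case (elim x)
      have "2 * K * (ln (ln (ln x)) / ln (ln x)) \<le> 2 * K * \<bar>ln (ln (ln x)) / ln (ln x)\<bar>"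
        using K(1) by (intro mult_left_mono abs_ge_self) simp
      with elim show ?case unfolding iter real_norm_def by linarith
    qed
  qed
  moreover have "M x = (MAX n \<in> {n::nat. 1 \<le> n \<and> real n \<le> x}. elog (of_rat (f (nat_of_rat (f n)))))" for x
  proof -
    have "of_rat (f (nat_of_rat (f n))) = real (F (F n))" for n
      by (simp flip: F_def of_F)
    then show ?thesis by (simp add: M_def)
  qed
  moreover have "\<forall>\<^sub>F x in at_top. M x = ereal (r x * (2 * sqrt lcS + E x))"
    using ev by eventually_elim simp
  ultimately show ?thesis unfolding iter(2) r_def by auto
qed

end

lemma not_dvd_quadratic:
  fixes p k x :: int
  assumes "p > 0" and "\<forall>r\<in>{0..<p}. \<not> p dvd r\<^sup>2 + r + k"
  shows "\<not> p dvd x\<^sup>2 + x + k"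
proof -
  have "[x\<^sup>2 + x + k = (x mod p)\<^sup>2 + x mod p + k] (mod p)"
    by (intro cong_add cong_pow) (simp_all add: cong_def)
  moreover have "x mod p \<in> {0..<p}" using assms(1) by simp
  ultimately show ?thesis using assms(2) by (metis cong_dvd_iff)
qed

text \<open>A prime satisfies \<open>3 p^2 >= 12\<close>, so the condition on small primes is
  vacuous.\<close>

lemma quadratic_form_small_discriminant:
  assumes "0 < 4 * c - b\<^sup>2" "4 * c - b\<^sup>2 < 12"
  shows "quadratic_form b c"
proof
  fix p x :: int assume p: "prime p" "3 * p\<^sup>2 \<le> 4 * c - b\<^sup>2"
  have "2\<^sup>2 \<le> p\<^sup>2" using prime_ge_2_int[OF p(1)] by (intro power_mono) auto
  then show "\<not> p dvd x\<^sup>2 + b * x + c" using p(2) assms by simp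
qed (use assms in auto)

text \<open>The discriminants are -7, -11, -19, -43, -67 and -163. As \<open>3 p^2 <= 163\<close>
  forces \<open>p <= 7\<close>, only 2, 3, 5 and 7 can occur, and these are checked residue by
  residue.\<close>

lemma quadratic_form_class_number_one:
  assumes k: "k \<in> {2, 3, 5, 11, 17, 41}"
  shows "quadratic_form 1 k"
proof
  fix p x :: int assume p: "prime p" "3 * p\<^sup>2 \<le> 4 * k - 1\<^sup>2"
  have p2: "p \<ge> 2" by (rule prime_ge_2_int[OF p(1)])
  have "p < 8"
  proof (rule ccontr)
    assume "\<not> p < 8"
    then have "8\<^sup>2 \<le> p\<^sup>2" by (intro power_mono) auto
    then show False using p(2) k by auto
  qed
  with p2 have "p \<in> {2, 3, 4, 5, 6, 7}" by auto
  moreover have "\<not> prime (4::int)" "\<not> prime (6::int)" by simp_all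
  ultimately have "p \<in> {2, 3, 5, 7}" using p(1) by auto
  moreover have "\<forall>r\<in>{0..<p}. \<not> p dvd r\<^sup>2 + r + k" if "p \<in> {2, 3, 5, 7}"
  proof -
    have "{0..<2} = {0, 1::int}" "{0..<3} = {0, 1, 2::int}" "{0..<5} = {0, 1, 2, 3, 4::int}"
      "{0..<7} = {0, 1, 2, 3, 4, 5, 6::int}" by auto
    then show ?thesis using that k p(2) by (elim insertE; simp)
  qed
  ultimately have "\<not> p dvd x\<^sup>2 + x + k" using p2 by (intro not_dvd_quadratic) auto
  then show "\<not> p dvd x\<^sup>2 + 1 * x + k" by simp
qed (use k in auto)

lemma card_unit_reps:
  "card {(x::int, y::int). x\<^sup>2 + y\<^sup>2 = 1} = 4"
  "card {(x::int, y::int). x\<^sup>2 + x * y + y\<^sup>2 = 1} = 6"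
  "k \<ge> 2 \<Longrightarrow> card {(x::int, y::int). x\<^sup>2 + k * y\<^sup>2 = 1} = 2"
  "k \<ge> 2 \<Longrightarrow> card {(x::int, y::int). x\<^sup>2 + x * y + k * y\<^sup>2 = 1} = 2"
proof -
  have small: "t \<in> {-1, 0, 1}" if "t\<^sup>2 \<le> 3" for t :: int
  proof -
    have "\<not> \<bar>t\<bar> \<ge> 2"
    proof
      assume "\<bar>t\<bar> \<ge> 2"
      then have "2\<^sup>2 \<le> \<bar>t\<bar>\<^sup>2" by (intro power_mono) auto
      then show False using that by simp
    qed
    then show ?thesis by auto
  qed
  \<comment> \<open>Applied with \<open>m = 4 k\<close> and \<open>m = 4 k - 1\<close>, which are at
    least 7 for \<open>k >= 2\<close>; the bound on \<open>m * t^2\<close> comes from the equation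
    multiplied by 4.\<close>
  have zero: "t = 0" if "m * t\<^sup>2 \<le> 6" "m \<ge> 7" for m t :: int
  proof (rule ccontr)
    assume "t \<noteq> 0"
    then have "1 \<le> t\<^sup>2" by (simp add: int_one_le_iff_zero_less)
    then have "7 * 1 \<le> m * t\<^sup>2" using that(2) by (intro mult_mono) auto
    then show False using that(1) by simp
  qed
  have unit: "t\<^sup>2 = 1 \<longleftrightarrow> t \<in> {-1, 1}" for t :: int
    using small[of t] by auto
  show "card {(x::int, y::int). x\<^sup>2 + y\<^sup>2 = 1} = 4"
  proof -
    have "x \<in> {-1, 0, 1} \<and> y \<in> {-1, 0, 1}" if "x\<^sup>2 + y\<^sup>2 = 1" for x y :: int
      using that zero_le_power2[of x] zero_le_power2[of y] small[of x] small[of y] by linarith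
    then have "{(x::int, y::int). x\<^sup>2 + y\<^sup>2 = 1} = {(1, 0), (-1, 0), (0, 1), (0, -1)}" by fastforce
    then show ?thesis by simp
  qed
  show "card {(x::int, y::int). x\<^sup>2 + x * y + y\<^sup>2 = 1} = 6"
  proof -
    have "x \<in> {-1, 0, 1} \<and> y \<in> {-1, 0, 1}" if "x\<^sup>2 + x * y + y\<^sup>2 = 1" for x y :: int
    proof -
      have "4 = (2 * x + y)\<^sup>2 + 3 * y\<^sup>2" "4 = (2 * y + x)\<^sup>2 + 3 * x\<^sup>2"
        using that by (simp_all add: power2_eq_square algebra_simps)
      then have "3 * y\<^sup>2 \<le> 4" "3 * x\<^sup>2 \<le> 4"
        using zero_le_power2[of "2 * x + y"] zero_le_power2[of "2 * y + x"] by linarith+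
      then show ?thesis using small[of x] small[of y] by linarith
    qed
    then have "{(x::int, y::int). x\<^sup>2 + x * y + y\<^sup>2 = 1} = {(1, 0), (-1, 0), (0, 1), (0, -1), (1, -1), (-1, 1)}"
      by fastforce
    then show ?thesis by simp
  qed
  assume k: "k \<ge> 2"
  show "card {(x::int, y::int). x\<^sup>2 + k * y\<^sup>2 = 1} = 2"
  proof -
    have "y = 0" if "x\<^sup>2 + k * y\<^sup>2 = 1" for x y :: int
      using zero[of "4 * k" y] that zero_le_power2[of x] k by linarith
    then have "{(x::int, y::int). x\<^sup>2 + k * y\<^sup>2 = 1} = {(1, 0), (-1, 0)}" using unit by fastforce
    then show ?thesis by simp
  qed
  show "card {(x::int, y::int). x\<^sup>2 + x * y + k * y\<^sup>2 = 1} = 2"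
  proof -
    have "y = 0" if "x\<^sup>2 + x * y + k * y\<^sup>2 = 1" for x y :: int
    proof -
      have "4 = (2 * x + y)\<^sup>2 + (4 * k - 1) * y\<^sup>2"
        using that by (simp add: power2_eq_square algebra_simps)
      then show ?thesis using zero[of "4 * k - 1" y] zero_le_power2[of "2 * x + y"] k by linarith
    qed
    then have "{(x::int, y::int). x\<^sup>2 + x * y + k * y\<^sup>2 = 1} = {(1, 0), (-1, 0)}" using unit by fastforce
    then show ?thesis by simp
  qed
qed

theorem theorem2p3:
  fixes k :: int and f :: "nat \<Rightarrow> rat" and c :: real
  assumes "k \<in> {2, 3, 5, 11, 17, 41}"
    and "f 0 = 1"
    and "(\<forall>n>0. f n = 1/4 * of_nat (card {(x::int, y::int). x\<^sup>2 + y\<^sup>2 = int n})) \<or>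
         (\<forall>n>0. f n = 1/2 * of_nat (card {(x::int, y::int). x\<^sup>2 + 2 * y\<^sup>2 = int n})) \<or>
         (\<forall>n>0. f n = 1/6 * of_nat (card {(x::int, y::int). x\<^sup>2 + x * y + y\<^sup>2 = int n})) \<or>
         (\<forall>n>0. f n = 1/2 * of_nat (card {(x::int, y::int). x\<^sup>2 + x * y + k * y\<^sup>2 = int n}))"
    and "c = sqrt (8 * (\<Sum>l. (ln (1 + 1 / real (Suc l)))\<^sup>2))"
  shows "\<exists>E :: real \<Rightarrow> real.
           E \<in> O[at_top](\<lambda>x. (ln ^^ 3) x / (ln ^^ 2) x) \<and>
           (\<forall>\<^sub>F x in at_top.
              (MAX n \<in> {n::nat. 1 \<le> n \<and> real n \<le> x}. elog (of_rat (f (nat_of_rat (f n))))) =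
              ereal (sqrt (ln x) / (ln ^^ 2) x * (c / sqrt 2 + E x)))"
proof -
  note f_Nats = normalised_count_in_Nats[OF assms(1-3)]
  have "c / sqrt 2 = sqrt (8 * lcS / 2)" unfolding assms(4) lcS_def by (rule real_sqrt_divide[symmetric])
  also have "8 * lcS / 2 = 2\<^sup>2 * lcS" by simp
  also have "sqrt (2\<^sup>2 * lcS) = 2 * sqrt lcS" by (simp only: real_sqrt_mult real_sqrt_abs)
  finally have c: "c / sqrt 2 = 2 * sqrt lcS" .
  have k2: "k \<ge> 2" using assms(1) by auto
  \<comment> \<open>All four expressions have one shape: the denominators 4, 2, 6 and 2 are the
    numbers of units, that is, of representations of 1.\<close>
  have "\<exists>b d. quadratic_form b d \<and> (\<forall>n>0. f n =
      of_nat (card {(x, y). x\<^sup>2 + b * x * y + d * y\<^sup>2 = int n}) / of_nat (card {(x, y). x\<^sup>2 + b * x * y + d * y\<^sup>2 = 1}))"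
    using assms(3)
  proof (elim disjE)
    assume "\<forall>n>0. f n = 1/4 * of_nat (card {(x::int, y::int). x\<^sup>2 + y\<^sup>2 = int n})"
    then show ?thesis
      using quadratic_form_small_discriminant[of 1 0] card_unit_reps(1)
      by (intro exI[of _ 0] exI[of _ 1]) simp
  next
    assume "\<forall>n>0. f n = 1/2 * of_nat (card {(x::int, y::int). x\<^sup>2 + 2 * y\<^sup>2 = int n})"
    then show ?thesis
      using quadratic_form_small_discriminant[of 2 0] card_unit_reps(3)[of 2]
      by (intro exI[of _ 0] exI[of _ 2]) simp
  next
    assume "\<forall>n>0. f n = 1/6 * of_nat (card {(x::int, y::int). x\<^sup>2 + x * y + y\<^sup>2 = int n})"
    then show ?thesis
      using quadratic_form_small_discriminant[of 1 1] card_unit_reps(2)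
      by (intro exI[of _ 1] exI[of _ 1]) simp
  next
    assume "\<forall>n>0. f n = 1/2 * of_nat (card {(x::int, y::int). x\<^sup>2 + x * y + k * y\<^sup>2 = int n})"
    then show ?thesis
      using quadratic_form_class_number_one[OF assms(1)] card_unit_reps(4)[OF k2]
      by (intro exI[of _ 1] exI[of _ k]) simp
  qed
  then obtain b d where "quadratic_form b d" and f: "\<forall>n>0. f n =
      of_nat (card {(x, y). x\<^sup>2 + b * x * y + d * y\<^sup>2 = int n}) / of_nat (card {(x, y). x\<^sup>2 + b * x * y + d * y\<^sup>2 = 1})"
    by blast
  then interpret quadratic_form b d by simp
  show ?thesis unfolding c
    by (rule max_iterate_asymp) (simp_all add: assms(2) f_Nats f reps_eq)
qed

end
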